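(* Let $N\ge1$, let $q^{1/2}$ be a primitive $2N$-th root of unity, $t=q^k$, and let $k\notin\mathbb Z/2$. (i) The polynomials $e_m$, $\varepsilon_m$ ($m\in\mathbb Z$) are well defined, and each family is a basis of $\mathcal P=\mathbb C[X^{\pm1}]$. For instance, $e_{-N}=X^N+X^{-N}$, $e_{-2N}=X^{2N}+X^{-2N}$. The form $\langle\cdot,\cdot\rangle_0$ is also well defined: $\langle\varepsilon_l,\varepsilon_m\rangle_0=\delta_{lm}(\mu^1(m_\#))^{-1}$. (ii) The vectors $\varepsilon_m$ with $m\le -N$ together with $\varepsilon_m$ with $m\ge N+1$ form a basis of the radical $Rad_0$ of the pairing $\langle\cdot,\cdot\rangle_0$ on $\mathcal P$. The $\mathcal H\!\mathcal H$-module $V_{2N}=\mathcal P/Rad_0=\oplus_{-N+1\le m\le N}\mathbb C\varepsilon_m$ is irreducible of dimension $2N$ with the simple $Y$-spectrum $$\Bigl\{\tfrac{k+N-1}{2},\ldots,\tfrac k2,-\tfrac{k+1}{2},\ldots,-\tfrac{k+N}{2}\Bigr\}.$$ As an ideal $Rad_0=(e_{-N})$, so $V_{2N}=\mathcal P/(X^N+X^{-N})$. (iii) The polynomials $\varepsilon_l-\varepsilon_m$ for $m_\#=l_\#\bmod N$ linearly generate the radical $Rad$ of the pairing $\{f,g\}=f(Y^{-1})(g)(-k/2)$. The quotient $\mathcal P/Rad$ is irreducible and isomorphic to the $\mathcal H\!\mathcal H$-module of functions on the set $\bowtie_N=\mathbb Z_\#\bmod N$ of cardinality $4N$, where $(Xf)(z)=q^zf(z)$,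 $(\pi f)(z)=f(1/2-z)$, $(Tf)(z)=\frac{t^{1/2}q^{2z}-t^{-1/2}}{q^{2z}-1}f(-z)-\frac{t^{1/2}-t^{-1/2}}{q^{2z}-1}f(z)$. As an ideal, $$Rad=(X^{2N}+X^{-2N}-t^N-t^{-N}).$$ (iv) An arbitrary nonzero irreducible quotient of $\mathcal P$ is either $V^C=\mathcal P/(X^{2N}+X^{-2N}+C)$ for some $C\ne2$, or $V_{2N}=\mathcal P/(X^N+X^{-N})$, which is the quotient of $V^2$ by a submodule isomorphic to the image of $V_{2N}$ under $\varsigma_y$. The dimension of $V^C$ is $4N$ and it is $Y$-semisimple with simple weights constituting the set $-\bowtie_N$. It is also $X$-semisimple (with simple weights) unless $C=-2$ (here $C\neq 2$). The module $\mathcal P/Rad$ from (iii) equals $V^{C_t}$ for $C_t=-(t^N+t^{-N})$; $C_t\ne\pm2$ since $k\notin\mathbb Z/2$.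
   Context: Fractional powers of $q$ are taken with respect to a fixed compatible choice of roots, $t^{1/2}=q^{k/2}$; the condition $k\notin\mathbb Z/2$ means that $t$ is not a power of $q^{1/2}$, i.e. $t^{2N}\ne1$. The double affine Hecke algebra $\mathcal H\!\mathcal H$ (type $A_1$) is generated by $X^{\pm1},Y^{\pm1},T$ with relations $TXT=X^{-1}$, $TY^{-1}T=Y$, $Y^{-1}X^{-1}YXT^2q^{1/2}=1$, $(T-t^{1/2})(T+t^{-1/2})=0$; $\pi=YT^{-1}$. Polynomial representation $\mathcal P=\mathbb C[X^{\pm1}]$, $X=q^x$: $X$ acts by multiplication, $T=t^{1/2}s+\frac{t^{1/2}-t^{-1/2}}{X^2-1}(s-1)$, $Y=\pi T$, with $s(X)=X^{-1}$, $\pi(X)=q^{1/2}X^{-1}$. A $Y$-weight $\lambda$ (mod $N$) means the $Y$-eigenvalue $q^\lambda$; similarly for $X$. $\varsigma_y$ is the automorphism $Y\mapsto -Y$ fixing $T,X,q^{1/2},t^{1/2}$. "$f(c)$" means the value at $X=q^c$, so $f(-k/2)$ is the value at $X=t^{-1/2}$. In $f(Y^{-1})$, the operator $Y^{-1}$ is substituted for $X$. For $n\in\mathbb Z$, $n_\#=(n+\mathrm{sgn}(n)k)/2$ with $\mathrm{sgn}(0)=-1$, $\mathbb Z_\#=\{n_\#:n\in\mathbb Z\}$. $\mu_k=\prod_{j\ge0}\frac{(1-q^{j}X^2)(1-q^{j+1}X^{-2})}{(1-tq^{j}X^2)(1-tq^{j+1}X^{-2})}$, $\langle\cdot\rangle$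 is the constant term, $\mu_k^0=\mu_k/\langle\mu_k\rangle$, whose coefficients are rational functions of $q,t$ (first computed for generic $q,t$, then specialized). $\langle f,g\rangle_0=\langle f\bar g\mu_k^0\rangle$, where the bar inverts $X,q,t$ and their fractional powers (the actual field of constants may be taken to be $\mathbb Q(q^{1/4},t^{1/2})$). The inverse of $\mu^1$ is given, for $m>0$, by $$\mu^1(m_\#)^{-1}=\mu^1((1-m)_\#)^{-1}=t^{m-1}\prod_{i=1}^{m-1}\frac{1-q^i}{1-t^2q^i}.$$ Order: $X^m\prec X^n$ if $|m|<|n|$ or $m=-n>0$. For generic $q,t$, $e_n$ is determined by $e_n=X^n+(\text{lower terms with respect to }\prec)$ and $\langle e_nX^{-m}\mu_k^0\rangle=0$ for $X^m\prec X^n$ (so $Ye_n=q^{-n_\#}e_n$), and $\varepsilon_n=e_n/e_n(-k/2)$; for special $q,t$ they are called well defined if their coefficients (rational functions of $q,t^{1/2}$) have no poles there. $(g)$ is the ideal of $\mathcal P$ generated by $g$.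
   Formalization: The formula e_{-2N}=X^{2N}+X^{-2N} is corrected to X^{2N}+X^{-2N}+2; in ⟨f,g⟩_0 the g has coefficients in Q(q^{1/2},t^{1/2}), conjugated and then specialized (also any g in P when the bar extends to C), since inverting t is undefined on C, e.g. for t=2. *)

theory Defs
  imports
    "HOL-Analysis.Analysis"
    "HOL-Library.Poly_Mapping"
    "HOL-Computational_Algebra.Fraction_Field"
    "HOL-Algebra.QuotRing"
    "Jordan_Normal_Form.Missing_VectorSpace"
begin

section \<open>Laurent polynomials\<close>

text \<open>The group algebra of the additive group of integers: \<open>Poly_Mapping.single n c\<close> is \<open>c X^n\<close>.\<close>
type_synonym 'a laurent = "int \<Rightarrow>\<^sub>0 'a"

definition lmon :: "int \<Rightarrow> 'a::field laurent" where
  "lmon n = Poly_Mapping.single n 1"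

definition lconst :: "'a::field \<Rightarrow> 'a laurent" where
  "lconst c = Poly_Mapping.single 0 c"

definition leval :: "'a::field laurent \<Rightarrow> 'a \<Rightarrow> 'a" where
  "leval f x = (\<Sum>n\<in>Poly_Mapping.keys f. Poly_Mapping.lookup f n * x powi n)"

text \<open>The semilinear extension of a map \<open>\<sigma>\<close> of the constants with \<open>X \<mapsto> X\<inverse>\<close>.\<close>
definition lbar :: "('a \<Rightarrow> 'a) \<Rightarrow> 'a::field laurent \<Rightarrow> 'a laurent" where
  "lbar \<sigma> f = (\<Sum>n\<in>Poly_Mapping.keys f. Poly_Mapping.single (- n) (\<sigma> (Poly_Mapping.lookup f n)))"

text \<open>The constant term of \<open>f \<mu>\<close>, where \<open>\<mu>\<close> is a two-sided series given by its coefficients.\<close>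
definition ct :: "(int \<Rightarrow> 'a) \<Rightarrow> 'a::field laurent \<Rightarrow> 'a" where
  "ct \<mu> f = (\<Sum>n\<in>Poly_Mapping.keys f. Poly_Mapping.lookup f n * \<mu> (- n))"


section \<open>Rational functions of \<open>q^(1/2)\<close> and \<open>t^(1/2)\<close>\<close>

text \<open>The field of rational functions over the rationals in two variables; the outer
  polynomial variable is \<open>q^(1/2)\<close>, the inner one is \<open>t^(1/2)\<close>.\<close>
type_synonym ratfun = "int poly poly fract"

definition qh_var :: ratfun where
  "qh_var = Fract [:0, 1:] 1"

definition th_var :: ratfun where
  "th_var = Fract [:[:0, 1:]:] 1"

definition eval2 :: "int poly poly \<Rightarrow> 'a::field \<Rightarrow> 'a \<Rightarrow> 'a" where
  "eval2 p a b = poly (map_poly (\<lambda>c. poly (map_poly of_int c) b) p) a"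

definition rf_regular :: "ratfun \<Rightarrow> 'a::field \<Rightarrow> 'a \<Rightarrow> bool" where
  "rf_regular r a b \<longleftrightarrow> (\<exists>p d. r = Fract p d \<and> eval2 d a b \<noteq> 0)"

definition rf_value :: "ratfun \<Rightarrow> 'a::field \<Rightarrow> 'a \<Rightarrow> 'a" where
  "rf_value r a b =
     (THE v. \<exists>p d. r = Fract p d \<and> eval2 d a b \<noteq> 0 \<and> v = eval2 p a b / eval2 d a b)"

text \<open>The automorphism inverting both variables.\<close>
definition rf_bar :: "ratfun \<Rightarrow> ratfun" where
  "rf_bar r = rf_value r (inverse qh_var) (inverse th_var)"

definition specialize :: "'a::field \<Rightarrow> 'a \<Rightarrow> ratfun laurent \<Rightarrow> 'a laurent" where
  "specialize qh th f = Poly_Mapping.map (\<lambda>r. rf_value r qh th) f"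

definition lregular :: "'a::field \<Rightarrow> 'a \<Rightarrow> ratfun laurent \<Rightarrow> bool" where
  "lregular qh th f \<longleftrightarrow> (\<forall>n. rf_regular (Poly_Mapping.lookup f n) qh th)"


section \<open>The weight \<open>\<mu>\<close> and the nonsymmetric polynomials\<close>

definition mu_fun :: "complex \<Rightarrow> complex \<Rightarrow> complex \<Rightarrow> complex" where
  "mu_fun q t X = prodinf (\<lambda>j. ((1 - q ^ j * X ^ 2) * (1 - q ^ (j + 1) * X powi (- 2))) /
                       ((1 - t * q ^ j * X ^ 2) * (1 - t * q ^ (j + 1) * X powi (- 2))))"

text \<open>For \<open>\<bar>q\<bar>, \<bar>t\<bar> < 1\<close> the expansion of \<open>\<mu>\<close> in non-negative powers of \<open>q\<close> and \<open>t\<close> is its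
  Laurent expansion in the annulus \<open>\<bar>t q\<bar> < \<bar>X\<bar>^2 < 1 / \<bar>t\<bar>\<close>, which contains the unit circle.\<close>
definition mu_expansion :: "complex \<Rightarrow> complex \<Rightarrow> (int \<Rightarrow> complex) \<Rightarrow> bool" where
  "mu_expansion q t a \<longleftrightarrow>
     (\<forall>X. norm (t * q) < norm X ^ 2 \<and> norm t * norm X ^ 2 < 1 \<longrightarrow>
        ((\<lambda>n. a n * X powi n) has_sum mu_fun q t X) UNIV)"

text \<open>The coefficient of \<open>X^n\<close> in \<open>\<mu> / \<langle>\<mu>\<rangle>\<close>, as a rational function.\<close>
definition mu0 :: "int \<Rightarrow> ratfun" where
  "mu0 n = (THE r. \<forall>qh th a.
     0 < norm qh \<and> norm qh < 1 \<and> 0 < norm th \<and> norm th < 1 \<and> mu_expansion (qh ^ 2) (th ^ 2) a \<longrightarrow>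
       rf_regular r qh th \<and> rf_value r qh th = a n / a 0)"

definition lprec :: "int \<Rightarrow> int \<Rightarrow> bool" where
  "lprec m n \<longleftrightarrow> \<bar>m\<bar> < \<bar>n\<bar> \<or> (m = - n \<and> - n > 0)"

definition e_poly :: "int \<Rightarrow> ratfun laurent" where
  "e_poly n = (THE e. Poly_Mapping.lookup e n = 1
     \<and> (\<forall>m. Poly_Mapping.lookup e m \<noteq> 0 \<longrightarrow> m = n \<or> lprec m n)
     \<and> (\<forall>m. lprec m n \<longrightarrow> ct mu0 (e * lmon (- m)) = 0))"

text \<open>The spherical normalization: the value at \<open>X = t^(-1/2)\<close> becomes 1.\<close>
definition eps_poly :: "int \<Rightarrow> ratfun laurent" where
  "eps_poly n = lconst (inverse (leval (e_poly n) (inverse th_var))) * e_poly n"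

definition e_sp :: "complex \<Rightarrow> complex \<Rightarrow> int \<Rightarrow> complex laurent" where
  "e_sp qh th n = specialize qh th (e_poly n)"

definition eps_sp :: "complex \<Rightarrow> complex \<Rightarrow> int \<Rightarrow> complex laurent" where
  "eps_sp qh th n = specialize qh th (eps_poly n)"

definition mu1_inv :: "complex \<Rightarrow> complex \<Rightarrow> int \<Rightarrow> complex" where
  "mu1_inv q t m = (let n = nat (if m > 0 then m - 1 else - m)
     in t ^ n * (\<Prod>i=1..n. (1 - q ^ i) / (1 - t ^ 2 * q ^ i)))"


section \<open>The form \<open>\<langle>f, g\<rangle>\<^sub>0\<close> for special parameters\<close>

text \<open>The conjugate of \<open>g\<close> involves the inversion of the parameters, which need not
  extend to the complex numbers when \<open>q\<close>, \<open>t\<close> are numbers (for instance, when \<open>t = 2\<close>). Therefore \<open>g\<close>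
  has coefficients depending on the variables \<open>q^(1/2)\<close>, \<open>t^(1/2)\<close>; it is conjugated first, and then
  specialized. The form is linear over the complex numbers in \<open>f\<close>.\<close>
definition form0 :: "complex \<Rightarrow> complex \<Rightarrow> complex laurent \<Rightarrow> ratfun laurent \<Rightarrow> complex" where
  "form0 qh th f g =
     ct (\<lambda>n. rf_value (mu0 n) qh th) (f * specialize qh th (lbar rf_bar g))"

text \<open>The second arguments for which both \<open>g\<close> and its conjugate can be specialized.\<close>
definition admissible :: "complex \<Rightarrow> complex \<Rightarrow> ratfun laurent \<Rightarrow> bool" where
  "admissible qh th g \<longleftrightarrow> lregular qh th g \<and> lregular qh th (lbar rf_bar g)"

definition Rad0 :: "complex \<Rightarrow> complex \<Rightarrow> complex laurent set" where
  "Rad0 qh th = {f. \<forall>g. admissible qh th g \<longrightarrow> form0 qh th f g = 0}"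

text \<open>The sesquilinear version, for parameters such that the inversion of \<open>q^(1/2)\<close>, \<open>t^(1/2)\<close> does extend
  to the constants. For \<open>\<bar>t\<bar> = 1\<close> one may take \<open>\<sigma>\<close> to be the complex conjugation.\<close>
definition const_bar :: "complex \<Rightarrow> complex \<Rightarrow> (complex \<Rightarrow> complex) \<Rightarrow> bool" where
  "const_bar qh th \<sigma> \<longleftrightarrow> \<sigma> 1 = 1 \<and> (\<forall>a b. \<sigma> (a + b) = \<sigma> a + \<sigma> b \<and> \<sigma> (a * b) = \<sigma> a * \<sigma> b)
     \<and> \<sigma> qh = inverse qh \<and> \<sigma> th = inverse th"

definition form0_bar :: "(complex \<Rightarrow> complex) \<Rightarrow> complex \<Rightarrow> complex \<Rightarrow>
    complex laurent \<Rightarrow> complex laurent \<Rightarrow> complex" where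
  "form0_bar \<sigma> qh th f g = ct (\<lambda>n. rf_value (mu0 n) qh th) (f * lbar \<sigma> g)"


section \<open>Modules over the double affine Hecke algebra\<close>

definition CC :: "complex ring" where
  "CC = \<lparr>carrier = UNIV, mult = (*), one = 1, zero = 0, add = (+)\<rparr>"

text \<open>The algebra is given by generators and relations; so a module is a vector space with
  operators satisfying the relations.\<close>
record 'v hh_module = "(complex, 'v) module" +
  Xop :: "'v \<Rightarrow> 'v"
  Yop :: "'v \<Rightarrow> 'v"
  Top :: "'v \<Rightarrow> 'v"

definition is_hh_module :: "complex \<Rightarrow> complex \<Rightarrow> 'v hh_module \<Rightarrow> bool" where
  "is_hh_module qh th M \<longleftrightarrow> vectorspace CC M
     \<and> Xop M \<in> module_hom CC M M \<and> Yop M \<in> module_hom CC M M \<and> Top M \<in> module_hom CC M M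
     \<and> bij_betw (Xop M) (carrier M) (carrier M) \<and> bij_betw (Yop M) (carrier M) (carrier M)
     \<and> (let X = Xop M; Y = Yop M; T = Top M;
            X' = inv_into (carrier M) X; Y' = inv_into (carrier M) Y
        in \<forall>v\<in>carrier M.
             T (X (T v)) = X' v
           \<and> T (Y' (T v)) = Y v
           \<and> qh \<odot>\<^bsub>M\<^esub> Y' (X' (Y (X (T (T v))))) = v
           \<and> (let w = T v \<oplus>\<^bsub>M\<^esub> inverse th \<odot>\<^bsub>M\<^esub> v in T w \<ominus>\<^bsub>M\<^esub> th \<odot>\<^bsub>M\<^esub> w) = \<zero>\<^bsub>M\<^esub>)"

text \<open>Stability under \<open>X\<inverse>\<close> and \<open>Y\<inverse>\<close> is not automatic in infinite dimension.\<close>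
definition hh_submodule :: "'v set \<Rightarrow> 'v hh_module \<Rightarrow> bool" where
  "hh_submodule W M \<longleftrightarrow> LinearCombinations.submodule CC W M
     \<and> Xop M ` W = W \<and> Yop M ` W = W \<and> Top M ` W \<subseteq> W"

definition hh_quotient :: "'v hh_module \<Rightarrow> 'v set \<Rightarrow> 'v set hh_module" where
  "hh_quotient M W =
     \<lparr>carrier = a_rcosets\<^bsub>M\<^esub> W, mult = rcoset_mult M W, one = W +>\<^bsub>M\<^esub> \<one>\<^bsub>M\<^esub>, zero = W, add = set_add M,
      smult = (\<lambda>c A. \<Union>a\<in>A. W +>\<^bsub>M\<^esub> (c \<odot>\<^bsub>M\<^esub> a)),
      Xop = (\<lambda>A. \<Union>a\<in>A. W +>\<^bsub>M\<^esub> Xop M a),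
      Yop = (\<lambda>A. \<Union>a\<in>A. W +>\<^bsub>M\<^esub> Yop M a),
      Top = (\<lambda>A. \<Union>a\<in>A. W +>\<^bsub>M\<^esub> Top M a)\<rparr>"

definition hh_iso :: "'v hh_module \<Rightarrow> 'w hh_module \<Rightarrow> bool" where
  "hh_iso M M' \<longleftrightarrow> (\<exists>\<phi> \<in> module_hom CC M M'. bij_betw \<phi> (carrier M) (carrier M') \<and>
     (\<forall>v\<in>carrier M. \<phi> (Xop M v) = Xop M' (\<phi> v) \<and> \<phi> (Yop M v) = Yop M' (\<phi> v)
                   \<and> \<phi> (Top M v) = Top M' (\<phi> v)))"

definition hh_irreducible :: "complex \<Rightarrow> complex \<Rightarrow> 'v hh_module \<Rightarrow> bool" where
  "hh_irreducible qh th M \<longleftrightarrow> is_hh_module qh th M \<and> carrier M \<noteq> {\<zero>\<^bsub>M\<^esub>}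
     \<and> (\<forall>W. hh_submodule W M \<longrightarrow> W = {\<zero>\<^bsub>M\<^esub>} \<or> W = carrier M)"

text \<open>The pullback along the automorphism \<open>\<varsigma>\<^sub>y\<close>.\<close>
definition twist_y :: "'v hh_module \<Rightarrow> 'v hh_module" where
  "twist_y M = M\<lparr>Yop := (\<lambda>v. \<ominus>\<^bsub>M\<^esub> Yop M v)\<rparr>"

definition family_basis :: "'v hh_module \<Rightarrow> ('i \<Rightarrow> 'v) \<Rightarrow> 'i set \<Rightarrow> bool" where
  "family_basis M b I \<longleftrightarrow> inj_on b I \<and> vectorspace.basis CC M (b ` I)"

definition has_dim :: "'v hh_module \<Rightarrow> nat \<Rightarrow> bool" where
  "has_dim M n \<longleftrightarrow> vectorspace.fin_dim CC M \<and> vectorspace.dim CC M = n"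

definition eigenspace :: "'v hh_module \<Rightarrow> ('v \<Rightarrow> 'v) \<Rightarrow> complex \<Rightarrow> 'v set" where
  "eigenspace M F c = {v \<in> carrier M. F v = c \<odot>\<^bsub>M\<^esub> v}"

definition spectrum :: "'v hh_module \<Rightarrow> ('v \<Rightarrow> 'v) \<Rightarrow> complex set" where
  "spectrum M F = {c. eigenspace M F c \<noteq> {\<zero>\<^bsub>M\<^esub>}}"

definition semisimple :: "'v hh_module \<Rightarrow> ('v \<Rightarrow> 'v) \<Rightarrow> bool" where
  "semisimple M F \<longleftrightarrow> LinearCombinations.module.span CC M (\<Union>c. eigenspace M F c) = carrier M"

definition simple_weights :: "'v hh_module \<Rightarrow> ('v \<Rightarrow> 'v) \<Rightarrow> bool" where
  "simple_weights M F \<longleftrightarrow> (\<forall>c \<in> spectrum M F. has_dim (M\<lparr>carrier := eigenspace M F c\<rparr>) 1)"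


section \<open>The polynomial representation\<close>

definition s_op :: "complex laurent \<Rightarrow> complex laurent" where
  "s_op f = (\<Sum>n\<in>Poly_Mapping.keys f. Poly_Mapping.single (- n) (Poly_Mapping.lookup f n))"

definition pi_op :: "complex \<Rightarrow> complex laurent \<Rightarrow> complex laurent" where
  "pi_op qh f = (\<Sum>n\<in>Poly_Mapping.keys f. Poly_Mapping.single (- n) (Poly_Mapping.lookup f n * qh powi n))"

text \<open>The quotient \<open>(s(f) - f) / (X^2 - 1)\<close> is taken in Laurent polynomials.\<close>
definition T_op :: "complex \<Rightarrow> complex laurent \<Rightarrow> complex laurent" where
  "T_op th f = lconst th * s_op f
     + lconst (th - inverse th) * (THE g. (lmon 2 - 1) * g = s_op f - f)"

definition Y_op :: "complex \<Rightarrow> complex \<Rightarrow> complex laurent \<Rightarrow> complex laurent" where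
  "Y_op qh th = pi_op qh \<circ> T_op th"

definition PP :: "complex \<Rightarrow> complex \<Rightarrow> complex laurent hh_module" where
  "PP qh th = \<lparr>carrier = UNIV, mult = (*), one = 1, zero = 0, add = (+),
     smult = (\<lambda>c f. lconst c * f),
     Xop = (\<lambda>f. lmon 1 * f), Yop = Y_op qh th, Top = T_op th\<rparr>"

definition Y_power :: "complex \<Rightarrow> complex \<Rightarrow> int \<Rightarrow> complex laurent \<Rightarrow> complex laurent" where
  "Y_power qh th n = (if n \<ge> 0 then Y_op qh th ^^ nat n else inv_into UNIV (Y_op qh th) ^^ nat (- n))"

definition curly_form :: "complex \<Rightarrow> complex \<Rightarrow> complex laurent \<Rightarrow> complex laurent \<Rightarrow> complex" where
  "curly_form qh th f g =
     leval (\<Sum>n\<in>Poly_Mapping.keys f. lconst (Poly_Mapping.lookup f n) * Y_power qh th (- n) g) (inverse th)"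

definition Rad :: "complex \<Rightarrow> complex \<Rightarrow> complex laurent set" where
  "Rad qh th = {f. \<forall>g. curly_form qh th f g = 0}"

definition VC_poly :: "nat \<Rightarrow> complex \<Rightarrow> complex laurent" where
  "VC_poly N C = lmon (2 * int N) + lmon (- 2 * int N) + lconst C"

definition VC :: "complex \<Rightarrow> complex \<Rightarrow> nat \<Rightarrow> complex \<Rightarrow> complex laurent set hh_module" where
  "VC qh th N C = hh_quotient (PP qh th) (PIdl\<^bsub>PP qh th\<^esub> (VC_poly N C))"


section \<open>Weights and functions on \<open>\<bowtie>\<^sub>N\<close>\<close>

text \<open>The powers \<open>q^a\<close> for complex \<open>a\<close> depend on the choice of \<open>l = log q\<close>.\<close>
definition qpow :: "complex \<Rightarrow> complex \<Rightarrow> complex" where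
  "qpow l a = exp (l * a)"

definition nsharp :: "complex \<Rightarrow> int \<Rightarrow> complex" where
  "nsharp k n = (of_int n + (if n > 0 then 1 else - 1) * k) / 2"

definition modN :: "nat \<Rightarrow> complex \<Rightarrow> complex set" where
  "modN N z = {w. \<exists>j::int. w = z + of_int j * of_nat N}"

definition bowtie :: "nat \<Rightarrow> complex \<Rightarrow> complex set set" where
  "bowtie N k = modN N ` range (nsharp k)"

definition rep :: "complex set \<Rightarrow> complex" where
  "rep A = (SOME z. z \<in> A)"

text \<open>The formulas below do not depend on the representatives since \<open>q^N = 1\<close>.\<close>
definition fun_pi :: "nat \<Rightarrow> complex \<Rightarrow> (complex set \<Rightarrow> complex) \<Rightarrow> complex set \<Rightarrow> complex" where
  "fun_pi N k f = (\<lambda>A\<in>bowtie N k. f (modN N (1 / 2 - rep A)))"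

definition fun_T :: "complex \<Rightarrow> nat \<Rightarrow> complex \<Rightarrow> (complex set \<Rightarrow> complex) \<Rightarrow> complex set \<Rightarrow> complex" where
  "fun_T l N k f = (\<lambda>A\<in>bowtie N k.
     let z = rep A; th = qpow l (k / 2) in
       (th * qpow l (2 * z) - inverse th) / (qpow l (2 * z) - 1) * f (modN N (- z))
     - (th - inverse th) / (qpow l (2 * z) - 1) * f A)"

definition Fun_bowtie :: "complex \<Rightarrow> nat \<Rightarrow> complex \<Rightarrow> (complex set \<Rightarrow> complex) hh_module" where
  "Fun_bowtie l N k = \<lparr>carrier = bowtie N k \<rightarrow>\<^sub>E UNIV,
     mult = (\<lambda>f g. \<lambda>A\<in>bowtie N k. f A * g A), one = (\<lambda>A\<in>bowtie N k. 1),
     zero = (\<lambda>A\<in>bowtie N k. 0), add = (\<lambda>f g. \<lambda>A\<in>bowtie N k. f A + g A),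
     smult = (\<lambda>c f. \<lambda>A\<in>bowtie N k. c * f A),
     Xop = (\<lambda>f. \<lambda>A\<in>bowtie N k. qpow l (rep A) * f A),
     Yop = fun_pi N k \<circ> fun_T l N k,
     Top = fun_T l N k\<rparr>"

end

theory Submission
  imports Defs "HOL-Computational_Algebra.Fundamental_Theorem_Algebra"
begin

text \<open>Write \<open>v = q^(1/2)\<close>, \<open>w = t^(1/2)\<close>, \<open>p = X^N + X^(-N)\<close> and \<open>z = X^(2 N) + X^(-2 N)\<close>, so that
  \<open>p^2 = z + 2\<close>. The proof constructs the eigenvectors of \<open>Y\<close> by intertwiners over an arbitrary field and
  lets them do all the work; the weight \<open>\<mu>\<close> enters only through its coefficients.

  Starting from 1, the operators \<open>X \<pi>\<close> and \<open>T - c\<close>, for suitable constants \<open>c\<close>, produce alternately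
  vectors of the indices 1, -1, 2, -2, and so on. They are eigenvectors of \<open>Y\<close>, unitriangular with respect
  to the order of the monomials, and their values at \<open>X = t^(-1/2)\<close> and norms are explicit products
  (\<open>dunkl_E\<close>, \<open>unitriangular_E\<close>, \<open>leval_E_nz\<close>, \<open>lform_E_diag\<close>). The only denominators in the
  construction are \<open>1 - t q^n\<close> with \<open>n \<ge> 1\<close>, and the values have factors \<open>1 - t^2 q^n\<close>. The
  normalized coefficients of \<open>\<mu>\<close> satisfy a two-term recurrence (\<open>mu_expansion_coeffs\<close>), which makes
  \<open>T\<close> and \<open>\<pi>\<close> unitary. Over the field of rational functions the eigenvalues are distinct and the norms
  nonzero, so the constructed vectors are the \<open>e_m\<close> (\<open>e_poly_eq\<close>). For the special parameters none of the
  factors above vanishes, hence everything specializes (part (i)); the passage between fields is organized by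
  relations compatible with the field operations.

  The norm of \<open>\<epsilon>_m\<close> has the factor \<open>1 - q^N = 0\<close> exactly for \<open>m \<le> -N\<close> and
  \<open>m \<ge> N + 1\<close>. The radical is an ideal containing \<open>e_(-N) = p\<close>, and division by \<open>p\<close> leaves only
  remainders that are combinations of the \<open>2 N\<close> remaining \<open>\<epsilon>_m\<close>, of nonzero norm; so the radical
  is \<open>(p)\<close> (\<open>Rad0_I0\<close>).

  Submodules of the polynomial representation \<open>P\<close> are ideals. In a quotient by \<open>p\<close> or by \<open>z + C\<close> the
  weights of \<open>Y\<close> are distinct, so a larger submodule contains some \<open>e_j\<close> of low index. If it contains
  \<open>(z + C)\<close>, the intertwiners lead up to \<open>e_(-2 N) = z + 2\<close>, and \<open>2 - C\<close> lies in the submodule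
  (\<open>IC_maximal\<close>). If it contains \<open>(p)\<close>, they can be inverted as long as the index is not divisible by
  \<open>N\<close>, and lead down to 1 (\<open>I0_maximal\<close>). Conversely, a maximal submodule has a common root \<open>b\<close>; since
  \<open>z\<close> is fixed by \<open>s\<close> and \<open>\<pi>\<close>, adding the ideal of \<open>z - z(b)\<close> to it gives a proper submodule
  again, and this determines all of them (\<open>maximal_submodules\<close>).

  The pairing \<open>{f, e_m}\<close> is a nonzero multiple of the value of \<open>f\<close> at the inverse eigenvalue of \<open>e_m\<close>.
  So the radical of part (iii) consists of the polynomials vanishing at \<open>4 N\<close> points, which are the roots of
  \<open>z - t^N - t^(-N)\<close> (\<open>Rad_eq\<close>), and interpolation identifies the quotient with the functions on these
  points. Interpolation at the roots of \<open>z + C\<close> also diagonalizes \<open>X\<close>, unless these roots are multiple.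
  Finally, multiplication by \<open>p\<close> embeds the twist of \<open>P/(p)\<close> into \<open>P/(p^2)\<close>, since \<open>\<pi>(p) = -p\<close>.\<close>

section \<open>Laurent polynomials\<close>

lemma laurent_expand: "f = (\<Sum>n\<in>Poly_Mapping.keys f. Poly_Mapping.single n (Poly_Mapping.lookup f n))"
proof (rule poly_mapping_eqI)
  fix k
  have "(\<Sum>n\<in>Poly_Mapping.keys f. Poly_Mapping.lookup (Poly_Mapping.single n (Poly_Mapping.lookup f n)) k)
    = (\<Sum>n\<in>Poly_Mapping.keys f. if n = k then Poly_Mapping.lookup f k else 0)"
    by (rule sum.cong) (auto simp: lookup_single when_def)
  also have "\<dots> = Poly_Mapping.lookup f k"
    by (auto simp: in_keys_iff)
  finally show "Poly_Mapping.lookup f k =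
     Poly_Mapping.lookup (\<Sum>n\<in>Poly_Mapping.keys f. Poly_Mapping.single n (Poly_Mapping.lookup f n)) k"
    by (simp add: lookup_sum)
qed

lemma single_eq_lconst_lmon: "Poly_Mapping.single n c = lconst c * lmon n"
  by (simp add: lconst_def lmon_def mult_single)

lemma lmon_add: "lmon (a + b) = lmon a * lmon b"
  by (simp add: lmon_def mult_single)

lemma lmon_0 [simp]: "lmon 0 = 1"
  by (simp add: lmon_def)

lemma lconst_add: "lconst (a + b) = lconst a + lconst b"
  by (simp add: lconst_def single_add)

lemma lconst_diff: "lconst (a - b) = lconst a - lconst b"
  by (simp add: lconst_def single_diff)

lemma lconst_uminus: "lconst (- a) = - lconst a"
  by (simp add: lconst_def single_uminus)

lemma lconst_mult: "lconst (a * b) = lconst a * lconst b"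
  by (simp add: lconst_def mult_single)

lemma lconst_0 [simp]: "lconst 0 = 0"
  by (simp add: lconst_def)

lemma lconst_1 [simp]: "lconst 1 = 1"
  by (simp add: lconst_def)

lemma lookup_lconst_times [simp]: "Poly_Mapping.lookup (lconst c * f) n = c * Poly_Mapping.lookup f n"
  by (simp add: lconst_def mult_map_scale_conv_mult[symmetric] map.rep_eq when_def)

lemma laurent_induct [case_names monomial add]:
  assumes mono: "\<And>n c. P (lconst c * lmon n)"
    and add: "\<And>f g. P f \<Longrightarrow> P g \<Longrightarrow> P (f + g)"
  shows "P f"
proof -
  have "P (\<Sum>n\<in>A. Poly_Mapping.single n (Poly_Mapping.lookup f n))" if "finite A" for A
    using that
  proof (induction A rule: finite_induct)
    case empty
    show ?case using mono[of 0 0] by simp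
  next
    case (insert x A)
    then show ?case using add mono by (simp add: single_eq_lconst_lmon)
  qed
  then show ?thesis
    using laurent_expand[of f] by (metis finite_keys)
qed

lemma lookup_lmon_times [simp]: "Poly_Mapping.lookup (lmon m * f) n = Poly_Mapping.lookup f (n - m)"
proof (induction f rule: laurent_induct)
  case (monomial k c)
  have "lmon m * (lconst c * lmon k) = Poly_Mapping.single (m + k) c"
    by (simp add: lmon_def lconst_def mult_single)
  moreover have "lconst c * lmon k = Poly_Mapping.single k c"
    by (simp add: lmon_def lconst_def mult_single)
  ultimately show ?case by (auto simp: lookup_single when_def)
next
  case (add f g)
  then show ?case by (simp add: distrib_left lookup_add)
qed

lemma lookup_lmon: "Poly_Mapping.lookup (lmon m) n = (if n = m then 1 else 0)"
  by (simp add: lmon_def lookup_single when_def)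

lemma lookup_lconst: "Poly_Mapping.lookup (lconst c) n = (if n = 0 then c else 0)"
  by (simp add: lconst_def lookup_single when_def)

text \<open>The supports of \<open>f\<close>, \<open>g\<close> and \<open>f + g\<close> differ, so additivity of a sum over the support needs an
  argument; evaluation, constant terms and reflections are of this form.\<close>

lemma laurent_ext_add:
  assumes "\<And>n. F n 0 = 0" "\<And>n a b. F n (a + b) = F n a + F n b"
  shows "(\<Sum>n\<in>Poly_Mapping.keys (f + g). F n (Poly_Mapping.lookup (f + g) n))
    = (\<Sum>n\<in>Poly_Mapping.keys f. F n (Poly_Mapping.lookup f n))
    + (\<Sum>n\<in>Poly_Mapping.keys g. F n (Poly_Mapping.lookup g n))"
  by (rule setsum_keys_plus_distrib) (use assms in auto)

subsection \<open>Evaluation\<close>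

lemma leval_add: "leval (f + g) x = leval f x + leval g x"
  unfolding leval_def by (rule laurent_ext_add) (auto simp: algebra_simps)

lemma leval_single: "leval (lconst c * lmon n) x = c * x powi n"
  unfolding leval_def single_eq_lconst_lmon[symmetric] by (cases "c = 0") auto

lemma leval_mult:
  assumes "x \<noteq> 0"
  shows "leval (f * g) x = leval f x * leval g x"
proof (induction f rule: laurent_induct)
  case (monomial n c)
  show ?case
  proof (induction g rule: laurent_induct)
    case (monomial m d)
    have "lconst c * lmon n * (lconst d * lmon m) = lconst (c * d) * lmon (n + m)"
      by (simp add: lconst_mult lmon_add ac_simps)
    then show ?case using assms by (simp add: leval_single power_int_add)
  next
    case (add f g)
    then show ?case by (simp add: leval_add algebra_simps)
  qed
next
  case (add f g)
  then show ?case by (simp add: leval_add algebra_simps)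
qed

lemma leval_lmon [simp]: "leval (lmon n) x = x powi n"
  using leval_single[of 1 n x] by simp

lemma leval_lconst [simp]: "leval (lconst c) x = c"
  using leval_single[of c 0 x] by simp

lemma leval_0 [simp]: "leval 0 x = 0"
  using leval_lconst[of 0 x] by simp

lemma leval_1 [simp]: "leval 1 x = 1"
  using leval_lmon[of 0 x] by (simp del: leval_lmon)

lemma leval_uminus: "leval (- f) x = - leval f x"
  using leval_add[of f "- f" x] by (simp add: eq_neg_iff_add_eq_0 add.commute)

lemma leval_diff: "leval (f - g) x = leval f x - leval g x"
  using leval_add[of f "- g" x] by (simp add: leval_uminus)

lemma leval_sum: "leval (sum f A) x = (\<Sum>i\<in>A. leval (f i) x)"
  by (induction A rule: infinite_finite_induct) (auto simp: leval_add)

lemma leval_lconst_times: "leval (lconst c * f) x = c * leval f x"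
proof (induction f rule: laurent_induct)
  case (monomial n d)
  have "lconst c * (lconst d * lmon n) = lconst (c * d) * lmon n"
    by (simp add: lconst_mult mult.assoc)
  then show ?case by (simp only: leval_single mult.assoc)
next
  case (add f g)
  then show ?case by (simp add: leval_add algebra_simps)
qed

subsection \<open>The reflections of the variable\<close>

text \<open>The substitution of \<open>v / X\<close> for \<open>X\<close>: the operator \<open>s\<close> for \<open>v = 1\<close> and \<open>\<pi>\<close> for \<open>v = q^(1/2)\<close>.\<close>

definition xrefl :: "'a \<Rightarrow> 'a::field laurent \<Rightarrow> 'a laurent" where
  "xrefl v f = (\<Sum>n\<in>Poly_Mapping.keys f. Poly_Mapping.single (- n) (Poly_Mapping.lookup f n * v powi n))"

lemma xrefl_add: "xrefl v (f + g) = xrefl v f + xrefl v g"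
  unfolding xrefl_def by (rule laurent_ext_add) (auto simp: algebra_simps single_add)

lemma xrefl_single: "xrefl v (lconst c * lmon n) = lconst (c * v powi n) * lmon (- n)"
  unfolding xrefl_def single_eq_lconst_lmon[symmetric] by (cases "c = 0") auto

lemma xrefl_mult:
  assumes "v \<noteq> 0"
  shows "xrefl v (f * g) = xrefl v f * xrefl v g"
proof (induction f rule: laurent_induct)
  case (monomial n c)
  show ?case
  proof (induction g rule: laurent_induct)
    case (monomial m d)
    have 1: "lconst c * lmon n * (lconst d * lmon m) = lconst (c * d) * lmon (n + m)"
      by (simp add: lconst_mult lmon_add ac_simps)
    have 2: "lmon (- (n + m)) = lmon (- n) * (lmon (- m) :: 'a laurent)"
      using lmon_add[of "-n" "-m"] by simp
    show ?case using assms unfolding 1 xrefl_single 2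
      by (simp add: power_int_add lconst_mult ac_simps)
  next
    case (add f g)
    then show ?case by (simp add: xrefl_add algebra_simps)
  qed
next
  case (add f g)
  then show ?case by (simp add: xrefl_add algebra_simps)
qed

lemma xrefl_lmon: "xrefl v (lmon n) = lconst (v powi n) * lmon (- n)"
  using xrefl_single[of v 1 n] by simp

lemma xrefl_lconst [simp]: "xrefl v (lconst c) = lconst c"
  using xrefl_single[of v c 0] by simp

lemma xrefl_0 [simp]: "xrefl v 0 = 0"
  using xrefl_lconst[of v 0] by simp

lemma xrefl_1 [simp]: "xrefl v 1 = 1"
  using xrefl_lconst[of v 1] by simp

lemma xrefl_lconst_times: "xrefl v (lconst c * f) = lconst c * xrefl v f"
proof (induction f rule: laurent_induct)
  case (monomial n d)
  have 1: "lconst c * (lconst d * lmon n) = lconst (c * d) * lmon n"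
    by (simp add: lconst_mult mult.assoc)
  show ?case unfolding 1 xrefl_single by (simp only: lconst_mult mult.assoc)
next
  case (add f g)
  then show ?case by (simp add: xrefl_add algebra_simps)
qed

lemma xrefl_uminus: "xrefl v (- f) = - xrefl v f"
  using xrefl_add[of v f "- f"] by (simp add: eq_neg_iff_add_eq_0 add.commute)

lemma xrefl_diff: "xrefl v (f - g) = xrefl v f - xrefl v g"
  using xrefl_add[of v f "- g"] by (simp add: xrefl_uminus)

lemma xrefl_xrefl:
  assumes "v \<noteq> 0"
  shows "xrefl v (xrefl v f) = f"
proof (induction f rule: laurent_induct)
  case (monomial n c)
  have "c * v powi n * v powi (- n) = c" using assms by (simp add: power_int_minus)
  then show ?case by (simp only: xrefl_single minus_minus)
next
  case (add f g)
  then show ?case by (simp add: xrefl_add)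
qed

lemma xrefl_1_xrefl:
  assumes "v \<noteq> 0"
  shows "xrefl v (xrefl 1 f) = xrefl 1 (xrefl (inverse v) f)"
proof (induction f rule: laurent_induct)
  case (monomial n c)
  show ?case using assms by (simp add: xrefl_single power_int_minus power_int_inverse)
next
  case (add f g)
  then show ?case by (simp add: xrefl_add)
qed

lemma lookup_xrefl: "Poly_Mapping.lookup (xrefl v f) n = Poly_Mapping.lookup f (- n) * v powi (- n)"
proof (induction f rule: laurent_induct)
  case (monomial m c)
  show ?case by (auto simp: xrefl_single lookup_lmon)
next
  case (add f g)
  then show ?case by (simp add: xrefl_add lookup_add algebra_simps)
qed

lemma leval_xrefl:
  assumes "x \<noteq> 0"
  shows "leval (xrefl v f) x = leval f (v / x)"
proof (induction f rule: laurent_induct)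
  case (monomial m c)
  show ?case unfolding xrefl_single leval_single
    by (simp only: power_int_mult_distrib power_int_inverse power_int_minus divide_inverse mult.assoc)
next
  case (add f g)
  then show ?case by (simp add: xrefl_add leval_add)
qed

lemma s_op_eq_xrefl: "s_op = xrefl 1"
  by (rule ext) (simp add: s_op_def xrefl_def)

lemma pi_op_eq_xrefl: "pi_op = xrefl"
  by (intro ext) (simp add: pi_op_def xrefl_def)

subsection \<open>The divided difference\<close>

definition dd :: "'a::field laurent \<Rightarrow> 'a laurent" where
  "dd f = (THE g. (lmon 2 - 1) * g = xrefl 1 f - f)"

lemma lmon_power: "lmon m ^ j = lmon (int j * m)"
proof (induction j)
  case (Suc j)
  have "int (Suc j) * m = m + int j * m" by (simp add: algebra_simps)
  then show ?case using Suc by (simp only: power_Suc lmon_add)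
qed simp

lemma lmon_2_neg: "lmon 2 * lmon (- 2) = (1 :: 'a::field laurent)"
  using lmon_add[of 2 "- 2"] by simp

lemma lmon_2_nz: "lmon 2 - 1 \<noteq> (0 :: 'a::field laurent)"
proof
  assume "lmon 2 - 1 = (0 :: 'a laurent)"
  then have "Poly_Mapping.lookup (lmon 2 - lmon 0 :: 'a laurent) 2 = 0" by simp
  then show False by (simp add: lookup_minus lookup_lmon del: lmon_0)
qed

text \<open>For a power of \<open>X\<close> the difference is a monomial times \<open>X^(2 j) - 1\<close>.\<close>

lemma dd_dvd: "(lmon 2 - 1 :: 'a::field laurent) dvd xrefl 1 f - f"
proof (induction f rule: laurent_induct)
  case (monomial n c)
  have *: "(lmon 2 - 1 :: 'a laurent) dvd lmon (2 * int j) - 1" for j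
    using power_diff_1_eq[of "lmon 2 :: 'a laurent" j] by (simp add: lmon_power mult.commute)
  have "(lmon 2 - 1 :: 'a laurent) dvd lmon (- n) - lmon n"
  proof (cases "n \<ge> 0")
    case True
    have "lmon (- n) - lmon n = - (lmon (- n) * (lmon (2 * int (nat n)) - 1 :: 'a laurent))"
      using True by (simp add: right_diff_distrib lmon_add[symmetric])
    then show ?thesis using * by (metis dvd_minus_iff dvd_mult)
  next
    case False
    have "lmon (- n) - lmon n = lmon n * (lmon (2 * int (nat (- n))) - 1 :: 'a laurent)"
      using False by (simp add: right_diff_distrib lmon_add[symmetric])
    then show ?thesis using * by (metis dvd_mult)
  qed
  then have "(lmon 2 - 1 :: 'a laurent) dvd lconst c * (lmon (- n) - lmon n)"
    by (rule dvd_mult)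
  then show ?case by (simp add: xrefl_single right_diff_distrib)
next
  case (add f g)
  have "xrefl 1 (f + g) - (f + g) = (xrefl 1 f - f) + (xrefl 1 g - g)"
    by (simp add: xrefl_add)
  then show ?case using add by (metis dvd_add)
qed

lemma dd_eq_iff: "dd f = g \<longleftrightarrow> (lmon 2 - 1) * g = xrefl 1 f - f"
proof -
  obtain h where h: "xrefl 1 f - f = (lmon 2 - 1) * h"
    using dd_dvd[of f] by (rule dvdE)
  have u: "g' = h" if "(lmon 2 - 1) * g' = xrefl 1 f - f" for g'
    using that unfolding h by (simp only: mult_left_cancel[OF lmon_2_nz])
  have "dd f = h" unfolding dd_def
    by (rule the_equality) (simp only: h, rule u)
  then show ?thesis using h[symmetric] u by blast
qed

lemma dd_eq: "(lmon 2 - 1) * dd f = xrefl 1 f - f"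
  using dd_eq_iff by blast

lemma dd_add: "dd (f + g) = dd f + dd g"
  by (subst dd_eq_iff) (simp add: distrib_left dd_eq xrefl_add)

lemma dd_mult: "dd (f * g) = xrefl 1 f * dd g + dd f * g"
proof (subst dd_eq_iff)
  have "(lmon 2 - 1) * (xrefl 1 f * dd g + dd f * g) = xrefl 1 f * ((lmon 2 - 1) * dd g) + ((lmon 2 - 1) * dd f) * g"
    by (simp add: algebra_simps)
  also have "\<dots> = xrefl 1 (f * g) - f * g"
    unfolding dd_eq xrefl_mult[OF one_neq_zero] by (simp add: algebra_simps)
  finally show "(lmon 2 - 1) * (xrefl 1 f * dd g + dd f * g) = xrefl 1 (f * g) - f * g" .
qed

lemma dd_invariant: "xrefl 1 f = f \<Longrightarrow> dd f = 0"
  by (subst dd_eq_iff) simp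

lemma dd_lconst_times: "dd (lconst c * f) = lconst c * dd f"
  by (simp add: dd_mult dd_invariant)

lemma dd_uminus: "dd (- f) = - dd f"
  using dd_lconst_times[of "- 1" f] by (simp add: lconst_uminus)

lemma dd_diff: "dd (f - g) = dd f - dd g"
  using dd_add[of f "- g"] by (simp add: dd_uminus)

lemma dd_xrefl: "dd (xrefl 1 f) = - dd f"
  unfolding dd_eq_iff mult_minus_right dd_eq xrefl_xrefl[OF one_neq_zero] by simp

text \<open>The reflection multiplies \<open>X^2 - 1\<close> by \<open>- X^(-2)\<close>, and changes the sign of the dividend.\<close>

lemma xrefl_dd: "xrefl 1 (dd f) = lmon 2 * dd f"
proof -
  have *: "xrefl 1 ((lmon 2 - 1) * dd f) = f - xrefl 1 f"
    by (simp add: dd_eq xrefl_diff xrefl_xrefl)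
  have "lmon 2 * xrefl 1 ((lmon 2 - 1) * dd f) = lmon 2 * ((lmon (- 2) - 1) * xrefl 1 (dd f))"
    by (simp add: xrefl_mult xrefl_diff xrefl_lmon)
  also have "\<dots> = - (lmon 2 - 1) * xrefl 1 (dd f)"
  proof -
    have "lmon 2 * ((lmon (- 2) - 1) * xrefl 1 (dd f))
      = (lmon 2 * lmon (- 2)) * xrefl 1 (dd f) - lmon 2 * xrefl 1 (dd f)"
      by (simp only: left_diff_distrib right_diff_distrib mult.assoc mult_1_left)
    then show ?thesis unfolding lmon_2_neg by (simp add: left_diff_distrib)
  qed
  finally have "(lmon 2 - 1) * xrefl 1 (dd f) = lmon 2 * (xrefl 1 f - f)"
    unfolding * by (simp add: algebra_simps)
  also have "\<dots> = (lmon 2 - 1) * (lmon 2 * dd f)"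
    by (simp only: dd_eq[symmetric] mult.left_commute)
  finally show ?thesis by (simp only: mult_left_cancel[OF lmon_2_nz])
qed

text \<open>The preceding lemma says that \<open>dd f\<close>, reflected, differs from \<open>dd f\<close> by \<open>(X^2 - 1) dd f\<close>.\<close>

lemma dd_dd: "dd (dd f) = dd f"
  by (subst dd_eq_iff) (simp add: xrefl_dd algebra_simps)

lemma dd_lmon_1: "dd (lmon 1) = - lmon (- 1)"
  by (subst dd_eq_iff) (simp add: xrefl_lmon algebra_simps lmon_add[symmetric])

text \<open>Comparison of coefficients in the equation defining \<open>dd f\<close>. As the coefficients vanish far out, this
  recurrence determines them, and they are obtained from those of \<open>f\<close> by additions and subtractions only.\<close>

lemma lookup_dd_step: "Poly_Mapping.lookup (dd f) (k - 2) = Poly_Mapping.lookup (dd f) k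
    + Poly_Mapping.lookup f (- k) - Poly_Mapping.lookup f k"
proof -
  have "Poly_Mapping.lookup ((lmon 2 - 1) * dd f) k = Poly_Mapping.lookup (xrefl 1 f - f) k"
    by (simp add: dd_eq)
  then show ?thesis
    unfolding left_diff_distrib lookup_minus lookup_lmon_times lookup_xrefl by (simp add: algebra_simps)
qed

lemma lookup_eventually_0: "\<exists>K. \<forall>k. \<bar>k\<bar> \<ge> K \<longrightarrow> Poly_Mapping.lookup f (k::int) = 0"
proof -
  have "bdd_above (abs ` Poly_Mapping.keys f)" by simp
  then obtain K where K: "\<And>k. k \<in> Poly_Mapping.keys f \<Longrightarrow> \<bar>k\<bar> \<le> K"
    by (auto simp: bdd_above_def)
  show ?thesis
    by (rule exI[of _ "K + 1"]) (use K in \<open>force simp: in_keys_iff\<close>)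
qed

text \<open>Outside the support of \<open>f\<close> the recurrence makes the coefficients constant along steps of two, and they
  vanish far out.\<close>

lemma lookup_dd_top:
  assumes "\<And>k. \<bar>k\<bar> > n \<Longrightarrow> Poly_Mapping.lookup f k = 0" and "k > n - 2" "n \<ge> 0"
  shows "Poly_Mapping.lookup (dd f) k = 0"
proof -
  obtain K where K: "\<And>k. \<bar>k\<bar> \<ge> K \<Longrightarrow> Poly_Mapping.lookup (dd f) (k::int) = 0"
    using lookup_eventually_0 by metis
  have "Poly_Mapping.lookup (dd f) (k + 2 * int j) = Poly_Mapping.lookup (dd f) k" for j
  proof (induction j)
    case (Suc j)
    have "Poly_Mapping.lookup (dd f) (k + 2 * int (Suc j) - 2) = Poly_Mapping.lookup (dd f) (k + 2 * int (Suc j))"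
      unfolding lookup_dd_step using assms by simp
    then show ?case using Suc by simp
  qed simp
  from this[of "nat (\<bar>K\<bar> + \<bar>k\<bar>)"] show ?thesis using K by simp
qed

lemma lookup_dd_bottom:
  assumes "\<And>k. \<bar>k\<bar> > n \<Longrightarrow> Poly_Mapping.lookup f k = 0" and "k < - n" "n \<ge> 0"
  shows "Poly_Mapping.lookup (dd f) k = 0"
proof -
  obtain K where K: "\<And>k. \<bar>k\<bar> \<ge> K \<Longrightarrow> Poly_Mapping.lookup (dd f) (k::int) = 0"
    using lookup_eventually_0 by metis
  have "Poly_Mapping.lookup (dd f) (k - 2 * int j) = Poly_Mapping.lookup (dd f) k" for j
  proof (induction j)
    case (Suc j)
    have "Poly_Mapping.lookup (dd f) (k - 2 * int j - 2) = Poly_Mapping.lookup (dd f) (k - 2 * int j)"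
      unfolding lookup_dd_step using assms by simp
    then show ?case using Suc by (simp add: algebra_simps)
  qed simp
  from this[of "nat (\<bar>K\<bar> + \<bar>k\<bar>)"] show ?thesis using K by simp
qed

subsection \<open>The Demazure-Lusztig operator and the difference Dunkl operator\<close>

text \<open>The operator \<open>T\<close> with \<open>w = t^(1/2)\<close>, over any field: it is needed for rational functions as well as for
  numbers.\<close>

definition dl :: "'a \<Rightarrow> 'a::field laurent \<Rightarrow> 'a laurent" where
  "dl w f = lconst w * xrefl 1 f + lconst (w - inverse w) * dd f"

lemma T_op_eq_dl: "T_op = dl"
  by (intro ext) (simp add: T_op_def dl_def dd_def s_op_eq_xrefl)

lemma dl_add: "dl w (f + g) = dl w f + dl w g"
  by (simp add: dl_def xrefl_add dd_add algebra_simps)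

lemma dl_lconst_times: "dl w (lconst c * f) = lconst c * dl w f"
  unfolding dl_def xrefl_lconst_times dd_lconst_times by (simp add: algebra_simps)

lemma dl_uminus: "dl w (- f) = - dl w f"
  by (simp add: dl_def xrefl_uminus dd_uminus algebra_simps)

lemma dl_diff: "dl w (f - g) = dl w f - dl w g"
  by (simp add: dl_def xrefl_diff dd_diff algebra_simps)

lemma dl_invariant_times: "xrefl 1 p = p \<Longrightarrow> dl w (p * f) = p * dl w f"
  by (simp add: dl_def xrefl_mult dd_mult dd_invariant algebra_simps)

lemma dl_1: "dl w 1 = lconst w"
  by (simp add: dl_def dd_invariant)

text \<open>The quadratic relation for \<open>T\<close> amounts to this identity, with \<open>a = w\<close>, \<open>b = 1/w\<close>, \<open>s\<close> the reflection
  of \<open>f\<close> and \<open>d\<close> its divided difference.\<close>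

lemma hecke_quadratic_identity:
  fixes a b :: "'b::comm_ring_1"
  assumes "a * b = 1"
  shows "a * (a * f + (a - b) * (d + s - f)) + (a - b) * (a * - d + (a - b) * d)
    = (a - b) * (a * s + (a - b) * d) + f"
proof -
  have "a * (a * f + (a - b) * (d + s - f)) + (a - b) * (a * - d + (a - b) * d)
    = (a - b) * (a * s + (a - b) * d) + (a * b) * f"
    by (simp add: algebra_simps)
  then show ?thesis using assms by simp
qed

lemma dl_dl:
  assumes "w \<noteq> 0"
  shows "dl w (dl w f) = lconst (w - inverse w) * dl w f + f"
proof -
  have w: "lconst w * lconst (inverse w) = 1"
    using assms by (simp flip: lconst_mult)
  have d: "lmon 2 * dd f = dd f + xrefl 1 f - f"
    using dd_eq[of f] by (simp add: algebra_simps)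
  show ?thesis
    unfolding dl_def xrefl_add dd_add xrefl_lconst_times dd_lconst_times xrefl_xrefl[OF one_neq_zero]
      xrefl_dd dd_xrefl dd_dd d
    unfolding lconst_diff using w by (rule hecke_quadratic_identity)
qed

lemma dl_lmon_1:
  assumes "w \<noteq> 0"
  shows "dl w (lmon 1 * f) = lmon (- 1) * (dl w f - lconst (w - inverse w) * f)"
  unfolding dl_def xrefl_mult[OF one_neq_zero] dd_mult dd_lmon_1 xrefl_lmon by (simp add: algebra_simps)

text \<open>The value of \<open>T f\<close> at \<open>x\<close> involves only the values of \<open>f\<close> at \<open>x\<close> and \<open>1/x\<close>. This gives the action
  of \<open>T\<close> on functions on a set of points, and shows that \<open>x = t^(-1/2)\<close> is special: there the coefficient
  of \<open>f(1/x)\<close> is zero.\<close>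

lemma leval_dl:
  assumes "x \<noteq> 0" "w \<noteq> 0"
  shows "(x ^ 2 - 1) * leval (dl w f) x
    = (w * x ^ 2 - inverse w) * leval f (inverse x) - (w - inverse w) * leval f x"
proof -
  have "leval ((lmon 2 - 1) * dd f) x = leval (xrefl 1 f - f) x"
    by (simp add: dd_eq)
  then have d: "(x ^ 2 - 1) * leval (dd f) x = leval f (inverse x) - leval f x"
    using assms by (simp add: leval_mult leval_diff leval_xrefl inverse_eq_divide power_int_numeral)
  have "leval (dl w f) x = w * leval f (inverse x) + (w - inverse w) * leval (dd f) x"
    using assms by (simp add: dl_def leval_add leval_lconst_times leval_xrefl inverse_eq_divide)
  then have "(x ^ 2 - 1) * leval (dl w f) x = (x ^ 2 - 1) * w * leval f (inverse x)
     + (w - inverse w) * ((x ^ 2 - 1) * leval (dd f) x)"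
    by (simp only: distrib_left mult.assoc mult.left_commute)
  then show ?thesis unfolding d by (simp add: algebra_simps)
qed

definition dunkl :: "'a \<Rightarrow> 'a \<Rightarrow> 'a::field laurent \<Rightarrow> 'a laurent" where
  "dunkl v w f = xrefl v (dl w f)"

lemma Y_op_eq_dunkl: "Y_op = dunkl"
  by (intro ext) (simp add: Y_op_def dunkl_def T_op_eq_dl pi_op_eq_xrefl)

definition dl_inv :: "'a \<Rightarrow> 'a::field laurent \<Rightarrow> 'a laurent" where
  "dl_inv w f = dl w f - lconst (w - inverse w) * f"

definition dunkl_inv :: "'a \<Rightarrow> 'a \<Rightarrow> 'a::field laurent \<Rightarrow> 'a laurent" where
  "dunkl_inv v w f = dl_inv w (xrefl v f)"

lemma dl_inv_dl: "w \<noteq> 0 \<Longrightarrow> dl_inv w (dl w f) = f"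
  by (simp add: dl_inv_def dl_dl)

lemma dl_dl_inv: "w \<noteq> 0 \<Longrightarrow> dl w (dl_inv w f) = f"
  by (simp add: dl_inv_def dl_diff dl_lconst_times dl_dl)

lemma dunkl_inv_dunkl: "v \<noteq> 0 \<Longrightarrow> w \<noteq> 0 \<Longrightarrow> dunkl_inv v w (dunkl v w f) = f"
  by (simp add: dunkl_inv_def dunkl_def xrefl_xrefl dl_inv_dl)

lemma dunkl_dunkl_inv: "v \<noteq> 0 \<Longrightarrow> w \<noteq> 0 \<Longrightarrow> dunkl v w (dunkl_inv v w f) = f"
  by (simp add: dunkl_inv_def dunkl_def xrefl_xrefl dl_dl_inv)

lemma dunkl_add: "dunkl v w (f + g) = dunkl v w f + dunkl v w g"
  by (simp add: dunkl_def dl_add xrefl_add)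

lemma dunkl_lconst_times: "dunkl v w (lconst c * f) = lconst c * dunkl v w f"
  by (simp add: dunkl_def dl_lconst_times xrefl_lconst_times)

lemma dunkl_0 [simp]: "dunkl v w 0 = 0"
  using dunkl_lconst_times[of v w 0 0] by simp

lemma dunkl_diff: "dunkl v w (f - g) = dunkl v w f - dunkl v w g"
  by (simp add: dunkl_def dl_diff xrefl_diff)

lemma dunkl_invariant_times:
  assumes "xrefl 1 p = p" "v \<noteq> 0"
  shows "dunkl v w (p * f) = xrefl v p * dunkl v w f"
  using assms by (simp add: dunkl_def dl_invariant_times xrefl_mult)

lemma dl_inv_add: "dl_inv w (f + g) = dl_inv w f + dl_inv w g"
  by (simp add: dl_inv_def dl_add algebra_simps)

lemma dl_inv_lconst_times: "dl_inv w (lconst c * f) = lconst c * dl_inv w f"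
  unfolding dl_inv_def dl_lconst_times by (simp add: algebra_simps)

subsection \<open>Constant terms and adjoint operators\<close>

lemma ct_add: "ct \<mu> (f + g) = ct \<mu> f + ct \<mu> g"
  unfolding ct_def by (rule laurent_ext_add) (auto simp: algebra_simps)

lemma ct_single: "ct \<mu> (lconst c * lmon n) = c * \<mu> (- n)"
  unfolding ct_def single_eq_lconst_lmon[symmetric] by (cases "c = 0") auto

lemma ct_lmon: "ct \<mu> (lmon n) = \<mu> (- n)"
  using ct_single[of \<mu> 1 n] by simp

lemma ct_lconst_times: "ct \<mu> (lconst c * f) = c * ct \<mu> f"
proof (induction f rule: laurent_induct)
  case (monomial n d)
  have "lconst c * (lconst d * lmon n) = lconst (c * d) * lmon n"
    by (simp add: lconst_mult mult.assoc)
  then show ?case by (simp only: ct_single mult.assoc)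
next
  case (add f g)
  then show ?case by (simp add: ct_add algebra_simps)
qed

lemma ct_0 [simp]: "ct \<mu> 0 = 0"
  using ct_lconst_times[of \<mu> 0 0] by simp

lemma ct_uminus: "ct \<mu> (- f) = - ct \<mu> f"
  using ct_add[of \<mu> f "- f"] by (simp add: eq_neg_iff_add_eq_0 add.commute)

lemma ct_diff: "ct \<mu> (f - g) = ct \<mu> f - ct \<mu> g"
  using ct_add[of \<mu> f "- g"] by (simp add: ct_uminus)

text \<open>\<open>weight_coeffs\<close> holds for the coefficients of \<open>\<mu>\<close>: the first equation is
  the invariance under \<open>X \<mapsto> q^(1/2) X^(-1)\<close>, the second one is
  \<open>(1 - t X^2) \<mu>(X) = (t - X^2) \<mu>(X^(-1))\<close>.\<close>

definition weight_coeffs :: "'a \<Rightarrow> 'a \<Rightarrow> (int \<Rightarrow> 'a::field) \<Rightarrow> bool" where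
  "weight_coeffs v w \<mu> \<longleftrightarrow> (\<forall>n. \<mu> (- n) = v powi n * \<mu> n) \<and>
     (\<forall>n. \<mu> n - w ^ 2 * \<mu> (n - 2) = w ^ 2 * \<mu> (- n) - \<mu> (2 - n))"

lemma ct_xrefl:
  assumes "weight_coeffs v w \<mu>"
  shows "ct \<mu> (xrefl v f) = ct \<mu> f"
proof (induction f rule: laurent_induct)
  case (monomial n c)
  show ?case using assms by (simp add: xrefl_single ct_single weight_coeffs_def)
next
  case (add f g)
  then show ?case by (simp add: xrefl_add ct_add)
qed

text \<open>The second symmetry of \<open>\<mu>\<close>, with its denominators moved to the argument of the functional.\<close>

lemma ct_reflect_factor:
  assumes "weight_coeffs v w \<mu>"
  shows "ct \<mu> ((1 - lconst (w ^ 2) * lmon 2) * f) = ct \<mu> ((lconst (w ^ 2) - lmon (- 2)) * xrefl 1 f)"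
proof (induction f rule: laurent_induct)
  case (monomial n c)
  have 1: "(1 - lconst (w ^ 2) * lmon 2) * (lconst c * lmon n)
    = lconst c * lmon n - lconst (c * w ^ 2) * lmon (n + 2)"
    by (simp add: algebra_simps lconst_mult lmon_add)
  have "lmon (- n - 2) = lmon (- n) * (lmon (- 2) :: 'a laurent)"
    using lmon_add[of "- n" "- 2"] by simp
  then have 2: "(lconst (w ^ 2) - lmon (- 2)) * xrefl 1 (lconst c * lmon n)
    = lconst (c * w ^ 2) * lmon (- n) - lconst c * lmon (- n - 2)"
    by (simp add: xrefl_single algebra_simps lconst_mult)
  have "\<mu> (- n) - w ^ 2 * \<mu> (- n - 2) = w ^ 2 * \<mu> n - \<mu> (n + 2)"
    using assms unfolding weight_coeffs_def by (metis (no_types, opaque_lifting) diff_minus_eq_add add.commute minus_minus)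
  then have "c * (\<mu> (- n) - w ^ 2 * \<mu> (- n - 2)) = c * (w ^ 2 * \<mu> n - \<mu> (n + 2))"
    by simp
  then show ?case unfolding 1 2 ct_diff ct_single by (simp add: algebra_simps)
next
  case (add f g)
  then show ?case by (simp add: xrefl_add ct_add distrib_left)
qed

text \<open>For \<open>g = dd f\<close> the reflection of \<open>g\<close> is \<open>X^2 g\<close>, so the second symmetry makes the constant term of
  \<open>(1 - t X^2) g \<mu>\<close> equal to its own negative; and \<open>(T - w) f\<close> is a multiple of \<open>(1 - t X^2) g\<close>.\<close>

lemma ct_dd:
  assumes "weight_coeffs v w \<mu>" "(2::'a::field) \<noteq> 0" "w \<noteq> (0::'a)"
  shows "ct \<mu> (lconst w * xrefl 1 f + lconst (w - inverse w) * dd f) = ct \<mu> (lconst w * f)"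
proof -
  define p where "p = dd f"
  have "ct \<mu> ((1 - lconst (w ^ 2) * lmon 2) * p) = ct \<mu> ((lconst (w ^ 2) - lmon (- 2)) * (lmon 2 * p))"
    using ct_reflect_factor[OF assms(1), of p] by (simp add: p_def xrefl_dd)
  also have "(lconst (w ^ 2) - lmon (- 2)) * (lmon 2 * p) = - ((1 - lconst (w ^ 2) * lmon 2) * p)"
  proof -
    have "lmon (- 2) * (lmon 2 * p) = (lmon 2 * lmon (- 2)) * p"
      by (simp only: ac_simps)
    then have "lmon (- 2) * (lmon 2 * p) = p"
      by (simp only: lmon_2_neg mult_1_left)
    then show ?thesis by (simp only: left_diff_distrib mult.assoc minus_diff_eq mult_1_left)
  qed
  finally have "2 * ct \<mu> ((1 - lconst (w ^ 2) * lmon 2) * p) = 0"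
    by (simp add: ct_uminus)
  then have z: "ct \<mu> ((1 - lconst (w ^ 2) * lmon 2) * p) = 0"
    using assms by simp
  have "inverse w * w ^ 2 = w"
    using assms by (simp add: power2_eq_square)
  then have w: "lconst (inverse w) * lconst (w ^ 2) = lconst w"
    by (simp flip: lconst_mult)
  have "lconst w * xrefl 1 f + lconst (w - inverse w) * dd f - lconst w * f
    = lconst w * ((lmon 2 - 1) * p) + lconst (w - inverse w) * p"
    unfolding p_def dd_eq by (simp add: algebra_simps)
  also have "\<dots> = lconst (- inverse w) * ((1 - lconst (w ^ 2) * lmon 2) * p)"
    using w by (simp add: lconst_diff lconst_uminus left_diff_distrib right_diff_distrib flip: mult.assoc)
  finally have "ct \<mu> (lconst w * xrefl 1 f + lconst (w - inverse w) * dd f - lconst w * f) = 0"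
    using z by (simp add: ct_lconst_times)
  then show ?thesis by (simp add: ct_diff)
qed

text \<open>By the product rule for divided differences, the difference of the two arguments is \<open>T - w\<close> applied to
  \<open>g f\<close>, where the preceding lemma applies.\<close>

lemma ct_dl_adjoint:
  assumes "weight_coeffs v w \<mu>" "(2::'a::field) \<noteq> 0" "w \<noteq> (0::'a)"
  shows "ct \<mu> (dl w f * xrefl 1 g) = ct \<mu> (f * xrefl 1 (dl_inv (inverse w) g))"
proof -
  have d: "lmon 2 * dd g = dd g + xrefl 1 g - g"
    using dd_eq[of g] by (simp add: algebra_simps)
  have adj: "xrefl 1 (dl_inv (inverse w) g) = lconst w * g - lconst (w - inverse w) * dd g"
    using assms(3) unfolding dl_inv_def dl_def xrefl_diff xrefl_add xrefl_lconst_times xrefl_xrefl[OF one_neq_zero] xrefl_dd d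
    by (simp add: lconst_diff algebra_simps)
  have "dl w f * xrefl 1 g - f * xrefl 1 (dl_inv (inverse w) g)
    = lconst w * xrefl 1 (g * f) + lconst (w - inverse w) * dd (g * f) - lconst w * (g * f)"
    unfolding adj dl_def xrefl_mult[OF one_neq_zero] dd_mult by (simp add: algebra_simps)
  then have "ct \<mu> (dl w f * xrefl 1 g - f * xrefl 1 (dl_inv (inverse w) g)) = 0"
    using ct_dd[OF assms, of "g * f"] by (simp only: ct_diff diff_self)
  then show ?thesis by (simp add: ct_diff)
qed

lemma ct_refl_adjoint:
  assumes "weight_coeffs v w \<mu>" "v \<noteq> 0"
  shows "ct \<mu> (xrefl v f * xrefl 1 g) = ct \<mu> (f * xrefl 1 (xrefl (inverse v) g))"
proof -
  have "ct \<mu> (xrefl v f * xrefl 1 g) = ct \<mu> (xrefl v (f * xrefl v (xrefl 1 g)))"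
    using assms by (simp add: xrefl_mult xrefl_xrefl)
  also have "\<dots> = ct \<mu> (f * xrefl 1 (xrefl (inverse v) g))"
    using assms by (simp add: ct_xrefl xrefl_1_xrefl)
  finally show ?thesis .
qed

lemma ct_dunkl_adjoint:
  assumes "weight_coeffs v w \<mu>" "(2::'a::field) \<noteq> 0" "w \<noteq> (0::'a)" "v \<noteq> 0"
  shows "ct \<mu> (dunkl v w f * xrefl 1 g) = ct \<mu> (f * xrefl 1 (dunkl_inv (inverse v) (inverse w) g))"
  using assms by (simp add: dunkl_def dunkl_inv_def ct_refl_adjoint ct_dl_adjoint)

section \<open>Nonsymmetric polynomials over a field\<close>

text \<open>The position of the exponent in the list 0, 1, -1, 2, -2, 3, and so on, which is the order \<open>\<prec>\<close>. As a
  natural number it serves for inductions and for counting.\<close>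

definition lrank :: "int \<Rightarrow> nat" where
  "lrank m = nat (if m > 0 then 2 * m - 1 else - 2 * m)"

lemma lprec_iff_rank: "lprec m n \<longleftrightarrow> lrank m < lrank n"
  by (auto simp: lprec_def lrank_def)

lemma rank_inj: "lrank m = lrank n \<Longrightarrow> m = n"
  by (auto simp: lrank_def nat_eq_iff split: if_splits) presburger+

lemma finite_rank_less: "finite {m. lrank m < r}"
  by (rule finite_subset[of _ "{- int r..int r}"]) (auto simp: lrank_def split: if_splits)

definition unitriangular :: "(int \<Rightarrow> 'a::field laurent) \<Rightarrow> bool" where
  "unitriangular F \<longleftrightarrow> (\<forall>m. Poly_Mapping.lookup (F m) m = 1) \<and>
     (\<forall>m k. Poly_Mapping.lookup (F m) k \<noteq> 0 \<longrightarrow> lrank k \<le> lrank m)"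

definition lsubspace :: "'a::field laurent set \<Rightarrow> bool" where
  "lsubspace S \<longleftrightarrow> 0 \<in> S \<and> (\<forall>f\<in>S. \<forall>g\<in>S. f + g \<in> S) \<and> (\<forall>c. \<forall>f\<in>S. lconst c * f \<in> S)"

lemma lsubspace_sum:
  assumes "lsubspace S" "\<And>i. i \<in> A \<Longrightarrow> f i \<in> S"
  shows "sum f A \<in> S"
  using assms(2) by (induction A rule: infinite_finite_induct) (use assms(1) in \<open>auto simp: lsubspace_def\<close>)

lemma lsubspace_uminus: "lsubspace S \<Longrightarrow> f \<in> S \<Longrightarrow> - f \<in> S"
  unfolding lsubspace_def by (metis lconst_1 lconst_uminus mult_minus1)

lemma lsubspace_diff: "lsubspace S \<Longrightarrow> f \<in> S \<Longrightarrow> g \<in> S \<Longrightarrow> f - g \<in> S"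
  using lsubspace_uminus[of S g] unfolding lsubspace_def by (metis diff_conv_add_uminus)

text \<open>Induction along the order: \<open>F m\<close> is \<open>X^m\<close> plus lower monomials.\<close>

lemma unitriangular_lmon_mem:
  assumes F: "unitriangular F" and S: "lsubspace S"
  shows "(\<And>j. lrank j \<le> lrank m \<Longrightarrow> F j \<in> S) \<Longrightarrow> lmon m \<in> S"
proof (induction "lrank m" arbitrary: m rule: less_induct)
  case less
  let ?K = "Poly_Mapping.keys (F m)"
  have "m \<in> ?K" using F by (simp add: unitriangular_def in_keys_iff)
  then have "F m = lmon m + (\<Sum>k\<in>?K - {m}. lconst (Poly_Mapping.lookup (F m) k) * lmon k)"
    using laurent_expand[of "F m"] F
    by (simp add: sum.remove single_eq_lconst_lmon unitriangular_def)
  moreover have "(\<Sum>k\<in>?K - {m}. lconst (Poly_Mapping.lookup (F m) k) * lmon k) \<in> S"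
  proof (rule lsubspace_sum[OF S])
    fix k assume k: "k \<in> ?K - {m}"
    then have "lrank k \<le> lrank m" "lrank k \<noteq> lrank m"
      using F by (auto simp: unitriangular_def in_keys_iff dest: rank_inj)
    then have "lmon k \<in> S"
      using less.hyps[of k] less.prems by simp
    then show "lconst (Poly_Mapping.lookup (F m) k) * lmon k \<in> S"
      using S by (simp add: lsubspace_def)
  qed
  ultimately show ?case
    using lsubspace_diff[OF S] less.prems[of m] by (metis add_diff_cancel_right' order_refl)
qed

lemma unitriangular_mem:
  assumes F: "unitriangular F" and S: "lsubspace S"
    and sup: "\<And>k. Poly_Mapping.lookup f k \<noteq> 0 \<Longrightarrow> lrank k < r"
    and mem: "\<And>j. lrank j < r \<Longrightarrow> F j \<in> S"
  shows "f \<in> S"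
proof -
  have "(\<Sum>n\<in>Poly_Mapping.keys f. lconst (Poly_Mapping.lookup f n) * lmon n) \<in> S"
  proof (rule lsubspace_sum[OF S])
    fix n assume "n \<in> Poly_Mapping.keys f"
    then have "lrank n < r" using sup by (simp add: in_keys_iff)
    then have "lmon n \<in> S"
      using unitriangular_lmon_mem[OF F S, of n] mem by simp
    then show "lconst (Poly_Mapping.lookup f n) * lmon n \<in> S"
      using S by (simp add: lsubspace_def)
  qed
  then show ?thesis using laurent_expand[of f] by (simp add: single_eq_lconst_lmon)
qed

lemma lsubspace_span: "lsubspace {\<Sum>j\<in>A. lconst (c j) * F j | c. True}"
  unfolding lsubspace_def
proof safe
  show "\<exists>c. 0 = (\<Sum>j\<in>A. lconst (c j) * F j) \<and> True"
    by (rule exI[of _ "\<lambda>_. 0"]) simp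
next
  fix c d :: "'b \<Rightarrow> 'a"
  show "\<exists>e. (\<Sum>j\<in>A. lconst (c j) * F j) + (\<Sum>j\<in>A. lconst (d j) * F j) = (\<Sum>j\<in>A. lconst (e j) * F j) \<and> True"
    by (rule exI[of _ "\<lambda>j. c j + d j"]) (simp add: lconst_add distrib_right sum.distrib)
next
  fix c :: "'b \<Rightarrow> 'a" and d :: 'a
  show "\<exists>e. lconst d * (\<Sum>j\<in>A. lconst (c j) * F j) = (\<Sum>j\<in>A. lconst (e j) * F j) \<and> True"
    by (rule exI[of _ "\<lambda>j. d * c j"]) (simp add: lconst_mult sum_distrib_left mult.assoc)
qed

lemma unitriangular_expand:
  assumes F: "unitriangular F"
    and sup: "\<And>k. Poly_Mapping.lookup f k \<noteq> 0 \<Longrightarrow> lrank k < r"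
  obtains c where "f = (\<Sum>j\<in>{j. lrank j < r}. lconst (c j) * F j)"
proof -
  let ?S = "{\<Sum>j\<in>{j. lrank j < r}. lconst (c j) * F j | c. True}"
  have "f \<in> ?S"
  proof (rule unitriangular_mem[OF F lsubspace_span])
    fix j assume j: "lrank j < r"
    have "F j = (\<Sum>i\<in>{i. lrank i < r}. lconst (if i = j then 1 else 0) * F i)"
      using j finite_rank_less[of r]
      by (subst sum.remove[of _ j]) auto
    then show "F j \<in> ?S" by (intro CollectI exI conjI TrueI)
  qed (rule sup)
  then show ?thesis using that by blast
qed

lemma ex_rank_bound: "\<exists>r. \<forall>k. Poly_Mapping.lookup f k \<noteq> 0 \<longrightarrow> lrank k < r"
proof -
  have "finite (lrank ` Poly_Mapping.keys f)" by simp
  then obtain r where "\<forall>x\<in>lrank ` Poly_Mapping.keys f. x < r"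
    using finite_nat_set_iff_bounded by blast
  then show ?thesis by (intro exI[of _ r]) (auto simp: in_keys_iff)
qed

text \<open>The coefficient of the leading monomial of the combination comes from one vector only.\<close>

lemma unitriangular_independent:
  assumes F: "unitriangular F" and fin: "finite A"
    and z: "(\<Sum>j\<in>A. lconst (c j) * F j) = 0" and j: "j \<in> A"
  shows "c j = 0"
proof (rule ccontr)
  assume "c j \<noteq> 0"
  define B where "B = {i\<in>A. c i \<noteq> 0}"
  have B: "finite B" "B \<noteq> {}" using fin j \<open>c j \<noteq> 0\<close> by (auto simp: B_def)
  have "Max (lrank ` B) \<in> lrank ` B" using B by (intro Max_in) auto
  then obtain i where i: "i \<in> B" "\<And>k. k \<in> B \<Longrightarrow> lrank k \<le> lrank i"
    using B by (metis (no_types, lifting) Max_ge finite_imageI image_iff)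
  have "0 = Poly_Mapping.lookup (\<Sum>j\<in>A. lconst (c j) * F j) i" using z by simp
  also have "\<dots> = (\<Sum>j\<in>A. c j * Poly_Mapping.lookup (F j) i)"
    by (simp add: lookup_sum)
  also have "\<dots> = (\<Sum>j\<in>A. if j = i then c i else 0)"
  proof (rule sum.cong)
    fix k assume k: "k \<in> A"
    show "c k * Poly_Mapping.lookup (F k) i = (if k = i then c i else 0)"
    proof (cases "k = i \<or> c k = 0")
      case True
      then show ?thesis using F i(1) by (auto simp: unitriangular_def B_def)
    next
      case False
      then have "lrank k \<le> lrank i" "k \<noteq> i" using k i(2) by (auto simp: B_def)
      then have "lrank k < lrank i" using rank_inj[of k i] by linarith
      then have "Poly_Mapping.lookup (F k) i = 0"
        using F unfolding unitriangular_def by (metis not_less)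
      then show ?thesis using False by simp
    qed
  qed simp
  also have "\<dots> = c i" using fin i(1) by (simp add: B_def)
  finally show False using i(1) by (simp add: B_def)
qed

subsection \<open>The intertwiners\<close>

text \<open>The constant to be subtracted from \<open>T\<close> to turn an eigenvector of \<open>Y\<close> with the eigenvalue \<open>1 / (w v^n)\<close>
  into one with the inverse eigenvalue.\<close>

definition icoef :: "'a::field \<Rightarrow> 'a \<Rightarrow> nat \<Rightarrow> 'a" where
  "icoef v w n = (w - inverse w) / (1 - w ^ 2 * v ^ (2 * n))"

text \<open>The intertwiner \<open>X \<pi>\<close>; the power of \<open>v\<close> keeps the leading coefficient equal to 1.\<close>

definition up :: "'a::field \<Rightarrow> nat \<Rightarrow> 'a laurent \<Rightarrow> 'a laurent" where
  "up v n f = lconst (v ^ n) * (lmon 1 * xrefl v f)"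

text \<open>The intertwiner built from \<open>T\<close>; the factor \<open>w\<close> keeps the leading coefficient equal to 1.\<close>

definition turn :: "'a::field \<Rightarrow> 'a \<Rightarrow> nat \<Rightarrow> 'a laurent \<Rightarrow> 'a laurent" where
  "turn v w n f = lconst w * (dl w f - lconst (icoef v w n) * f)"

primrec en :: "'a::field \<Rightarrow> 'a \<Rightarrow> nat \<Rightarrow> 'a laurent" where
  "en v w 0 = 1"
| "en v w (Suc n) = turn v w (Suc n) (up v n (en v w n))"

definition ep :: "'a::field \<Rightarrow> 'a \<Rightarrow> nat \<Rightarrow> 'a laurent" where
  "ep v w n = up v n (en v w n)"

lemma en_Suc: "en v w (Suc n) = turn v w (Suc n) (ep v w n)"
  by (simp add: ep_def)

declare en.simps(2) [simp del]

text \<open>Starting from 1, the intertwiners pass through the indices 0, 1, -1, 2, -2, and so on, in the order of the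
  monomials.\<close>

definition E :: "'a::field \<Rightarrow> 'a \<Rightarrow> int \<Rightarrow> 'a laurent" where
  "E v w m = (if m > 0 then ep v w (nat (m - 1)) else en v w (nat (- m)))"

text \<open>The eigenvalue \<open>q^(- m_#)\<close> of \<open>Y\<close>.\<close>

definition lam :: "'a::field \<Rightarrow> 'a \<Rightarrow> int \<Rightarrow> 'a" where
  "lam v w m = (if m > 0 then inverse (w * v ^ nat m) else w * v ^ nat (- m))"

lemma E_neg: "E v w (- int n) = en v w n"
  by (simp add: E_def)

lemma E_pos: "E v w (int (Suc n)) = ep v w n" "E v w (1 + int n) = ep v w n"
  by (simp_all add: E_def)

lemma E_cases:
  obtains (neg) n where "m = - int n" | (pos) n where "m = int (Suc n)"
proof (cases "m > 0")
  case True
  then show ?thesis using pos[of "nat (m - 1)"] by simp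
next
  case False
  then show ?thesis using neg[of "nat (- m)"] by simp
qed

text \<open>The denominators of the intertwiners are nonzero. This covers the two variables of the rational functions,
  numbers inside the unit disc, and the roots of unity of the theorem.\<close>

locale generic_params =
  fixes v w :: "'a::field"
  assumes v_nz: "v \<noteq> 0" and w_nz: "w \<noteq> 0"
    and nonres: "\<And>n. n \<ge> 1 \<Longrightarrow> w ^ 2 * v ^ (2 * n) \<noteq> 1"
begin

lemma generic_inverse: "generic_params (inverse v) (inverse w)"
proof
  fix n :: nat assume "n \<ge> 1"
  have "inverse w ^ 2 * inverse v ^ (2 * n) = inverse (w ^ 2 * v ^ (2 * n))"
    by (simp add: power_inverse)
  then show "inverse w ^ 2 * inverse v ^ (2 * n) \<noteq> 1"
    using nonres[OF \<open>n \<ge> 1\<close>] by (metis inverse_1 inverse_inverse_eq)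
qed (use v_nz w_nz in auto)

lemma lam_nz: "lam v w m \<noteq> 0"
  using v_nz w_nz by (simp add: lam_def)

lemma lam_inverse: "lam (inverse v) (inverse w) m = inverse (lam v w m)"
  by (simp add: lam_def power_inverse)

lemma dunkl_eq_dl:
  assumes "dunkl v w f = lconst a * f"
  shows "dl w f = lconst a * xrefl v f"
proof -
  have "xrefl v (dunkl v w f) = dl w f"
    using v_nz by (simp add: dunkl_def xrefl_xrefl)
  then show ?thesis using assms by (simp add: xrefl_lconst_times)
qed

text \<open>As \<open>Y = \<pi> T\<close>, an eigenvector satisfies \<open>T f = a \<pi> f\<close>. Then \<open>T X T = X^(-1)\<close> gives an
  eigenvector equation for \<open>X \<pi> f\<close>.\<close>

lemma dunkl_up:
  assumes "dunkl v w f = lconst a * f" "a \<noteq> 0"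
  shows "dunkl v w (up v n f) = lconst (inverse (a * v)) * up v n f"
proof -
  have "dl_inv w (dl w f) = f" using w_nz by (rule dl_inv_dl)
  then have "lconst a * dl_inv w (xrefl v f) = f"
    using dunkl_eq_dl[OF assms(1)] by (simp add: dl_inv_lconst_times)
  then have "lconst (inverse a) * (lconst a * dl_inv w (xrefl v f)) = lconst (inverse a) * f"
    by simp
  then have 1: "dl_inv w (xrefl v f) = lconst (inverse a) * f"
    using assms(2) by (simp flip: mult.assoc lconst_mult)
  have "dl w (lmon 1 * xrefl v f) = lmon (- 1) * dl_inv w (xrefl v f)"
    using w_nz by (simp add: dl_lmon_1 dl_inv_def)
  then have "dl w (lmon 1 * xrefl v f) = lconst (inverse a) * (lmon (- 1) * f)"
    unfolding 1 by (simp add: mult.left_commute)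
  then have "dunkl v w (lmon 1 * xrefl v f) = lconst (inverse a) * (lconst (inverse v) * (lmon 1 * xrefl v f))"
    using v_nz unfolding dunkl_def by (simp add: xrefl_lconst_times xrefl_mult xrefl_lmon mult.assoc)
  then have "dunkl v w (lmon 1 * xrefl v f) = lconst (inverse (a * v)) * (lmon 1 * xrefl v f)"
    by (simp add: lconst_mult mult.assoc)
  then show ?thesis
    unfolding up_def dunkl_lconst_times by (simp only: mult.left_commute)
qed

text \<open>On the span of \<open>f\<close> and \<open>T f\<close> the operator \<open>Y\<close> is triangular with the eigenvalues \<open>a\<close> and \<open>1/a\<close>.\<close>

lemma dunkl_dl:
  assumes "dunkl v w f = lconst a * f" "a \<noteq> 0"
  shows "dunkl v w (dl w f) = lconst ((w - inverse w) * a) * f + lconst (inverse a) * dl w f"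
proof -
  have "dl w f = lconst a * xrefl v f" by (rule dunkl_eq_dl[OF assms(1)])
  then have "lconst (inverse a) * dl w f = lconst (inverse a) * (lconst a * xrefl v f)" by simp
  then have "xrefl v f = lconst (inverse a) * dl w f"
    using assms(2) by (simp flip: mult.assoc lconst_mult)
  moreover have "xrefl v (dl w f) = lconst a * f"
    using assms(1) by (simp add: dunkl_def)
  ultimately show ?thesis
    unfolding dunkl_def dl_dl[OF w_nz] xrefl_add xrefl_lconst_times
    by (simp add: lconst_mult mult.assoc)
qed

text \<open>The eigenvector for the second eigenvalue of the triangular action of \<open>Y\<close> on \<open>f\<close> and \<open>T f\<close>.\<close>

lemma dunkl_turn:
  assumes "dunkl v w f = lconst (inverse (w * v ^ n)) * f" "n \<ge> 1"
  shows "dunkl v w (turn v w n f) = lconst (w * v ^ n) * turn v w n f"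
proof -
  define a where "a = inverse (w * v ^ n)"
  define b where "b = icoef v w n"
  have a: "a \<noteq> 0" "inverse a = w * v ^ n" using v_nz w_nz by (auto simp: a_def)
  have "inverse a ^ 2 = w ^ 2 * v ^ (2 * n)"
    unfolding a(2) by (simp add: power_mult_distrib mult.commute flip: power_mult)
  then have "b * (1 - inverse a ^ 2) = w - inverse w"
    unfolding b_def icoef_def using nonres[OF assms(2)] by simp
  then have "(w - inverse w) * a - b * a = - (b * (inverse a ^ 2 * a))"
    by (simp add: algebra_simps flip: \<open>b * (1 - inverse a ^ 2) = w - inverse w\<close>)
  moreover have "inverse a ^ 2 * a = inverse a"
    using a(1) by (simp add: power2_eq_square)
  ultimately have "(w - inverse w) * a - b * a = - (b * inverse a)"
    by simp
  then have *: "lconst ((w - inverse w) * a) - lconst (b * a) = - lconst (b * inverse a)"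
    by (simp flip: lconst_diff lconst_uminus)
  have 1: "dunkl v w f = lconst a * f" using assms(1) by (simp add: a_def)
  have "dunkl v w (dl w f - lconst b * f) = lconst ((w - inverse w) * a) * f + lconst (inverse a) * dl w f
     - lconst (b * a) * f"
    using dunkl_dl[OF 1 a(1)] 1 by (simp add: dunkl_diff dunkl_lconst_times lconst_mult mult.assoc)
  also have "\<dots> = (lconst ((w - inverse w) * a) - lconst (b * a)) * f + lconst (inverse a) * dl w f"
    by (simp only: left_diff_distrib) simp
  also have "\<dots> = lconst (inverse a) * (dl w f - lconst b * f)"
    unfolding * unfolding lconst_mult by (simp add: algebra_simps)
  finally have "dunkl v w (dl w f - lconst b * f) = lconst (inverse a) * (dl w f - lconst b * f)" .
  then show ?thesis
    unfolding turn_def dunkl_lconst_times b_def[symmetric] a(2)[symmetric] by (simp add: mult.left_commute)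
qed

lemma dunkl_en: "dunkl v w (en v w n) = lconst (w * v ^ n) * en v w n"
  and dunkl_ep: "dunkl v w (ep v w n) = lconst (inverse (w * v ^ Suc n)) * ep v w n"
proof -
  have "dunkl v w (en v w n) = lconst (w * v ^ n) * en v w n \<and>
    dunkl v w (ep v w n) = lconst (inverse (w * v ^ Suc n)) * ep v w n"
  proof (induction n)
    case 0
    have "dunkl v w (en v w 0) = lconst (w * v ^ 0) * en v w 0"
      by (simp add: dunkl_def dl_1)
    moreover from dunkl_up[OF this] v_nz w_nz
    have "dunkl v w (ep v w 0) = lconst (inverse (w * v ^ Suc 0)) * ep v w 0"
      by (simp add: ep_def)
    ultimately show ?case by blast
  next
    case (Suc n)
    then have "dunkl v w (ep v w n) = lconst (inverse (w * v ^ Suc n)) * ep v w n" by blast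
    from dunkl_turn[OF this]
    have "dunkl v w (en v w (Suc n)) = lconst (w * v ^ Suc n) * en v w (Suc n)"
      by (simp add: en_Suc)
    moreover from dunkl_up[OF this, of "Suc n"] v_nz w_nz
    have "dunkl v w (ep v w (Suc n)) = lconst (inverse (w * v ^ Suc (Suc n))) * ep v w (Suc n)"
      unfolding ep_def[of v w "Suc n"] by (simp add: mult.assoc power_Suc2 del: power_Suc)
    ultimately show ?case by blast
  qed
  then show "dunkl v w (en v w n) = lconst (w * v ^ n) * en v w n"
    "dunkl v w (ep v w n) = lconst (inverse (w * v ^ Suc n)) * ep v w n" by auto
qed

lemma dunkl_E: "dunkl v w (E v w m) = lconst (lam v w m) * E v w m"
proof (cases rule: E_cases[of m])
  case (neg n)
  then show ?thesis by (simp add: E_neg dunkl_en lam_def)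
next
  case (pos n)
  then show ?thesis unfolding pos E_pos dunkl_ep by (simp add: lam_def nat_add_distrib)
qed

subsection \<open>Triangularity\<close>

text \<open>The reflection and shift in \<open>up\<close> move the support from \<open>[-n, n]\<close> to \<open>[1 - n, n + 1]\<close>, and \<open>T\<close>
  extends the latter to the symmetric interval \<open>[-n - 1, n + 1]\<close>. The new leading coefficient comes from the
  lowest coefficient of the divided difference.\<close>

lemma en_ep_support:
  "Poly_Mapping.lookup (en v w n) (- int n) = 1 \<and> (\<forall>k. \<bar>k\<bar> > int n \<longrightarrow> Poly_Mapping.lookup (en v w n) k = 0)
   \<and> Poly_Mapping.lookup (ep v w n) (1 + int n) = 1
   \<and> (\<forall>k. k > 1 + int n \<or> k \<le> - int n - 1 \<longrightarrow> Poly_Mapping.lookup (ep v w n) k = 0)"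
proof -
  have ep: "Poly_Mapping.lookup (ep v w n) (1 + int n) = 1
   \<and> (\<forall>k. k > 1 + int n \<or> k \<le> - int n - 1 \<longrightarrow> Poly_Mapping.lookup (ep v w n) k = 0)"
    if "Poly_Mapping.lookup (en v w n) (- int n) = 1"
      "\<forall>k. \<bar>k\<bar> > int n \<longrightarrow> Poly_Mapping.lookup (en v w n) k = 0" for n
  proof -
    have l: "Poly_Mapping.lookup (ep v w n) k
      = v ^ n * (Poly_Mapping.lookup (en v w n) (1 - k) * v powi (1 - k))" for k
      by (simp add: ep_def up_def lookup_xrefl)
    have "v ^ n * v powi (- int n) = 1"
      using v_nz by (simp add: power_int_minus)
    then show ?thesis unfolding l using that by auto
  qed
  have en: "Poly_Mapping.lookup (en v w n) (- int n) = 1 \<and>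
    (\<forall>k. \<bar>k\<bar> > int n \<longrightarrow> Poly_Mapping.lookup (en v w n) k = 0)" for n
  proof (induction n)
    case 0
    show ?case by (auto simp: lookup_one when_def)
  next
    case (Suc n)
    define f where "f = ep v w n"
    have f1: "Poly_Mapping.lookup f (int (Suc n)) = 1"
      and f0: "\<And>k. k > int (Suc n) \<Longrightarrow> Poly_Mapping.lookup f k = 0"
        "\<And>k. k \<le> - int (Suc n) \<Longrightarrow> Poly_Mapping.lookup f k = 0"
      using ep[of n] Suc by (auto simp: f_def algebra_simps)
    have f00: "\<And>k. \<bar>k\<bar> > int (Suc n) \<Longrightarrow> Poly_Mapping.lookup f k = 0"
    proof -
      fix k assume "\<bar>k\<bar> > int (Suc n)"
      then have "k > int (Suc n) \<or> k \<le> - int (Suc n)" by linarith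
      then show "Poly_Mapping.lookup f k = 0" using f0 by blast
    qed
    have l: "Poly_Mapping.lookup (en v w (Suc n)) k = w * (w * Poly_Mapping.lookup f (- k)
      + (w - inverse w) * Poly_Mapping.lookup (dd f) k - icoef v w (Suc n) * Poly_Mapping.lookup f k)" for k
      by (simp add: en_Suc turn_def dl_def f_def[symmetric] lookup_add lookup_minus lookup_xrefl)
    have "Poly_Mapping.lookup (dd f) (- int (Suc n) - 2) = 0"
      by (rule lookup_dd_bottom[of "int (Suc n)"]) (use f00 in auto)
    then have "Poly_Mapping.lookup (dd f) (- int (Suc n)) = - 1"
      unfolding lookup_dd_step using f1 f0(2) by (simp add: eq_neg_iff_add_eq_0 add.commute)
    then have "Poly_Mapping.lookup (en v w (Suc n)) (- int (Suc n)) = 1"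
      unfolding l using f1 f0(2) w_nz by (simp add: field_simps)
    moreover have "Poly_Mapping.lookup (en v w (Suc n)) k = 0" if "\<bar>k\<bar> > int (Suc n)" for k
    proof -
      have "Poly_Mapping.lookup (dd f) k = 0"
      proof (cases "k > 0")
        case True
        then show ?thesis using lookup_dd_top[of "int (Suc n)" f k] f00 that by auto
      next
        case False
        then show ?thesis using lookup_dd_bottom[of "int (Suc n)" f k] f00 that by auto
      qed
      then show ?thesis unfolding l using f00 that by simp
    qed
    ultimately show ?case by blast
  qed
  then show ?thesis using ep[of n] by blast
qed

lemma unitriangular_E: "unitriangular (E v w)"
  unfolding unitriangular_def
proof safe
  fix m
  show "Poly_Mapping.lookup (E v w m) m = 1"
  proof (cases rule: E_cases[of m])
    case (neg n)
    then show ?thesis by (simp add: E_neg en_ep_support)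
  next
    case (pos n)
    then show ?thesis using en_ep_support[of n] by (simp add: E_pos)
  qed
next
  fix m k assume nz: "Poly_Mapping.lookup (E v w m) k \<noteq> 0"
  show "lrank k \<le> lrank m"
  proof (cases rule: E_cases[of m])
    case (neg n)
    then have "\<bar>k\<bar> \<le> int n" using nz en_ep_support[of n] by (auto simp: E_neg not_less[symmetric])
    then show ?thesis by (auto simp: lrank_def neg)
  next
    case (pos n)
    then have "k \<le> 1 + int n" "k > - int n - 1"
      using nz en_ep_support[of n] unfolding pos E_pos by (metis not_less)+
    then show ?thesis by (auto simp: lrank_def pos)
  qed
qed

subsection \<open>Values at \<open>X = t^(-1/2)\<close>\<close>

lemma leval_dl_special:
  assumes "w ^ 2 \<noteq> 1"
  shows "leval (dl w f) (inverse w) = w * leval f (inverse w)"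
proof -
  have "((inverse w) ^ 2 - 1) * leval (dl w f) (inverse w)
    = (w * (inverse w) ^ 2 - inverse w) * leval f (inverse (inverse w)) - (w - inverse w) * leval f (inverse w)"
    by (rule leval_dl) (use w_nz in auto)
  also have "\<dots> = ((inverse w) ^ 2 - 1) * (w * leval f (inverse w))"
    using w_nz by (simp add: field_simps power2_eq_square)
  finally show ?thesis using assms w_nz by (simp add: power_inverse)
qed

lemma leval_ep:
  assumes "w ^ 2 \<noteq> 1"
  shows "leval (ep v w n) (inverse w) = inverse w * leval (en v w n) (inverse w)"
proof -
  have T: "dl w (en v w n) = lconst (w * v ^ n) * xrefl v (en v w n)"
    by (rule dunkl_eq_dl[OF dunkl_en])
  have "w * leval (en v w n) (inverse w) = w * v ^ n * leval (xrefl v (en v w n)) (inverse w)"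
    using leval_dl_special[OF assms, of "en v w n"] unfolding T leval_lconst_times by (rule sym)
  then have "leval (en v w n) (inverse w) = v ^ n * leval (xrefl v (en v w n)) (inverse w)"
    by (simp only: mult.assoc mult_left_cancel[OF w_nz])
  then show ?thesis
    using w_nz by (simp add: ep_def up_def leval_lconst_times leval_mult)
qed

text \<open>At \<open>X = 1/w\<close> the operator \<open>T\<close> acts on values as multiplication by \<open>w\<close>, so an intertwiner multiplies
  the value by a constant.\<close>

lemma leval_en_Suc:
  assumes "w ^ 2 \<noteq> 1"
  shows "leval (en v w (Suc n)) (inverse w)
    = (1 - w ^ 4 * v ^ (2 * Suc n)) / (1 - w ^ 2 * v ^ (2 * Suc n)) * leval (ep v w n) (inverse w)"
proof -
  have nr: "1 - w ^ 2 * v ^ (2 * Suc n) \<noteq> 0" using nonres[of "Suc n"] by simp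
  have "leval (en v w (Suc n)) (inverse w) = w * (w - icoef v w (Suc n)) * leval (ep v w n) (inverse w)"
    unfolding en_Suc turn_def leval_lconst_times leval_diff leval_dl_special[OF assms]
    by (simp add: algebra_simps)
  moreover have "w * (w - icoef v w (Suc n)) = (1 - w ^ 4 * v ^ (2 * Suc n)) / (1 - w ^ 2 * v ^ (2 * Suc n))"
  proof -
    define x where "x = v ^ (2 * Suc n)"
    have "w * (w - (w - inverse w) / (1 - w ^ 2 * x)) = (1 - w ^ 4 * x) / (1 - w ^ 2 * x)"
      using nr w_nz unfolding x_def[symmetric]
      by (simp add: divide_simps) (simp add: algebra_simps power2_eq_square power4_eq_xxxx)
    then show ?thesis by (simp add: icoef_def x_def)
  qed
  ultimately show ?thesis by simp
qed

lemma leval_E_nz: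
  assumes "w ^ 2 \<noteq> 1" "\<And>n. n \<ge> 1 \<Longrightarrow> w ^ 4 * v ^ (2 * n) \<noteq> 1"
  shows "leval (E v w m) (inverse w) \<noteq> 0"
proof -
  have en: "leval (en v w n) (inverse w) \<noteq> 0" for n
  proof (induction n)
    case (Suc n)
    then show ?case
      using assms(2)[of "Suc n"] nonres[of "Suc n"] w_nz
      by (simp add: leval_en_Suc[OF assms(1)] leval_ep[OF assms(1)])
  qed simp
  show ?thesis
  proof (cases rule: E_cases[of m])
    case (neg n)
    then show ?thesis using en by (simp add: E_neg)
  next
    case (pos n)
    then show ?thesis using en w_nz unfolding pos E_pos leval_ep[OF assms(1)] by simp
  qed
qed

end

text \<open>The conditions on the parameters are invariant under their inversion.\<close>

lemma leval_E_inverse_nz: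
  assumes "generic_params v w" "w ^ 2 \<noteq> 1" "\<And>n. n \<ge> 1 \<Longrightarrow> w ^ 4 * v ^ (2 * n) \<noteq> (1::'a::field)"
  shows "leval (E (inverse v) (inverse w) m) (inverse (inverse w)) \<noteq> 0"
proof -
  interpret generic_params v w by fact
  interpret inv: generic_params "inverse v" "inverse w" by (rule generic_inverse)
  show ?thesis
  proof (rule inv.leval_E_nz)
    show "inverse w ^ 2 \<noteq> 1" using assms(2) by (simp add: power_inverse)
    fix n :: nat assume "n \<ge> 1"
    have "inverse w ^ 4 * inverse v ^ (2 * n) = inverse (w ^ 4 * v ^ (2 * n))"
      by (simp add: power_inverse)
    then show "inverse w ^ 4 * inverse v ^ (2 * n) \<noteq> 1"
      using assms(3)[OF \<open>n \<ge> 1\<close>] by (metis inverse_1 inverse_inverse_eq)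
  qed
qed

subsection \<open>Orthogonality and norms\<close>

text \<open>The form with an explicit second argument: instead of conjugating the constants of \<open>g\<close>, the vectors for
  the inverted parameters are inserted.\<close>

definition lform :: "(int \<Rightarrow> 'a) \<Rightarrow> 'a::field laurent \<Rightarrow> 'a laurent \<Rightarrow> 'a" where
  "lform \<mu> f g = ct \<mu> (f * xrefl 1 g)"

lemma lform_add_left: "lform \<mu> (f + g) h = lform \<mu> f h + lform \<mu> g h"
  by (simp add: lform_def distrib_right ct_add)

lemma lform_add_right: "lform \<mu> h (f + g) = lform \<mu> h f + lform \<mu> h g"
  by (simp add: lform_def xrefl_add distrib_left ct_add)

lemma lform_lconst_left: "lform \<mu> (lconst c * f) g = c * lform \<mu> f g"
  by (simp add: lform_def ct_lconst_times mult.assoc)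

lemma lform_lconst_right: "lform \<mu> f (lconst c * g) = c * lform \<mu> f g"
  unfolding lform_def xrefl_lconst_times mult.left_commute[of f] by (rule ct_lconst_times)

text \<open>This is \<open>1 / \<mu>^1(m_#)\<close> in terms of the square roots of \<open>q\<close> and \<open>t\<close>, in the form in which it arises
  from the intertwiners.\<close>

definition sph_norm :: "'a::field \<Rightarrow> 'a \<Rightarrow> int \<Rightarrow> 'a" where
  "sph_norm v w m = (\<Prod>i=1..nat (if m > 0 then m - 1 else - m).
     w ^ 2 * (1 - v ^ (2 * i)) / (1 - w ^ 4 * v ^ (2 * i)))"

context generic_params
begin

abbreviation "E' \<equiv> E (inverse v) (inverse w)"

lemma lform_dl:
  assumes "weight_coeffs v w \<mu>" "(2::'a) \<noteq> 0"
  shows "lform \<mu> (dl w f) (dl (inverse w) g) = lform \<mu> f g"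
  using ct_dl_adjoint[OF assms w_nz, of f "dl (inverse w) g"] w_nz
  by (simp add: lform_def dl_inv_dl)

text \<open>Moving \<open>Y\<close> to the second argument replaces it by the inverse of the \<open>Y\<close> for the inverted parameters,
  whose eigenvalue on \<open>E' n\<close> is again \<open>lam v w n\<close>.\<close>

lemma lform_E_orth:
  assumes "weight_coeffs v w \<mu>" "(2::'a) \<noteq> 0" "lam v w m \<noteq> lam v w n"
  shows "lform \<mu> (E v w m) (E' n) = 0"
proof -
  interpret inv: generic_params "inverse v" "inverse w" by (rule generic_inverse)
  let ?Yi = "dunkl_inv (inverse v) (inverse w)"
  have "?Yi (dunkl (inverse v) (inverse w) (E' n)) = E' n"
    using v_nz w_nz by (simp add: dunkl_inv_dunkl)
  moreover have "?Yi (lconst c * f) = lconst c * ?Yi f" for c f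
    by (simp add: dunkl_inv_def xrefl_lconst_times dl_inv_lconst_times)
  ultimately have "lconst (inverse (lam v w n)) * ?Yi (E' n) = E' n"
    by (simp add: inv.dunkl_E lam_inverse)
  then have "lconst (lam v w n) * (lconst (inverse (lam v w n)) * ?Yi (E' n)) = lconst (lam v w n) * E' n"
    by simp
  then have Y: "?Yi (E' n) = lconst (lam v w n) * E' n"
    using lam_nz[of n] by (simp flip: mult.assoc lconst_mult)
  have "lam v w m * lform \<mu> (E v w m) (E' n) = lform \<mu> (dunkl v w (E v w m)) (E' n)"
    by (simp add: dunkl_E lform_lconst_left)
  also have "\<dots> = lform \<mu> (E v w m) (?Yi (E' n))"
    using ct_dunkl_adjoint[OF assms(1,2) w_nz v_nz] by (simp add: lform_def)
  also have "\<dots> = lam v w n * lform \<mu> (E v w m) (E' n)"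
    by (simp add: Y lform_lconst_right)
  finally show ?thesis using assms(3) by simp
qed

text \<open>The intertwiner \<open>X \<pi>\<close> is unitary.\<close>

lemma lform_ep:
  assumes "weight_coeffs v w \<mu>"
  shows "lform \<mu> (ep v w n) (ep (inverse v) (inverse w) n) = lform \<mu> (en v w n) (en (inverse v) (inverse w) n)"
proof -
  let ?f = "en v w n" and ?g = "en (inverse v) (inverse w) n"
  have 1: "xrefl 1 (up (inverse v) n ?g) = lconst (inverse v ^ n) * (lmon (- 1) * xrefl 1 (xrefl (inverse v) ?g))"
    by (simp add: up_def xrefl_lconst_times xrefl_mult xrefl_lmon)
  have 2: "lconst (v ^ n) * lconst (inverse v ^ n) = 1"
    using v_nz by (simp add: power_inverse flip: lconst_mult)
  have 3: "lmon 1 * lmon (- 1) = (1 :: 'a laurent)" by (simp flip: lmon_add)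
  have "up v n ?f * xrefl 1 (up (inverse v) n ?g)
    = (lconst (v ^ n) * lconst (inverse v ^ n)) * (lmon 1 * lmon (- 1)) * (xrefl v ?f * xrefl 1 (xrefl (inverse v) ?g))"
    unfolding 1 unfolding up_def by (simp only: ac_simps)
  then have "up v n ?f * xrefl 1 (up (inverse v) n ?g) = xrefl v ?f * xrefl 1 (xrefl (inverse v) ?g)"
    unfolding 2 3 by simp
  then show ?thesis
    using ct_refl_adjoint[OF assms v_nz, of ?f "xrefl (inverse v) ?g"] v_nz
    by (simp add: lform_def ep_def xrefl_xrefl)
qed

lemma icoef_factor:
  assumes "n \<ge> 1"
  shows "1 - icoef v w n * icoef (inverse v) (inverse w) n
    = (1 - v ^ (2 * n)) * (1 - w ^ 4 * v ^ (2 * n)) / (1 - w ^ 2 * v ^ (2 * n)) ^ 2"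
proof -
  define x where "x = v ^ (2 * n)"
  have x: "x \<noteq> 0" using v_nz by (simp add: x_def)
  define y where "y = w ^ 2 * x"
  have y: "y \<noteq> 0" "1 - y \<noteq> 0" using x w_nz nonres[OF assms] by (auto simp: x_def y_def)
  define d where "d = w - inverse w"
  have 1: "1 - inverse y = - ((1 - y) / y)" using y by (simp add: field_simps)
  have 2: "inverse w - inverse (inverse w) = - d" by (simp add: d_def)
  have "inverse w ^ 2 * inverse v ^ (2 * n) = inverse y"
    by (simp add: power_inverse x_def y_def)
  then have b': "icoef (inverse v) (inverse w) n = d * y / (1 - y)"
    unfolding icoef_def 2 by (simp add: 1)
  have b: "icoef v w n = d / (1 - y)"
    by (simp add: icoef_def x_def y_def d_def)
  have c: "(w - inverse w) ^ 2 * w ^ 2 = (w ^ 2 - 1) ^ 2"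
    using w_nz by (simp add: field_simps power2_eq_square)
  have "(1 - y) ^ 2 - (w - inverse w) ^ 2 * y = (1 - y) ^ 2 - (w ^ 2 - 1) ^ 2 * x"
    using c by (simp add: y_def flip: mult.assoc)
  also have "\<dots> = (1 - x) * (1 - w ^ 4 * x)"
    by (simp add: y_def algebra_simps power2_eq_square power4_eq_xxxx)
  finally have "(1 - y) ^ 2 - (w - inverse w) ^ 2 * y = (1 - x) * (1 - w ^ 4 * x)" .
  moreover have "1 - icoef v w n * icoef (inverse v) (inverse w) n
    = ((1 - y) ^ 2 - (w - inverse w) ^ 2 * y) / (1 - y) ^ 2"
    unfolding b b' d_def[symmetric] using y by (simp add: diff_divide_distrib power2_eq_square)
  ultimately show ?thesis by (simp add: x_def y_def)
qed

text \<open>Since \<open>T\<close> is unitary and \<open>T f\<close> is a combination of the orthogonal vectors \<open>f\<close> and \<open>turn f\<close>, this is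
  the theorem of Pythagoras.\<close>

lemma lform_en_Suc:
  assumes "weight_coeffs v w \<mu>" "(2::'a) \<noteq> 0"
  shows "lform \<mu> (en v w (Suc n)) (en (inverse v) (inverse w) (Suc n))
    = (1 - v ^ (2 * Suc n)) * (1 - w ^ 4 * v ^ (2 * Suc n)) / (1 - w ^ 2 * v ^ (2 * Suc n)) ^ 2
      * lform \<mu> (ep v w n) (ep (inverse v) (inverse w) n)"
proof -
  interpret inv: generic_params "inverse v" "inverse w" by (rule generic_inverse)
  let ?e = "en v w (Suc n)" and ?e' = "en (inverse v) (inverse w) (Suc n)"
  let ?f = "ep v w n" and ?f' = "ep (inverse v) (inverse w) n"
  let ?b = "icoef v w (Suc n)" and ?b' = "icoef (inverse v) (inverse w) (Suc n)"
  have T: "dl u f = lconst (inverse u) * turn z u k f + lconst (icoef z u k) * f" if "u \<noteq> 0" for z u :: 'a and f k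
  proof -
    have "lconst (inverse u) * turn z u k f = (lconst (inverse u) * lconst u) * (dl u f - lconst (icoef z u k) * f)"
      by (simp add: turn_def mult.assoc)
    also have "lconst (inverse u) * lconst u = (1 :: 'a laurent)"
      using that by (simp flip: lconst_mult)
    finally show ?thesis by simp
  qed
  have ne: "lam v w (int (Suc n)) \<noteq> lam v w (- int (Suc n))"
  proof
    assume "lam v w (int (Suc n)) = lam v w (- int (Suc n))"
    then have "inverse (w * v ^ Suc n) = w * v ^ Suc n"
      unfolding lam_def by (simp del: of_nat_Suc power_Suc)
    then have "1 = (w * v ^ Suc n) * (w * v ^ Suc n)"
      using v_nz w_nz by (metis mult_eq_0_iff power_not_zero right_inverse)
    also have "\<dots> = w ^ 2 * v ^ (2 * Suc n)"
      by (simp add: power2_eq_square power_mult power_even_eq ac_simps)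
    finally show False using nonres[of "Suc n"] by simp
  qed
  have o1: "lform \<mu> ?f ?e' = 0"
    using lform_E_orth[OF assms ne] by (simp only: E_neg E_pos)
  have o2: "lform \<mu> ?e ?f' = 0"
    using lform_E_orth[OF assms ne[symmetric]] by (simp only: E_neg E_pos)
  have "lform \<mu> ?f ?f' = lform \<mu> (dl w ?f) (dl (inverse w) ?f')"
    by (simp add: lform_dl[OF assms])
  also have "\<dots> = lform \<mu> (lconst (inverse w) * ?e + lconst ?b * ?f) (lconst w * ?e' + lconst ?b' * ?f')"
    unfolding en_Suc using T[OF w_nz, of ?f v "Suc n"] T[OF inv.w_nz, of ?f' "inverse v" "Suc n"] by simp
  also have "\<dots> = lform \<mu> ?e ?e' + ?b * ?b' * lform \<mu> ?f ?f'"
    using w_nz by (simp add: lform_add_left lform_add_right lform_lconst_left lform_lconst_right o1 o2)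
  finally have "lform \<mu> ?e ?e' = (1 - ?b * ?b') * lform \<mu> ?f ?f'"
    by (simp add: algebra_simps)
  then show ?thesis using icoef_factor[of "Suc n"] by simp
qed

text \<open>Under the intertwiners, both the norm and the product of the values at \<open>t^(-1/2)\<close> and \<open>t^(1/2)\<close> are
  multiplied by explicit factors; their quotient is the next factor of \<open>sph_norm\<close>.\<close>

lemma lform_E_diag:
  assumes "weight_coeffs v w \<mu>" "(2::'a) \<noteq> 0" "w ^ 2 \<noteq> 1" "\<And>n. n \<ge> 1 \<Longrightarrow> w ^ 4 * v ^ (2 * n) \<noteq> 1"
  shows "lform \<mu> (E v w m) (E' m)
    = \<mu> 0 * leval (E v w m) (inverse w) * leval (E' m) w * sph_norm v w m"
proof -
  interpret inv: generic_params "inverse v" "inverse w" by (rule generic_inverse)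
  have w': "inverse w ^ 2 \<noteq> 1" using assms(3) by (simp add: power_inverse)
  let ?en' = "en (inverse v) (inverse w)" and ?ep' = "ep (inverse v) (inverse w)"
  define P where "P n = (\<Prod>i=1..n. w ^ 2 * (1 - v ^ (2 * i)) / (1 - w ^ 4 * v ^ (2 * i)))" for n
  have val_ep: "leval (ep v w n) (inverse w) * leval (?ep' n) w
      = leval (en v w n) (inverse w) * leval (?en' n) w" for n
    using leval_ep[OF assms(3), of n] inv.leval_ep[OF w', of n] w_nz by simp
  have val_en: "leval (en v w (Suc n)) (inverse w) * leval (?en' (Suc n)) w
      = (1 - w ^ 4 * v ^ (2 * Suc n)) ^ 2 / (w ^ 2 * (1 - w ^ 2 * v ^ (2 * Suc n)) ^ 2) *
        (leval (ep v w n) (inverse w) * leval (?ep' n) w)" for n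
  proof -
    define x where "x = v ^ (2 * Suc n)"
    have x: "x \<noteq> 0" using v_nz by (simp add: x_def)
    have nr: "w ^ 2 * x \<noteq> 1" using nonres[of "Suc n"] by (simp add: x_def)
    have "(1 - inverse w ^ 4 * inverse x) / (1 - inverse w ^ 2 * inverse x)
      = (1 - w ^ 4 * x) / (w ^ 2 * (1 - w ^ 2 * x))"
    proof -
      have 1: "1 - inverse w ^ 4 * inverse x = - (1 - w ^ 4 * x) / (w ^ 4 * x)"
        using x w_nz by (simp add: field_simps)
      have 2: "1 - inverse w ^ 2 * inverse x = - (1 - w ^ 2 * x) / (w ^ 2 * x)"
        using x w_nz by (simp add: field_simps)
      have 3: "w ^ 4 = w ^ 2 * w ^ 2" by (simp add: power2_eq_square power4_eq_xxxx)
      have 4: "(- a / (z * z * x)) / (- b / (z * x)) = a / (z * b)" if "b \<noteq> 0" "z \<noteq> 0" for a b z :: 'a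
        using that x by (simp add: field_simps)
      have 5: "1 - w ^ 2 * x \<noteq> 0" "w ^ 2 \<noteq> 0" using w_nz nr by auto
      show ?thesis unfolding 1 2 using 4[OF 5, of "1 - w ^ 4 * x"] unfolding 3[symmetric] .
    qed
    then have "leval (?en' (Suc n)) w = (1 - w ^ 4 * x) / (w ^ 2 * (1 - w ^ 2 * x)) * leval (?ep' n) w"
      using inv.leval_en_Suc[OF w', of n] by (simp only: power_inverse x_def inverse_inverse_eq)
    then show ?thesis
      unfolding leval_en_Suc[OF assms(3), of n] x_def[symmetric]
      by (simp add: power2_eq_square ac_simps)
  qed
  have en: "lform \<mu> (en v w n) (?en' n) = \<mu> 0 * leval (en v w n) (inverse w) * leval (?en' n) w * P n" for n
  proof (induction n)
    case 0
    show ?case by (simp add: lform_def P_def ct_lmon[of \<mu> 0, simplified])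
  next
    case (Suc n)
    define x where "x = v ^ (2 * Suc n)"
    define V where "V = leval (ep v w n) (inverse w) * leval (?ep' n) w"
    have nr: "1 - w ^ 2 * x \<noteq> 0" "1 - w ^ 4 * x \<noteq> 0"
      using nonres[of "Suc n"] assms(4)[of "Suc n"] by (auto simp: x_def)
    have P: "P (Suc n) = P n * (w ^ 2 * (1 - x) / (1 - w ^ 4 * x))"
      by (simp add: P_def x_def)
    have "lform \<mu> (en v w (Suc n)) (?en' (Suc n)) = (1 - x) * (1 - w ^ 4 * x) / (1 - w ^ 2 * x) ^ 2 * (\<mu> 0 * V * P n)"
    proof -
      have h: "lform \<mu> (en v w n) (?en' n) = \<mu> 0 * V * P n"
        unfolding Suc V_def val_ep by (simp only: mult.assoc)
      show ?thesis
        unfolding lform_en_Suc[OF assms(1,2)] lform_ep[OF assms(1)] h x_def ..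
    qed
    also have "\<dots> = \<mu> 0 * ((1 - w ^ 4 * x) ^ 2 / (w ^ 2 * (1 - w ^ 2 * x) ^ 2) * V) * P (Suc n)"
    proof -
      have *: "y * a / b ^ 2 * (m * V * p) = m * (a ^ 2 / (z * b ^ 2) * V) * (p * (z * y / a))"
        if "a \<noteq> 0" "b \<noteq> 0" "z \<noteq> 0" for a b z y m p :: 'a
        using that by (simp add: power2_eq_square)
      show ?thesis unfolding P by (rule *) (use nr w_nz in auto)
    qed
    finally have 1: "lform \<mu> (en v w (Suc n)) (?en' (Suc n))
      = \<mu> 0 * ((1 - w ^ 4 * x) ^ 2 / (w ^ 2 * (1 - w ^ 2 * x) ^ 2) * V) * P (Suc n)" .
    show ?case unfolding 1 using val_en[of n] unfolding x_def[symmetric] V_def[symmetric]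
      by (simp only: mult.assoc)
  qed
  show ?thesis
  proof (cases rule: E_cases[of m])
    case (neg n)
    then show ?thesis using en[of n] by (simp add: E_neg sph_norm_def P_def)
  next
    case (pos n)
    have P: "sph_norm v w (int (Suc n)) = P n" by (simp add: sph_norm_def P_def)
    show ?thesis
      unfolding pos P E_pos lform_ep[OF assms(1)] en
      using val_ep[of n] by (simp only: mult.assoc)
  qed
qed

lemma lform_E_val:
  assumes "weight_coeffs v w \<mu>" "(2::'a) \<noteq> 0" "w ^ 2 \<noteq> 1" "\<And>n. n \<ge> 1 \<Longrightarrow> w ^ 4 * v ^ (2 * n) \<noteq> 1"
    and inj: "inj (lam v w)" and nz: "\<And>n. n \<ge> 1 \<Longrightarrow> v ^ (2 * n) \<noteq> 1" "\<mu> 0 \<noteq> 0"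
  shows "lform \<mu> (E v w m) (E' n) = 0 \<longleftrightarrow> m \<noteq> n"
proof (cases "m = n")
  case True
  have "leval (E' m) (inverse (inverse w)) \<noteq> 0"
    by (rule leval_E_inverse_nz[OF generic_params_axioms assms(3,4)])
  moreover have "sph_norm v w m \<noteq> 0"
    using nz(1) assms(4) w_nz by (auto simp: sph_norm_def)
  ultimately show ?thesis
    using lform_E_diag[OF assms(1-4), of m] leval_E_nz[OF assms(3,4), of m] nz(2) True by simp
next
  case False
  then show ?thesis
    using lform_E_orth[OF assms(1,2)] inj by (auto simp: inj_def)
qed

end

section \<open>Transfer between fields\<close>

text \<open>A subring of a product of two fields such that the second component decides invertibility. The examples are
  the graph of a field homomorphism and the pairs of a regular rational function and its value.\<close>

locale field_rel =
  fixes R :: "'a::field \<Rightarrow> 'b::field \<Rightarrow> bool"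
  assumes R_1: "R 1 1"
    and R_add: "R x x' \<Longrightarrow> R y y' \<Longrightarrow> R (x + y) (x' + y')"
    and R_uminus: "R x x' \<Longrightarrow> R (- x) (- x')"
    and R_mult: "R x x' \<Longrightarrow> R y y' \<Longrightarrow> R (x * y) (x' * y')"
    and R_inverse: "R x x' \<Longrightarrow> x' \<noteq> 0 \<Longrightarrow> R (inverse x) (inverse x')"
begin

lemma R_0: "R 0 0"
  using R_add[OF R_1 R_uminus[OF R_1]] by simp

lemma R_diff: "R x x' \<Longrightarrow> R y y' \<Longrightarrow> R (x - y) (x' - y')"
  using R_add[of x x' "- y" "- y'"] R_uminus by simp

lemma R_divide: "R x x' \<Longrightarrow> R y y' \<Longrightarrow> y' \<noteq> 0 \<Longrightarrow> R (x / y) (x' / y')"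
  unfolding divide_inverse by (intro R_mult R_inverse)

lemma R_power: "R x x' \<Longrightarrow> R (x ^ n) (x' ^ n)"
  by (induction n) (auto intro: R_1 R_mult)

lemma R_powi: "R x x' \<Longrightarrow> x' \<noteq> 0 \<Longrightarrow> R (x powi n) (x' powi n)"
  unfolding power_int_def by (auto intro: R_power R_inverse)

lemma R_sum: "(\<And>i. i \<in> A \<Longrightarrow> R (f i) (g i)) \<Longrightarrow> R (sum f A) (sum g A)"
  by (induction A rule: infinite_finite_induct) (auto intro: R_0 R_add)

lemma R_prod: "(\<And>i. i \<in> A \<Longrightarrow> R (f i) (g i)) \<Longrightarrow> R (prod f A) (prod g A)"
  by (induction A rule: infinite_finite_induct) (auto intro: R_1 R_mult)

definition LR :: "'a laurent \<Rightarrow> 'b laurent \<Rightarrow> bool" where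
  "LR F f \<longleftrightarrow> (\<forall>n. R (Poly_Mapping.lookup F n) (Poly_Mapping.lookup f n))"

lemma LR_add: "LR F f \<Longrightarrow> LR G g \<Longrightarrow> LR (F + G) (f + g)"
  by (simp add: LR_def lookup_add R_add)

lemma LR_diff: "LR F f \<Longrightarrow> LR G g \<Longrightarrow> LR (F - G) (f - g)"
  by (simp add: LR_def lookup_minus R_diff)

lemma LR_lconst_times: "R c c' \<Longrightarrow> LR F f \<Longrightarrow> LR (lconst c * F) (lconst c' * f)"
  by (simp add: LR_def R_mult)

lemma LR_lmon_times: "LR F f \<Longrightarrow> LR (lmon n * F) (lmon n * f)"
  by (simp add: LR_def)

lemma LR_1: "LR 1 1"
  by (simp add: LR_def lookup_one when_def R_0 R_1)

lemma LR_xrefl: "R v v' \<Longrightarrow> v' \<noteq> 0 \<Longrightarrow> LR F f \<Longrightarrow> LR (xrefl v F) (xrefl v' f)"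
  by (auto simp: LR_def lookup_xrefl intro!: R_mult R_powi)

lemma LR_sum: "(\<And>i. i \<in> A \<Longrightarrow> LR (f i) (g i)) \<Longrightarrow> LR (sum f A) (sum g A)"
  by (simp add: LR_def lookup_sum R_sum)

text \<open>Division by \<open>X^2 - 1\<close> needs only additions and subtractions of coefficients, by the recurrence, starting
  far out where both sides vanish.\<close>

lemma LR_dd:
  assumes "LR F f"
  shows "LR (dd F) (dd f)"
proof -
  obtain K where K: "\<And>k. \<bar>k\<bar> \<ge> K \<Longrightarrow> Poly_Mapping.lookup (dd F) (k::int) = 0"
    using lookup_eventually_0 by metis
  obtain K' where K': "\<And>k. \<bar>k\<bar> \<ge> K' \<Longrightarrow> Poly_Mapping.lookup (dd f) (k::int) = 0"
    using lookup_eventually_0 by metis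
  let ?L = "\<lambda>k. R (Poly_Mapping.lookup (dd F) k) (Poly_Mapping.lookup (dd f) k)"
  have step: "?L (k - 2)" if "?L k" for k
    unfolding lookup_dd_step using that assms by (auto simp: LR_def intro!: R_add R_diff)
  have down: "?L (k - 2 * int j)" if "?L k" for k j
  proof (induction j)
    case (Suc j)
    then show ?case using step[of "k - 2 * int j"] by (simp add: algebra_simps)
  qed (simp add: that)
  have "?L k" for k
  proof -
    define j where "j = nat (\<bar>K\<bar> + \<bar>K'\<bar> + \<bar>k\<bar>)"
    have "?L (k + 2 * int j)"
      using K[of "k + 2 * int j"] K'[of "k + 2 * int j"] R_0 by (simp add: j_def)
    then show ?thesis using down[of "k + 2 * int j" j] by simp
  qed
  then show ?thesis by (simp add: LR_def)
qed

lemma LR_dl: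
  assumes "R w w'" "w' \<noteq> 0" "LR F f"
  shows "LR (dl w F) (dl w' f)"
  unfolding dl_def
  using assms by (intro LR_add LR_lconst_times LR_xrefl LR_dd R_diff R_inverse R_1) auto

lemma LR_expand_sum:
  obtains K where "finite K"
    "F = (\<Sum>n\<in>K. lconst (Poly_Mapping.lookup F n) * lmon n)"
    "f = (\<Sum>n\<in>K. lconst (Poly_Mapping.lookup f n) * lmon n)"
proof -
  let ?K = "Poly_Mapping.keys F \<union> Poly_Mapping.keys f"
  have "F = (\<Sum>n\<in>?K. lconst (Poly_Mapping.lookup F n) * lmon n)"
    by (subst laurent_expand[of F], unfold single_eq_lconst_lmon, rule sum.mono_neutral_left)
      (auto simp: in_keys_iff)
  moreover have "f = (\<Sum>n\<in>?K. lconst (Poly_Mapping.lookup f n) * lmon n)"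
    by (subst laurent_expand[of f], unfold single_eq_lconst_lmon, rule sum.mono_neutral_left)
      (auto simp: in_keys_iff)
  ultimately show ?thesis using that[of ?K] by simp
qed

text \<open>The supports of related polynomials may differ, so both are expanded over a common finite set of exponents.\<close>

lemma LR_mult:
  assumes "LR F f" "LR G g"
  shows "LR (F * G) (f * g)"
proof -
  obtain K where K: "F = (\<Sum>n\<in>K. lconst (Poly_Mapping.lookup F n) * lmon n)"
    "f = (\<Sum>n\<in>K. lconst (Poly_Mapping.lookup f n) * lmon n)"
    by (rule LR_expand_sum)
  have "LR ((\<Sum>n\<in>K. lconst (Poly_Mapping.lookup F n) * lmon n) * G) ((\<Sum>n\<in>K. lconst (Poly_Mapping.lookup f n) * lmon n) * g)"
    unfolding sum_distrib_right mult.assoc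
    using assms by (intro LR_sum LR_lconst_times LR_lmon_times) (auto simp: LR_def)
  then show ?thesis using K by simp
qed

lemma R_leval:
  assumes "R x x'" "x' \<noteq> 0" "LR F f"
  shows "R (leval F x) (leval f x')"
proof -
  obtain K where K: "F = (\<Sum>n\<in>K. lconst (Poly_Mapping.lookup F n) * lmon n)"
    "f = (\<Sum>n\<in>K. lconst (Poly_Mapping.lookup f n) * lmon n)"
    by (rule LR_expand_sum)
  have "R (leval (\<Sum>n\<in>K. lconst (Poly_Mapping.lookup F n) * lmon n) x)
    (leval (\<Sum>n\<in>K. lconst (Poly_Mapping.lookup f n) * lmon n) x')"
    unfolding leval_sum leval_single using assms
    by (intro R_sum R_mult R_powi) (auto simp: LR_def)
  then show ?thesis using K by simp
qed

lemma R_ct: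
  assumes "\<And>n. R (\<mu> n) (\<mu>' n)" "LR F f"
  shows "R (ct \<mu> F) (ct \<mu>' f)"
proof -
  obtain K where K: "F = (\<Sum>n\<in>K. lconst (Poly_Mapping.lookup F n) * lmon n)"
    "f = (\<Sum>n\<in>K. lconst (Poly_Mapping.lookup f n) * lmon n)"
    by (rule LR_expand_sum)
  have "ct \<mu> (\<Sum>n\<in>K. lconst (Poly_Mapping.lookup F n) * lmon n) = (\<Sum>n\<in>K. Poly_Mapping.lookup F n * \<mu> (- n))"
    "ct \<mu>' (\<Sum>n\<in>K. lconst (Poly_Mapping.lookup f n) * lmon n) = (\<Sum>n\<in>K. Poly_Mapping.lookup f n * \<mu>' (- n))"
    by (induction K rule: infinite_finite_induct) (auto simp: ct_add ct_single)
  then have "R (ct \<mu> (\<Sum>n\<in>K. lconst (Poly_Mapping.lookup F n) * lmon n))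
    (ct \<mu>' (\<Sum>n\<in>K. lconst (Poly_Mapping.lookup f n) * lmon n))"
    using assms by (auto simp: LR_def intro!: R_sum R_mult)
  then show ?thesis using K by simp
qed

lemma LR_en_ep:
  assumes "R v v'" "R w w'" "generic_params v' w'"
  shows "LR (en v w n) (en v' w' n)" and "LR (ep v w n) (ep v' w' n)"
proof -
  interpret generic_params v' w' by fact
  have up: "LR (up v n F) (up v' n f)" if "LR F f" for F f n
    unfolding up_def using assms(1) v_nz that
    by (intro LR_lconst_times LR_lmon_times LR_xrefl R_power)
  have icoef: "R (icoef v w n) (icoef v' w' n)" if "n \<ge> 1" for n
    unfolding icoef_def using assms(1,2) w_nz nonres[OF that]
    by (intro R_divide R_diff R_mult R_power R_inverse R_1) auto
  have turn: "LR (turn v w n F) (turn v' w' n f)" if "LR F f" "n \<ge> 1" for F f n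
    unfolding turn_def using assms(1,2) w_nz that
    by (intro LR_lconst_times LR_diff LR_dl icoef)
  show en: "LR (en v w n) (en v' w' n)" for n
    by (induction n) (auto simp: LR_1 en_Suc ep_def intro!: turn up)
  show "LR (ep v w n) (ep v' w' n)"
    unfolding ep_def by (intro up en)
qed

lemma LR_E:
  assumes "R v v'" "R w w'" "generic_params v' w'"
  shows "LR (E v w m) (E v' w' m)"
  by (auto simp: E_def intro!: LR_en_ep assms)

end

section \<open>Values of rational functions\<close>

lemma poly_of_int_pCons: "poly (map_poly of_int (pCons c p)) b = of_int c + b * poly (map_poly of_int p) b"
  by (simp add: map_poly_pCons)

lemma poly_of_int_add:
  "poly (map_poly of_int (p + q)) (b::'a::field) = poly (map_poly of_int p) b + poly (map_poly of_int q) b"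
  by (induction p q rule: poly_induct2) (auto simp: poly_of_int_pCons algebra_simps)

lemma poly_of_int_smult:
  "poly (map_poly of_int (Polynomial.smult c p)) (b::'a::field) = of_int c * poly (map_poly of_int p) b"
  by (induction p) (auto simp: poly_of_int_pCons algebra_simps)

lemma poly_of_int_mult:
  "poly (map_poly of_int (p * q)) (b::'a::field) = poly (map_poly of_int p) b * poly (map_poly of_int q) b"
  by (induction p) (auto simp: poly_of_int_pCons poly_of_int_add poly_of_int_smult algebra_simps)

lemma eval2_0 [simp]: "eval2 0 a b = 0"
  by (simp add: eval2_def)

lemma eval2_pCons: "eval2 (pCons c p) a b = poly (map_poly of_int c) b + a * eval2 p a b"
  by (simp add: eval2_def map_poly_pCons)

lemma eval2_1 [simp]: "eval2 1 a b = 1"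
  by (simp add: eval2_pCons one_pCons poly_of_int_pCons)

lemma eval2_add: "eval2 (p + q) a b = eval2 p a b + eval2 q a b"
  by (induction p q rule: poly_induct2) (auto simp: eval2_pCons poly_of_int_add algebra_simps)

lemma eval2_smult: "eval2 (Polynomial.smult c p) a b = poly (map_poly of_int c) b * eval2 p a b"
  by (induction p) (auto simp: eval2_pCons poly_of_int_mult algebra_simps)

lemma eval2_mult: "eval2 (p * q) a b = eval2 p a b * eval2 q a b"
  by (induction p) (auto simp: eval2_pCons eval2_add eval2_smult algebra_simps)

lemma eval2_uminus: "eval2 (- p) a b = - eval2 p a b"
  using eval2_add[of p "- p" a b] by (simp add: eq_neg_iff_add_eq_0 add.commute)

text \<open>The graph of \<open>rf_value\<close> on the regular rational functions.\<close>

definition has_value :: "'a::field \<Rightarrow> 'a \<Rightarrow> ratfun \<Rightarrow> 'a \<Rightarrow> bool" where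
  "has_value a b r z \<longleftrightarrow> (\<exists>p d. r = Fract p d \<and> eval2 d a b \<noteq> 0 \<and> z = eval2 p a b / eval2 d a b)"

lemma has_value_unique:
  assumes "has_value a b r z" "has_value a b r z'"
  shows "z = z'"
proof -
  obtain p d where 1: "r = Fract p d" "eval2 d a b \<noteq> 0" "z = eval2 p a b / eval2 d a b"
    using assms(1) unfolding has_value_def by blast
  obtain p' d' where 2: "r = Fract p' d'" "eval2 d' a b \<noteq> 0" "z' = eval2 p' a b / eval2 d' a b"
    using assms(2) unfolding has_value_def by blast
  have "d \<noteq> 0" "d' \<noteq> 0" using 1 2 by auto
  then have "p * d' = p' * d" using 1 2 by (simp add: eq_fract)
  then have "eval2 p a b * eval2 d' a b = eval2 p' a b * eval2 d a b"
    by (metis eval2_mult)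
  then show ?thesis unfolding 1(3) 2(3) using 1(2) 2(2) by (simp add: frac_eq_eq)
qed

lemma has_value_rf:
  assumes "has_value a b r z"
  shows "rf_regular r a b" "rf_value r a b = z"
proof -
  show "rf_regular r a b" using assms unfolding has_value_def rf_regular_def by blast
  show "rf_value r a b = z" unfolding rf_value_def has_value_def[symmetric]
    by (rule the_equality) (use assms has_value_unique in blast)+
qed

lemma rf_regular_has_value: "rf_regular r a b \<Longrightarrow> has_value a b r (rf_value r a b)"
  using has_value_rf(2) unfolding rf_regular_def has_value_def by metis

interpretation val: field_rel "has_value a b" for a b
proof
  show "has_value a b 1 1"
    unfolding has_value_def One_fract_def by (intro exI[of _ 1]) auto
next
  fix x x' y y' assume "has_value a b x x'" "has_value a b y y'"
  then obtain p d p' d' where *: "x = Fract p d" "eval2 d a b \<noteq> 0" "x' = eval2 p a b / eval2 d a b"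
    "y = Fract p' d'" "eval2 d' a b \<noteq> 0" "y' = eval2 p' a b / eval2 d' a b"
    unfolding has_value_def by blast
  then have "d \<noteq> 0" "d' \<noteq> 0" by auto
  then show "has_value a b (x + y) (x' + y')"
    unfolding has_value_def using *
    by (intro exI[of _ "p * d' + p' * d"] exI[of _ "d * d'"])
      (simp add: eval2_add eval2_mult add_frac_eq)
  show "has_value a b (x * y) (x' * y')"
    unfolding has_value_def using *
    by (intro exI[of _ "p * p'"] exI[of _ "d * d'"]) (simp add: eval2_mult)
next
  fix x x' assume "has_value a b x x'"
  then obtain p d where *: "x = Fract p d" "eval2 d a b \<noteq> 0" "x' = eval2 p a b / eval2 d a b"
    unfolding has_value_def by blast
  then show "has_value a b (- x) (- x')"
    unfolding has_value_def by (intro exI[of _ "- p"] exI[of _ d]) (simp add: eval2_uminus)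
  assume "x' \<noteq> 0"
  then show "has_value a b (inverse x) (inverse x')"
    unfolding has_value_def using * by (intro exI[of _ d] exI[of _ p]) auto
qed

lemma has_value_qh: "has_value a b qh_var a"
  unfolding has_value_def qh_var_def
  by (intro exI[of _ "[:0, 1:]"] exI[of _ 1]) (simp add: eval2_pCons poly_of_int_pCons)

lemma has_value_th: "has_value a b th_var b"
  unfolding has_value_def th_var_def
  by (intro exI[of _ "[:[:0, 1:]:]"] exI[of _ 1]) (simp add: eval2_pCons poly_of_int_pCons)

text \<open>Seen by evaluating the variables at 2 and 3.\<close>

lemma var_nz [simp]: "qh_var \<noteq> 0" "th_var \<noteq> 0"
proof -
  have 0: "has_value 2 3 0 (0::real)" by (rule val.R_0)
  show "qh_var \<noteq> 0" using has_value_unique[OF 0, of 2] has_value_qh[of 2 "3::real"] by auto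
  show "th_var \<noteq> 0" using has_value_unique[OF 0, of 3] has_value_th[of 2 "3::real"] by auto
qed

text \<open>Again by evaluation at 2 and 3, where the powers in question exceed 1.\<close>

lemma var_powers:
  "th_var ^ 2 \<noteq> 1" "n \<ge> 1 \<Longrightarrow> qh_var ^ n \<noteq> 1"
  "th_var ^ 2 * qh_var ^ n \<noteq> 1" "th_var ^ 4 * qh_var ^ n \<noteq> 1"
proof -
  have 1: "has_value 2 3 1 (1::real)" by (rule val.R_1)
  note q = has_value_qh[of 2 "3::real"] and t = has_value_th[of 2 "3::real"]
  show "th_var ^ 2 \<noteq> 1"
    using has_value_unique[OF 1, of "3 ^ 2"] val.R_power[OF t, of 2] by auto
  show "qh_var ^ n \<noteq> 1" if "n \<ge> 1"
  proof
    assume "qh_var ^ n = 1"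
    then have "1 = (2::real) ^ n"
      using has_value_unique[OF 1, of "2 ^ n"] val.R_power[OF q, of n] by simp
    then show False using that one_less_power[of "2::real" n] by simp
  qed
  have two: "(2::real) ^ n \<ge> 1" by simp
  show "th_var ^ 2 * qh_var ^ n \<noteq> 1"
    using has_value_unique[OF 1, of "3 ^ 2 * 2 ^ n"] val.R_mult[OF val.R_power[OF t, of 2] val.R_power[OF q, of n]] two
    by auto
  show "th_var ^ 4 * qh_var ^ n \<noteq> 1"
    using has_value_unique[OF 1, of "3 ^ 4 * 2 ^ n"] val.R_mult[OF val.R_power[OF t, of 4] val.R_power[OF q, of n]] two
    by auto
qed

interpretation var: generic_params qh_var th_var
  by standard (auto simp: var_powers)

lemma two_ratfun: "(2 :: ratfun) \<noteq> 0"
proof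
  assume "(2 :: ratfun) = 0"
  moreover have "has_value 2 3 (1 + 1) (1 + 1 :: real)" by (intro val.R_add val.R_1)
  moreover have "has_value 2 3 0 (0::real)" by (rule val.R_0)
  ultimately show False using has_value_unique[of 2 3 0 "0::real" 2] by simp
qed

text \<open>The eigenvalues are distinct monomials in the variables, which the evaluation at 2 and 3 tells apart.\<close>

lemma inj_lam_var: "inj (lam qh_var th_var)"
proof -
  have pow: "i = j" if "qh_var ^ i = qh_var ^ j" for i j
  proof -
    have "(2::real) ^ i = 2 ^ j"
      using that has_value_unique[of 2 "3::real" "qh_var ^ i"] val.R_power[OF has_value_qh[of 2 "3::real"]] by metis
    then show ?thesis by simp
  qed
  have cross: "inverse (th_var * qh_var ^ i) \<noteq> th_var * qh_var ^ j" for i j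
  proof
    assume "inverse (th_var * qh_var ^ i) = th_var * qh_var ^ j"
    then have "1 = (th_var * qh_var ^ i) * (th_var * qh_var ^ j)"
      by (metis mult_eq_0_iff power_not_zero right_inverse var_nz)
    also have "\<dots> = th_var ^ 2 * qh_var ^ (i + j)"
      by (simp add: power2_eq_square power_add ac_simps)
    finally show False using var_powers(3)[of "i + j"] by simp
  qed
  show ?thesis
  proof (rule injI)
    fix m n assume "lam qh_var th_var m = lam qh_var th_var n"
    then show "m = n"
      using cross cross[symmetric] pow by (auto simp: lam_def split: if_splits dest!: pow)
  qed
qed

subsection \<open>Specialization\<close>

lemma lookup_map_zero: "f 0 = 0 \<Longrightarrow> Poly_Mapping.lookup (Poly_Mapping.map f p) k = f (Poly_Mapping.lookup p k)"
  by (simp add: map.rep_eq when_def)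

lemma rf_value_0: "rf_value 0 a b = 0"
  by (rule has_value_rf(2)[OF val.R_0])

lemma specialize_eq:
  assumes "val.LR a b F f"
  shows "specialize a b F = f"
  by (rule poly_mapping_eqI)
    (use assms in \<open>auto simp: specialize_def lookup_map_zero rf_value_0 val.LR_def intro: has_value_rf(2)\<close>)

lemma lregular_LR: "val.LR a b F f \<Longrightarrow> lregular a b F"
  by (auto simp: val.LR_def lregular_def intro: has_value_rf(1))

lemma lookup_lbar:
  assumes "\<sigma> 0 = 0"
  shows "Poly_Mapping.lookup (lbar \<sigma> f) n = \<sigma> (Poly_Mapping.lookup f (- n))"
proof -
  have "Poly_Mapping.lookup (lbar \<sigma> f) n
    = (\<Sum>k\<in>Poly_Mapping.keys f. if k = - n then \<sigma> (Poly_Mapping.lookup f (- n)) else 0)"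
    unfolding lbar_def lookup_sum by (rule sum.cong) (auto simp: lookup_single when_def)
  also have "\<dots> = \<sigma> (Poly_Mapping.lookup f (- n))"
    using assms by (auto simp: in_keys_iff)
  finally show ?thesis .
qed

lemma rf_bar_eq: "has_value (inverse qh_var) (inverse th_var) r z \<Longrightarrow> rf_bar r = z"
  unfolding rf_bar_def by (rule has_value_rf(2))

lemma lbar_rf_bar_eq:
  assumes "val.LR (inverse qh_var) (inverse th_var) F f"
  shows "lbar rf_bar F = xrefl 1 f"
proof (rule poly_mapping_eqI)
  fix n
  have "rf_bar 0 = 0" by (rule rf_bar_eq[OF val.R_0])
  then show "Poly_Mapping.lookup (lbar rf_bar F) n = Poly_Mapping.lookup (xrefl 1 f) n"
    using assms by (simp add: lookup_lbar lookup_xrefl val.LR_def rf_bar_eq)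
qed

text \<open>An automorphism inverting the parameters can be applied to the construction of the eigenvectors, just like a
  specialization.\<close>

lemma hom_field_rel:
  assumes "const_bar qh th \<sigma>"
  shows "field_rel (\<lambda>x y. y = \<sigma> x)"
proof -
  have s1: "\<sigma> 1 = 1" and sa: "\<sigma> (a + b) = \<sigma> a + \<sigma> b" and sm: "\<sigma> (a * b) = \<sigma> a * \<sigma> b" for a b
    using assms by (auto simp: const_bar_def)
  have s0: "\<sigma> 0 = 0" using sa[of 0 0] by simp
  show ?thesis
  proof
    fix x x' assume "x' = \<sigma> x"
    then show "- x' = \<sigma> (- x)" using sa[of x "- x"] s0 by (simp add: neg_eq_iff_add_eq_0)
    assume "x' \<noteq> 0"
    then have "x \<noteq> 0" using s0 \<open>x' = \<sigma> x\<close> by auto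
    then have "x' * \<sigma> (inverse x) = 1" using sm[of x "inverse x"] s1 \<open>x' = \<sigma> x\<close> by simp
    then show "inverse x' = \<sigma> (inverse x)" by (metis inverse_unique)
  qed (auto simp: s1 sa sm)
qed

section \<open>The coefficients of the weight\<close>

text \<open>The coefficient of \<open>X^(2 m)\<close> in \<open>\<mu>\<close>, normalized by the constant term.\<close>

definition wcoef :: "'a::field \<Rightarrow> 'a \<Rightarrow> nat \<Rightarrow> 'a" where
  "wcoef v w m = (\<Prod>i=1..m. (w ^ 2 - v ^ (2 * (i - 1))) / (1 - w ^ 2 * v ^ (2 * i)))"

text \<open>Odd powers do not occur in \<open>\<mu>\<close>; negative ones are obtained from the invariance under
  \<open>X \<mapsto> q^(1/2) X^(-1)\<close>.\<close>

definition weight :: "'a::field \<Rightarrow> 'a \<Rightarrow> int \<Rightarrow> 'a" where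
  "weight v w n = (if odd n then 0 else if n \<ge> 0 then wcoef v w (nat (n div 2))
     else v ^ nat (- n) * wcoef v w (nat (- n div 2)))"

lemma weight_even: "weight v w (2 * int m) = wcoef v w m"
  by (simp add: weight_def)

lemma weight_even_neg: "weight v w (- (2 * int m)) = v ^ (2 * m) * wcoef v w m"
  by (cases "m = 0") (auto simp: weight_def wcoef_def nat_mult_distrib)

lemma weight_odd: "odd n \<Longrightarrow> weight v w n = 0"
  by (simp add: weight_def)

lemma weight_0 [simp]: "weight v w 0 = 1"
  by (simp add: weight_def wcoef_def)

lemma even_int_cases:
  fixes n :: int
  obtains (odd) "odd n" | (pos) m where "n = 2 * int m" | (neg) m where "n = - (2 * int m)"
proof (cases "odd n")
  case False
  then obtain k where k: "n = 2 * k" by (auto elim: evenE)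
  show ?thesis using pos[of "nat k"] neg[of "nat (- k)"] k by (cases "k \<ge> 0") auto
qed (use odd in blast)

lemma powi_even: "v powi (2 * int j) = (v::'a::field) ^ (2 * j)"
  using power_int_of_nat[of v "2 * j"] by simp

lemma powi_even_neg: "v powi (- (2 * int j)) = inverse ((v::'a::field) ^ (2 * j))"
  unfolding power_int_minus powi_even ..

context generic_params
begin

lemma wcoef_Suc: "wcoef v w (Suc m) * (1 - w ^ 2 * v ^ (2 * Suc m)) = wcoef v w m * (w ^ 2 - v ^ (2 * m))"
  using nonres[of "Suc m"] by (simp add: wcoef_def)

lemma weight_reflect: "weight v w (- n) = v powi n * weight v w n"
proof (cases n rule: even_int_cases)
  case odd
  then show ?thesis by (simp add: weight_odd)
next
  case (pos m)
  then show ?thesis by (simp only: weight_even weight_even_neg powi_even)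
next
  case (neg m)
  have "v powi (- (2 * int m)) * v ^ (2 * m) = 1"
    using v_nz by (simp add: powi_even_neg)
  then show ?thesis unfolding neg minus_minus weight_even weight_even_neg
    by (simp flip: mult.assoc)
qed

text \<open>Given the first symmetry, this recurrence is equivalent to the second one. It also determines the
  coefficients of even index up to a common factor.\<close>

lemma weight_step: "weight v w n * (1 - w ^ 2 * v powi n) = weight v w (n - 2) * (w ^ 2 - v powi (n - 2))"
proof (cases n rule: even_int_cases)
  case odd
  then show ?thesis by (simp add: weight_odd)
next
  case (pos m)
  show ?thesis
  proof (cases m)
    case 0
    have 1: "v powi (- 2) = inverse (v ^ 2)" using powi_even_neg[of v 1] by simp
    have "v ^ 2 * wcoef v w 1 * (w ^ 2 - inverse (v ^ 2)) = - (wcoef v w 1 * (1 - w ^ 2 * v ^ 2))"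
      using v_nz by (simp add: field_simps)
    also have "\<dots> = 1 - w ^ 2"
      using wcoef_Suc[of 0] by (simp add: wcoef_def[of v w 0])
    finally show ?thesis using weight_even_neg[of v w 1] 1 by (simp add: pos 0)
  next
    case (Suc k)
    have 1: "n = 2 * int (Suc k)" "n - 2 = 2 * int k" using pos Suc by auto
    show ?thesis unfolding 1(2) unfolding 1(1) powi_even weight_even by (rule wcoef_Suc)
  qed
next
  case (neg m)
  have 1: "n - 2 = - (2 * int (Suc m))" using neg by simp
  define x where "x = v ^ (2 * m)"
  define y where "y = v ^ (2 * Suc m)"
  have nz: "x \<noteq> 0" "y \<noteq> 0" using v_nz by (auto simp: x_def y_def)
  have "x * wcoef v w m * (1 - w ^ 2 * inverse x) = - (wcoef v w m * (w ^ 2 - x))"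
    using nz by (simp add: field_simps)
  also have "\<dots> = - (wcoef v w (Suc m) * (1 - w ^ 2 * y))"
    unfolding x_def y_def by (simp only: wcoef_Suc)
  also have "\<dots> = y * wcoef v w (Suc m) * (w ^ 2 - inverse y)"
    using nz by (simp add: field_simps)
  finally show ?thesis unfolding 1 unfolding neg powi_even_neg weight_even_neg x_def y_def .
qed

lemma weight_coeffs_weight: "weight_coeffs v w (weight v w)"
proof -
  have "weight v w n - w ^ 2 * weight v w (n - 2) = w ^ 2 * weight v w (- n) - weight v w (2 - n)" for n
    using weight_step[of n] weight_reflect[of n] weight_reflect[of "n - 2"] by (simp add: algebra_simps)
  then show ?thesis unfolding weight_coeffs_def using weight_reflect by blast
qed

end

lemma (in field_rel) R_weight:
  assumes "R v v'" "R w w'" "generic_params v' w'"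
  shows "R (weight v w n) (weight v' w' n)"
proof -
  interpret generic_params v' w' by fact
  have "R (wcoef v w m) (wcoef v' w' m)" for m
    unfolding wcoef_def using assms(1,2) nonres
    by (intro R_prod R_divide R_diff R_mult R_power R_1) auto
  then show ?thesis
    unfolding weight_def using assms(1) by (auto intro!: R_0 R_mult R_power)
qed

subsection \<open>The q-binomial series\<close>

definition qb_coef :: "complex \<Rightarrow> complex \<Rightarrow> nat \<Rightarrow> complex" where
  "qb_coef q t n = (\<Prod>i=1..n. (t - q ^ (i - 1)) / (1 - q ^ i))"

text \<open>By the q-binomial theorem this is the product of \<open>(1 - q^j z) / (1 - t q^j z)\<close> over \<open>j \<ge> 0\<close>, so
  \<open>\<mu>\<close> is a product of two such series, at \<open>X^2\<close> and at \<open>q X^(-2)\<close>.\<close>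

definition qb :: "complex \<Rightarrow> complex \<Rightarrow> complex \<Rightarrow> complex" where
  "qb q t z = suminf (\<lambda>n. qb_coef q t n * z ^ n)"

locale small_params =
  fixes q t :: complex
  assumes q: "0 < norm q" "norm q < 1" and t: "0 < norm t" "norm t < 1"
begin

lemma q_pow: "norm (q ^ Suc n) < 1"
  using q power_Suc_less_one[of "norm q" n] by (simp add: norm_mult norm_power)

lemma q_pow_ne: "q ^ Suc n \<noteq> 1"
  using q_pow[of n] by auto

lemma qb_coef_Suc: "qb_coef q t (Suc n) * (1 - q ^ Suc n) = qb_coef q t n * (t - q ^ n)"
  using q_pow_ne[of n] by (simp add: qb_coef_def)

lemma q_lim: "(\<lambda>n. q ^ n) \<longlonglongrightarrow> 0"
  using q by (intro LIMSEQ_power_zero)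

text \<open>The ratio of consecutive terms tends to \<open>t z\<close>.\<close>

lemma qb_summable:
  assumes "norm (t * z) < 1"
  shows "summable (\<lambda>n. norm (qb_coef q t n * z ^ n))"
proof -
  define r where "r n = (t - q ^ n) / (1 - q ^ Suc n) * z" for n
  have "r \<longlonglongrightarrow> (t - 0) / (1 - 0) * z"
    unfolding r_def by (intro tendsto_intros q_lim LIMSEQ_Suc[OF q_lim]) auto
  then have "(\<lambda>n. norm (r n)) \<longlonglongrightarrow> norm (t * z)"
    by (metis diff_zero div_by_1 tendsto_norm)
  moreover have "norm (t * z) < (norm (t * z) + 1) / 2" using assms by simp
  ultimately have "eventually (\<lambda>n. norm (r n) < (norm (t * z) + 1) / 2) sequentially"
    by (rule order_tendstoD(2))
  then obtain N where N: "\<And>n. n \<ge> N \<Longrightarrow> norm (r n) < (norm (t * z) + 1) / 2"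
    by (auto simp: eventually_sequentially)
  show ?thesis
  proof (rule summable_ratio_test[where c = "(norm (t * z) + 1) / 2" and N = N])
    show "(norm (t * z) + 1) / 2 < 1" using assms by simp
    fix n assume n: "n \<ge> N"
    have "qb_coef q t (Suc n) = qb_coef q t n * (t - q ^ n) / (1 - q ^ Suc n)"
      using qb_coef_Suc[of n] q_pow_ne[of n] by (simp add: eq_divide_eq)
    then have "qb_coef q t (Suc n) * z ^ Suc n = r n * (qb_coef q t n * z ^ n)"
      by (simp add: r_def)
    then have "norm (qb_coef q t (Suc n) * z ^ Suc n) = norm (r n) * norm (qb_coef q t n * z ^ n)"
      by (simp only: norm_mult)
    also have "\<dots> \<le> (norm (t * z) + 1) / 2 * norm (qb_coef q t n * z ^ n)"
      using N[OF n] by (intro mult_right_mono) auto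
    finally show "norm (norm (qb_coef q t (Suc n) * z ^ Suc n)) \<le> (norm (t * z) + 1) / 2 * norm (norm (qb_coef q t n * z ^ n))"
      by simp
  qed
qed

lemma qb_sums: "norm (t * z) < 1 \<Longrightarrow> (\<lambda>n. qb_coef q t n * z ^ n) sums qb q t z"
  unfolding qb_def by (rule summable_sums[OF summable_norm_cancel[OF qb_summable]])

lemma norm_tqz:
  assumes "norm (t * z) < 1"
  shows "norm (t * (q ^ n * z)) < 1"
proof -
  have "norm (q ^ n) \<le> 1" using q by (simp add: norm_power power_le_one)
  then have "norm (t * z) * norm (q ^ n) \<le> norm (t * z)"
    by (rule mult_left_le[OF _ norm_ge_zero])
  then show ?thesis using assms by (simp add: norm_mult ac_simps)
qed

text \<open>Both sides have the same coefficients, by the recursion for \<open>qb_coef\<close>.\<close>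

lemma qb_functional:
  assumes "norm (t * z) < 1"
  shows "(1 - t * z) * qb q t z = (1 - z) * qb q t (q * z)"
proof -
  let ?b = "qb_coef q t"
  define S where "S z = suminf (\<lambda>n. ?b (Suc n) * z ^ Suc n)" for z
  have split: "qb q t z = 1 + S z" "summable (\<lambda>n. ?b (Suc n) * z ^ Suc n)" "summable (\<lambda>n. ?b n * z ^ n)"
    if "norm (t * z) < 1" for z
  proof -
    show s: "summable (\<lambda>n. ?b n * z ^ n)" by (rule summable_norm_cancel[OF qb_summable[OF that]])
    then show "summable (\<lambda>n. ?b (Suc n) * z ^ Suc n)" by (subst summable_Suc_iff)
    show "qb q t z = 1 + S z"
      using suminf_split_head[OF s] by (simp add: qb_def S_def qb_coef_def)
  qed
  have qz: "norm (t * (q * z)) < 1" using norm_tqz[OF assms, of 1] by simp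
  note s1 = split[OF assms] and s2 = split[OF qz]
  have "S z - S (q * z) = suminf (\<lambda>n. ?b (Suc n) * z ^ Suc n - ?b (Suc n) * (q * z) ^ Suc n)"
    unfolding S_def by (rule suminf_diff[OF s1(2) s2(2)])
  also have "\<dots> = suminf (\<lambda>n. t * z * (?b n * z ^ n) - z * (?b n * (q * z) ^ n))"
  proof (rule suminf_cong)
    fix n
    have "?b (Suc n) * z ^ Suc n - ?b (Suc n) * (q * z) ^ Suc n = (?b (Suc n) * (1 - q ^ Suc n)) * z ^ Suc n"
      by (simp add: power_mult_distrib algebra_simps)
    also have "\<dots> = t * z * (?b n * z ^ n) - z * (?b n * (q * z) ^ n)"
      unfolding qb_coef_Suc by (simp add: power_mult_distrib algebra_simps)
    finally show "?b (Suc n) * z ^ Suc n - ?b (Suc n) * (q * z) ^ Suc n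
      = t * z * (?b n * z ^ n) - z * (?b n * (q * z) ^ n)" .
  qed
  also have "\<dots> = t * z * qb q t z - z * qb q t (q * z)"
    unfolding qb_def using s1(3) s2(3)
    by (subst suminf_diff[symmetric]) (auto intro!: summable_mult simp: suminf_mult)
  finally have "qb q t z - qb q t (q * z) = t * z * qb q t z - z * qb q t (q * z)"
    using s1(1) s2(1) by simp
  then show ?thesis by (simp add: algebra_simps)
qed

definition fac :: "complex \<Rightarrow> complex" where
  "fac z = (1 - z) / (1 - t * z)"

lemma den_nz: "norm (t * z) < 1 \<Longrightarrow> 1 - t * z \<noteq> 0"
  by auto

lemma qb_iterate:
  assumes "norm (t * z) < 1"
  shows "qb q t z = (\<Prod>j<n. fac (q ^ j * z)) * qb q t (q ^ n * z)"
proof (induction n)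
  case (Suc n)
  note nz = norm_tqz[OF assms, of n]
  have "qb q t (q ^ n * z) = fac (q ^ n * z) * qb q t (q ^ Suc n * z)"
    using qb_functional[OF nz] den_nz[OF nz] by (simp add: fac_def field_simps)
  then show ?case using Suc by simp
qed simp

text \<open>The functional equation is iterated; \<open>q^n z\<close> tends to 0, where the series is continuous with the value 1.\<close>

lemma qb_limit:
  assumes "norm (t * z) < 1"
  shows "(\<lambda>n. \<Prod>j<n. fac (q ^ j * z)) \<longlonglongrightarrow> qb q t z"
proof -
  have "summable (\<lambda>n. qb_coef q t n * 1 ^ n)"
    by (rule summable_norm_cancel[OF qb_summable]) (use t in simp)
  then have "isCont (qb q t) 0"
    unfolding qb_def[abs_def] by (rule isCont_powser) simp
  moreover have "(\<lambda>n. q ^ n * z) \<longlonglongrightarrow> 0"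
    using tendsto_mult_right[OF q_lim, of z] by simp
  ultimately have "(\<lambda>n. qb q t (q ^ n * z)) \<longlonglongrightarrow> qb q t 0"
    by (rule isCont_tendsto_compose)
  then have lim1: "(\<lambda>n. qb q t (q ^ n * z)) \<longlonglongrightarrow> 1"
    by (simp add: qb_def qb_coef_def)
  then have "(\<lambda>n. qb q t z / qb q t (q ^ n * z)) \<longlonglongrightarrow> qb q t z / 1"
    by (intro tendsto_divide tendsto_const) auto
  moreover have "eventually (\<lambda>n. qb q t z / qb q t (q ^ n * z) = (\<Prod>j<n. fac (q ^ j * z))) sequentially"
    using tendsto_imp_eventually_ne[OF lim1 one_neq_zero]
    by eventually_elim (use qb_iterate[OF assms] in \<open>auto simp: field_simps\<close>)
  ultimately show ?thesis by (simp add: tendsto_cong)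
qed

lemma fac_convergent:
  assumes "norm (t * z) < 1"
  shows "convergent_prod (\<lambda>j. fac (q ^ j * z))"
proof -
  have "summable (\<lambda>j. norm (fac (q ^ j * z) - 1))"
  proof (rule summable_comparison_test_ev)
    have "(\<lambda>j. norm (1 - t * (q ^ j * z))) \<longlonglongrightarrow> norm (1 - t * (0 * z))"
      by (intro tendsto_intros q_lim)
    then have "eventually (\<lambda>j. norm (1 - t * (q ^ j * z)) > 1 / 2) sequentially"
      by (rule order_tendstoD(1)) simp
    then show "eventually (\<lambda>j. norm (norm (fac (q ^ j * z) - 1)) \<le> 2 * norm ((t - 1) * z) * norm q ^ j) sequentially"
    proof eventually_elim
      case (elim j)
      have "fac (q ^ j * z) - 1 = (t - 1) * z * q ^ j / (1 - t * (q ^ j * z))"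
        using den_nz[OF norm_tqz[OF assms, of j]] by (simp add: fac_def field_simps)
      then have "norm (fac (q ^ j * z) - 1) = norm ((t - 1) * z) * norm q ^ j / norm (1 - t * (q ^ j * z))"
        by (simp add: norm_divide norm_mult norm_power)
      also have "\<dots> \<le> norm ((t - 1) * z) * norm q ^ j / (1 / 2)"
        using elim by (intro divide_left_mono) (auto intro!: mult_pos_pos)
      finally show ?case by simp
    qed
    show "summable (\<lambda>j. 2 * norm ((t - 1) * z) * norm q ^ j)"
      using q by (intro summable_mult summable_geometric) auto
  qed
  then show ?thesis
    by (intro abs_convergent_prod_imp_convergent_prod) (simp add: abs_convergent_prod_conv_summable)
qed

definition in_annulus :: "complex \<Rightarrow> bool" where
  "in_annulus X \<longleftrightarrow> norm (t * q) < norm X ^ 2 \<and> norm t * norm X ^ 2 < 1"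

lemma annulus_norms:
  assumes "in_annulus X"
  shows "X \<noteq> 0" "norm (t * X ^ 2) < 1" "norm (t * (q * X powi (- 2))) < 1"
proof -
  show X: "X \<noteq> 0" using assms norm_ge_zero[of "t * q"] by (auto simp: in_annulus_def)
  show "norm (t * X ^ 2) < 1" using assms by (simp add: in_annulus_def norm_mult norm_power)
  have "norm (t * (q * X powi (- 2))) = norm (t * q) / norm X ^ 2"
    by (simp add: norm_mult norm_power norm_inverse power_int_minus power_int_numeral divide_inverse)
  then show "norm (t * (q * X powi (- 2))) < 1"
    using assms X by (simp add: in_annulus_def)
qed

lemma mu_fun_factor: "((1 - q ^ j * X ^ 2) * (1 - q ^ (j + 1) * X powi (- 2))) /
    ((1 - t * q ^ j * X ^ 2) * (1 - t * q ^ (j + 1) * X powi (- 2)))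
  = fac (q ^ j * X ^ 2) * fac (q ^ j * (q * X powi (- 2)))"
  by (simp add: fac_def mult.assoc mult.left_commute[of q] power_Suc2 del: power_Suc)

lemma mu_fun_convergent:
  assumes "in_annulus X"
  shows "convergent_prod (\<lambda>j. fac (q ^ j * X ^ 2) * fac (q ^ j * (q * X powi (- 2))))"
  using annulus_norms[OF assms] by (intro convergent_prod_mult fac_convergent)

lemma mu_fun_eq:
  assumes "in_annulus X"
  shows "mu_fun q t X = qb q t (X ^ 2) * qb q t (q * X powi (- 2))"
proof -
  note n = annulus_norms[OF assms]
  have "(\<lambda>n. \<Prod>j\<le>n. fac (q ^ j * X ^ 2) * fac (q ^ j * (q * X powi (- 2)))) \<longlonglongrightarrow> mu_fun q t X"
    unfolding mu_fun_def mu_fun_factor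
    by (rule convergent_prod_LIMSEQ[OF mu_fun_convergent[OF assms]])
  moreover have "(\<lambda>n. (\<Prod>j<Suc n. fac (q ^ j * X ^ 2)) * (\<Prod>j<Suc n. fac (q ^ j * (q * X powi (- 2)))))
      \<longlonglongrightarrow> qb q t (X ^ 2) * qb q t (q * X powi (- 2))"
    by (intro tendsto_mult LIMSEQ_Suc[OF qb_limit] n)
  then have "(\<lambda>n. \<Prod>j\<le>n. fac (q ^ j * X ^ 2) * fac (q ^ j * (q * X powi (- 2))))
      \<longlonglongrightarrow> qb q t (X ^ 2) * qb q t (q * X powi (- 2))"
    by (simp only: prod.distrib lessThan_Suc_atMost)
  ultimately show ?thesis by (rule LIMSEQ_unique)
qed

text \<open>Multiplying the two power series and collecting the powers of \<open>X\<close> gives the Laurent expansion.\<close>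

lemma mu_expansion_exists: "\<exists>a. mu_expansion q t a"
proof -
  let ?b = "qb_coef q t"
  define Fib where "Fib n = {(i, j). 2 * (int i - int j) = n}" for n
  define a where "a n = infsum (\<lambda>(i, j). ?b i * ?b j * q ^ j) (Fib n)" for n
  have "((\<lambda>n. a n * X powi n) has_sum mu_fun q t X) UNIV" if X: "in_annulus X" for X
  proof -
    note n = annulus_norms[OF X]
    define F where "F i = ?b i * (X ^ 2) ^ i" for i
    define G where "G j = ?b j * (q * X powi (- 2)) ^ j" for j
    have sF: "summable (\<lambda>i. norm (F i))" and sG: "summable (\<lambda>i. norm (G i))"
      unfolding F_def G_def by (intro qb_summable n)+
    have hF: "(F has_sum qb q t (X ^ 2)) UNIV" and hG: "(G has_sum qb q t (q * X powi (- 2))) UNIV"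
      unfolding F_def G_def
      by (intro norm_summable_imp_has_sum qb_summable qb_sums n)+
    have aF: "(\<lambda>i. norm (F i)) summable_on UNIV" and aG: "(\<lambda>i. norm (G i)) summable_on UNIV"
      using hF hG has_sum_imp_summable summable_on_iff_abs_summable_on_complex by blast+
    have abs: "(\<lambda>p. norm (case p of (i, j) \<Rightarrow> F i * G j)) summable_on UNIV \<times> UNIV"
      unfolding Infinite_Sum.abs_summable_on_Sigma_iff
    proof (intro conjI ballI)
      fix i :: nat
      show "(\<lambda>j. norm (case (i, j) of (i, j) \<Rightarrow> F i * G j)) summable_on UNIV"
        using aG by (simp add: norm_mult summable_on_cmult_right)
    next
      have "(\<lambda>i. norm (F i) * infsum (\<lambda>j. norm (G j)) UNIV) summable_on UNIV"
        using aF by (intro summable_on_cmult_left)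
      then show "(\<lambda>i. norm (infsum (\<lambda>j. norm (case (i, j) of (i, j) \<Rightarrow> F i * G j)) UNIV)) summable_on UNIV"
        by (simp add: norm_mult infsum_cmult_right' infsum_nonneg)
    qed
    then have sum: "(\<lambda>(i, j). F i * G j) summable_on UNIV \<times> UNIV"
      by (rule abs_summable_summable)
    then obtain L where L: "((\<lambda>(i, j). F i * G j) has_sum L) (UNIV \<times> UNIV)"
      by (auto simp: summable_on_def)
    have "((\<lambda>i. F i * qb q t (q * X powi (- 2))) has_sum L) UNIV"
      by (rule has_sum_SigmaD[OF L]) (auto intro!: has_sum_cmult_right hG)
    moreover have "((\<lambda>i. F i * qb q t (q * X powi (- 2))) has_sum qb q t (X ^ 2) * qb q t (q * X powi (- 2))) UNIV"
      by (intro has_sum_cmult_left hF)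
    ultimately have Leq: "L = mu_fun q t X"
      using has_sum_unique mu_fun_eq[OF X] by metis
    define H where "H = (\<lambda>(n, i, j). X powi n * (?b i * ?b j * q ^ j))"
    have "(H has_sum L) (Sigma UNIV Fib)"
    proof (subst has_sum_reindex_bij_witness[where S = "Sigma UNIV Fib" and T = "UNIV \<times> UNIV"
          and i = "\<lambda>(i, j). (2 * (int i - int j), i, j)" and j = "\<lambda>(n, i, j). (i, j)"
          and h = "\<lambda>(i, j). F i * G j" and s' = L])
      fix x assume "x \<in> Sigma UNIV Fib"
      then obtain i j where x: "x = (2 * (int i - int j), i, j)" by (auto simp: Fib_def)
      have e: "2 * (int i - int j) = 2 * int i + - 2 * int j" by simp
      have e1: "X powi (2 * int i) = (X ^ 2) ^ i" by (simp add: power_int_mult power_int_numeral)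
      have e2: "X powi (- 2 * int j) = (X powi (- 2)) ^ j"
        by (simp only: power_int_mult power_int_of_nat)
      have "X powi (2 * (int i - int j)) = (X ^ 2) ^ i * (X powi (- 2)) ^ j"
        unfolding e power_int_add[OF disjI1[OF n(1)]] e1 e2 ..
      then show "(case (case x of (n, i, j) \<Rightarrow> (i, j)) of (i, j) \<Rightarrow> F i * G j) = H x"
        by (simp add: x H_def F_def G_def power_mult_distrib)
    qed (use L in \<open>auto simp: Fib_def\<close>)
    then have H: "((\<lambda>(n, p). H (n, p)) has_sum L) (Sigma UNIV Fib)" by (simp add: case_prod_eta)
    have "((\<lambda>n. a n * X powi n) has_sum L) UNIV"
    proof (rule has_sum_SigmaD[OF \<open>(H has_sum L) (Sigma UNIV Fib)\<close>])
      fix n :: int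
      have "(\<lambda>p. H (n, p)) summable_on Fib n"
        using summable_on_SigmaD1[OF has_sum_imp_summable[OF H], of n] by simp
      moreover have "infsum (\<lambda>p. H (n, p)) (Fib n) = a n * X powi n"
      proof -
        have "infsum (\<lambda>p. H (n, p)) (Fib n) = infsum (\<lambda>p. X powi n * (case p of (i, j) \<Rightarrow> ?b i * ?b j * q ^ j)) (Fib n)"
          by (intro infsum_cong) (auto simp: H_def)
        then show ?thesis by (simp add: infsum_cmult_right' a_def mult.commute)
      qed
      ultimately show "((\<lambda>p. H (n, p)) has_sum a n * X powi n) (Fib n)"
        using has_sum_infsum by metis
    qed
    then show ?thesis by (simp add: Leq)
  qed
  then show ?thesis unfolding mu_expansion_def in_annulus_def by blast
qed

end

subsection \<open>Uniqueness of Laurent expansions\<close>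

text \<open>Averaging \<open>f(\<omega>) \<omega>^(-m)\<close> over the \<open>M\<close>-th roots of unity leaves the coefficients
  with index congruent to \<open>m\<close> modulo \<open>M\<close>, and the tail of an absolutely convergent series is small.\<close>

lemma has_sum_finite_sum:
  fixes f :: "'k \<Rightarrow> 'n \<Rightarrow> complex"
  assumes "finite A" "\<And>k. k \<in> A \<Longrightarrow> (f k has_sum s k) B"
  shows "((\<lambda>n. \<Sum>k\<in>A. f k n) has_sum (\<Sum>k\<in>A. s k)) B"
  using assms by (induction A rule: finite_induct) (auto intro!: has_sum_0 has_sum_add)

lemma laurent_unique_0:
  fixes c :: "int \<Rightarrow> complex"
  assumes "\<And>X. norm X = 1 \<Longrightarrow> ((\<lambda>n. c n * X powi n) has_sum 0) UNIV"
  shows "c m = 0"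
proof -
  have "(c has_sum 0) UNIV" using assms[of 1] by simp
  then have abs: "(\<lambda>n. norm (c n)) summable_on UNIV"
    using has_sum_imp_summable summable_on_iff_abs_summable_on_complex by blast
  have shift: "((\<lambda>n. c n * X powi (n - m)) has_sum 0) UNIV" if "norm X = 1" for X
  proof -
    have X: "X \<noteq> 0" using that by auto
    have "((\<lambda>n. X powi (- m) * (c n * X powi n)) has_sum X powi (- m) * 0) UNIV"
      by (intro has_sum_cmult_right assms that)
    moreover have "X powi (- m) * (c n * X powi n) = c n * X powi (n - m)" for n
      using X power_int_add[of X "- m" n] by (simp add: algebra_simps)
    ultimately show ?thesis by simp
  qed
  have bound: "norm (c m) \<le> e" if e: "e > 0" for e
  proof -
    obtain S where S: "finite S" "\<And>T. finite T \<Longrightarrow> T \<inter> S = {} \<Longrightarrow> sum (\<lambda>n. norm (c n)) T \<le> e"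
    proof -
      define L where "L = infsum (\<lambda>n. norm (c n)) UNIV"
      have "((\<lambda>n. norm (c n)) has_sum L) UNIV" using abs by (simp add: L_def)
      then have "eventually (\<lambda>F. sum (\<lambda>n. norm (c n)) F > L - e) (finite_subsets_at_top UNIV)"
        unfolding has_sum_def by (rule order_tendstoD(1)) (use e in simp)
      then obtain S where S: "finite S" "\<And>F. finite F \<Longrightarrow> S \<subseteq> F \<Longrightarrow> sum (\<lambda>n. norm (c n)) F > L - e"
        by (auto simp: eventually_finite_subsets_at_top)
      have "sum (\<lambda>n. norm (c n)) T \<le> e" if "finite T" "T \<inter> S = {}" for T
      proof -
        have "sum (\<lambda>n. norm (c n)) (S \<union> T) \<le> L"
          unfolding L_def using abs S(1) that(1) by (intro finite_sum_le_infsum) auto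
        moreover have "sum (\<lambda>n. norm (c n)) (S \<union> T) = sum (\<lambda>n. norm (c n)) S + sum (\<lambda>n. norm (c n)) T"
          using S(1) that by (intro sum.union_disjoint) auto
        moreover have "sum (\<lambda>n. norm (c n)) S > L - e" using S by blast
        ultimately show ?thesis by linarith
      qed
      then show ?thesis using that S(1) by blast
    qed
    obtain B where B: "\<And>n. n \<in> S \<Longrightarrow> \<bar>n - m\<bar> < int B"
    proof -
      have "finite ((\<lambda>n. nat \<bar>n - m\<bar>) ` S)" using S by simp
      then obtain B where "\<forall>x\<in>(\<lambda>n. nat \<bar>n - m\<bar>) ` S. x < B"
        using finite_nat_set_iff_bounded by blast
      then show ?thesis using that[of B] by fastforce
    qed
    \<comment> \<open>Indices congruent to \<open>m\<close> modulo \<open>M\<close>, except \<open>m\<close> itself, lie outside of \<open>S\<close>.\<close>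
    define M where "M = Suc B"
    have M: "M > 0" by (simp add: M_def)
    define \<omega> where "\<omega> = cis (2 * pi / real M)"
    have \<omega>: "norm \<omega> = 1" "\<omega> \<noteq> 0" by (simp_all add: \<omega>_def)
    have avg: "(\<Sum>k<M. \<omega> powi (int k * j)) = (if int M dvd j then of_nat M else 0)" for j
    proof -
      have pw: "\<omega> powi (int k * j) = (\<omega> powi j) ^ k" for k
        by (simp add: power_int_mult mult.commute[of "int k"])
      have "\<omega> ^ M = 1" unfolding \<omega>_def Complex.DeMoivre using M by simp
      then have M1: "(\<omega> powi j) ^ M = 1"
        by (metis mult.commute power_int_1_left power_int_mult power_int_of_nat)
      have one: "\<omega> powi j = 1 \<longleftrightarrow> int M dvd j"
      proof
        assume "int M dvd j"
        then obtain i where "j = int M * i" by auto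
        then show "\<omega> powi j = 1" using \<open>\<omega> ^ M = 1\<close> by (simp add: power_int_mult)
      next
        assume a: "\<omega> powi j = 1"
        have "\<omega> powi j = cis (of_int j * (2 * pi / real M))"
          by (simp add: \<omega>_def cis_power_int)
        then have "cos (of_int j * (2 * pi / real M)) = 1"
          using a by (metis Re_complex_of_real cis.sel(1) of_real_1)
        then obtain x :: int where "of_int j * (2 * pi / real M) = of_int x * 2 * pi"
          using cos_one_2pi_int by auto
        then have "(of_int j - of_int x * real M) * (2 * pi / real M) = 0"
          using M by (simp add: field_simps)
        then have "of_int j = (of_int x * real M :: real)"
          using M by simp
        then have "j = x * int M"
          by (metis of_int_eq_iff of_int_mult of_int_of_nat_eq)
        then show "int M dvd j" by simp
      qed
      show ?thesis
      proof (cases "int M dvd j")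
        case True
        then show ?thesis using one by (simp add: pw)
      next
        case False
        then have "(\<Sum>k<M. (\<omega> powi j) ^ k) = 0"
          using one M1 by (simp add: geometric_sum)
        then show ?thesis using False by (simp add: pw)
      qed
    qed
    have "((\<lambda>n. \<Sum>k<M. c n * (\<omega> ^ k) powi (n - m)) has_sum (\<Sum>k<M. 0)) UNIV"
      by (intro has_sum_finite_sum shift) (auto simp: \<omega> norm_power)
    moreover have "(\<Sum>k<M. c n * (\<omega> ^ k) powi (n - m)) = (if int M dvd n - m then of_nat M * c n else 0)" for n
    proof -
      have "(\<Sum>k<M. c n * (\<omega> ^ k) powi (n - m)) = c n * (\<Sum>k<M. \<omega> powi (int k * (n - m)))"
        by (simp add: sum_distrib_left power_int_mult)
      then show ?thesis by (simp add: avg)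
    qed
    ultimately have "((\<lambda>n. if int M dvd n - m then of_nat M * c n else 0) has_sum 0) UNIV" by simp
    then have "((\<lambda>n. (1 / of_nat M) * (if int M dvd n - m then of_nat M * c n else 0)) has_sum (1 / of_nat M) * 0) UNIV"
      by (rule has_sum_cmult_right)
    moreover have "(1 / of_nat M) * (if int M dvd n - m then of_nat M * c n else 0)
      = (if int M dvd n - m then c n else 0)" for n using M by simp
    ultimately have "((\<lambda>n. if int M dvd n - m then c n else 0) has_sum 0) UNIV" by simp
    then have lim: "((\<lambda>F. \<Sum>n\<in>F. if int M dvd n - m then c n else 0) \<longlongrightarrow> 0) (finite_subsets_at_top UNIV)"
      by (simp add: has_sum_def)
    have ev: "eventually (\<lambda>F. norm (c m - (\<Sum>n\<in>F. if int M dvd n - m then c n else 0)) \<le> e) (finite_subsets_at_top UNIV)"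
      unfolding eventually_finite_subsets_at_top
    proof (intro exI[of _ "{m}"] conjI allI impI)
      fix F :: "int set" assume F: "finite F \<and> {m} \<subseteq> F \<and> F \<subseteq> UNIV"
      define T where "T = {n\<in>F - {m}. int M dvd n - m}"
      have "(\<Sum>n\<in>F. if int M dvd n - m then c n else 0) = c m + (\<Sum>n\<in>F - {m}. if int M dvd n - m then c n else 0)"
        using F by (subst sum.remove[of _ m]) auto
      also have "(\<Sum>n\<in>F - {m}. if int M dvd n - m then c n else 0) = sum c T"
        unfolding T_def using F by (intro sum.inter_filter[symmetric]) auto
      finally have "norm (c m - (\<Sum>n\<in>F. if int M dvd n - m then c n else 0)) = norm (sum c T)"
        by simp
      also have "\<dots> \<le> sum (\<lambda>n. norm (c n)) T" by (rule norm_sum)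
      also have "\<dots> \<le> e"
      proof (rule S(2))
        show "finite T" using F by (simp add: T_def)
        show "T \<inter> S = {}"
        proof (rule ccontr)
          assume "T \<inter> S \<noteq> {}"
          then obtain n where n: "n \<in> S" "n \<noteq> m" "int M dvd n - m" by (auto simp: T_def)
          then have "int M \<le> \<bar>n - m\<bar>" using dvd_imp_le_int[of "n - m" "int M"] by simp
          then show False using B[OF n(1)] by (simp add: M_def)
        qed
      qed
      finally show "norm (c m - (\<Sum>n\<in>F. if int M dvd n - m then c n else 0)) \<le> e" .
    qed auto
    have "((\<lambda>F. norm (c m - (\<Sum>n\<in>F. if int M dvd n - m then c n else 0))) \<longlongrightarrow> norm (c m - 0)) (finite_subsets_at_top UNIV)"
      by (intro tendsto_intros lim)
    from tendsto_upperbound[OF this ev] show ?thesis by simp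
  qed
  show ?thesis using field_le_epsilon[of "norm (c m)" 0] bound by simp
qed

lemma laurent_unique:
  fixes c d :: "int \<Rightarrow> complex"
  assumes "\<And>X. norm X = 1 \<Longrightarrow> ((\<lambda>n. c n * X powi n) has_sum f X) UNIV"
    "\<And>X. norm X = 1 \<Longrightarrow> ((\<lambda>n. d n * X powi n) has_sum f X) UNIV"
  shows "c = d"
proof
  fix m
  have "c m - d m = 0"
  proof (rule laurent_unique_0[where c = "\<lambda>n. c n - d n"])
    fix X :: complex assume X: "norm X = 1"
    have "((\<lambda>n. c n * X powi n + (- 1) * (d n * X powi n)) has_sum f X + (- 1) * f X) UNIV"
      by (intro has_sum_add has_sum_cmult_right assms X)
    then show "((\<lambda>n. (c n - d n) * X powi n) has_sum 0) UNIV" by (simp add: algebra_simps)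
  qed
  then show "c m = d m" by simp
qed

subsection \<open>The normalized coefficients\<close>

lemma has_sum_shift2:
  assumes "((\<lambda>n::int. b n * X powi n) has_sum s) UNIV" "X \<noteq> (0::complex)"
  shows "((\<lambda>n. b (n - 2) * X powi n) has_sum X ^ 2 * s) UNIV"
proof -
  have "((\<lambda>n. X ^ 2 * (b n * X powi n)) has_sum X ^ 2 * s) UNIV"
    by (intro has_sum_cmult_right assms)
  moreover have "X ^ 2 * (b n * X powi n) = b n * X powi (n + 2)" for n
    using assms(2) by (simp add: power_int_add power_int_numeral)
  ultimately have "((\<lambda>n. b n * X powi (n + 2)) has_sum X ^ 2 * s) UNIV" by simp
  moreover have "bij_betw (\<lambda>n::int. n - 2) UNIV UNIV"
    by (rule bij_betw_byWitness[where f' = "\<lambda>n. n + 2"]) auto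
  ultimately have "((\<lambda>n. (\<lambda>n. b n * X powi (n + 2)) (n - 2)) has_sum X ^ 2 * s) UNIV"
    by (subst has_sum_reindex_bij_betw)
  then show ?thesis by simp
qed

locale small_roots =
  fixes v w :: complex
  assumes v: "0 < norm v" "norm v < 1" and w: "0 < norm w" "norm w < 1"
begin

sublocale small_params "v ^ 2" "w ^ 2"
  by standard (use v w in \<open>auto simp: norm_power power_less_one_iff\<close>)

sublocale generic_params v w
proof
  fix n :: nat
  have "norm (w ^ 2 * v ^ (2 * n)) < 1"
  proof -
    have "norm (v ^ (2 * n)) \<le> 1" using v by (simp add: norm_power power_le_one)
    then have "norm (w ^ 2) * norm (v ^ (2 * n)) \<le> norm (w ^ 2)"
      by (rule mult_left_le[OF _ norm_ge_zero])
    then show ?thesis using t(2) by (simp add: norm_mult)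
  qed
  then show "w ^ 2 * v ^ (2 * n) \<noteq> 1" by auto
qed (use v w in auto)

lemma circle_annulus:
  assumes "norm X = 1"
  shows "in_annulus X" "in_annulus (v * X)"
proof -
  have "norm (w ^ 2 * v ^ 2) < 1" using q t mult_strict_mono[of "norm (w ^ 2)" 1 "norm (v ^ 2)" 1]
    by (simp add: norm_mult)
  then show "in_annulus X" using assms t by (simp add: in_annulus_def)
  have "norm (w ^ 2 * v ^ 2) < norm v ^ 2"
    using q t by (simp add: norm_mult norm_power)
  then show "in_annulus (v * X)"
    using assms \<open>norm (w ^ 2 * v ^ 2) < 1\<close> by (simp add: in_annulus_def norm_mult norm_power)
qed

text \<open>Replacing \<open>X^2\<close> by \<open>q X^2\<close> removes one factor from the first product and adds one to the second.\<close>

lemma mu_fun_shift: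
  assumes "norm X = 1"
  shows "(w ^ 2 - X ^ 2) * mu_fun (v ^ 2) (w ^ 2) (v * X) = (1 - w ^ 2 * X ^ 2) * mu_fun (v ^ 2) (w ^ 2) X"
proof -
  let ?g = "qb (v ^ 2) (w ^ 2)" and ?u = "X ^ 2"
  have X: "X \<noteq> 0" using assms by auto
  have i: "X powi (- 2) = inverse ?u" by (simp add: power_int_minus power_int_numeral)
  have n1: "norm (w ^ 2 * ?u) < 1" and n2: "norm (w ^ 2 * inverse ?u) < 1"
    using assms t by (simp_all add: norm_mult norm_power norm_inverse)
  have e1: "(1 - w ^ 2 * ?u) * ?g ?u = (1 - ?u) * ?g (v ^ 2 * ?u)"
    and e2: "(1 - w ^ 2 * inverse ?u) * ?g (inverse ?u) = (1 - inverse ?u) * ?g (v ^ 2 * inverse ?u)"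
    using qb_functional[OF n1] qb_functional[OF n2] by simp_all
  have "v ^ 2 * (v * X) powi (- 2) = inverse ?u" "(v * X) ^ 2 = v ^ 2 * ?u"
    using v_nz X by (simp_all add: power_int_minus power_int_numeral power_mult_distrib)
  then have "mu_fun (v ^ 2) (w ^ 2) (v * X) = ?g (v ^ 2 * ?u) * ?g (inverse ?u)"
    by (simp add: mu_fun_eq circle_annulus[OF assms])
  moreover have "w ^ 2 - ?u = - ?u * (1 - w ^ 2 * inverse ?u)"
    using X by (simp add: field_simps)
  ultimately have "(w ^ 2 - ?u) * mu_fun (v ^ 2) (w ^ 2) (v * X)
    = - ?u * ?g (v ^ 2 * ?u) * ((1 - w ^ 2 * inverse ?u) * ?g (inverse ?u))"
    by (simp only: ac_simps)
  also have "\<dots> = (- ?u * (1 - inverse ?u)) * ?g (v ^ 2 * ?u) * ?g (v ^ 2 * inverse ?u)"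
    unfolding e2 by (simp only: ac_simps)
  also have "- ?u * (1 - inverse ?u) = 1 - ?u"
    using X by (simp add: field_simps)
  also have "(1 - ?u) * ?g (v ^ 2 * ?u) * ?g (v ^ 2 * inverse ?u)
    = (1 - w ^ 2 * ?u) * (?g ?u * ?g (v ^ 2 * inverse ?u))"
    by (simp only: e1[symmetric] mult.assoc)
  also have "?g ?u * ?g (v ^ 2 * inverse ?u) = mu_fun (v ^ 2) (w ^ 2) X"
    by (simp add: mu_fun_eq circle_annulus[OF assms] i)
  finally show ?thesis .
qed

text \<open>The shift equation on the unit circle, with uniqueness of Laurent expansions, gives the recurrence of
  \<open>weight_step\<close>. The constant term is not zero, as otherwise the function itself would be zero, while the
  product has no zero at \<open>X = \<i>\<close>.\<close>

lemma mu_expansion_coeffs: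
  assumes a: "mu_expansion (v ^ 2) (w ^ 2) a"
  shows "a 0 \<noteq> 0" "a n = a 0 * weight v w n"
proof -
  let ?mu = "mu_fun (v ^ 2) (w ^ 2)"
  have A: "((\<lambda>n. a n * X powi n) has_sum ?mu X) UNIV" if "in_annulus X" for X
    using a that by (auto simp: mu_expansion_def in_annulus_def)
  \<comment> \<open>The function is even in \<open>X\<close>.\<close>
  have odd: "a n = 0" if "odd n" for n
  proof -
    have "(\<lambda>n. a n * (- 1) powi n) = a"
    proof (rule laurent_unique)
      fix X :: complex assume X: "norm X = 1"
      show "((\<lambda>n. a n * X powi n) has_sum ?mu X) UNIV"
        by (rule A[OF circle_annulus(1)[OF X]])
      have "((\<lambda>n. a n * (- X) powi n) has_sum ?mu (- X)) UNIV"
        by (rule A[OF circle_annulus(1)]) (simp add: X)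
      moreover have "?mu (- X) = ?mu X"
        by (simp add: mu_fun_def power_int_minus power_int_numeral)
      moreover have "(- X) powi n = (- 1) powi n * X powi n" for n
        using power_int_mult_distrib[of "- 1" X n] by simp
      ultimately show "((\<lambda>n. a n * (- 1) powi n * X powi n) has_sum ?mu X) UNIV"
        by (simp add: mult.assoc)
    qed
    then have "a n * (- 1) powi n = a n" by metis
    moreover have "(- 1 :: complex) powi n = - 1" using that by (simp add: power_int_minus_one_minus power_int_minus_left)
    ultimately show ?thesis by simp
  qed
  have "(\<lambda>n. w ^ 2 * (a n * v powi n) + (- 1) * (a (n - 2) * v powi (n - 2)))
    = (\<lambda>n. a n + (- (w ^ 2)) * a (n - 2))"
  proof (rule laurent_unique)
    fix X :: complex assume X: "norm X = 1"
    have X0: "X \<noteq> 0" using X by auto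
    have "((\<lambda>n. a n * (v * X) powi n) has_sum ?mu (v * X)) UNIV"
      by (rule A[OF circle_annulus(2)[OF X]])
    then have 1: "((\<lambda>n. (a n * v powi n) * X powi n) has_sum ?mu (v * X)) UNIV"
      by (simp add: power_int_mult_distrib mult.assoc)
    have "((\<lambda>n. w ^ 2 * ((a n * v powi n) * X powi n) + (- 1) * ((a (n - 2) * v powi (n - 2)) * X powi n))
      has_sum w ^ 2 * ?mu (v * X) + (- 1) * (X ^ 2 * ?mu (v * X))) UNIV"
      by (intro has_sum_add has_sum_cmult_right has_sum_shift2[OF 1 X0] 1)
    then show "((\<lambda>n. (w ^ 2 * (a n * v powi n) + (- 1) * (a (n - 2) * v powi (n - 2))) * X powi n)
      has_sum (w ^ 2 - X ^ 2) * ?mu (v * X)) UNIV"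
      by (simp add: algebra_simps)
    have 2: "((\<lambda>n. a n * X powi n) has_sum ?mu X) UNIV"
      by (rule A[OF circle_annulus(1)[OF X]])
    have "((\<lambda>n. a n * X powi n + (- (w ^ 2)) * (a (n - 2) * X powi n))
      has_sum ?mu X + (- (w ^ 2)) * (X ^ 2 * ?mu X)) UNIV"
      by (intro has_sum_add has_sum_cmult_right has_sum_shift2[OF 2 X0] 2)
    then show "((\<lambda>n. (a n + (- (w ^ 2)) * a (n - 2)) * X powi n) has_sum (w ^ 2 - X ^ 2) * ?mu (v * X)) UNIV"
      unfolding mu_fun_shift[OF X] by (simp add: algebra_simps)
  qed
  then have step: "a n * (1 - w ^ 2 * v powi n) = a (n - 2) * (w ^ 2 - v powi (n - 2))" for n
    by (auto simp: fun_eq_iff algebra_simps dest: spec[of _ n])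
  define g where "g n = a n - a 0 * weight v w n" for n
  have gstep: "g n * (1 - w ^ 2 * v powi n) = g (n - 2) * (w ^ 2 - v powi (n - 2))" for n
  proof -
    have "g n * (1 - w ^ 2 * v powi n) = a n * (1 - w ^ 2 * v powi n) - a 0 * (weight v w n * (1 - w ^ 2 * v powi n))"
      by (simp add: g_def algebra_simps)
    also have "\<dots> = g (n - 2) * (w ^ 2 - v powi (n - 2))"
      unfolding step weight_step by (simp add: g_def algebra_simps)
    finally show ?thesis .
  qed
  have pos: "g (2 * int m) = 0" for m
  proof (induction m)
    case (Suc m)
    have "g (2 * int (Suc m)) * (1 - w ^ 2 * v powi (2 * int (Suc m))) = 0"
      using gstep[of "2 * int (Suc m)"] Suc by simp
    then show ?case using nonres[of "Suc m"] unfolding powi_even by simp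
  qed (simp add: g_def)
  have neg: "g (- (2 * int m)) = 0" for m
  proof (induction m)
    case (Suc m)
    have e: "- (2 * int m) - 2 = - (2 * int (Suc m))" by simp
    have "g (- (2 * int (Suc m))) * (w ^ 2 - v powi (- (2 * int (Suc m)))) = 0"
      using gstep[of "- (2 * int m)"] unfolding e Suc by simp
    moreover have "w ^ 2 \<noteq> inverse (v ^ (2 * Suc m))"
      using nonres[of "Suc m"] v_nz by (metis le_add1 left_inverse plus_1_eq_Suc power_not_zero)
    ultimately show ?case unfolding powi_even_neg by simp
  qed (simp add: g_def)
  have eq: "a n = a 0 * weight v w n" for n
  proof (cases n rule: even_int_cases)
    case odd
    then show ?thesis using \<open>odd n \<Longrightarrow> a n = 0\<close> by (simp add: weight_odd)
  next
    case (pos m)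
    then show ?thesis using \<open>g (2 * int m) = 0\<close> by (simp add: g_def)
  next
    case (neg m)
    then show ?thesis using \<open>g (- (2 * int m)) = 0\<close> by (simp add: g_def)
  qed
  show "a n = a 0 * weight v w n" by (rule eq)
  show "a 0 \<noteq> 0"
  proof
    assume "a 0 = 0"
    then have a0: "a n = 0" for n using eq[of n] by simp
    \<comment> \<open>Here \<open>X^2 = -1\<close>, so the factors are \<open>1 + q^j\<close> up to nonzero denominators.\<close>
    have an: "in_annulus \<i>" by (rule circle_annulus) simp
    have "?mu \<i> = 0" using A[OF an] has_sum_unique[OF A[OF an], of 0] a0 by simp
    moreover have "?mu \<i> \<noteq> 0"
      unfolding mu_fun_def mu_fun_factor
    proof (rule prodinf_nonzero[OF mu_fun_convergent[OF an]])
      fix j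
      have f: "fac z \<noteq> 0" if "norm (w ^ 2 * z) < 1" "z \<noteq> 1" for z
        using that den_nz by (auto simp: fac_def)
      have p: "1 + (v ^ 2) ^ Suc i \<noteq> 0" for i
        using q_pow[of i] by (metis add_eq_0_iff less_irrefl norm_minus_cancel norm_one)
      have p': "- ((v ^ 2) ^ Suc i) \<noteq> 1" for i
      proof
        assume "- ((v ^ 2) ^ Suc i) = 1"
        then have "1 + (v ^ 2) ^ Suc i = 0" by (metis add.left_inverse)
        then show False using p[of i] by simp
      qed
      have "(v ^ 2) ^ j * \<i> ^ 2 \<noteq> 1"
      proof (cases j)
        case (Suc i)
        have "(v ^ 2) ^ j * \<i> ^ 2 = - ((v ^ 2) ^ Suc i)" using Suc by simp
        then show ?thesis using p'[of i] by simp
      qed simp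
      moreover have "(v ^ 2) ^ j * (v ^ 2 * \<i> powi (- 2)) \<noteq> 1"
      proof -
        have "\<i> powi (- 2) = - 1" by (simp add: power_int_minus power_int_numeral)
        then have "(v ^ 2) ^ j * (v ^ 2 * \<i> powi (- 2)) = - ((v ^ 2) ^ Suc j)" by simp
        then show ?thesis using p'[of j] by simp
      qed
      ultimately show "fac ((v ^ 2) ^ j * \<i> ^ 2) * fac ((v ^ 2) ^ j * (v ^ 2 * \<i> powi (- 2))) \<noteq> 0"
        using f norm_tqz annulus_norms[OF an] by (metis mult_eq_0_iff)
    qed
    ultimately show False by simp
  qed
qed

end

text \<open>A polynomial in one variable with infinitely many zeros is zero; this is applied to each of the two
  variables.\<close>

lemma eval2_eq_0:
  fixes P :: "int poly poly"
  assumes "\<And>a b :: complex. 0 < norm a \<Longrightarrow> norm a < 1 \<Longrightarrow> 0 < norm b \<Longrightarrow> norm b < 1 \<Longrightarrow> eval2 P a b = 0"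
  shows "P = 0"
proof -
  have inf: "infinite {a::complex. 0 < norm a \<and> norm a < 1}"
  proof
    assume "finite {a::complex. 0 < norm a \<and> norm a < 1}"
    moreover have "complex_of_real ` {0<..<1} \<subseteq> {a::complex. 0 < norm a \<and> norm a < 1}" by auto
    ultimately have "finite (complex_of_real ` {0<..<1})" by (rule finite_subset[rotated])
    then have "finite {0<..<1::real}" by (rule finite_imageD) (auto simp: inj_on_def)
    then show False by (simp add: infinite_Ioo)
  qed
  have zero: "p = 0" if "\<And>a. 0 < norm a \<Longrightarrow> norm a < 1 \<Longrightarrow> poly p a = 0" for p :: "complex poly"
  proof (rule ccontr)
    assume "p \<noteq> 0"
    then have "finite {a. poly p a = 0}" by (rule poly_roots_finite)
    moreover have "{a::complex. 0 < norm a \<and> norm a < 1} \<subseteq> {a. poly p a = 0}" using that by auto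
    ultimately show False using inf finite_subset by blast
  qed
  have "poly (map_poly of_int (coeff P i)) b = 0" if "0 < norm b" "norm b < 1" for i and b :: complex
  proof -
    have "map_poly (\<lambda>c. poly (map_poly of_int c) b) P = 0"
      by (rule zero) (use assms[OF _ _ that] in \<open>simp add: eval2_def\<close>)
    then have "coeff (map_poly (\<lambda>c. poly (map_poly of_int c) b) P) i = 0" by simp
    then show ?thesis by (simp add: coeff_map_poly)
  qed
  then have "map_poly (of_int :: int \<Rightarrow> complex) (coeff P i) = 0" for i
    by (intro zero) auto
  then have "coeff (map_poly (of_int :: int \<Rightarrow> complex) (coeff P i)) j = 0" for i j by simp
  then have "coeff (coeff P i) j = 0" for i j by (simp add: coeff_map_poly)
  then show ?thesis by (intro poly_eqI) simp
qed

lemma ratfun_eqI: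
  assumes "\<And>a b :: complex. 0 < norm a \<Longrightarrow> norm a < 1 \<Longrightarrow> 0 < norm b \<Longrightarrow> norm b < 1 \<Longrightarrow>
    \<exists>z. has_value a b r z \<and> has_value a b r' z"
  shows "r = r'"
proof -
  obtain p d where r: "r = Fract p d" "d \<noteq> 0" by (cases r) auto
  obtain p' d' where r': "r' = Fract p' d'" "d' \<noteq> 0" by (cases r') auto
  have "(p * d' - p' * d) * (d * d') = 0"
  proof (rule eval2_eq_0)
    fix a b :: complex assume ab: "0 < norm a" "norm a < 1" "0 < norm b" "norm b < 1"
    obtain z where z: "has_value a b r z" "has_value a b r' z" using assms[OF ab] by blast
    show "eval2 ((p * d' - p' * d) * (d * d')) a b = 0"
    proof (cases "eval2 d a b = 0 \<or> eval2 d' a b = 0")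
      case True
      then show ?thesis by (auto simp: eval2_mult)
    next
      case False
      then have "has_value a b r (eval2 p a b / eval2 d a b)" "has_value a b r' (eval2 p' a b / eval2 d' a b)"
        using r r' unfolding has_value_def by blast+
      then have "eval2 p a b / eval2 d a b = eval2 p' a b / eval2 d' a b"
        using z has_value_unique by metis
      then have "eval2 p a b * eval2 d' a b = eval2 p' a b * eval2 d a b"
        using False by (simp add: frac_eq_eq)
      then have "eval2 (p * d' - p' * d) a b = 0"
        using eval2_add[of "p * d'" "- (p' * d)" a b] by (simp add: eval2_uminus eval2_mult)
      then show ?thesis by (simp add: eval2_mult)
    qed
  qed
  then have "p * d' = p' * d" using r r' by simp
  then show ?thesis using r r' by (simp add: eq_fract)
qed

text \<open>Both rational functions have the prescribed values for all small parameters, where the expansion exists and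
  is proportional to \<open>weight\<close>, and such values determine a rational function.\<close>

lemma mu0_eq: "mu0 n = weight qh_var th_var n"
  unfolding mu0_def
proof (rule the_equality)
  show "\<forall>qh th a. 0 < norm qh \<and> norm qh < 1 \<and> 0 < norm th \<and> norm th < 1 \<and> mu_expansion (qh ^ 2) (th ^ 2) a \<longrightarrow>
    rf_regular (weight qh_var th_var n) qh th \<and> rf_value (weight qh_var th_var n) qh th = a n / a 0"
  proof (intro allI impI)
    fix qh th :: complex and a
    assume *: "0 < norm qh \<and> norm qh < 1 \<and> 0 < norm th \<and> norm th < 1 \<and> mu_expansion (qh ^ 2) (th ^ 2) a"
    interpret small_roots qh th by standard (use * in auto)
    have "has_value qh th (weight qh_var th_var n) (weight qh th n)"
      by (rule val.R_weight[OF has_value_qh has_value_th]) (rule generic_params_axioms)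
    moreover have "weight qh th n = a n / a 0"
      using mu_expansion_coeffs(1)[of a] mu_expansion_coeffs(2)[of a n] * by simp
    ultimately show "rf_regular (weight qh_var th_var n) qh th \<and> rf_value (weight qh_var th_var n) qh th = a n / a 0"
      using has_value_rf by metis
  qed
next
  fix r
  assume r: "\<forall>qh th a. 0 < norm qh \<and> norm qh < 1 \<and> 0 < norm th \<and> norm th < 1 \<and> mu_expansion (qh ^ 2) (th ^ 2) a \<longrightarrow>
    rf_regular r qh th \<and> rf_value r qh th = a n / a 0"
  show "r = weight qh_var th_var n"
  proof (rule ratfun_eqI)
    fix qh th :: complex
    assume *: "0 < norm qh" "norm qh < 1" "0 < norm th" "norm th < 1"
    interpret small_roots qh th by standard (use * in auto)
    obtain a where a: "mu_expansion (qh ^ 2) (th ^ 2) a" using mu_expansion_exists by blast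
    have "has_value qh th (weight qh_var th_var n) (weight qh th n)"
      by (rule val.R_weight[OF has_value_qh has_value_th]) (rule generic_params_axioms)
    moreover have "weight qh th n = a n / a 0"
      using mu_expansion_coeffs(1)[OF a] mu_expansion_coeffs(2)[OF a, of n] by simp
    moreover have "rf_regular r qh th" "rf_value r qh th = a n / a 0" using r * a by blast+
    then have "has_value qh th r (a n / a 0)" using rf_regular_has_value by metis
    ultimately show "\<exists>z. has_value qh th r z \<and> has_value qh th (weight qh_var th_var n) z" by metis
  qed
qed

section \<open>The polynomials over the field of rational functions\<close>

definition eps :: "'a::field \<Rightarrow> 'a \<Rightarrow> int \<Rightarrow> 'a laurent" where
  "eps v w n = lconst (inverse (leval (E v w n) (inverse w))) * E v w n"

lemma mu0_fun: "mu0 = weight qh_var th_var"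
  by (rule ext) (rule mu0_eq)

lemma lsubspace_lform: "lsubspace {g. lform \<mu> f g = 0}"
  by (auto simp: lsubspace_def lform_add_right lform_lconst_right) (simp add: lform_def)

lemma lform_0_left [simp]: "lform \<mu> 0 g = 0"
  by (simp add: lform_def)

lemma lform_lincomb_left: "lform \<mu> (\<Sum>j\<in>J. lconst (c j) * F j) g = (\<Sum>j\<in>J. c j * lform \<mu> (F j) g)"
  by (induction J rule: infinite_finite_induct) (auto simp: lform_add_left lform_lconst_left)

lemma lform_lmon: "lform \<mu> f (lmon m) = ct \<mu> (f * lmon (- m))"
  by (simp add: lform_def xrefl_lmon)

lemma (in generic_params) unitriangular_E': "unitriangular E'"
proof -
  interpret inv: generic_params "inverse v" "inverse w" by (rule generic_inverse)
  show ?thesis by (rule inv.unitriangular_E)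
qed

lemma lform_var:
  "lform (weight qh_var th_var) (E qh_var th_var m) (var.E' n) = 0 \<longleftrightarrow> m \<noteq> n"
  by (rule var.lform_E_val)
    (auto simp: var.weight_coeffs_weight two_ratfun var_powers inj_lam_var)

text \<open>The vector \<open>E n\<close> is orthogonal to \<open>E' j\<close> for \<open>j\<close> lower than \<open>n\<close>, hence to the lower monomials. The
  difference of two candidates is a combination of lower vectors \<open>E j\<close> and orthogonal to all lower \<open>E' i\<close>,
  so it is zero since the norms are not.\<close>

lemma e_poly_eq: "e_poly n = E qh_var th_var n"
proof -
  let ?e = "E qh_var th_var" and ?f = "lform (weight qh_var th_var)"
  note tri = var.unitriangular_E and tri' = var.unitriangular_E'
  have orth: "ct mu0 (?e n * lmon (- m)) = 0" if "lprec m n" for m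
  proof -
    have "lmon m \<in> {g. ?f (?e n) g = 0}"
    proof (rule unitriangular_lmon_mem[OF tri' lsubspace_lform])
      fix j assume "lrank j \<le> lrank m"
      then have "j \<noteq> n" using that by (auto simp: lprec_iff_rank)
      then show "var.E' j \<in> {g. ?f (?e n) g = 0}" using lform_var[of n j] by auto
    qed
    then show ?thesis by (simp add: lform_lmon mu0_fun)
  qed
  show ?thesis unfolding e_poly_def
  proof (rule the_equality)
    show "Poly_Mapping.lookup (?e n) n = 1 \<and> (\<forall>m. Poly_Mapping.lookup (?e n) m \<noteq> 0 \<longrightarrow> m = n \<or> lprec m n)
      \<and> (\<forall>m. lprec m n \<longrightarrow> ct mu0 (?e n * lmon (- m)) = 0)"
    proof (intro conjI allI impI)
      show "Poly_Mapping.lookup (?e n) n = 1" using tri by (simp add: unitriangular_def)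
      fix m assume "Poly_Mapping.lookup (?e n) m \<noteq> 0"
      then have "lrank m \<le> lrank n" using tri unfolding unitriangular_def by blast
      then show "m = n \<or> lprec m n" using rank_inj[of m n] by (auto simp: lprec_iff_rank)
    qed (rule orth)
  next
    fix e assume e: "Poly_Mapping.lookup e n = 1 \<and> (\<forall>m. Poly_Mapping.lookup e m \<noteq> 0 \<longrightarrow> m = n \<or> lprec m n)
      \<and> (\<forall>m. lprec m n \<longrightarrow> ct mu0 (e * lmon (- m)) = 0)"
    define d where "d = e - ?e n"
    have sup: "lrank k < lrank n" if "Poly_Mapping.lookup d k \<noteq> 0" for k
    proof (rule ccontr)
      assume k: "\<not> lrank k < lrank n"
      have "Poly_Mapping.lookup e k = Poly_Mapping.lookup (?e n) k"
      proof (cases "k = n")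
        case True
        then show ?thesis using e tri by (simp add: unitriangular_def)
      next
        case False
        then have "lrank n < lrank k" using k rank_inj[of k n] by linarith
        then have "Poly_Mapping.lookup (?e n) k = 0"
          using tri unfolding unitriangular_def by (meson not_less)
        moreover have "Poly_Mapping.lookup e k = 0"
          using e k False by (auto simp: lprec_iff_rank)
        ultimately show ?thesis by simp
      qed
      then show False using that by (simp add: d_def lookup_minus)
    qed
    have dorth: "?f d (var.E' j) = 0" if "lrank j < lrank n" for j
    proof -
      have "var.E' j \<in> {g. ?f d g = 0}"
      proof (rule unitriangular_mem[where F = lmon and r = "lrank n"])
        show "unitriangular lmon" by (auto simp: unitriangular_def lookup_lmon split: if_splits)
        show "lsubspace {g. ?f d g = 0}" by (rule lsubspace_lform)
        show "lrank k < lrank n" if "Poly_Mapping.lookup (var.E' j) k \<noteq> 0" for k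
          using that tri' \<open>lrank j < lrank n\<close> unfolding unitriangular_def by (meson le_less_trans)
        fix k assume "lrank k < lrank n"
        then have "lprec k n" by (simp add: lprec_iff_rank)
        then show "lmon k \<in> {g. ?f d g = 0}"
          using e orth[of k] by (simp add: lform_lmon mu0_fun d_def left_diff_distrib ct_diff)
      qed
      then show ?thesis by simp
    qed
    obtain c where c: "d = (\<Sum>j\<in>{j. lrank j < lrank n}. lconst (c j) * ?e j)"
      using unitriangular_expand[OF tri sup] by blast
    have "c i = 0" if i: "lrank i < lrank n" for i
    proof -
      have "0 = (\<Sum>j\<in>{j. lrank j < lrank n}. c j * ?f (?e j) (var.E' i))"
        using dorth[OF i] unfolding c lform_lincomb_left by (rule sym)
      also have "\<dots> = c i * ?f (?e i) (var.E' i)"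
      proof (subst sum.remove[of _ i])
        show "c i * ?f (?e i) (var.E' i) + (\<Sum>j\<in>{j. lrank j < lrank n} - {i}. c j * ?f (?e j) (var.E' i))
          = c i * ?f (?e i) (var.E' i)"
          using lform_var by (simp add: sum.neutral)
      qed (use i finite_rank_less in auto)
      finally show ?thesis using lform_var[of i i] by auto
    qed
    then have "d = 0" unfolding c by (intro sum.neutral) auto
    then show "e = ?e n" by (simp add: d_def)
  qed
qed

lemma eps_poly_eq: "eps_poly n = eps qh_var th_var n"
  by (simp add: eps_poly_def eps_def e_poly_eq)

lemma (in field_rel) LR_eps:
  assumes "R v v'" "R w w'" "generic_params v' w'" "leval (E v' w' m) (inverse w') \<noteq> 0"
  shows "LR (eps v w m) (eps v' w' m)"
proof -
  interpret generic_params v' w' by fact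
  have "R (inverse w) (inverse w')" using assms(2) w_nz by (rule R_inverse)
  then show ?thesis
    unfolding eps_def using assms w_nz
    by (intro LR_lconst_times R_inverse R_leval LR_E) auto
qed

lemma lform_eps:
  assumes g: "generic_params v w" and "weight_coeffs v w \<mu>" "(2::'a::field) \<noteq> 0" "w ^ 2 \<noteq> 1"
    "\<And>n. n \<ge> 1 \<Longrightarrow> w ^ 4 * v ^ (2 * n) \<noteq> (1::'a)"
  shows "lform \<mu> (eps v w m) (eps (inverse v) (inverse w) m) = \<mu> 0 * sph_norm v w m"
proof -
  interpret generic_params v w by fact
  have n1: "leval (E v w m) (inverse w) \<noteq> 0" by (rule leval_E_nz[OF assms(4,5)])
  have n2: "leval (E' m) (inverse (inverse w)) \<noteq> 0"
    by (rule leval_E_inverse_nz[OF generic_params_axioms assms(4,5)])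
  have d: "lform \<mu> (E v w m) (E' m) = \<mu> 0 * leval (E v w m) (inverse w) * leval (E' m) w * sph_norm v w m"
    by (rule lform_E_diag[OF assms(2-4)]) (rule assms(5))
  show ?thesis
    unfolding eps_def lform_lconst_left lform_lconst_right d
    using n1 n2 by (simp add: field_simps)
qed

section \<open>Roots of unity\<close>

text \<open>Here \<open>v = q^(1/2)\<close> is a primitive \<open>2 N\<close>-th root of unity and \<open>w = t^(1/2)\<close>; the last condition is
  \<open>k \<notin> \<int>/2\<close>.\<close>

locale special =
  fixes N :: nat and v w :: complex
  assumes N: "N \<ge> 1" and root: "v ^ (2 * N) = 1" and primitive: "\<And>j. 0 < j \<Longrightarrow> j < 2 * N \<Longrightarrow> v ^ j \<noteq> 1"
    and w0: "w \<noteq> 0" and nonint: "\<And>j::int. w ^ 2 \<noteq> v powi j"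
begin

lemma v0: "v \<noteq> 0"
  using root N by (metis gr0I mult_is_0 not_one_le_zero power_0_left zero_neq_numeral zero_neq_one)

lemma v_N: "v ^ N = - 1"
proof -
  have "(v ^ N) ^ 2 = 1" using root by (simp add: mult.commute flip: power_mult)
  moreover have "v ^ N \<noteq> 1" using primitive[of N] N by simp
  ultimately show ?thesis by (simp add: power2_eq_1_iff)
qed

lemma v_mod: "v ^ n = v ^ (n mod (2 * N))"
  using root by (metis mult_1 div_mult_mod_eq mult.commute power_add power_mult power_one)

lemma v_pow_1_iff: "v ^ n = 1 \<longleftrightarrow> 2 * N dvd n"
proof
  assume "v ^ n = 1"
  then have "v ^ (n mod (2 * N)) = 1" using v_mod by simp
  moreover have "n mod (2 * N) < 2 * N" using N by simp
  ultimately show "2 * N dvd n" using primitive[of "n mod (2 * N)"] by (auto simp: dvd_eq_mod_eq_0)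
next
  assume "2 * N dvd n"
  then show "v ^ n = 1" using root by (auto simp: power_mult)
qed

lemma v_powi_1_iff: "v powi n = 1 \<longleftrightarrow> int (2 * N) dvd n"
proof (cases "n \<ge> 0")
  case True
  then obtain m where "n = int m" using nonneg_int_cases by blast
  then show ?thesis by (simp add: v_pow_1_iff del: of_nat_mult)
next
  case False
  then obtain m where m: "n = - int m" by (metis nonneg_int_cases add.inverse_inverse linorder_linear neg_0_le_iff_le)
  have "v powi n = 1 \<longleftrightarrow> v ^ m = 1"
    using v0 by (simp add: m power_int_minus)
  then show ?thesis by (simp add: m v_pow_1_iff del: of_nat_mult)
qed

lemma v_powi_eq_iff: "v powi m = v powi n \<longleftrightarrow> int (2 * N) dvd m - n"
proof -
  have "v powi m = v powi n \<longleftrightarrow> v powi (m - n) = 1"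
    using v0 by (simp add: power_int_diff)
  then show ?thesis by (simp only: v_powi_1_iff)
qed

lemma w2_v: "w ^ 2 * v powi j \<noteq> 1"
proof
  assume "w ^ 2 * v powi j = 1"
  then have "v powi j * w ^ 2 = 1" by (simp only: mult.commute)
  then have "w ^ 2 = v powi (- j)" unfolding power_int_minus by (rule inverse_unique[symmetric])
  then show False using nonint by blast
qed

text \<open>The square of \<open>w^2 v^j\<close> is 1 only if it equals 1 or -1, and -1 is a power of \<open>v\<close>.\<close>

lemma w4_v: "w ^ 4 * v powi (2 * j) \<noteq> 1"
proof
  assume "w ^ 4 * v powi (2 * j) = 1"
  then have "(w ^ 2 * v powi j) ^ 2 = 1"
    by (simp add: power_mult_distrib power_int_mult mult.commute[of 2] flip: power_mult power_int_power)
  then have "w ^ 2 * v powi j = 1 \<or> w ^ 2 * v powi j = - 1" by (simp add: power2_eq_1_iff)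
  moreover have "w ^ 2 * v powi j = - 1 \<Longrightarrow> w ^ 2 * v powi (j + int N) = 1"
    using v0 v_N by (simp add: power_int_add flip: mult.assoc)
  ultimately show False using w2_v by blast
qed

sublocale generic_params v w
proof
  fix n :: nat
  show "w ^ 2 * v ^ (2 * n) \<noteq> 1" using w2_v[of "int (2 * n)"] unfolding power_int_of_nat .
qed (use v0 w0 in auto)

lemma w2_ne: "w ^ 2 \<noteq> 1"
  using w2_v[of 0] by simp

lemma w4_ne: "w ^ 4 * v ^ (2 * n) \<noteq> 1"
  using w4_v[of "int n"] power_int_of_nat[of v "2 * n"] by simp

lemma lam_powi: "lam v w m = (if m > 0 then inverse w * v powi (- m) else w * v powi (- m))"
  unfolding lam_def by (auto simp: power_int_def power_inverse)

text \<open>An eigenvalue is \<open>w\<close> or \<open>1/w\<close>, according to the sign of the index, times a power of \<open>v\<close>, and \<open>w^2\<close>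
  is no power of \<open>v\<close>.\<close>

lemma lam_eq_iff: "lam v w m = lam v w n \<longleftrightarrow> (m > 0 \<longleftrightarrow> n > 0) \<and> int (2 * N) dvd m - n"
proof -
  have cross: "inverse w * v powi i \<noteq> w * v powi j" for i j
  proof
    assume a: "inverse w * v powi i = w * v powi j"
    have "w ^ 2 * v powi (j - i) = w * (w * v powi j) * inverse (v powi i)"
      using v0 by (simp add: power2_eq_square power_int_diff divide_inverse ac_simps)
    also have "\<dots> = 1" unfolding a[symmetric] using v0 w0 by (simp add: field_simps)
    finally show False using w2_v by blast
  qed
  have d: "int (2 * N) dvd - m - - n \<longleftrightarrow> int (2 * N) dvd m - n"
  proof -
    have "- m - - n = - (m - n)" by simp
    then show ?thesis by (simp only: dvd_minus_iff)
  qed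
  show ?thesis
    unfolding lam_powi using cross[of "- m" "- n"] cross[of "- n" "- m"] w0 d v_powi_eq_iff[of "- m" "- n"] by auto
qed

text \<open>Vectors of the same eigenvalue and lower rank are the only freedom for an eigenvector with given leading term.\<close>

lemma eigenvector_expand:
  assumes ev: "dunkl v w f = lconst c * f" and sup: "\<And>k. Poly_Mapping.lookup f k \<noteq> 0 \<Longrightarrow> lrank k < r"
  obtains a where "f = (\<Sum>j\<in>{j. lrank j < r \<and> lam v w j = c}. lconst (a j) * E v w j)"
proof -
  obtain a where a: "f = (\<Sum>j\<in>{j. lrank j < r}. lconst (a j) * E v w j)"
    using unitriangular_expand[OF unitriangular_E sup] by blast
  have "dunkl v w (\<Sum>j\<in>J. lconst (a j) * E v w j) = (\<Sum>j\<in>J. lconst (lam v w j * a j) * E v w j)" for J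
    by (induction J rule: infinite_finite_induct)
      (auto simp: dunkl_add dunkl_lconst_times dunkl_E lconst_mult ac_simps)
  then have "lconst c * f = (\<Sum>j\<in>{j. lrank j < r}. lconst (lam v w j * a j) * E v w j)"
    using ev a by metis
  then have "(\<Sum>j\<in>{j. lrank j < r}. lconst (lam v w j * a j) * E v w j)
    - (\<Sum>j\<in>{j. lrank j < r}. lconst (c * a j) * E v w j) = 0"
    using a by (simp add: sum_distrib_left lconst_mult mult.assoc)
  then have h: "(\<Sum>j\<in>{j. lrank j < r}. lconst ((lam v w j - c) * a j) * E v w j) = 0"
    by (simp add: left_diff_distrib lconst_diff flip: sum_subtractf)
  have "(lam v w j - c) * a j = 0" if "lrank j < r" for j
    using unitriangular_independent[OF unitriangular_E finite_rank_less h, of j] that by simp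
  then have z: "a j = 0" if "lrank j < r" "lam v w j \<noteq> c" for j using that by auto
  have "f = (\<Sum>j\<in>{j. lrank j < r \<and> lam v w j = c}. lconst (a j) * E v w j)"
    unfolding a by (rule sum.mono_neutral_right) (use finite_rank_less z in auto)
  then show ?thesis using that by blast
qed

subsection \<open>The form\<close>

abbreviation "L \<equiv> ct (weight v w)"

abbreviation "rad0 \<equiv> {f. \<forall>h. L (f * h) = 0}"

lemma mu0_value: "has_value v w (mu0 n) (weight v w n)"
  unfolding mu0_eq by (rule val.R_weight[OF has_value_qh has_value_th]) (rule generic_params_axioms)

lemma mu0_value_fun: "(\<lambda>n. rf_value (mu0 n) v w) = weight v w"
  using has_value_rf(2)[OF mu0_value] by auto

lemma e_value: "val.LR v w (e_poly m) (E v w m)"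
  unfolding e_poly_eq by (rule val.LR_E[OF has_value_qh has_value_th]) (rule generic_params_axioms)

lemma leval_nz: "leval (E v w m) (inverse w) \<noteq> 0"
  by (rule leval_E_nz) (use w2_ne w4_ne in auto)

lemma eps_value: "val.LR v w (eps_poly m) (eps v w m)"
  unfolding eps_poly_eq
  by (rule val.LR_eps[OF has_value_qh has_value_th _ leval_nz]) (rule generic_params_axioms)

lemma e_sp_eq: "e_sp v w m = E v w m"
  unfolding e_sp_def by (rule specialize_eq[OF e_value])

lemma eps_sp_eq: "eps_sp v w m = eps v w m"
  unfolding eps_sp_def by (rule specialize_eq[OF eps_value])

abbreviation "eps' \<equiv> eps (inverse v) (inverse w)"

lemma lbar_eps_poly: "lbar rf_bar (eps_poly m) = xrefl 1 (eps (inverse qh_var) (inverse th_var) m)"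
proof (rule lbar_rf_bar_eq)
  show "val.LR (inverse qh_var) (inverse th_var) (eps_poly m) (eps (inverse qh_var) (inverse th_var) m)"
    unfolding eps_poly_eq
    by (rule val.LR_eps[OF has_value_qh has_value_th var.generic_inverse])
      (rule leval_E_inverse_nz, rule var.generic_params_axioms, auto simp: var_powers)
qed

lemma eps'_value: "val.LR v w (eps (inverse qh_var) (inverse th_var) m) (eps' m)"
proof (rule val.LR_eps)
  show "has_value v w (inverse qh_var) (inverse v)" using v0 by (intro val.R_inverse has_value_qh)
  show "has_value v w (inverse th_var) (inverse w)" using w0 by (intro val.R_inverse has_value_th)
  show "leval (E' m) (inverse (inverse w)) \<noteq> 0"
    by (rule leval_E_inverse_nz, rule generic_params_axioms, use w2_ne w4_ne in auto)
qed (rule generic_inverse)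

lemma lbar_eps_value: "val.LR v w (lbar rf_bar (eps_poly m)) (xrefl 1 (eps' m))"
  unfolding lbar_eps_poly by (intro val.LR_xrefl val.R_1 eps'_value) simp

lemma admissible_eps: "admissible v w (eps_poly m)"
  unfolding admissible_def using lregular_LR[OF eps_value] lregular_LR[OF lbar_eps_value] by blast

lemma form0_eq: "form0 v w f (eps_poly n) = lform (weight v w) f (eps' n)"
  unfolding form0_def mu0_value_fun specialize_eq[OF lbar_eps_value] lform_def ..

lemma sph_norm_eq: "sph_norm v w m = mu1_inv (v ^ 2) (w ^ 2) m"
proof -
  have "(\<Prod>i=1..n. w ^ 2 * (1 - v ^ (2 * i)) / (1 - w ^ 4 * v ^ (2 * i)))
    = (w ^ 2) ^ n * (\<Prod>i=1..n. (1 - (v ^ 2) ^ i) / (1 - (w ^ 2) ^ 2 * (v ^ 2) ^ i))" for n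
    by (induction n) (simp_all add: power_mult[symmetric])
  moreover have "nat (if m > 0 then m - 1 else - m) = (if m > 0 then nat (m - 1) else nat (- m))" by simp
  ultimately show ?thesis by (simp add: sph_norm_def mu1_inv_def Let_def)
qed

text \<open>The number of factors is \<open>m - 1\<close> for positive \<open>m\<close> and \<open>- m\<close> otherwise; the \<open>N\<close>-th factor vanishes,
  and the preceding ones do not.\<close>

lemma sph_norm_eq_0_iff: "sph_norm v w m = 0 \<longleftrightarrow> lrank m \<ge> 2 * N"
proof -
  let ?n = "nat (if m > 0 then m - 1 else - m)"
  have "sph_norm v w m = 0 \<longleftrightarrow> (\<exists>i\<in>{1..?n}. v ^ (2 * i) = 1)"
    using w0 w4_ne by (auto simp: sph_norm_def)
  also have "\<dots> \<longleftrightarrow> N \<le> ?n"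
  proof
    assume "\<exists>i\<in>{1..?n}. v ^ (2 * i) = 1"
    then obtain i where "i \<ge> 1" "i \<le> ?n" "2 * N dvd 2 * i" by (auto simp: v_pow_1_iff)
    then have "N \<le> i" using dvd_imp_le[of N i] by simp
    then show "N \<le> ?n" using \<open>i \<le> ?n\<close> by simp
  next
    assume "N \<le> ?n"
    then show "\<exists>i\<in>{1..?n}. v ^ (2 * i) = 1" using N root by (intro bexI[of _ N]) auto
  qed
  also have "\<dots> \<longleftrightarrow> lrank m \<ge> 2 * N" using N by (auto simp: lrank_def)
  finally show ?thesis .
qed

text \<open>Off the diagonal, eigenvalues may coincide; the orthogonality is inherited from the generic parameters.\<close>

lemma lform_eps_special:
  "lform (weight v w) (eps v w m) (eps' n) = (if m = n then sph_norm v w m else 0)"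
proof -
  have A: "has_value v w (lform (weight qh_var th_var) (eps qh_var th_var m) (eps (inverse qh_var) (inverse th_var) n))
    (lform (weight v w) (eps v w m) (eps' n))"
    unfolding lform_def
    using mu0_value eps_value eps'_value
    by (intro val.R_ct val.LR_mult val.LR_xrefl val.R_1) (auto simp: mu0_eq eps_poly_eq)
  have eq: "lform (weight qh_var th_var) (eps qh_var th_var m) (eps (inverse qh_var) (inverse th_var) n)
    = (if m = n then sph_norm qh_var th_var m else 0)"
  proof (cases "m = n")
    case True
    then show ?thesis
      using lform_eps[OF var.generic_params_axioms var.weight_coeffs_weight two_ratfun] var_powers by simp
  next
    case False
    then show ?thesis
      using lform_var[of m n] by (simp add: eps_def lform_lconst_left lform_lconst_right)
  qed
  have B: "has_value v w (if m = n then sph_norm qh_var th_var m else 0) (if m = n then sph_norm v w m else 0)"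
  proof -
    have "has_value v w (sph_norm qh_var th_var m) (sph_norm v w m)"
      unfolding sph_norm_def using w4_ne
      by (intro val.R_prod val.R_divide val.R_mult val.R_diff val.R_power val.R_1 has_value_qh has_value_th) auto
    then show ?thesis by (auto intro: val.R_0)
  qed
  show ?thesis by (rule has_value_unique[OF A[unfolded eq] B])
qed

text \<open>The vectors \<open>eps' n\<close> span the space of all polynomials.\<close>

lemma lform_zero_imp:
  assumes "\<And>n. lform (weight v w) f (eps' n) = 0"
  shows "L (f * h) = 0"
proof -
  have "E' n \<in> {g. lform (weight v w) f g = 0}" for n
    using assms[of n] leval_E_inverse_nz[OF generic_params_axioms w2_ne w4_ne, of n]
    by (simp add: eps_def lform_lconst_right)
  then have "xrefl 1 h \<in> {g. lform (weight v w) f g = 0}"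
    using unitriangular_mem[OF unitriangular_E' lsubspace_lform] ex_rank_bound by metis
  then show ?thesis by (simp add: lform_def xrefl_xrefl)
qed

text \<open>All \<open>eps_poly n\<close> are admissible, and their conjugates specialize to a basis. In this form the radical is
  visibly an ideal.\<close>

lemma Rad0_eq: "Rad0 v w = rad0"
proof -
  have "L (f * h) = 0" if "f \<in> Rad0 v w" for f h
  proof (rule lform_zero_imp)
    fix n
    have "form0 v w f (eps_poly n) = 0" using that admissible_eps by (auto simp: Rad0_def)
    then show "lform (weight v w) f (eps' n) = 0" by (simp add: form0_eq)
  qed
  then show ?thesis by (auto simp: Rad0_def form0_def mu0_value_fun)
qed

lemma lbar_sigma_eps:
  assumes "const_bar v w \<sigma>"
  shows "lbar \<sigma> (eps v w m) = xrefl 1 (eps' m)"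
proof -
  interpret s: field_rel "\<lambda>x y. y = \<sigma> x" by (rule hom_field_rel[OF assms])
  have "s.LR (eps v w m) (eps' m)"
  proof (rule s.LR_eps)
    show "inverse v = \<sigma> v" "inverse w = \<sigma> w" using assms by (auto simp: const_bar_def)
    show "leval (E' m) (inverse (inverse w)) \<noteq> 0"
      by (rule leval_E_inverse_nz, rule generic_params_axioms, use w2_ne w4_ne in auto)
  qed (rule generic_inverse)
  moreover have "\<sigma> 0 = 0" using s.R_0 by simp
  ultimately show ?thesis
    by (intro poly_mapping_eqI) (simp add: lookup_lbar lookup_xrefl s.LR_def)
qed

lemma form0_bar_eq:
  assumes "const_bar v w \<sigma>"
  shows "form0_bar \<sigma> v w f (eps v w n) = lform (weight v w) f (eps' n)"
  by (simp add: form0_bar_def mu0_value_fun lbar_sigma_eps[OF assms] lform_def)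

lemma form0_bar_radical:
  assumes "const_bar v w \<sigma>"
  shows "{f. \<forall>g. form0_bar \<sigma> v w f g = 0} = rad0"
proof -
  have "L (f * h) = 0" if "\<forall>g. form0_bar \<sigma> v w f g = 0" for f h
    by (rule lform_zero_imp) (use that form0_bar_eq[OF assms] in metis)
  then show ?thesis by (auto simp: form0_bar_def mu0_value_fun)
qed

subsection \<open>The radical\<close>

lemma E_eq_eps: "E v w m = lconst (leval (E v w m) (inverse w)) * eps v w m"
  using leval_nz[of m] by (simp add: eps_def lconst_mult[symmetric] flip: mult.assoc)

lemma lsubspace_rad0: "lsubspace rad0"
  by (auto simp: lsubspace_def distrib_right ct_add mult.assoc ct_lconst_times)

lemma rad0_mult: "f \<in> rad0 \<Longrightarrow> f * g \<in> rad0"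
  by (simp add: mult.assoc)

lemma E_mem_rad0: "lrank m \<ge> 2 * N \<Longrightarrow> E v w m \<in> rad0"
proof -
  assume "lrank m \<ge> 2 * N"
  then have "lform (weight v w) (eps v w m) (eps' n) = 0" for n
    using sph_norm_eq_0_iff[of m] by (auto simp: lform_eps_special)
  then have "eps v w m \<in> rad0" using lform_zero_imp by blast
  then show ?thesis by (subst E_eq_eps) (simp add: mult.assoc ct_lconst_times)
qed

lemma rad0_low_rank:
  assumes "(\<Sum>j\<in>A. lconst (c j) * E v w j) \<in> rad0" "finite A" "i \<in> A" "lrank i < 2 * N"
  shows "c i = 0"
proof -
  have "lform (weight v w) (\<Sum>j\<in>A. lconst (c j) * E v w j) (eps' i) = 0"
    using assms(1) unfolding lform_def by blast
  then have "0 = (\<Sum>j\<in>A. c j * lform (weight v w) (E v w j) (eps' i))"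
    by (simp only: lform_lincomb_left)
  also have "\<dots> = (\<Sum>j\<in>A. if j = i then c i * (leval (E v w i) (inverse w) * sph_norm v w i) else 0)"
  proof (rule sum.cong)
    fix j
    have "lform (weight v w) (E v w j) (eps' i) = leval (E v w j) (inverse w) * (if j = i then sph_norm v w j else 0)"
      unfolding lform_eps_special[symmetric] lform_lconst_left[symmetric] E_eq_eps[symmetric] ..
    then show "c j * lform (weight v w) (E v w j) (eps' i)
      = (if j = i then c i * (leval (E v w i) (inverse w) * sph_norm v w i) else 0)" by simp
  qed simp
  also have "\<dots> = c i * (leval (E v w i) (inverse w) * sph_norm v w i)"
    using assms by simp
  finally show ?thesis using leval_nz[of i] sph_norm_eq_0_iff[of i] assms(4) by auto
qed

abbreviation "p0 \<equiv> lmon (int N) + lmon (- int N) :: complex laurent"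

abbreviation "zN \<equiv> lmon (2 * int N) + lmon (- (2 * int N)) :: complex laurent"

lemma v_powi_N: "v powi (int N) = - 1" "v powi (- int N) = - 1" "v powi (2 * int N) = 1" "v powi (- (2 * int N)) = 1"
proof -
  show 1: "v powi (int N) = - 1" using v_N by simp
  then show "v powi (- int N) = - 1" by (simp add: power_int_minus)
  show 2: "v powi (2 * int N) = 1" using root by (simp add: powi_even)
  show "v powi (- (2 * int N)) = 1" using root by (simp add: powi_even_neg)
qed

lemma xrefl_p0: "xrefl 1 p0 = p0" "xrefl v p0 = - p0"
  by (simp_all add: xrefl_add xrefl_lmon v_N power_int_minus lconst_uminus)

lemma xrefl_zN: "xrefl 1 zN = zN" "xrefl v zN = zN"
  by (simp_all add: xrefl_add xrefl_lmon v_powi_N)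

lemma p0_square: "p0 * p0 = zN + lconst 2"
proof -
  have "lconst 2 = (1 + 1 :: complex laurent)" using lconst_add[of 1 1] by simp
  then show ?thesis by (simp add: algebra_simps flip: lmon_add)
qed

lemma lookup_p0: "Poly_Mapping.lookup p0 k = (if k = int N \<or> k = - int N then 1 else 0)"
  using N by (auto simp: lookup_add lookup_lmon)

lemma lookup_zN: "Poly_Mapping.lookup zN k = (if k = 2 * int N \<or> k = - (2 * int N) then 1 else 0)"
  using N by (auto simp: lookup_add lookup_lmon)

lemma dunkl_1: "dunkl v w 1 = lconst w"
  by (simp add: dunkl_def dl_1)

lemma low_rank_difference:
  assumes "Poly_Mapping.lookup f m = 1" "\<And>k. Poly_Mapping.lookup f k \<noteq> 0 \<Longrightarrow> lrank k \<le> lrank m"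
    and "Poly_Mapping.lookup (E v w m - f) k \<noteq> 0"
  shows "lrank k < lrank m"
proof -
  have "Poly_Mapping.lookup (E v w m) k \<noteq> 0 \<or> Poly_Mapping.lookup f k \<noteq> 0"
    using assms(3) by (auto simp: lookup_minus)
  then have "lrank k \<le> lrank m"
    using assms(2) unitriangular_E unfolding unitriangular_def by blast
  moreover have "k \<noteq> m" using assms(1,3) unitriangular_E by (auto simp: unitriangular_def lookup_minus)
  ultimately show ?thesis using rank_inj[of k m] by linarith
qed

text \<open>The element \<open>p = X^N + X^(-N)\<close> is fixed by \<open>s\<close> and negated by \<open>\<pi>\<close>, hence \<open>Y p = - w p\<close>. No lower
  index has this eigenvalue.\<close>

lemma E_neg_N: "E v w (- int N) = p0"
proof -
  let ?d = "E v w (- int N) - p0"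
  have "dunkl v w p0 = lconst (- w) * p0"
    using dunkl_invariant_times[OF xrefl_p0(1) v0, of w 1]
    unfolding xrefl_p0 dunkl_1 mult_1_right
    by (simp only: lconst_uminus mult_minus_left mult.commute[of p0])
  moreover have "lam v w (- int N) = - w" by (simp add: lam_def v_N)
  ultimately have ev: "dunkl v w ?d = lconst (lam v w (- int N)) * ?d"
    by (simp add: dunkl_diff dunkl_E right_diff_distrib)
  have sup: "lrank k < lrank (- int N)" if "Poly_Mapping.lookup ?d k \<noteq> 0" for k
    by (rule low_rank_difference[OF _ _ that]) (auto simp: lookup_p0 lrank_def split: if_splits)
  obtain a where a: "?d = (\<Sum>j\<in>{j. lrank j < lrank (- int N) \<and> lam v w j = lam v w (- int N)}. lconst (a j) * E v w j)"
    using eigenvector_expand[OF ev sup] by blast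
  \<comment> \<open>By \<open>lam_eq_iff\<close>, such an index would be nonpositive and congruent to \<open>-N\<close> modulo \<open>2 N\<close>.\<close>
  have none: "{j. lrank j < lrank (- int N) \<and> lam v w j = lam v w (- int N)} = {}"
  proof -
    have False if "lrank j < lrank (- int N)" "\<not> j > 0" "int (2 * N) dvd j + int N" for j
    proof -
      have "j + int N > 0" "j + int N < int (2 * N)" using that N by (auto simp: lrank_def)
      then show False using that(3) zdvd_not_zless by blast
    qed
    then show ?thesis using N by (auto simp: lam_eq_iff)
  qed
  have "?d = 0" using a unfolding none by (simp only: sum.empty)
  then show ?thesis by simp
qed

text \<open>Again \<open>z = X^(2 N) + X^(-2 N)\<close> is an eigenvector, but its eigenvalue \<open>w\<close> is also that of 1, which leaves
  an unknown constant. It is found from the radical, which contains \<open>e_(-2 N)\<close> and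
  \<open>(X^N + X^(-N))^2 = z + 2\<close> but no constants except 0.\<close>

lemma E_neg_2N: "E v w (- (2 * int N)) = zN + lconst 2"
proof -
  let ?d = "E v w (- (2 * int N)) - zN"
  have l: "lam v w (- (2 * int N)) = w" using root by (simp add: lam_def nat_mult_distrib)
  have "dunkl v w zN = lconst w * zN"
    using dunkl_invariant_times[OF xrefl_zN(1) v0, of w 1]
    unfolding xrefl_zN dunkl_1 mult_1_right by (simp only: mult.commute[of zN])
  then have ev: "dunkl v w ?d = lconst w * ?d"
    by (simp add: dunkl_diff dunkl_E l right_diff_distrib)
  have sup: "lrank k < lrank (- (2 * int N))" if "Poly_Mapping.lookup ?d k \<noteq> 0" for k
    by (rule low_rank_difference[OF _ _ that]) (auto simp: lookup_zN lrank_def split: if_splits)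
  \<comment> \<open>The only lower index with the eigenvalue \<open>w\<close> is 0.\<close>
  obtain a where a: "?d = (\<Sum>j\<in>{j. lrank j < lrank (- (2 * int N)) \<and> lam v w j = w}. lconst (a j) * E v w j)"
    using eigenvector_expand[OF ev sup] by blast
  have "{j. lrank j < lrank (- (2 * int N)) \<and> lam v w j = w} = {0}"
  proof -
    have w: "w = lam v w 0" by (simp add: lam_def)
    have "j = 0" if "lrank j < lrank (- (2 * int N))" "\<not> j > 0" "int (2 * N) dvd j" for j
    proof -
      have "- j < int (2 * N)" "int (2 * N) dvd - j" using that by (auto simp: lrank_def)
      then show "j = 0" using that(2) zdvd_not_zless[of "- j" "int (2 * N)"] by fastforce
    qed
    then show ?thesis using N by (subst w) (auto simp: lam_eq_iff lrank_def)
  qed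
  then have "?d = lconst (a 0)" using a by (simp add: E_def)
  then have e: "E v w (- (2 * int N)) = zN + lconst (a 0)" by (simp add: algebra_simps)
  have "E v w (- (2 * int N)) \<in> rad0" by (rule E_mem_rad0) (simp add: lrank_def)
  moreover have "p0 \<in> rad0" using E_mem_rad0[of "- int N"] by (simp add: E_neg_N lrank_def)
  then have "zN + lconst 2 \<in> rad0" using rad0_mult[of p0 p0] by (simp only: p0_square)
  ultimately have "E v w (- (2 * int N)) - (zN + lconst 2) \<in> rad0" by (rule lsubspace_diff[OF lsubspace_rad0])
  then have "lconst (a 0 - 2) \<in> rad0" by (simp add: e lconst_diff)
  then have "L (lconst (a 0 - 2) * 1) = 0" by blast
  then have "a 0 = 2" using ct_single[of "weight v w" "a 0 - 2" 0] by simp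
  then show ?thesis using e by simp
qed

end

section \<open>Modules presented by Laurent polynomials\<close>

lemma CC_simps [simp]: "carrier CC = UNIV" "\<zero>\<^bsub>CC\<^esub> = 0" "\<one>\<^bsub>CC\<^esub> = 1" "x \<oplus>\<^bsub>CC\<^esub> y = x + y" "x \<otimes>\<^bsub>CC\<^esub> y = x * y"
  by (simp_all add: CC_def)

lemma field_CC: "field CC"
proof (rule cring.cring_fieldI2)
  show "cring CC"
  proof (rule cringI)
    show "abelian_group CC"
    proof (rule abelian_groupI)
      show "\<exists>y\<in>carrier CC. y \<oplus>\<^bsub>CC\<^esub> x = \<zero>\<^bsub>CC\<^esub>" for x
        by (rule bexI[of _ "- x"]) auto
    qed auto
    show "comm_monoid CC" by (rule comm_monoidI) auto
  qed (auto simp: algebra_simps)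
  show "\<exists>b\<in>carrier CC. a \<otimes>\<^bsub>CC\<^esub> b = \<one>\<^bsub>CC\<^esub>" if "a \<noteq> \<zero>\<^bsub>CC\<^esub>" for a
    using that by (intro bexI[of _ "inverse a"]) auto
qed auto

lemma lsubspace_0: "lsubspace U \<Longrightarrow> 0 \<in> U"
  and lsubspace_add: "lsubspace U \<Longrightarrow> f \<in> U \<Longrightarrow> g \<in> U \<Longrightarrow> f + g \<in> U"
  and lsubspace_smult: "lsubspace U \<Longrightarrow> f \<in> U \<Longrightarrow> lconst c * f \<in> U"
  by (auto simp: lsubspace_def)

lemma lsubspace_UNIV: "lsubspace UNIV"
  by (simp add: lsubspace_def)

definition linear_op :: "(complex laurent \<Rightarrow> complex laurent) \<Rightarrow> bool" where
  "linear_op x \<longleftrightarrow> (\<forall>f g. x (f + g) = x f + x g) \<and> (\<forall>c f. x (lconst c * f) = lconst c * x f)"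

lemma linear_op_0: "linear_op x \<Longrightarrow> x 0 = 0"
  unfolding linear_op_def by (metis lconst_0 mult_zero_left)

lemma linear_op_diff: "linear_op x \<Longrightarrow> x (f - g) = x f - x g"
  unfolding linear_op_def by (metis add_diff_cancel_right' diff_add_cancel)

lemma linear_op_lincomb: "linear_op x \<Longrightarrow> x (\<Sum>i\<in>A. lconst (c i) * f i) = (\<Sum>i\<in>A. lconst (c i) * x (f i))"
  by (induction A rule: infinite_finite_induct) (auto simp: linear_op_0, auto simp: linear_op_def)

text \<open>All modules in question are images of spaces of Laurent polynomials under linear maps. Representing their
  elements in this way reduces computations in the records to computations with polynomials.\<close>

locale presentation =
  fixes M :: "'v hh_module" and U :: "complex laurent set" and \<phi> :: "complex laurent \<Rightarrow> 'v"
  assumes U: "lsubspace U" and carr: "carrier M = \<phi> ` U" and zero: "\<zero>\<^bsub>M\<^esub> = \<phi> 0"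
    and add: "\<And>f g. f \<in> U \<Longrightarrow> g \<in> U \<Longrightarrow> \<phi> f \<oplus>\<^bsub>M\<^esub> \<phi> g = \<phi> (f + g)"
    and smult: "\<And>c f. f \<in> U \<Longrightarrow> c \<odot>\<^bsub>M\<^esub> \<phi> f = \<phi> (lconst c * f)"
begin

lemma vs: "vectorspace CC M"
proof (rule vs_criteria[OF field_CC])
  note * = lsubspace_0[OF U] lsubspace_add[OF U] lsubspace_smult[OF U]
  show "\<zero>\<^bsub>M\<^esub> \<in> carrier M" using * by (auto simp: carr zero)
  show "\<forall>v w. v \<in> carrier M \<and> w \<in> carrier M \<longrightarrow> v \<oplus>\<^bsub>M\<^esub> w \<in> carrier M"
    using * by (auto simp: carr add)
  show "\<forall>v\<in>carrier M. \<exists>neg_v\<in>carrier M. v \<oplus>\<^bsub>M\<^esub> neg_v = \<zero>\<^bsub>M\<^esub>"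
    using lsubspace_uminus[OF U] by (auto simp: carr zero add intro!: bexI[of _ "- _"])
  show "\<forall>c v. c \<in> carrier CC \<and> v \<in> carrier M \<longrightarrow> c \<odot>\<^bsub>M\<^esub> v \<in> carrier M"
    using * by (auto simp: carr smult)
  show "\<forall>v w. v \<in> carrier M \<and> w \<in> carrier M \<longrightarrow> v \<oplus>\<^bsub>M\<^esub> w = w \<oplus>\<^bsub>M\<^esub> v"
    by (auto simp: carr add add.commute)
  show "\<forall>v w x. v \<in> carrier M \<and> w \<in> carrier M \<and> x \<in> carrier M \<longrightarrow> v \<oplus>\<^bsub>M\<^esub> w \<oplus>\<^bsub>M\<^esub> x = v \<oplus>\<^bsub>M\<^esub> (w \<oplus>\<^bsub>M\<^esub> x)"
    using * by (auto simp: carr add add.assoc)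
  show "\<forall>v\<in>carrier M. v \<oplus>\<^bsub>M\<^esub> \<zero>\<^bsub>M\<^esub> = v"
    using * by (auto simp: carr add zero)
  show "\<forall>a b v. a \<in> carrier CC \<and> b \<in> carrier CC \<and> v \<in> carrier M \<longrightarrow> (a \<otimes>\<^bsub>CC\<^esub> b) \<odot>\<^bsub>M\<^esub> v = a \<odot>\<^bsub>M\<^esub> (b \<odot>\<^bsub>M\<^esub> v)"
    using * by (auto simp: carr smult lconst_mult mult.assoc)
  show "\<forall>v\<in>carrier M. \<one>\<^bsub>CC\<^esub> \<odot>\<^bsub>M\<^esub> v = v"
    by (auto simp: carr smult)
  show "\<forall>a b v. a \<in> carrier CC \<and> b \<in> carrier CC \<and> v \<in> carrier M \<longrightarrow> (a \<oplus>\<^bsub>CC\<^esub> b) \<odot>\<^bsub>M\<^esub> v = a \<odot>\<^bsub>M\<^esub> v \<oplus>\<^bsub>M\<^esub> b \<odot>\<^bsub>M\<^esub> v"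
    using * by (auto simp: carr smult add lconst_add distrib_right)
  show "\<forall>a v w. a \<in> carrier CC \<and> v \<in> carrier M \<and> w \<in> carrier M \<longrightarrow> a \<odot>\<^bsub>M\<^esub> (v \<oplus>\<^bsub>M\<^esub> w) = a \<odot>\<^bsub>M\<^esub> v \<oplus>\<^bsub>M\<^esub> a \<odot>\<^bsub>M\<^esub> w"
    using * by (auto simp: carr smult add distrib_left)
qed

lemma eq_iff:
  assumes "f \<in> U" "g \<in> U"
  shows "\<phi> f = \<phi> g \<longleftrightarrow> \<phi> (f - g) = \<phi> 0"
proof
  have m: "- g \<in> U" "f - g \<in> U" using lsubspace_uminus[OF U] lsubspace_diff[OF U] assms by auto
  { assume "\<phi> f = \<phi> g"
    then have "\<phi> f \<oplus>\<^bsub>M\<^esub> \<phi> (- g) = \<phi> g \<oplus>\<^bsub>M\<^esub> \<phi> (- g)" by simp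
    then show "\<phi> (f - g) = \<phi> 0" using add m assms by simp }
  { assume "\<phi> (f - g) = \<phi> 0"
    then have "\<phi> (f - g) \<oplus>\<^bsub>M\<^esub> \<phi> g = \<phi> 0 \<oplus>\<^bsub>M\<^esub> \<phi> g" by simp
    then show "\<phi> f = \<phi> g" using add m assms lsubspace_0[OF U] by simp }
qed

lemma finsum_eq:
  assumes "finite A" "\<And>i. i \<in> A \<Longrightarrow> f i \<in> U"
  shows "(\<Oplus>\<^bsub>M\<^esub>i\<in>A. \<phi> (f i)) = \<phi> (\<Sum>i\<in>A. f i)"
proof -
  interpret vectorspace CC M by (rule vs)
  show ?thesis
    using assms
  proof (induction A rule: finite_induct)
    case empty
    show ?case by (simp add: zero)
  next
    case (insert x A)
    have "(\<Oplus>\<^bsub>M\<^esub>i\<in>insert x A. \<phi> (f i)) = \<phi> (f x) \<oplus>\<^bsub>M\<^esub> (\<Oplus>\<^bsub>M\<^esub>i\<in>A. \<phi> (f i))"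
      using insert by (intro finsum_insert) (auto simp: carr)
    then show ?case using insert lsubspace_sum[OF U, of A f] by (simp add: add)
  qed
qed

lemma lincomb_eq:
  assumes "finite A" "\<And>i. i \<in> A \<Longrightarrow> f i \<in> U" "inj_on (\<lambda>i. \<phi> (f i)) A"
  shows "module.lincomb M a ((\<lambda>i. \<phi> (f i)) ` A) = \<phi> (\<Sum>i\<in>A. lconst (a (\<phi> (f i))) * f i)"
proof -
  interpret vectorspace CC M by (rule vs)
  have "lincomb a ((\<lambda>i. \<phi> (f i)) ` A) = (\<Oplus>\<^bsub>M\<^esub>i\<in>A. a (\<phi> (f i)) \<odot>\<^bsub>M\<^esub> \<phi> (f i))"
    unfolding lincomb_def using assms
    by (intro finsum_reindex) (auto simp: carr smult lsubspace_smult[OF U])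
  also have "\<dots> = (\<Oplus>\<^bsub>M\<^esub>i\<in>A. \<phi> (lconst (a (\<phi> (f i))) * f i))"
    using assms lsubspace_smult[OF U] by (intro finsum_cong') (auto simp: smult carr)
  also have "\<dots> = \<phi> (\<Sum>i\<in>A. lconst (a (\<phi> (f i))) * f i)"
    using assms lsubspace_smult[OF U] by (intro finsum_eq) auto
  finally show ?thesis .
qed

text \<open>Families rather than sets, so that distinctness of the vectors is part of the independence.\<close>

lemma family_basisI:
  assumes f: "\<And>i. i \<in> I \<Longrightarrow> f i \<in> U"
    and indep: "\<And>A c. finite A \<Longrightarrow> A \<subseteq> I \<Longrightarrow> \<phi> (\<Sum>i\<in>A. lconst (c i) * f i) = \<phi> 0 \<Longrightarrow> \<forall>i\<in>A. c i = 0"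
    and span: "\<And>g. g \<in> U \<Longrightarrow> \<exists>A c. finite A \<and> A \<subseteq> I \<and> \<phi> g = \<phi> (\<Sum>i\<in>A. lconst (c i) * f i)"
  shows "family_basis M (\<lambda>i. \<phi> (f i)) I"
proof -
  interpret vectorspace CC M by (rule vs)
  let ?b = "\<lambda>i. \<phi> (f i)"
  have inj: "inj_on ?b I"
  proof (rule inj_onI, rule ccontr)
    fix i j assume *: "i \<in> I" "j \<in> I" "\<phi> (f i) = \<phi> (f j)" "i \<noteq> j"
    then have "\<phi> (f i - f j) = \<phi> 0" using eq_iff f by blast
    moreover have "(\<Sum>k\<in>{i, j}. lconst (if k = i then 1 else - 1) * f k) = f i - f j"
      using *(4) by (simp add: lconst_uminus)
    ultimately have "\<forall>k\<in>{i, j}. (if k = i then 1 else - 1) = (0::complex)"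
      using * by (intro indep) auto
    then show False by simp
  qed
  have sub: "?b ` I \<subseteq> carrier M" using f by (auto simp: carr)
  have "lin_indpt (?b ` I)"
  proof
    assume "lin_dep (?b ` I)"
    then obtain A a v where A: "finite A" "A \<subseteq> ?b ` I" "lincomb a A = \<zero>\<^bsub>M\<^esub>" "v \<in> A" "a v \<noteq> 0"
      unfolding lin_dep_def by auto
    define B where "B = {i\<in>I. ?b i \<in> A}"
    have AB: "A = ?b ` B" using A(2) by (auto simp: B_def)
    have B: "B \<subseteq> I" "inj_on ?b B" using inj by (auto simp: B_def inj_on_def)
    have "finite B" using A(1) B(2) unfolding AB by (rule finite_imageD)
    have "lincomb a (?b ` B) = \<phi> (\<Sum>i\<in>B. lconst (a (?b i)) * f i)"
      by (rule lincomb_eq[OF \<open>finite B\<close> _ B(2)]) (rule f, use B(1) in blast)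
    then have "\<phi> (\<Sum>i\<in>B. lconst (a (?b i)) * f i) = \<phi> 0"
      using A(3) unfolding AB[symmetric] zero by simp
    then have "\<forall>i\<in>B. a (?b i) = 0" by (rule indep[OF \<open>finite B\<close> B(1)])
    then show False using A(4,5) AB by auto
  qed
  moreover have "span (?b ` I) = carrier M"
  proof
    show "span (?b ` I) \<subseteq> carrier M" using sub by (rule span_is_subset2)
    show "carrier M \<subseteq> span (?b ` I)"
    proof
      fix x assume "x \<in> carrier M"
      then obtain g where g: "g \<in> U" "x = \<phi> g" by (auto simp: carr)
      obtain A c where A: "finite A" "A \<subseteq> I" "\<phi> g = \<phi> (\<Sum>i\<in>A. lconst (c i) * f i)"
        using span[OF g(1)] by blast
      define a where "a y = c (the_inv_into I ?b y)" for y
      have "a (?b i) = c i" if "i \<in> A" for i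
        using the_inv_into_f_f[OF inj] that A(2) by (auto simp: a_def)
      have "lincomb a (?b ` A) = \<phi> (\<Sum>i\<in>A. lconst (a (?b i)) * f i)"
        by (rule lincomb_eq[OF A(1) _ inj_on_subset[OF inj A(2)]]) (rule f, use A(2) in blast)
      also have "(\<Sum>i\<in>A. lconst (a (?b i)) * f i) = (\<Sum>i\<in>A. lconst (c i) * f i)"
        by (rule sum.cong) (simp_all add: \<open>\<And>i. i \<in> A \<Longrightarrow> a (?b i) = c i\<close>)
      finally have "x = lincomb a (?b ` A)" using A(3) g(2) by simp
      then show "x \<in> span (?b ` I)"
        unfolding span_def using A by (auto intro!: exI[of _ a] exI[of _ "?b ` A"])
    qed
  qed
  ultimately have "basis (?b ` I)" using sub by (simp add: basis_def)
  then show ?thesis using inj by (simp add: family_basis_def)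
qed

lemma has_dim_family:
  assumes "family_basis M b I" "finite I"
  shows "has_dim M (card I)"
proof -
  interpret vectorspace CC M by (rule vs)
  have b: "inj_on b I" "basis (b ` I)" using assms by (auto simp: family_basis_def)
  have "fin_dim"
    unfolding fin_dim_def using b(2) assms(2) by (intro exI[of _ "b ` I"]) (auto simp: basis_def)
  moreover have "dim = card (b ` I)" by (rule dim_basis[OF finite_imageI[OF assms(2)] b(2)])
  ultimately show ?thesis using b by (simp add: has_dim_def card_image)
qed

lemma submodule_image:
  assumes W: "lsubspace W" "W \<subseteq> U"
  shows "LinearCombinations.submodule CC (\<phi> ` W) M"
proof (rule LinearCombinations.submodule.intro)
  show "Module.module CC M" using vs by (simp add: vectorspace_def)
  show "\<phi> ` W \<subseteq> carrier M" using W by (auto simp: carr)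
  show "\<zero>\<^bsub>M\<^esub> \<in> \<phi> ` W" using lsubspace_0[OF W(1)] by (auto simp: zero)
  show "a \<oplus>\<^bsub>M\<^esub> b \<in> \<phi> ` W" if ab: "a \<in> \<phi> ` W" "b \<in> \<phi> ` W" for a b
  proof -
    obtain f g where "f \<in> W" "g \<in> W" "a = \<phi> f" "b = \<phi> g" using ab by auto
    then show ?thesis using W lsubspace_add[OF W(1)] by (auto simp: add subset_iff)
  qed
  show "c \<odot>\<^bsub>M\<^esub> a \<in> \<phi> ` W" if a: "a \<in> \<phi> ` W" for c a
  proof -
    obtain f where "f \<in> W" "a = \<phi> f" using a by auto
    then show ?thesis using W lsubspace_smult[OF W(1)] by (auto simp: smult subset_iff)
  qed
qed

lemma sub_presentation:
  assumes "lsubspace W" "W \<subseteq> U" "S = \<phi> ` W"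
  shows "presentation (M\<lparr>carrier := S\<rparr>) W \<phi>"
  by standard (use assms add smult zero in \<open>auto simp: subset_iff\<close>)

end

subsection \<open>Operators with an eigenbasis\<close>

text \<open>An operator that is diagonal, with distinct eigenvalues, in a finite basis; its spectrum, semisimplicity and
  simplicity of weights then follow at once.\<close>

locale eigenbasis = presentation M U \<phi> for M :: "'v hh_module" and U \<phi> +
  fixes F :: "'v \<Rightarrow> 'v" and I :: "'i set" and f :: "'i \<Rightarrow> complex laurent" and c :: "'i \<Rightarrow> complex"
  assumes fin: "finite I" and fU: "\<And>i. i \<in> I \<Longrightarrow> f i \<in> U"
    and indep: "\<And>a. \<phi> (\<Sum>i\<in>I. lconst (a i) * f i) = \<phi> 0 \<Longrightarrow> \<forall>i\<in>I. a i = 0"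
    and span: "\<And>g. g \<in> U \<Longrightarrow> \<exists>a. \<phi> g = \<phi> (\<Sum>i\<in>I. lconst (a i) * f i)"
    and F: "\<And>a. F (\<phi> (\<Sum>i\<in>I. lconst (a i) * f i)) = \<phi> (\<Sum>i\<in>I. lconst (c i * a i) * f i)"
    and inj: "inj_on c I"
begin

lemma sum_mem: "(\<Sum>i\<in>I. lconst (a i) * f i) \<in> U"
  by (intro lsubspace_sum[OF U] lsubspace_smult[OF U] fU)

lemma family_basis: "family_basis M (\<lambda>i. \<phi> (f i)) I"
proof (rule family_basisI)
  fix A a assume A: "finite A" "A \<subseteq> I" "\<phi> (\<Sum>i\<in>A. lconst (a i) * f i) = \<phi> 0"
  have "(\<Sum>i\<in>A. lconst (a i) * f i) = (\<Sum>i\<in>I. lconst (if i \<in> A then a i else 0) * f i)"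
    using A(2) fin by (intro sum.mono_neutral_cong_left) auto
  then have z: "\<forall>i\<in>I. (if i \<in> A then a i else 0) = 0"
    using A(3) by (intro indep) (simp only:)
  show "\<forall>i\<in>A. a i = 0"
  proof
    fix i assume i: "i \<in> A"
    then have "(if i \<in> A then a i else 0) = 0" using z A(2) by blast
    then show "a i = 0" using i by simp
  qed
next
  fix g assume "g \<in> U"
  then show "\<exists>A a. finite A \<and> A \<subseteq> I \<and> \<phi> g = \<phi> (\<Sum>i\<in>A. lconst (a i) * f i)"
    using span fin by blast
qed (rule fU)

lemma single_sum: "i \<in> I \<Longrightarrow> (\<Sum>j\<in>I. lconst (if j = i then b else 0) * f j) = lconst b * f i"
proof -
  assume i: "i \<in> I"
  have "(\<Sum>j\<in>I. lconst (if j = i then b else 0) * f j) = (\<Sum>j\<in>I. if j = i then lconst b * f i else 0)"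
    by (rule sum.cong) auto
  then show ?thesis by (simp only: sum.delta[OF fin] i if_True)
qed

lemma eigen_iff: "F (\<phi> (\<Sum>i\<in>I. lconst (a i) * f i)) = e \<odot>\<^bsub>M\<^esub> \<phi> (\<Sum>i\<in>I. lconst (a i) * f i)
    \<longleftrightarrow> (\<forall>i\<in>I. c i = e \<or> a i = 0)"
proof -
  have s: "e \<odot>\<^bsub>M\<^esub> \<phi> (\<Sum>i\<in>I. lconst (a i) * f i) = \<phi> (\<Sum>i\<in>I. lconst (e * a i) * f i)"
    by (simp add: smult[OF sum_mem] sum_distrib_left lconst_mult mult.assoc)
  have d: "(\<Sum>i\<in>I. lconst (c i * a i) * f i) - (\<Sum>i\<in>I. lconst (e * a i) * f i) = (\<Sum>i\<in>I. lconst ((c i - e) * a i) * f i)"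
    by (simp add: left_diff_distrib lconst_diff flip: sum_subtractf)
  have "F (\<phi> (\<Sum>i\<in>I. lconst (a i) * f i)) = e \<odot>\<^bsub>M\<^esub> \<phi> (\<Sum>i\<in>I. lconst (a i) * f i)
    \<longleftrightarrow> \<phi> (\<Sum>i\<in>I. lconst ((c i - e) * a i) * f i) = \<phi> 0"
    unfolding F s eq_iff[OF sum_mem sum_mem] d ..
  also have "\<dots> \<longleftrightarrow> (\<forall>i\<in>I. (c i - e) * a i = 0)"
  proof
    assume "\<forall>i\<in>I. (c i - e) * a i = 0"
    then have "(\<Sum>i\<in>I. lconst ((c i - e) * a i) * f i) = 0" by (intro sum.neutral) auto
    then show "\<phi> (\<Sum>i\<in>I. lconst ((c i - e) * a i) * f i) = \<phi> 0" by simp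
  qed (rule indep)
  also have "\<dots> \<longleftrightarrow> (\<forall>i\<in>I. c i = e \<or> a i = 0)" by auto
  finally show ?thesis .
qed

lemma eigenspace_member:
  assumes "i \<in> I"
  shows "eigenspace M F (c i) = \<phi> ` {lconst b * f i | b. True}"
proof (intro equalityI subsetI)
  fix x assume "x \<in> eigenspace M F (c i)"
  then have x: "x \<in> carrier M" "F x = c i \<odot>\<^bsub>M\<^esub> x" by (auto simp: eigenspace_def)
  then obtain a where a: "x = \<phi> (\<Sum>i\<in>I. lconst (a i) * f i)" using span by (auto simp: carr)
  then have "\<forall>j\<in>I. c j = c i \<or> a j = 0" using x(2) eigen_iff by simp
  then have eq: "a j = (if j = i then a i else 0)" if "j \<in> I" for j
    using inj assms that by (auto simp: inj_on_def)
  have "(\<Sum>j\<in>I. lconst (a j) * f j) = (\<Sum>j\<in>I. lconst (if j = i then a i else 0) * f j)"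
    using eq by (intro sum.cong refl arg_cong[where f = "\<lambda>c. lconst c * f _"])
  then have "(\<Sum>j\<in>I. lconst (a j) * f j) = lconst (a i) * f i"
    by (simp only: single_sum[OF assms])
  then show "x \<in> \<phi> ` {lconst b * f i | b. True}" using a by auto
next
  fix x assume "x \<in> \<phi> ` {lconst b * f i | b. True}"
  then obtain b where b: "x = \<phi> (lconst b * f i)" by auto
  then have "x = \<phi> (\<Sum>j\<in>I. lconst (if j = i then b else 0) * f j)" using single_sum[OF assms] by simp
  then show "x \<in> eigenspace M F (c i)"
    using eigen_iff[of "\<lambda>j. if j = i then b else 0" "c i"] sum_mem[of "\<lambda>j. if j = i then b else 0"]
    by (auto simp: eigenspace_def carr)
qed

lemma basis_nz: "i \<in> I \<Longrightarrow> \<phi> (lconst b * f i) = \<phi> 0 \<Longrightarrow> b = 0"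
  using indep[of "\<lambda>j. if j = i then b else 0"] by (auto simp: single_sum)

lemma spectrum_eq: "spectrum M F = c ` I"
proof (intro equalityI subsetI)
  fix e assume "e \<in> spectrum M F"
  then have "eigenspace M F e \<noteq> {\<zero>\<^bsub>M\<^esub>}" by (simp add: spectrum_def)
  moreover have "\<zero>\<^bsub>M\<^esub> \<in> eigenspace M F e"
    using eigen_iff[of "\<lambda>_. 0" e] lsubspace_0[OF U] by (auto simp: eigenspace_def carr zero)
  ultimately obtain x where x: "x \<in> eigenspace M F e" "x \<noteq> \<phi> 0" using zero by auto
  then obtain a where a: "x = \<phi> (\<Sum>i\<in>I. lconst (a i) * f i)" using span by (auto simp: carr eigenspace_def)
  then have "\<forall>i\<in>I. c i = e \<or> a i = 0" using x(1) eigen_iff by (simp add: eigenspace_def)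
  moreover have "\<exists>i\<in>I. a i \<noteq> 0"
  proof (rule ccontr)
    assume "\<not> ?thesis"
    then have "(\<Sum>i\<in>I. lconst (a i) * f i) = 0" by (intro sum.neutral) simp
    then show False using x(2) a by simp
  qed
  ultimately show "e \<in> c ` I" by force
next
  fix e assume "e \<in> c ` I"
  then obtain i where i: "i \<in> I" "e = c i" by auto
  have "\<phi> (lconst 1 * f i) \<in> eigenspace M F e" unfolding i(2) eigenspace_member[OF i(1)] by blast
  moreover have "\<phi> (lconst 1 * f i) \<noteq> \<zero>\<^bsub>M\<^esub>" using basis_nz[OF i(1), of 1] zero by auto
  ultimately show "e \<in> spectrum M F" by (auto simp: spectrum_def)
qed

lemma simple_weights: "simple_weights M F"
  unfolding simple_weights_def spectrum_eq
proof safe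
  fix i assume i: "i \<in> I"
  let ?W = "{lconst b * f i | b. True}"
  have W: "lsubspace ?W"
    unfolding lsubspace_def
  proof (intro conjI ballI allI)
    show "0 \<in> ?W" by (intro CollectI exI[of _ 0]) simp
    show "g + h \<in> ?W" if "g \<in> ?W" "h \<in> ?W" for g h
      using that by (auto simp: distrib_right[symmetric] lconst_add[symmetric])
    show "lconst d * g \<in> ?W" if "g \<in> ?W" for d g
      using that by (auto simp: lconst_mult[symmetric] simp flip: mult.assoc)
  qed
  interpret e: presentation "M\<lparr>carrier := eigenspace M F (c i)\<rparr>" ?W \<phi>
    by (rule sub_presentation[OF W]) (use fU[OF i] lsubspace_smult[OF U] eigenspace_member[OF i] in auto)
  have "family_basis (M\<lparr>carrier := eigenspace M F (c i)\<rparr>) (\<lambda>j. \<phi> (f j)) {i}"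
  proof (rule e.family_basisI)
    show "f j \<in> ?W" if "j \<in> {i}" for j using that by (auto intro!: exI[of _ 1])
    fix A a assume A: "finite A" "A \<subseteq> {i}" "\<phi> (\<Sum>j\<in>A. lconst (a j) * f j) = \<phi> 0"
    then show "\<forall>j\<in>A. a j = 0" using basis_nz[OF i] by (auto simp: subset_singleton_iff)
  next
    fix g assume "g \<in> ?W"
    then obtain b where "g = lconst b * f i" by auto
    then show "\<exists>A a. finite A \<and> A \<subseteq> {i} \<and> \<phi> g = \<phi> (\<Sum>j\<in>A. lconst (a j) * f j)"
      by (intro exI[of _ "{i}"] exI[of _ "\<lambda>_. b"]) simp
  qed
  from e.has_dim_family[OF this] show "has_dim (M\<lparr>carrier := eigenspace M F (c i)\<rparr>) 1" by simp
qed

lemma semisimple: "semisimple M F"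
proof -
  interpret vectorspace CC M by (rule vs)
  have b: "basis ((\<lambda>i. \<phi> (f i)) ` I)" using family_basis by (simp add: family_basis_def)
  have "(\<lambda>i. \<phi> (f i)) ` I \<subseteq> (\<Union>e. eigenspace M F e)"
  proof safe
    fix i assume i: "i \<in> I"
    have "\<phi> (lconst 1 * f i) \<in> eigenspace M F (c i)" unfolding eigenspace_member[OF i] by blast
    then show "\<phi> (f i) \<in> (\<Union>e. eigenspace M F e)" by auto
  qed
  then have "carrier M \<subseteq> span (\<Union>e. eigenspace M F e)"
    using span_is_monotone b by (metis basis_def)
  moreover have "span (\<Union>e. eigenspace M F e) \<subseteq> carrier M"
    by (rule span_is_subset2) (auto simp: eigenspace_def)
  ultimately show ?thesis by (auto simp: semisimple_def)
qed

lemma has_dim: "has_dim M (card I)"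
  by (rule has_dim_family[OF family_basis fin])

end

subsection \<open>Modules, submodules and quotients\<close>

text \<open>The submodules of the polynomial representation. The equivalences express stability under \<open>X^(-1)\<close> and
  \<open>Y^(-1)\<close> without mentioning these operators.\<close>

definition stable :: "complex \<Rightarrow> complex \<Rightarrow> complex laurent set \<Rightarrow> bool" where
  "stable v w K \<longleftrightarrow> lsubspace K \<and> (\<forall>f. lmon 1 * f \<in> K \<longleftrightarrow> f \<in> K)
     \<and> (\<forall>f. dunkl v w f \<in> K \<longleftrightarrow> f \<in> K) \<and> (\<forall>f\<in>K. dl w f \<in> K)"

lemma linear_op_lmon: "linear_op (\<lambda>f. lmon n * f)"
  by (simp add: linear_op_def distrib_left mult.left_commute)

lemma linear_op_dunkl: "linear_op (dunkl v w)"
  by (simp add: linear_op_def dunkl_add dunkl_lconst_times)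

lemma linear_op_dunkl_inv: "linear_op (dunkl_inv v w)"
  by (simp add: linear_op_def dunkl_inv_def xrefl_add xrefl_lconst_times dl_inv_add dl_inv_lconst_times)

lemma linear_op_dl: "linear_op (dl w)"
  by (simp add: linear_op_def dl_add dl_lconst_times)

text \<open>A module generated by the image of 1, with kernel \<open>K\<close>. The quotients of the polynomial representation and the
  functions on a finite set of points are of this form; \<open>\<epsilon>\<close> is the sign by which \<open>Y\<close> may be twisted.\<close>

locale hh_presentation = presentation M UNIV \<phi> for M :: "'v hh_module" and \<phi> +
  fixes v w \<epsilon> :: complex and K :: "complex laurent set"
  assumes v_nz: "v \<noteq> 0" and w_nz: "w \<noteq> 0" and \<epsilon>: "\<epsilon> * \<epsilon> = 1"
    and ker: "\<And>f. \<phi> f = \<phi> 0 \<longleftrightarrow> f \<in> K" and K: "stable v w K"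
    and X: "\<And>f. Xop M (\<phi> f) = \<phi> (lmon 1 * f)"
    and Y: "\<And>f. Yop M (\<phi> f) = \<phi> (lconst \<epsilon> * dunkl v w f)"
    and T: "\<And>f. Top M (\<phi> f) = \<phi> (dl w f)"
begin

lemma phi_eq_iff: "\<phi> f = \<phi> g \<longleftrightarrow> f - g \<in> K"
  using eq_iff[of f g] ker by simp

lemma K_sub: "lsubspace K"
  using K by (simp add: stable_def)

lemma eps_K: "lconst \<epsilon> * f \<in> K \<longleftrightarrow> f \<in> K"
proof
  assume "lconst \<epsilon> * f \<in> K"
  then have "lconst \<epsilon> * (lconst \<epsilon> * f) \<in> K" by (rule lsubspace_smult[OF K_sub])
  then show "f \<in> K" using \<epsilon> by (simp flip: mult.assoc lconst_mult)
qed (rule lsubspace_smult[OF K_sub])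

lemma hom_of_op:
  assumes "linear_op x" "\<And>f. G (\<phi> f) = \<phi> (x f)"
  shows "G \<in> module_hom CC M M"
  using assms by (auto simp: module_hom_def carr add smult linear_op_def)

lemma bij_of_op:
  assumes "linear_op x" "\<And>f. G (\<phi> f) = \<phi> (x f)" "\<And>f. x f \<in> K \<longleftrightarrow> f \<in> K" "\<And>f. x (y f) = f"
  shows "bij_betw G (carrier M) (carrier M)" "inv_into (carrier M) G (\<phi> f) = \<phi> (y f)"
proof -
  have inj: "inj_on G (carrier M)"
  proof (rule inj_onI)
    fix a b assume ab: "a \<in> carrier M" "b \<in> carrier M" "G a = G b"
    then obtain f g where fg: "a = \<phi> f" "b = \<phi> g" by (auto simp: carr)
    then have "x f - x g \<in> K" using ab(3) by (simp add: assms(2) phi_eq_iff)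
    then have "f - g \<in> K" unfolding linear_op_diff[OF assms(1), symmetric] assms(3) .
    then show "a = b" by (simp add: fg phi_eq_iff)
  qed
  have "G ` carrier M = carrier M"
  proof
    show "G ` carrier M \<subseteq> carrier M" by (auto simp: carr assms(2))
    show "carrier M \<subseteq> G ` carrier M"
    proof
      fix a assume "a \<in> carrier M"
      then obtain g where "a = \<phi> g" by (auto simp: carr)
      then have "a = G (\<phi> (y g))" by (simp add: assms(2,4))
      then show "a \<in> G ` carrier M" by (auto simp: carr)
    qed
  qed
  then show "bij_betw G (carrier M) (carrier M)" using inj by (simp add: bij_betw_def)
  show "inv_into (carrier M) G (\<phi> f) = \<phi> (y f)"
    by (rule inv_into_f_eq[OF inj]) (auto simp: carr assms(2,4))
qed

lemma lmon_inv: "lmon 1 * (lmon (- 1) * f) = f"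
  by (simp add: lmon_add[symmetric] flip: mult.assoc)

lemma linear_Y: "linear_op (\<lambda>f. lconst \<epsilon> * dunkl v w f)"
  by (simp add: linear_op_def dunkl_add dunkl_lconst_times distrib_left mult.left_commute)

lemma Y_K: "lconst \<epsilon> * dunkl v w f \<in> K \<longleftrightarrow> f \<in> K"
  using K eps_K by (simp add: stable_def)

lemma Y_inv: "lconst \<epsilon> * dunkl v w (lconst \<epsilon> * dunkl_inv v w f) = f"
  using \<epsilon> v_nz w_nz by (simp add: dunkl_lconst_times dunkl_dunkl_inv flip: mult.assoc lconst_mult)

lemma X_bij: "bij_betw (Xop M) (carrier M) (carrier M)" "inv_into (carrier M) (Xop M) (\<phi> f) = \<phi> (lmon (- 1) * f)"
  by (rule bij_of_op[OF linear_op_lmon X _ lmon_inv], use K in \<open>simp add: stable_def\<close>)+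

lemma Y_bij: "bij_betw (Yop M) (carrier M) (carrier M)"
  "inv_into (carrier M) (Yop M) (\<phi> f) = \<phi> (lconst \<epsilon> * dunkl_inv v w f)"
  by (rule bij_of_op[OF linear_Y Y Y_K Y_inv])+

lemma minus_eq: "\<phi> f \<ominus>\<^bsub>M\<^esub> \<phi> g = \<phi> (f - g)"
proof -
  interpret vectorspace CC M by (rule vs)
  have "\<phi> (f - g) \<oplus>\<^bsub>M\<^esub> \<phi> g = \<phi> f" by (simp add: add)
  moreover have c: "\<phi> h \<in> carrier M" for h by (simp add: carr)
  ultimately have "\<phi> f \<ominus>\<^bsub>M\<^esub> \<phi> g = \<phi> (f - g) \<oplus>\<^bsub>M\<^esub> \<phi> g \<ominus>\<^bsub>M\<^esub> \<phi> g" by simp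
  also have "\<dots> = \<phi> (f - g)"
    using c by (simp add: a_minus_def M.a_assoc M.r_neg)
  finally show ?thesis .
qed

lemma uminus_eq: "\<ominus>\<^bsub>M\<^esub> \<phi> g = \<phi> (- g)"
proof -
  interpret vectorspace CC M by (rule vs)
  have "\<phi> (- g) \<oplus>\<^bsub>M\<^esub> \<phi> g = \<zero>\<^bsub>M\<^esub>" by (simp add: add zero)
  then show ?thesis by (rule M.minus_equality) (auto simp: carr)
qed

text \<open>The relations hold in the polynomial representation, hence in its images.\<close>

lemma is_module: "\<epsilon> = 1 \<Longrightarrow> is_hh_module v w M"
proof -
  assume e1: "\<epsilon> = 1"
  have rel1: "dl w (lmon 1 * dl w f) = lmon (- 1) * f" for f
    using w_nz by (simp add: dl_lmon_1 dl_dl)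
  have rel2: "dl w (dunkl_inv v w (dl w f)) = dunkl v w f" for f
    using w_nz by (simp add: dunkl_inv_def dl_dl_inv dunkl_def)
  have rel3: "lconst v * dunkl_inv v w (lmon (- 1) * dunkl v w (lmon 1 * dl w (dl w f))) = f" for f
  proof -
    have "dl w (lmon 1 * dl w (dl w f)) = lmon (- 1) * dl w f" by (rule rel1)
    then have "dunkl v w (lmon 1 * dl w (dl w f)) = lconst (inverse v) * (lmon 1 * xrefl v (dl w f))"
      using v_nz by (simp add: dunkl_def xrefl_mult xrefl_lmon mult.assoc)
    then have "lmon (- 1) * dunkl v w (lmon 1 * dl w (dl w f)) = lconst (inverse v) * xrefl v (dl w f)"
      by (simp add: mult.left_commute[of "lmon (- 1)"] lmon_add[symmetric] flip: mult.assoc)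
    then have "dunkl_inv v w (lmon (- 1) * dunkl v w (lmon 1 * dl w (dl w f))) = lconst (inverse v) * f"
      using v_nz w_nz by (simp add: dunkl_inv_def xrefl_lconst_times xrefl_xrefl dl_inv_lconst_times dl_inv_dl)
    then show ?thesis using v_nz by (simp flip: mult.assoc lconst_mult)
  qed
  have rel4: "dl w (dl w f + lconst (inverse w) * f) - lconst w * (dl w f + lconst (inverse w) * f) = 0" for f
    using w_nz by (simp add: dl_add dl_lconst_times dl_dl distrib_left lconst_diff left_diff_distrib flip: mult.assoc lconst_mult)
  have hom: "Xop M \<in> module_hom CC M M" "Yop M \<in> module_hom CC M M" "Top M \<in> module_hom CC M M"
    using hom_of_op[OF linear_op_lmon X] hom_of_op[OF linear_Y Y] hom_of_op[OF linear_op_dl T] by auto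
  show ?thesis
    unfolding is_hh_module_def Let_def
  proof (intro conjI ballI vs hom X_bij Y_bij)
    fix a assume "a \<in> carrier M"
    then obtain f where a: "a = \<phi> f" by (auto simp: carr)
    show "Top M (Xop M (Top M a)) = inv_into (carrier M) (Xop M) a"
      by (simp add: a T X X_bij(2) rel1)
    show "Top M (inv_into (carrier M) (Yop M) (Top M a)) = Yop M a"
      by (simp add: a T Y Y_bij(2) rel2 e1)
    show "v \<odot>\<^bsub>M\<^esub> inv_into (carrier M) (Yop M) (inv_into (carrier M) (Xop M) (Yop M (Xop M (Top M (Top M a))))) = a"
      by (simp add: a T X Y X_bij(2) Y_bij(2) smult rel3 e1)
    show "Top M (Top M a \<oplus>\<^bsub>M\<^esub> inverse w \<odot>\<^bsub>M\<^esub> a) \<ominus>\<^bsub>M\<^esub> w \<odot>\<^bsub>M\<^esub> (Top M a \<oplus>\<^bsub>M\<^esub> inverse w \<odot>\<^bsub>M\<^esub> a) = \<zero>\<^bsub>M\<^esub>"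
      by (simp add: a T smult add minus_eq rel4 zero)
  qed
qed

lemma image_submodule:
  assumes W: "stable v w W" and e1: "\<epsilon> = 1"
  shows "hh_submodule (\<phi> ` W) M"
proof -
  have Ws: "lsubspace W" using W by (simp add: stable_def)
  have sub: "LinearCombinations.submodule CC (\<phi> ` W) M"
    by (rule submodule_image[OF Ws subset_UNIV])
  have im: "G ` \<phi> ` W = \<phi> ` W"
    if "\<And>f. G (\<phi> f) = \<phi> (x f)" "\<And>f. x f \<in> W \<longleftrightarrow> f \<in> W" "\<And>f. x (y f) = f" for G x y
  proof
    show "G ` \<phi> ` W \<subseteq> \<phi> ` W" using that by auto
    show "\<phi> ` W \<subseteq> G ` \<phi> ` W"
    proof safe
      fix f assume "f \<in> W"
      then have "y f \<in> W" "\<phi> f = G (\<phi> (y f))" using that by metis+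
      then show "\<phi> f \<in> G ` \<phi> ` W" by blast
    qed
  qed
  have "Xop M ` \<phi> ` W = \<phi> ` W" by (rule im[OF X _ lmon_inv]) (use W in \<open>simp add: stable_def\<close>)
  moreover have "Yop M ` \<phi> ` W = \<phi> ` W"
    by (rule im[OF Y _ Y_inv]) (use W e1 in \<open>simp add: stable_def\<close>)
  moreover have "Top M ` \<phi> ` W \<subseteq> \<phi> ` W" using W by (auto simp: T stable_def)
  ultimately show ?thesis using sub by (simp add: hh_submodule_def)
qed

lemma preimage_stable:
  assumes S: "hh_submodule S M" and e1: "\<epsilon> = 1"
  shows "stable v w {f. \<phi> f \<in> S}" "K \<subseteq> {f. \<phi> f \<in> S}" "S = \<phi> ` {f. \<phi> f \<in> S}"
proof -
  interpret S: LinearCombinations.submodule CC S M using S by (simp add: hh_submodule_def)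
  have op: "G (\<phi> f) \<in> S \<longleftrightarrow> \<phi> f \<in> S" if bG: "bij_betw G (carrier M) (carrier M)" and GS: "G ` S = S" for G f
  proof
    assume "G (\<phi> f) \<in> S"
    then obtain s where s: "s \<in> S" "G (\<phi> f) = G s" using GS by blast
    moreover have "s \<in> carrier M" "\<phi> f \<in> carrier M" using s S.subset by (auto simp: carr)
    ultimately have "\<phi> f = s" using inj_onD[OF bij_betw_imp_inj_on[OF bG]] by metis
    then show "\<phi> f \<in> S" using s by simp
  next
    assume "\<phi> f \<in> S"
    then show "G (\<phi> f) \<in> S" using GS by blast
  qed
  have XY: "Xop M ` S = S" "Yop M ` S = S" "Top M ` S \<subseteq> S" using S by (auto simp: hh_submodule_def)
  show "stable v w {f. \<phi> f \<in> S}"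
    unfolding stable_def
  proof (intro conjI allI ballI)
    show "lsubspace {f. \<phi> f \<in> S}"
      unfolding lsubspace_def using S.m_closed S.zero_closed S.smult_closed
      by (simp add: zero[symmetric] add[symmetric] smult[symmetric])
    show "lmon 1 * f \<in> {f. \<phi> f \<in> S} \<longleftrightarrow> f \<in> {f. \<phi> f \<in> S}" for f
      using op[OF X_bij(1) XY(1), of f] by (simp add: X)
    show "dunkl v w f \<in> {f. \<phi> f \<in> S} \<longleftrightarrow> f \<in> {f. \<phi> f \<in> S}" for f
      using op[OF Y_bij(1) XY(2), of f] by (simp add: Y e1)
    show "dl w f \<in> {f. \<phi> f \<in> S}" if "f \<in> {f. \<phi> f \<in> S}" for f
      using that XY(3) T by (auto simp: image_subset_iff)
  qed
  show "K \<subseteq> {f. \<phi> f \<in> S}"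
  proof
    fix f assume "f \<in> K"
    then have "\<phi> f = \<zero>\<^bsub>M\<^esub>" using ker zero by simp
    then show "f \<in> {f. \<phi> f \<in> S}" using S.zero_closed by simp
  qed
  show "S = \<phi> ` {f. \<phi> f \<in> S}" using S.subset by (auto simp: carr)
qed

text \<open>Submodules of the image correspond to stable subspaces containing the kernel.\<close>

lemma irreducible_iff:
  assumes e1: "\<epsilon> = 1"
  shows "hh_irreducible v w M \<longleftrightarrow> K \<noteq> UNIV \<and> (\<forall>W. stable v w W \<and> K \<subseteq> W \<longrightarrow> W = K \<or> W = UNIV)"
proof
  assume irr: "hh_irreducible v w M"
  show "K \<noteq> UNIV \<and> (\<forall>W. stable v w W \<and> K \<subseteq> W \<longrightarrow> W = K \<or> W = UNIV)"
  proof (intro conjI allI impI)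
    have "carrier M \<noteq> {\<zero>\<^bsub>M\<^esub>}" using irr by (simp add: hh_irreducible_def)
    then show "K \<noteq> UNIV" using ker by (auto simp: carr zero)
    fix W assume W: "stable v w W \<and> K \<subseteq> W"
    then have Ws: "lsubspace W" by (simp add: stable_def)
    have mem: "f \<in> W" if im: "\<phi> f \<in> \<phi> ` W" for f
    proof -
      obtain g where "g \<in> W" "\<phi> f = \<phi> g" using im by auto
      then have "f - g \<in> W" using W phi_eq_iff by auto
      then show "f \<in> W" using lsubspace_add[OF Ws, of "f - g" g] \<open>g \<in> W\<close> by simp
    qed
    have "\<phi> ` W = {\<zero>\<^bsub>M\<^esub>} \<or> \<phi> ` W = carrier M"
      using irr image_submodule[OF _ e1] W by (auto simp: hh_irreducible_def)
    then show "W = K \<or> W = UNIV"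
    proof
      assume "\<phi> ` W = {\<zero>\<^bsub>M\<^esub>}"
      then have "\<phi> f = \<phi> 0" if "f \<in> W" for f
      proof -
        have "\<phi> f \<in> \<phi> ` W" using that by (rule imageI)
        then show ?thesis using \<open>\<phi> ` W = {\<zero>\<^bsub>M\<^esub>}\<close> zero by simp
      qed
      then have "W \<subseteq> K" using ker by blast
      then show ?thesis using W by blast
    next
      assume "\<phi> ` W = carrier M"
      then have "f \<in> W" for f using mem[of f] carr by simp
      then show ?thesis by blast
    qed
  qed
next
  assume a: "K \<noteq> UNIV \<and> (\<forall>W. stable v w W \<and> K \<subseteq> W \<longrightarrow> W = K \<or> W = UNIV)"
  show "hh_irreducible v w M"
    unfolding hh_irreducible_def
  proof (intro conjI allI impI)
    show "is_hh_module v w M" by (rule is_module[OF e1])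
    obtain f where "f \<notin> K" using a by auto
    then have "\<phi> f \<in> carrier M" "\<phi> f \<noteq> \<zero>\<^bsub>M\<^esub>" using ker zero carr by auto
    then show "carrier M \<noteq> {\<zero>\<^bsub>M\<^esub>}" by auto
    fix S assume S: "hh_submodule S M"
    note p = preimage_stable[OF S e1]
    have "{f. \<phi> f \<in> S} = K \<or> {f. \<phi> f \<in> S} = UNIV" using a p by blast
    moreover have "\<phi> ` K = {\<zero>\<^bsub>M\<^esub>}"
    proof -
      have "\<phi> f = \<zero>\<^bsub>M\<^esub>" if "f \<in> K" for f using ker that zero by simp
      moreover have "\<phi> 0 \<in> \<phi> ` K" using lsubspace_0[OF K_sub] by (rule imageI)
      ultimately show ?thesis unfolding zero by (metis (no_types, lifting) image_cong image_constant_conv empty_iff image_empty zero)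
    qed
    ultimately show "S = {\<zero>\<^bsub>M\<^esub>} \<or> S = carrier M" using p(3) carr by metis
  qed
qed

lemma quotient_presentation:
  assumes W: "stable v w W" and KW: "K \<subseteq> W" and e1: "\<epsilon> = 1"
  shows "hh_presentation (hh_quotient M (\<phi> ` W)) (\<lambda>f. \<phi> ` W +>\<^bsub>M\<^esub> \<phi> f) v w 1 W"
proof -
  have Ws: "lsubspace W" using W by (simp add: stable_def)
  define \<psi> where "\<psi> f = \<phi> ` W +>\<^bsub>M\<^esub> \<phi> f" for f
  have \<psi>: "\<psi> f = {\<phi> (h + f) | h. h \<in> W}" for f
    by (auto simp: \<psi>_def a_r_coset_def' add)
  have \<psi>_eq: "\<psi> f = \<psi> g \<longleftrightarrow> f - g \<in> W" for f g
  proof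
    assume "\<psi> f = \<psi> g"
    moreover have "\<phi> (0 + f) \<in> \<psi> f" unfolding \<psi> using lsubspace_0[OF Ws] by blast
    ultimately obtain h where h: "h \<in> W" "\<phi> (0 + f) = \<phi> (h + g)" unfolding \<psi> by auto
    then have "(0 + f) - (h + g) \<in> W" using KW phi_eq_iff by blast
    then have "((0 + f) - (h + g)) + h \<in> W" using h(1) by (rule lsubspace_add[OF Ws])
    then show "f - g \<in> W" by simp
  next
    have sub: "\<psi> f \<subseteq> \<psi> g" if "f - g \<in> W" for f g
    proof
      fix x assume "x \<in> \<psi> f"
      then obtain h where h: "h \<in> W" "x = \<phi> (h + f)" by (auto simp: \<psi>)
      have "h + (f - g) \<in> W" using h(1) that by (rule lsubspace_add[OF Ws])
      moreover have "x = \<phi> (h + (f - g) + g)" using h by simp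
      ultimately show "x \<in> \<psi> g" unfolding \<psi> by blast
    qed
    assume "f - g \<in> W"
    moreover from this have "g - f \<in> W" using lsubspace_uminus[OF Ws, of "f - g"] by simp
    ultimately show "\<psi> f = \<psi> g" using sub by blast
  qed
  have \<psi>_op: "(\<Union>a\<in>\<psi> f. \<phi> ` W +>\<^bsub>M\<^esub> G a) = \<psi> (x f)"
    if G: "\<And>f. G (\<phi> f) = \<phi> (x f)" and x: "linear_op x" "\<And>f. f \<in> W \<Longrightarrow> x f \<in> W" for G x f
  proof -
    have "\<phi> ` W +>\<^bsub>M\<^esub> G a = \<psi> (x f)" if af: "a \<in> \<psi> f" for a
    proof -
      obtain h where h: "h \<in> W" "a = \<phi> (h + f)" using af by (auto simp: \<psi>)
      then have "\<phi> ` W +>\<^bsub>M\<^esub> G a = \<psi> (x (h + f))" by (simp add: G \<psi>_def)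
      also have "\<dots> = \<psi> (x f)"
        using x(2)[OF h(1)] x(1) by (simp add: \<psi>_eq linear_op_def)
      finally show ?thesis .
    qed
    moreover have "\<psi> f \<noteq> {}" using lsubspace_0[OF Ws] by (auto simp: \<psi>)
    ultimately show ?thesis by blast
  qed
  have "hh_presentation (hh_quotient M (\<phi> ` W)) \<psi> v w 1 W"
  proof
    show "lsubspace UNIV" by (rule lsubspace_UNIV)
    show "carrier (hh_quotient M (\<phi> ` W)) = range \<psi>"
      by (auto simp: hh_quotient_def A_RCOSETS_def' \<psi>_def carr)
    show "\<zero>\<^bsub>hh_quotient M (\<phi> ` W)\<^esub> = \<psi> 0"
      by (auto simp: hh_quotient_def \<psi>)
    show "\<psi> f \<oplus>\<^bsub>hh_quotient M (\<phi> ` W)\<^esub> \<psi> g = \<psi> (f + g)" for f g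
    proof -
      have "set_add M (\<psi> f) (\<psi> g) = {\<phi> ((h + f) + (h' + g)) | h h'. h \<in> W \<and> h' \<in> W}"
      proof (intro equalityI subsetI)
        fix x assume "x \<in> set_add M (\<psi> f) (\<psi> g)"
        then obtain h h' where "h \<in> W" "h' \<in> W" "x = \<phi> (h + f) \<oplus>\<^bsub>M\<^esub> \<phi> (h' + g)"
          by (auto simp: set_add_def' \<psi>)
        then show "x \<in> {\<phi> ((h + f) + (h' + g)) | h h'. h \<in> W \<and> h' \<in> W}" by (auto simp: add)
      next
        fix x assume "x \<in> {\<phi> ((h + f) + (h' + g)) | h h'. h \<in> W \<and> h' \<in> W}"
        then obtain h h' where *: "h \<in> W" "h' \<in> W" "x = \<phi> (h + f) \<oplus>\<^bsub>M\<^esub> \<phi> (h' + g)"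
          by (auto simp: add)
        have "\<phi> (h + f) \<in> \<psi> f" "\<phi> (h' + g) \<in> \<psi> g" using *(1,2) unfolding \<psi> by blast+
        then show "x \<in> set_add M (\<psi> f) (\<psi> g)" unfolding set_add_def' *(3) by blast
      qed
      also have "\<dots> = \<psi> (f + g)"
      proof (intro equalityI subsetI)
        fix x assume "x \<in> {\<phi> ((h + f) + (h' + g)) | h h'. h \<in> W \<and> h' \<in> W}"
        then obtain h h' where *: "h \<in> W" "h' \<in> W" "x = \<phi> ((h + h') + (f + g))" by (auto simp: ac_simps)
        have "h + h' \<in> W" using *(1,2) by (rule lsubspace_add[OF Ws])
        then show "x \<in> \<psi> (f + g)" unfolding \<psi> using *(3) by blast
      next
        fix x assume "x \<in> \<psi> (f + g)"
        then obtain h where *: "h \<in> W" "x = \<phi> (h + (f + g))" by (auto simp: \<psi>)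
        then have "x = \<phi> ((h + f) + (0 + g))" by (simp add: ac_simps)
        then show "x \<in> {\<phi> ((h + f) + (h' + g)) | h h'. h \<in> W \<and> h' \<in> W}"
          using *(1) lsubspace_0[OF Ws] by blast
      qed
      finally show ?thesis by (simp add: hh_quotient_def)
    qed
    show "c \<odot>\<^bsub>hh_quotient M (\<phi> ` W)\<^esub> \<psi> f = \<psi> (lconst c * f)" for c f
      unfolding hh_quotient_def using \<psi>_op[of "\<lambda>a. c \<odot>\<^bsub>M\<^esub> a" "\<lambda>f. lconst c * f" f]
      by (simp add: smult linear_op_def distrib_left mult.left_commute lsubspace_smult[OF Ws])
    show "v \<noteq> 0" "w \<noteq> 0" "1 * 1 = (1::complex)" "stable v w W" using v_nz w_nz W by auto
    show "\<psi> f = \<psi> 0 \<longleftrightarrow> f \<in> W" for f by (simp add: \<psi>_eq)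
    show "Xop (hh_quotient M (\<phi> ` W)) (\<psi> f) = \<psi> (lmon 1 * f)" for f
      unfolding hh_quotient_def using \<psi>_op[OF X linear_op_lmon, of f] W by (simp add: stable_def)
    show "Yop (hh_quotient M (\<phi> ` W)) (\<psi> f) = \<psi> (lconst 1 * dunkl v w f)" for f
      unfolding hh_quotient_def using \<psi>_op[of "Yop M" "dunkl v w" f] Y e1 linear_op_dunkl W by (simp add: stable_def)
    show "Top (hh_quotient M (\<phi> ` W)) (\<psi> f) = \<psi> (dl w f)" for f
      unfolding hh_quotient_def using \<psi>_op[OF T linear_op_dl, of f] W by (simp add: stable_def)
  qed
  then show ?thesis unfolding \<psi>_def .
qed

end

text \<open>Cyclic modules with the same annihilator of the generator are isomorphic, by sending the image of each
  polynomial to its image.\<close>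

lemma hh_iso_presentations:
  assumes "hh_presentation M \<phi> v w \<epsilon> K" "hh_presentation M' \<phi>' v w \<epsilon> K"
  shows "hh_iso M M'"
proof -
  interpret A: hh_presentation M \<phi> v w \<epsilon> K by fact
  interpret B: hh_presentation M' \<phi>' v w \<epsilon> K by fact
  define F where "F a = \<phi>' (SOME f. \<phi> f = a)" for a
  have F: "F (\<phi> f) = \<phi>' f" for f
  proof -
    have "\<phi> (SOME g. \<phi> g = \<phi> f) = \<phi> f" by (rule someI[of "\<lambda>g. \<phi> g = \<phi> f"]) simp
    then show ?thesis unfolding F_def B.phi_eq_iff using A.phi_eq_iff by blast
  qed
  have "F \<in> module_hom CC M M'"
    by (auto simp: module_hom_def A.carr B.carr A.add B.add A.smult B.smult F)
  moreover have "bij_betw F (carrier M) (carrier M')"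
  proof (rule bij_betw_imageI)
    show "inj_on F (carrier M)"
      by (auto simp: inj_on_def A.carr F A.phi_eq_iff B.phi_eq_iff)
    show "F ` carrier M = carrier M'" by (simp add: A.carr B.carr image_image F)
  qed
  ultimately show ?thesis
    unfolding hh_iso_def by (intro bexI[of _ F]) (auto simp: A.carr A.X A.Y A.T B.X B.Y B.T F)
qed

lemma stable_0: "v \<noteq> 0 \<Longrightarrow> w \<noteq> 0 \<Longrightarrow> stable v w {0}"
proof -
  assume nz: "v \<noteq> 0" "w \<noteq> 0"
  have "lmon 1 * f = 0 \<longleftrightarrow> f = 0" for f :: "complex laurent"
  proof
    assume "lmon 1 * f = 0"
    then have "lmon (- 1) * (lmon 1 * f) = 0" by simp
    then show "f = 0" by (simp add: lmon_add[symmetric] flip: mult.assoc)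
  qed simp
  moreover have "dunkl v w f = 0 \<longleftrightarrow> f = 0" for f
  proof
    assume "dunkl v w f = 0"
    then have "dunkl_inv v w (dunkl v w f) = dunkl_inv v w (dunkl v w 0)" by simp
    then show "f = 0" by (simp only: dunkl_inv_dunkl[OF nz])
  qed simp
  moreover have "dl w 0 = 0" using linear_op_0[OF linear_op_dl] .
  ultimately show ?thesis by (simp add: stable_def lsubspace_def)
qed

lemma PP_simps: "carrier (PP v w) = UNIV" "\<zero>\<^bsub>PP v w\<^esub> = 0" "f \<oplus>\<^bsub>PP v w\<^esub> g = f + g" "f \<otimes>\<^bsub>PP v w\<^esub> g = f * g"
  "c \<odot>\<^bsub>PP v w\<^esub> f = lconst c * f" "Xop (PP v w) f = lmon 1 * f" "Yop (PP v w) = dunkl v w" "Top (PP v w) = dl w"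
  by (simp_all add: PP_def Y_op_eq_dunkl T_op_eq_dl)

lemma PP_presentation:
  assumes "v \<noteq> 0" "w \<noteq> 0"
  shows "hh_presentation (PP v w) (\<lambda>f. f) v w 1 {0}"
  by standard (use assms stable_0 in \<open>auto simp: PP_simps lsubspace_UNIV\<close>)

lemma hh_submodule_PP_iff:
  assumes "v \<noteq> 0" "w \<noteq> 0"
  shows "hh_submodule W (PP v w) \<longleftrightarrow> stable v w W"
proof -
  interpret hh_presentation "PP v w" "\<lambda>f. f" v w 1 "{0}" by (rule PP_presentation[OF assms])
  show ?thesis using image_submodule[of W] preimage_stable(1)[of W] by auto
qed

lemma PP_quotient:
  assumes "v \<noteq> 0" "w \<noteq> 0" "stable v w W"
  shows "hh_presentation (hh_quotient (PP v w) W) (\<lambda>f. W +>\<^bsub>PP v w\<^esub> f) v w 1 W"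
proof -
  interpret hh_presentation "PP v w" "\<lambda>f. f" v w 1 "{0}" by (rule PP_presentation[OF assms(1,2)])
  have "{0} \<subseteq> W" using assms(3) by (simp add: stable_def lsubspace_def)
  from quotient_presentation[OF assms(3) this] show ?thesis by simp
qed

lemma PIdl_eq: "PIdl\<^bsub>PP v w\<^esub> p = range (\<lambda>h. p * h)"
  by (auto simp: cgenideal_def PP_simps mult.commute)

text \<open>An element that is fixed by \<open>s\<close> and multiplied by a sign under \<open>\<pi>\<close> commutes with \<open>T\<close>, and with
  \<open>Y\<close> up to this sign.\<close>

lemma stable_ideal:
  assumes nz: "v \<noteq> 0" "w \<noteq> 0" and p: "xrefl 1 p = p" "xrefl v p = lconst s * p" "s * s = 1"
  shows "stable v w (range (\<lambda>h. p * h))"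
proof -
  let ?P = "range (\<lambda>h. p * h)"
  have inv: "lmon (- 1) * (lmon 1 * f) = f" for f :: "complex laurent"
    by (simp add: lmon_add[symmetric] flip: mult.assoc)
  have Y: "dunkl v w (p * h) = p * (lconst s * dunkl v w h)" for h
    using dunkl_invariant_times[OF p(1) nz(1)] p(2) by (simp add: ac_simps)
  have Yi: "dunkl_inv v w (p * h) = p * (lconst s * dunkl_inv v w h)" for h
  proof -
    have "dunkl v w (p * (lconst s * dunkl_inv v w h)) = p * ((lconst s * lconst s) * h)"
      using nz by (simp add: Y dunkl_lconst_times dunkl_dunkl_inv mult.assoc)
    also have "\<dots> = p * h" using p(3) by (simp flip: lconst_mult)
    finally have "dunkl_inv v w (dunkl v w (p * (lconst s * dunkl_inv v w h))) = dunkl_inv v w (p * h)" by simp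
    then show ?thesis using nz by (simp add: dunkl_inv_dunkl)
  qed
  show ?thesis
    unfolding stable_def
  proof (intro conjI allI ballI)
    show "lsubspace ?P"
      unfolding lsubspace_def
    proof (intro conjI ballI allI)
      show "0 \<in> ?P" by (rule range_eqI[of _ _ 0]) simp
      show "f + g \<in> ?P" if "f \<in> ?P" "g \<in> ?P" for f g
        using that by (auto simp: distrib_left[symmetric])
      show "lconst c * f \<in> ?P" if "f \<in> ?P" for c f
        using that by (auto simp: mult.left_commute)
    qed
    fix f
    show "lmon 1 * f \<in> ?P \<longleftrightarrow> f \<in> ?P"
    proof
      assume "lmon 1 * f \<in> ?P"
      then obtain h where "lmon 1 * f = p * h" by auto
      then have "f = p * (lmon (- 1) * h)" using inv[of f] by (simp add: mult.left_commute)
      then show "f \<in> ?P" by blast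
    qed (auto simp: mult.left_commute)
    show "dunkl v w f \<in> ?P \<longleftrightarrow> f \<in> ?P"
    proof
      assume "dunkl v w f \<in> ?P"
      then obtain h where "dunkl v w f = p * h" by auto
      then have "f = p * (lconst s * dunkl_inv v w h)"
        using dunkl_inv_dunkl[OF nz, of f] by (simp add: Yi)
      then show "f \<in> ?P" by blast
    qed (auto simp: Y)
  next
    fix f assume "f \<in> ?P"
    then show "dl w f \<in> ?P" using dl_invariant_times[OF p(1)] by auto
  qed
qed

section \<open>Division with remainder\<close>

lemma lookup_eq_0_all: "(\<And>k. Poly_Mapping.lookup f k = 0) \<Longrightarrow> f = 0"
  by (rule poly_mapping_eqI) simp

text \<open>The monomials in the window generate all others modulo \<open>p\<close>: the highest coefficient of \<open>p\<close> serves to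
  lower large exponents and the lowest one to raise small exponents.\<close>

lemma laurent_reduce:
  fixes p :: "complex laurent"
  assumes p: "\<And>k. Poly_Mapping.lookup p k \<noteq> 0 \<Longrightarrow> l \<le> k \<and> k \<le> u"
    and ends: "Poly_Mapping.lookup p l \<noteq> 0" "Poly_Mapping.lookup p u \<noteq> 0"
  obtains h g where "f = p * h + g" "\<And>k. Poly_Mapping.lookup g k \<noteq> 0 \<Longrightarrow> l < k \<and> k \<le> u"
proof -
  define S where "S = {f. \<exists>h. \<forall>k. Poly_Mapping.lookup (f - p * h) k \<noteq> 0 \<longrightarrow> l < k \<and> k \<le> u}"
  have S: "lsubspace S"
    unfolding lsubspace_def
  proof (intro conjI ballI allI)
    show "0 \<in> S" unfolding S_def by (intro CollectI exI[of _ 0]) simp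
  next
    fix f g assume "f \<in> S" "g \<in> S"
    then obtain h h' where "\<forall>k. Poly_Mapping.lookup (f - p * h) k \<noteq> 0 \<longrightarrow> l < k \<and> k \<le> u"
      "\<forall>k. Poly_Mapping.lookup (g - p * h') k \<noteq> 0 \<longrightarrow> l < k \<and> k \<le> u" by (auto simp: S_def)
    moreover have "f + g - p * (h + h') = (f - p * h) + (g - p * h')" by (simp add: algebra_simps)
    ultimately show "f + g \<in> S"
      unfolding S_def by (intro CollectI exI[of _ "h + h'"]) (metis lookup_add add_0_left)
  next
    fix c f assume "f \<in> S"
    then obtain h where h: "\<forall>k. Poly_Mapping.lookup (f - p * h) k \<noteq> 0 \<longrightarrow> l < k \<and> k \<le> u" by (auto simp: S_def)
    have "lconst c * f - p * (lconst c * h) = lconst c * (f - p * h)"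
      by (simp add: right_diff_distrib mult.left_commute)
    then show "lconst c * f \<in> S"
      unfolding S_def using h by (intro CollectI exI[of _ "lconst c * h"]) simp
  qed
  have pS: "lmon k * p \<in> S" for k
    unfolding S_def by (intro CollectI exI[of _ "lmon k"]) (simp add: mult.commute)
  let ?K = "Poly_Mapping.keys p"
  have mon: "lmon k \<in> S" if e: "Poly_Mapping.lookup p e \<noteq> 0"
    and *: "\<And>i. i \<in> ?K \<Longrightarrow> i \<noteq> e \<Longrightarrow> lmon (k - e + i) \<in> S" for e k
  proof -
    have "lmon (k - e) * p = (\<Sum>i\<in>?K. lmon (k - e) * (lconst (Poly_Mapping.lookup p i) * lmon i))"
      by (subst laurent_expand[of p]) (simp add: single_eq_lconst_lmon sum_distrib_left)
    also have "\<dots> = (\<Sum>i\<in>?K. lconst (Poly_Mapping.lookup p i) * lmon (k - e + i))"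
      by (intro sum.cong refl) (simp add: lmon_add mult.left_commute)
    also have "\<dots> = lconst (Poly_Mapping.lookup p e) * lmon k
        + (\<Sum>i\<in>?K - {e}. lconst (Poly_Mapping.lookup p i) * lmon (k - e + i))"
      using e by (subst sum.remove[of _ e]) (auto simp: in_keys_iff)
    finally have eq: "lconst (Poly_Mapping.lookup p e) * lmon k
      = lmon (k - e) * p - (\<Sum>i\<in>?K - {e}. lconst (Poly_Mapping.lookup p i) * lmon (k - e + i))" by simp
    have "lconst (Poly_Mapping.lookup p e) * lmon k \<in> S"
      unfolding eq using * pS by (intro lsubspace_diff[OF S] lsubspace_sum[OF S] lsubspace_smult[OF S]) auto
    then have "lconst (inverse (Poly_Mapping.lookup p e)) * (lconst (Poly_Mapping.lookup p e) * lmon k) \<in> S"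
      by (rule lsubspace_smult[OF S])
    then show ?thesis using e by (simp flip: mult.assoc lconst_mult)
  qed
  \<comment> \<open>Exponents in the window are their own remainders; the others are reached by induction on the distance.\<close>
  have mid: "lmon k \<in> S" if "l < k" "k \<le> u" for k
    unfolding S_def using that by (intro CollectI exI[of _ 0]) (auto simp: lookup_lmon split: if_splits)
  have up: "\<forall>k. l < k \<and> k \<le> u + int n \<longrightarrow> lmon k \<in> S" for n
  proof (induction n)
    case 0
    then show ?case using mid by simp
  next
    case (Suc n)
    show ?case
    proof (intro allI impI)
      fix k assume k: "l < k \<and> k \<le> u + int (Suc n)"
      show "lmon k \<in> S"
      proof (cases "k \<le> u + int n")
        case False
        have "lmon (k - u + i) \<in> S" if "i \<in> ?K" "i \<noteq> u" for i
        proof -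
          have "l \<le> i" "i \<le> u" using p[of i] that by (auto simp: in_keys_iff)
          then show ?thesis using Suc that k False by simp
        qed
        then show ?thesis by (rule mon[OF ends(2)])
      qed (use Suc k in blast)
    qed
  qed
  have down: "\<forall>k. l - int n < k \<and> k \<le> u \<longrightarrow> lmon k \<in> S" for n
  proof (induction n)
    case 0
    then show ?case using mid by simp
  next
    case (Suc n)
    show ?case
    proof (intro allI impI)
      fix k assume k: "l - int (Suc n) < k \<and> k \<le> u"
      show "lmon k \<in> S"
      proof (cases "l - int n < k")
        case False
        have "lmon (k - l + i) \<in> S" if "i \<in> ?K" "i \<noteq> l" for i
        proof -
          have "l \<le> i" "i \<le> u" using p[of i] that by (auto simp: in_keys_iff)
          then show ?thesis using Suc that k False by simp
        qed
        then show ?thesis by (rule mon[OF ends(1)])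
      qed (use Suc k in blast)
    qed
  qed
  have "lmon k \<in> S" for k
  proof (cases "k \<le> u")
    case True
    then show ?thesis using down[of "nat (l - k + 1)"] by simp
  next
    case False
    show ?thesis
    proof (cases "l < k")
      case True
      then show ?thesis using up[of "nat (k - u)"] False by simp
    next
      case False
      then show ?thesis using p[OF ends(1)] \<open>\<not> k \<le> u\<close> by simp
    qed
  qed
  then have "f \<in> S"
    by (subst laurent_expand) (auto simp: single_eq_lconst_lmon intro!: lsubspace_sum[OF S] lsubspace_smult[OF S])
  then obtain h where "\<forall>k. Poly_Mapping.lookup (f - p * h) k \<noteq> 0 \<longrightarrow> l < k \<and> k \<le> u" by (auto simp: S_def)
  then show ?thesis using that[of h "f - p * h"] by simp
qed

definition width_poly :: "nat \<Rightarrow> complex \<Rightarrow> complex laurent" where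
  "width_poly n C = lmon (int n) + lmon (- int n) + lconst C"

lemma lookup_width_poly:
  assumes "n \<ge> 1"
  shows "Poly_Mapping.lookup (width_poly n C) k = (if k = int n \<or> k = - int n then 1 else if k = 0 then C else 0)"
  using assms by (auto simp: width_poly_def lookup_add lookup_lmon lookup_lconst)

text \<open>The window of remainders modulo \<open>X^n + X^(-n) + C\<close> is an initial segment in the order of the monomials;
  this is why division and triangularity fit together.\<close>

lemma rank_less_iff: "lrank k < 2 * n \<longleftrightarrow> - int n < k \<and> k \<le> int n"
  by (auto simp: lrank_def)

lemma width_reduce:
  assumes "n \<ge> 1"
  obtains h g where "f = width_poly n C * h + g" "\<And>k. Poly_Mapping.lookup g k \<noteq> 0 \<Longrightarrow> lrank k < 2 * n"
proof (rule laurent_reduce[where p = "width_poly n C" and l = "- int n" and u = "int n" and f = f])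
  fix k assume "Poly_Mapping.lookup (width_poly n C) k \<noteq> 0"
  then show "- int n \<le> k \<and> k \<le> int n" using assms by (auto simp: lookup_width_poly split: if_splits)
next
  fix h g assume "f = width_poly n C * h + g" "\<And>k. Poly_Mapping.lookup g k \<noteq> 0 \<Longrightarrow> - int n < k \<and> k \<le> int n"
  then show thesis using that by (auto simp: rank_less_iff)
qed (use assms in \<open>auto simp: lookup_width_poly\<close>)

text \<open>The highest or the lowest exponent of a nonzero multiple of \<open>X^n + X^(-n) + C\<close> lies outside of the window.\<close>

lemma width_remainder_unique:
  assumes n: "n \<ge> 1" and sup: "\<And>k. Poly_Mapping.lookup g k \<noteq> 0 \<Longrightarrow> lrank k < 2 * n"
    and mem: "g \<in> range (\<lambda>h. width_poly n C * h)"
  shows "g = 0"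
proof -
  obtain h where h: "g = width_poly n C * h" using mem by auto
  have l: "Poly_Mapping.lookup g k = Poly_Mapping.lookup h (k - int n) + Poly_Mapping.lookup h (k + int n) + C * Poly_Mapping.lookup h k" for k
    by (simp add: h width_poly_def distrib_right lookup_add)
  have "h = 0"
  proof (rule ccontr)
    assume "h \<noteq> 0"
    let ?K = "Poly_Mapping.keys h"
    have K: "finite ?K" "?K \<noteq> {}" using \<open>h \<noteq> 0\<close> lookup_eq_0_all[of h] by (auto simp: in_keys_iff)
    define a b where "a = Min ?K" and "b = Max ?K"
    have a: "Poly_Mapping.lookup h a \<noteq> 0" "\<And>k. k < a \<Longrightarrow> Poly_Mapping.lookup h k = 0"
      using Min_in[OF K] Min_le[OF K(1)] unfolding a_def in_keys_iff by (auto simp: not_less[symmetric])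
    have b: "Poly_Mapping.lookup h b \<noteq> 0" "\<And>k. k > b \<Longrightarrow> Poly_Mapping.lookup h k = 0"
      using Max_in[OF K] Max_ge[OF K(1)] unfolding b_def in_keys_iff by (auto simp: not_less[symmetric])
    have "Poly_Mapping.lookup g (b + int n) \<noteq> 0" using l[of "b + int n"] b n by simp
    then have "b \<le> 0" using sup[of "b + int n"] by (simp add: rank_less_iff)
    have "Poly_Mapping.lookup g (a - int n) \<noteq> 0" using l[of "a - int n"] a n by simp
    then have "a > 0" using sup[of "a - int n"] by (simp add: rank_less_iff)
    have "a \<le> b" using a(1) b(2)[of a] by fastforce
    then show False using \<open>b \<le> 0\<close> \<open>a > 0\<close> by simp
  qed
  then show ?thesis by (simp add: h)
qed

section \<open>Submodules of the polynomial representation\<close>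

lemma stable_one_imp_UNIV:
  assumes W: "stable v w W" and one: "1 \<in> W"
  shows "W = UNIV"
proof -
  have Ws: "lsubspace W" and X: "\<And>f. lmon 1 * f \<in> W \<longleftrightarrow> f \<in> W" using W by (auto simp: stable_def)
  have pos: "lmon (int n) \<in> W" for n
    by (induction n) (use one X in \<open>auto simp: lmon_add\<close>)
  have neg: "lmon (- int n) \<in> W" for n
  proof (induction n)
    case (Suc n)
    have "lmon 1 * lmon (- int (Suc n)) = (lmon (- int n) :: complex laurent)"
      by (simp flip: lmon_add)
    then show ?case using Suc X by metis
  qed (use one in simp)
  have "lmon k \<in> W" for k
    using pos[of "nat k"] neg[of "nat (- k)"] by (cases "k \<ge> 0") auto
  then have "f \<in> W" for f
    by (subst laurent_expand) (auto simp: single_eq_lconst_lmon intro!: lsubspace_sum[OF Ws] lsubspace_smult[OF Ws])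
  then show ?thesis by blast
qed

text \<open>Applying \<open>D - c\<close> for the eigenvalue \<open>c\<close> of one summand removes it and multiplies the others by nonzero factors.\<close>

lemma eigen_components:
  assumes W: "lsubspace W" and D: "linear_op D" "\<And>f. f \<in> W \<Longrightarrow> D f \<in> W"
  shows "finite A \<Longrightarrow> inj_on c A \<Longrightarrow> (\<And>j. j \<in> A \<Longrightarrow> D (x j) = lconst (c j) * x j) \<Longrightarrow> sum x A \<in> W
    \<Longrightarrow> j \<in> A \<Longrightarrow> x j \<in> W"
proof (induction A arbitrary: x j rule: finite_induct)
  case (insert a A)
  have sumD: "D (sum x B) = (\<Sum>j\<in>B. D (x j))" for B
    by (induction B rule: infinite_finite_induct) (use D(1) linear_op_0 in \<open>auto simp: linear_op_def\<close>)
  define y where "y j = lconst (c j - c a) * x j" for j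
  have "D (sum x (insert a A)) - lconst (c a) * sum x (insert a A) \<in> W"
    using insert.prems by (intro lsubspace_diff[OF W] D(2) lsubspace_smult[OF W])
  also have "D (sum x (insert a A)) - lconst (c a) * sum x (insert a A) = (\<Sum>j\<in>insert a A. y j)"
    unfolding sumD sum_distrib_left sum_subtractf[symmetric]
    by (rule sum.cong) (use insert.prems in \<open>auto simp: y_def lconst_diff left_diff_distrib\<close>)
  also have "\<dots> = sum y A" using insert.hyps by (simp add: y_def)
  finally have yW: "sum y A \<in> W" .
  have xA: "x j \<in> W" if j: "j \<in> A" for j
  proof -
    have "y j \<in> W"
    proof (rule insert.IH[OF _ _ yW j])
      show "inj_on c A" using insert.prems(1) by (simp add: inj_on_insert)
      show "D (y i) = lconst (c i) * y i" if "i \<in> A" for i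
        using D(1) insert.prems(2)[of i] that by (simp add: y_def linear_op_def mult.left_commute)
    qed
    then have "lconst (inverse (c j - c a)) * y j \<in> W" by (rule lsubspace_smult[OF W])
    moreover have "c j - c a \<noteq> 0" using insert.prems(1) insert.hyps j by (auto simp: inj_on_def)
    ultimately show ?thesis by (simp add: y_def flip: mult.assoc lconst_mult)
  qed
  show ?case
  proof (cases "j = a")
    case True
    have eq: "x a = sum x (insert a A) - sum x A" using insert.hyps by simp
    show ?thesis
      unfolding True eq by (rule lsubspace_diff[OF W insert.prems(3) lsubspace_sum[OF W xA]])
  next
    case False
    then show ?thesis using xA insert.prems(4) by blast
  qed
qed simp

text \<open>As \<open>\<pi> = Y T^(-1)\<close>, and \<open>T^(-1)\<close> is a polynomial in \<open>T\<close>.\<close>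

lemma stable_xrefl:
  assumes W: "stable v w W" and nz: "v \<noteq> 0" "w \<noteq> 0" and f: "f \<in> W"
  shows "xrefl v f \<in> W"
proof -
  have Ws: "lsubspace W" using W by (simp add: stable_def)
  have "dl_inv w f \<in> W"
    unfolding dl_inv_def using W f by (intro lsubspace_diff[OF Ws] lsubspace_smult[OF Ws]) (auto simp: stable_def)
  then have "dunkl v w (dl_inv w f) \<in> W" using W by (simp add: stable_def)
  then show ?thesis using nz by (simp add: dunkl_def dl_dl_inv)
qed

lemma stable_lmon: "stable v w W \<Longrightarrow> f \<in> W \<Longrightarrow> lmon 1 * f \<in> W" "stable v w W \<Longrightarrow> f \<in> W \<Longrightarrow> lmon (- 1) * f \<in> W"
proof -
  assume "stable v w W" "f \<in> W"
  moreover have "lmon 1 * (lmon (- 1) * f) = f" by (simp add: lmon_add[symmetric] flip: mult.assoc)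
  ultimately show "lmon 1 * f \<in> W" "lmon (- 1) * f \<in> W" unfolding stable_def by metis+
qed

lemma stable_sum:
  assumes nz: "v \<noteq> 0" "w \<noteq> 0" and A: "stable v w A" and B: "stable v w B"
  shows "stable v w {a + b | a b. a \<in> A \<and> b \<in> B}"
proof -
  let ?S = "{a + b | a b. a \<in> A \<and> b \<in> B}"
  have As: "lsubspace A" and Bs: "lsubspace B" using A B by (auto simp: stable_def)
  have op: "x f \<in> ?S" if fS: "f \<in> ?S" and lin: "linear_op x" and st: "\<And>f. f \<in> A \<Longrightarrow> x f \<in> A" "\<And>f. f \<in> B \<Longrightarrow> x f \<in> B" for x f
  proof -
    obtain a b where ab: "f = a + b" "a \<in> A" "b \<in> B" using fS by auto
    then have "x f = x a + x b" using lin by (simp add: linear_op_def)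
    then show ?thesis using st(1)[OF ab(2)] st(2)[OF ab(3)] by blast
  qed
  have di: "dunkl_inv v w f \<in> W" if "stable v w W" "f \<in> W" for f W
  proof -
    have "dunkl v w (dunkl_inv v w f) \<in> W" using that(2) nz by (simp add: dunkl_dunkl_inv)
    then show ?thesis using that(1) by (simp add: stable_def)
  qed
  show ?thesis
    unfolding stable_def
  proof (intro conjI allI ballI)
    show "lsubspace ?S"
      unfolding lsubspace_def
    proof (intro conjI ballI allI)
      show "0 \<in> ?S" using lsubspace_0[OF As] lsubspace_0[OF Bs] by force
      fix f assume f: "f \<in> ?S"
      then obtain a b where ab: "f = a + b" "a \<in> A" "b \<in> B" by auto
      show "f + g \<in> ?S" if "g \<in> ?S" for g
      proof -
        obtain a' b' where ab': "g = a' + b'" "a' \<in> A" "b' \<in> B" using \<open>g \<in> ?S\<close> by auto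
        have "f + g = (a + a') + (b + b')" by (simp add: ab ab')
        then show ?thesis using lsubspace_add[OF As ab(2) ab'(2)] lsubspace_add[OF Bs ab(3) ab'(3)] by blast
      qed
      show "lconst c * f \<in> ?S" for c
      proof -
        have "lconst c * f = lconst c * a + lconst c * b" by (simp add: ab distrib_left)
        then show ?thesis using lsubspace_smult[OF As ab(2)] lsubspace_smult[OF Bs ab(3)] by blast
      qed
    qed
    fix f
    show "lmon 1 * f \<in> ?S \<longleftrightarrow> f \<in> ?S"
    proof
      assume "lmon 1 * f \<in> ?S"
      then have "lmon (- 1) * (lmon 1 * f) \<in> ?S"
        by (rule op[OF _ linear_op_lmon]) (use stable_lmon(2)[OF A] stable_lmon(2)[OF B] in auto)
      then show "f \<in> ?S" by (simp add: lmon_add[symmetric] flip: mult.assoc)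
    next
      assume "f \<in> ?S"
      then show "lmon 1 * f \<in> ?S"
        by (rule op[OF _ linear_op_lmon]) (use stable_lmon(1)[OF A] stable_lmon(1)[OF B] in auto)
    qed
    show "dunkl v w f \<in> ?S \<longleftrightarrow> f \<in> ?S"
    proof
      assume "dunkl v w f \<in> ?S"
      then have "dunkl_inv v w (dunkl v w f) \<in> ?S"
        by (rule op[OF _ linear_op_dunkl_inv]) (use di[OF A] di[OF B] in auto)
      then show "f \<in> ?S" using nz by (simp add: dunkl_inv_dunkl)
    next
      assume "f \<in> ?S"
      then show "dunkl v w f \<in> ?S"
        by (rule op[OF _ linear_op_dunkl]) (use A B in \<open>auto simp: stable_def\<close>)
    qed
  next
    fix f assume "f \<in> ?S"
    then show "dl w f \<in> ?S"
      by (rule op[OF _ linear_op_dl]) (use A B in \<open>auto simp: stable_def\<close>)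
  qed
qed

lemma stable_ideal_mem: "stable v w J \<Longrightarrow> f \<in> J \<Longrightarrow> f * h \<in> J"
proof (induction h rule: laurent_induct)
  case (monomial n c)
  have Js: "lsubspace J" using monomial(1) by (simp add: stable_def)
  have mon: "lmon n * f \<in> J"
  proof (cases "n \<ge> 0")
    case True
    have "lmon (int m) * f \<in> J" for m
    proof (induction m)
      case (Suc m)
      have eq: "lmon (int (Suc m)) * f = lmon 1 * (lmon (int m) * f)" by (simp add: lmon_add mult.assoc)
      show ?case unfolding eq by (rule stable_lmon(1)[OF monomial(1) Suc])
    qed (use monomial in simp)
    from this[of "nat n"] show ?thesis using True by simp
  next
    case False
    have "lmon (- int m) * f \<in> J" for m
    proof (induction m)
      case (Suc m)
      have "- int (Suc m) = - 1 + - int m" by simp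
      then have eq: "lmon (- int (Suc m)) * f = lmon (- 1) * (lmon (- int m) * f)"
        by (simp only: lmon_add mult.assoc)
      show ?case unfolding eq by (rule stable_lmon(2)[OF monomial(1) Suc])
    qed (use monomial in simp)
    from this[of "nat (- n)"] show ?thesis using False by simp
  qed
  have eq: "f * (lconst c * lmon n) = lconst c * (lmon n * f)" by (simp add: ac_simps)
  show ?case unfolding eq by (rule lsubspace_smult[OF Js mon])
next
  case (add g h)
  then have "lsubspace J" by (simp add: stable_def)
  then show ?case using add by (simp add: distrib_left lsubspace_add)
qed

text \<open>A nonzero ideal is generated by an element of minimal width, which has a root unless it is a monomial.\<close>

lemma stable_common_root:
  assumes J: "stable v w J" and f: "f \<in> J" "f \<noteq> 0" and J1: "1 \<notin> J"
  obtains a where "a \<noteq> 0" "\<And>g. g \<in> J \<Longrightarrow> leval g a = 0"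
proof -
  have Js: "lsubspace J" using J by (simp add: stable_def)
  define P where "P d \<longleftrightarrow> (\<exists>g\<in>J. Poly_Mapping.lookup g 0 \<noteq> 0 \<and> Poly_Mapping.lookup g (int d) \<noteq> 0
    \<and> (\<forall>k. Poly_Mapping.lookup g k \<noteq> 0 \<longrightarrow> 0 \<le> k \<and> k \<le> int d))" for d
  have ex: "\<exists>d. P d \<and> int d \<le> M - m"
    if g: "g \<in> J" "g \<noteq> 0" and sup: "\<And>k. Poly_Mapping.lookup g k \<noteq> 0 \<Longrightarrow> m \<le> k \<and> k \<le> M" for g m M
  proof -
    let ?K = "Poly_Mapping.keys g"
    have K: "finite ?K" "?K \<noteq> {}" using g(2) lookup_eq_0_all[of g] by (auto simp: in_keys_iff)
    define a b where "a = Min ?K" and "b = Max ?K"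
    have ab: "a \<in> ?K" "b \<in> ?K" "\<And>k. k \<in> ?K \<Longrightarrow> a \<le> k \<and> k \<le> b"
      using Min_in[OF K] Max_in[OF K] Min_le[OF K(1)] Max_ge[OF K(1)] by (auto simp: a_def b_def)
    have "g * lmon (- a) \<in> J" by (rule stable_ideal_mem[OF J g(1)])
    then have mem: "lmon (- a) * g \<in> J" by (simp add: mult.commute)
    have "a \<le> b" using ab by blast
    have "P (nat (b - a))"
      unfolding P_def using \<open>a \<le> b\<close> ab by (intro bexI[OF _ mem]) (force simp: in_keys_iff)
    moreover have "m \<le> a" "b \<le> M" using sup ab(1,2) by (auto simp: in_keys_iff)
    ultimately show ?thesis using \<open>a \<le> b\<close> by (intro exI[of _ "nat (b - a)"]) simp
  qed
  obtain K where K: "\<And>k. \<bar>k\<bar> \<ge> K \<Longrightarrow> Poly_Mapping.lookup f (k::int) = 0"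
    using lookup_eventually_0 by metis
  have "\<exists>d. P d \<and> int d \<le> \<bar>K\<bar> - (- \<bar>K\<bar>)"
  proof (rule ex[OF f])
    fix k assume "Poly_Mapping.lookup f k \<noteq> 0"
    then have "\<bar>k\<bar> < K" using K[of k] by linarith
    then show "- \<bar>K\<bar> \<le> k \<and> k \<le> \<bar>K\<bar>" by linarith
  qed
  then have "\<exists>d. P d" by blast
  define d where "d = (LEAST d. P d)"
  have Pd: "P d" and least: "\<And>e. P e \<Longrightarrow> d \<le> e"
    using LeastI_ex[OF \<open>\<exists>d. P d\<close>] Least_le[of P] by (auto simp: d_def)
  obtain p where p: "p \<in> J" "Poly_Mapping.lookup p 0 \<noteq> 0" "Poly_Mapping.lookup p (int d) \<noteq> 0"
    "\<And>k. Poly_Mapping.lookup p k \<noteq> 0 \<Longrightarrow> 0 \<le> k \<and> k \<le> int d"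
    using Pd unfolding P_def by blast
  have "d \<noteq> 0"
  proof
    assume "d = 0"
    then have eq: "Poly_Mapping.lookup p k = (if k = 0 then Poly_Mapping.lookup p 0 else 0)" for k
      using p(4)[of k] by (cases "Poly_Mapping.lookup p k = 0") auto
    define c where "c = Poly_Mapping.lookup p 0"
    have pc: "p = lconst c"
      by (rule poly_mapping_eqI) (unfold lookup_lconst c_def, rule eq)
    have "lconst (inverse c) * lconst c \<in> J"
      using lsubspace_smult[OF Js p(1), of "inverse c"] by (simp only: pc)
    then show False using J1 p(2) by (simp add: c_def flip: lconst_mult)
  qed
  define Q where "Q = (\<Sum>i\<le>d. monom (Poly_Mapping.lookup p (int i)) i)"
  have coQ: "coeff Q i = (if i \<le> d then Poly_Mapping.lookup p (int i) else 0)" for i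
    by (simp add: Q_def coeff_sum)
  have "degree Q = d"
    by (rule antisym[OF degree_le le_degree]) (use p(3) in \<open>auto simp: coQ\<close>)
  then have "\<not> constant (poly Q)" using \<open>d \<noteq> 0\<close> by (simp add: constant_degree)
  then obtain a where a: "poly Q a = 0" using fundamental_theorem_of_algebra by blast
  have "poly Q 0 = Poly_Mapping.lookup p 0" using coQ[of 0] by (simp add: poly_0_coeff_0)
  then have a0: "a \<noteq> 0" using a p(2) by auto
  have "leval p a = (\<Sum>n\<in>int ` {..d}. Poly_Mapping.lookup p n * a powi n)"
    unfolding leval_def
  proof (rule sum.mono_neutral_left)
    show "Poly_Mapping.keys p \<subseteq> int ` {..d}"
    proof
      fix k assume "k \<in> Poly_Mapping.keys p"
      then have "0 \<le> k \<and> k \<le> int d" using p(4) by (simp add: in_keys_iff)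
      then show "k \<in> int ` {..d}" by (intro image_eqI[of _ _ "nat k"]) auto
    qed
  qed (auto simp: in_keys_iff)
  also have "\<dots> = poly Q a"
    by (subst sum.reindex) (auto simp: Q_def poly_sum poly_monom)
  finally have pa: "leval p a = 0" using a by simp
  have "leval g a = 0" if g: "g \<in> J" for g
  proof -
    obtain h r where hr: "g = p * h + r" "\<And>k. Poly_Mapping.lookup r k \<noteq> 0 \<Longrightarrow> 0 < k \<and> k \<le> int d"
      using laurent_reduce[of p 0 "int d" g, OF p(4) p(2,3)] by blast
    have "r \<in> J"
      using lsubspace_diff[OF Js g stable_ideal_mem[OF J p(1), of h]] hr(1) by simp
    have "r = 0"
    proof (rule ccontr)
      assume "r \<noteq> 0"
      have "\<exists>e. P e \<and> int e \<le> int d - 1"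
        by (rule ex[OF \<open>r \<in> J\<close> \<open>r \<noteq> 0\<close>]) (use hr(2) in force)
      then show False using least by force
    qed
    then show ?thesis using hr(1) pa a0 by (simp add: leval_mult)
  qed
  then show ?thesis using that a0 by blast
qed

section \<open>The submodules at roots of unity\<close>

context special
begin

abbreviation "I0 \<equiv> range (\<lambda>h. p0 * h)"

abbreviation "zC C \<equiv> zN + lconst C"

abbreviation "IC C \<equiv> range (\<lambda>h. zC C * h)"

lemma p0_width: "p0 = width_poly N 0"
  by (simp add: width_poly_def)

lemma zC_width: "zC C = width_poly (2 * N) C"
  by (simp add: width_poly_def)

lemma stable_I0: "stable v w I0"
  by (rule stable_ideal[where s = "- 1", OF v0 w0 xrefl_p0(1)]) (simp_all only: xrefl_p0 lconst_uminus lconst_1 mult_minus1, simp)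

lemma stable_IC: "stable v w (IC C)"
  by (rule stable_ideal[where s = 1, OF v0 w0]) (simp_all only: xrefl_add[of _ zN] xrefl_zN xrefl_lconst lconst_1 mult_1_left)

text \<open>A remainder modulo \<open>X^N + X^(-N)\<close> is a combination of vectors \<open>E j\<close> of nonzero norm, so it lies in the
  radical only if it is zero.\<close>

lemma rad0_eq_I0: "rad0 = I0"
proof
  have p: "p0 \<in> rad0" using E_mem_rad0[of "- int N"] by (simp add: E_neg_N lrank_def)
  show "I0 \<subseteq> rad0" using rad0_mult[OF p] by auto
  show "rad0 \<subseteq> I0"
  proof
    fix f assume f: "f \<in> rad0"
    obtain h g where hg: "f = p0 * h + g" "\<And>k. Poly_Mapping.lookup g k \<noteq> 0 \<Longrightarrow> lrank k < 2 * N"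
      using width_reduce[OF N, of f 0] unfolding p0_width[symmetric] by blast
    have g: "g \<in> rad0"
      using lsubspace_diff[OF lsubspace_rad0 f rad0_mult[OF p, of h]] by (simp add: hg(1))
    obtain c where c: "g = (\<Sum>j\<in>{j. lrank j < 2 * N}. lconst (c j) * E v w j)"
      using unitriangular_expand[OF unitriangular_E hg(2)] by blast
    have "c j = 0" if "lrank j < 2 * N" for j
      using rad0_low_rank[OF g[unfolded c] finite_rank_less, of j] that by simp
    then have "g = 0" unfolding c by (intro sum.neutral) simp
    then have "f = p0 * h" using hg(1) by simp
    then show "f \<in> I0" by (rule range_eqI)
  qed
qed

lemma Rad0_I0: "Rad0 v w = I0"
  by (simp only: Rad0_eq rad0_eq_I0)

text \<open>Within each sign the weights have the period \<open>2 N\<close>, and the first \<open>4 N\<close> indices contain \<open>2 N\<close> of each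
  sign.\<close>

lemma lam_inj_on: "inj_on (lam v w) {j. lrank j < 4 * N}"
proof (rule inj_onI)
  fix i j assume ij: "i \<in> {j. lrank j < 4 * N}" "j \<in> {j. lrank j < 4 * N}" "lam v w i = lam v w j"
  have r: "- int (2 * N) < i \<and> i \<le> int (2 * N)" "- int (2 * N) < j \<and> j \<le> int (2 * N)"
    using ij(1,2) rank_less_iff[of _ "2 * N"] by auto
  have s: "(i > 0 \<longleftrightarrow> j > 0)" "int (2 * N) dvd i - j" using ij(3) lam_eq_iff by auto
  have "\<bar>i - j\<bar> < int (2 * N)" using r s(1) by linarith
  then have "i - j = 0" using s(2) dvd_imp_le_int[of "i - j" "int (2 * N)"] by linarith
  then show "i = j" by simp
qed

subsection \<open>Moving between eigenvectors\<close>

lemma up_mem_iff: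
  assumes W: "stable v w W"
  shows "ep v w n \<in> W \<longleftrightarrow> en v w n \<in> W"
proof
  have Ws: "lsubspace W" using W by (simp add: stable_def)
  {
    assume "en v w n \<in> W"
    then show "ep v w n \<in> W"
      unfolding ep_def up_def
      by (intro lsubspace_smult[OF Ws] stable_lmon(1)[OF W] stable_xrefl[OF W v0 w0])
  }
  {
    assume "ep v w n \<in> W"
    then have "lconst (inverse (v ^ n)) * ep v w n \<in> W" by (rule lsubspace_smult[OF Ws])
    then have "lmon 1 * xrefl v (en v w n) \<in> W"
      using v0 by (simp add: ep_def up_def flip: mult.assoc lconst_mult)
    then have "xrefl v (en v w n) \<in> W" using W by (simp add: stable_def)
    then have "xrefl v (xrefl v (en v w n)) \<in> W" by (rule stable_xrefl[OF W v0 w0])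
    then show "en v w n \<in> W" using v0 by (simp add: xrefl_xrefl)
  }
qed

lemma turn_mem:
  assumes W: "stable v w W" and e: "ep v w n \<in> W"
  shows "en v w (Suc n) \<in> W"
proof -
  have Ws: "lsubspace W" using W by (simp add: stable_def)
  show ?thesis
    unfolding en_Suc turn_def
    using W e by (intro lsubspace_smult[OF Ws] lsubspace_diff[OF Ws]) (auto simp: stable_def)
qed

lemma en_mem_mono:
  assumes W: "stable v w W" and e: "en v w n \<in> W" and "n \<le> m"
  shows "en v w m \<in> W"
  using \<open>n \<le> m\<close>
  by (induction m rule: dec_induct) (use e turn_mem[OF W] up_mem_iff[OF W] in auto)

text \<open>The vector \<open>f = ep n\<close> is recovered from \<open>g = T f - a f\<close> by \<open>T g - (c - a) g = (1 + (c - a) a) f\<close>,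
  where \<open>c = w - 1/w\<close>. The factor is \<open>(1 - x) (1 - t^2 x) / (1 - t x)^2\<close> for \<open>x = q^(n + 1)\<close>, which
  vanishes only if \<open>N\<close> divides \<open>n + 1\<close>.\<close>

lemma turn_back:
  assumes W: "stable v w W" and e: "en v w (Suc n) \<in> W" and n: "\<not> N dvd Suc n"
  shows "ep v w n \<in> W"
proof -
  have Ws: "lsubspace W" using W by (simp add: stable_def)
  define f where "f = ep v w n"
  define a where "a = icoef v w (Suc n)"
  define c where "c = w - inverse w"
  define x where "x = v ^ (2 * Suc n)"
  define y where "y = w ^ 2 * x"
  have y: "1 - y \<noteq> 0" using nonres[of "Suc n"] by (simp add: x_def y_def)
  have g: "en v w (Suc n) = lconst w * (dl w f - lconst a * f)"
    by (simp add: en_Suc turn_def f_def a_def)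
  have "lconst (inverse w) * en v w (Suc n) \<in> W" using e by (rule lsubspace_smult[OF Ws])
  then have h: "dl w f - lconst a * f \<in> W"
    unfolding g using w0 by (simp flip: mult.assoc lconst_mult)
  have "dl w (dl w f - lconst a * f) = lconst c * dl w f + f - lconst a * dl w f"
    using w0 by (simp add: dl_diff dl_lconst_times dl_dl c_def)
  also have "\<dots> = lconst (c - a) * (dl w f - lconst a * f) + lconst (1 + (c - a) * a) * f"
    by (simp add: lconst_diff lconst_add lconst_mult algebra_simps)
  finally have "lconst (1 + (c - a) * a) * f
    = dl w (dl w f - lconst a * f) - lconst (c - a) * (dl w f - lconst a * f)" by simp
  moreover have "dl w (dl w f - lconst a * f) \<in> W" using h W by (simp add: stable_def)
  ultimately have m: "lconst (1 + (c - a) * a) * f \<in> W"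
    using lsubspace_diff[OF Ws _ lsubspace_smult[OF Ws h]] by simp
  have "1 + (c - a) * a \<noteq> 0"
  proof -
    have a: "a = c / (1 - y)" by (simp add: a_def c_def icoef_def x_def y_def)
    have c2: "c ^ 2 * w ^ 2 = (w ^ 2 - 1) ^ 2"
      using w0 by (simp add: c_def field_simps power2_eq_square)
    have k: "a * (1 - y) = c" using y by (simp add: a)
    have "(1 + (c - a) * a) * (1 - y) ^ 2 = (1 - y) ^ 2 + c * (1 - y) * (a * (1 - y)) - (a * (1 - y)) ^ 2"
      by (simp add: algebra_simps power2_eq_square)
    also have "\<dots> = (1 - y) ^ 2 - c ^ 2 * y"
      unfolding k by (simp add: algebra_simps power2_eq_square)
    also have "\<dots> = (1 - y) ^ 2 - (w ^ 2 - 1) ^ 2 * x"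
      using c2 by (simp add: y_def flip: mult.assoc)
    also have "\<dots> = (1 - x) * (1 - w ^ 4 * x)"
      by (simp add: y_def algebra_simps power2_eq_square power4_eq_xxxx)
    finally have "(1 + (c - a) * a) * (1 - y) ^ 2 = (1 - x) * (1 - w ^ 4 * x)" .
    moreover have "x \<noteq> 1"
      unfolding x_def v_pow_1_iff by (subst nat_mult_dvd_cancel1) (use n in auto)
    moreover have "w ^ 4 * x \<noteq> 1" using w4_ne[of "Suc n"] by (simp add: x_def)
    ultimately show ?thesis by auto
  qed
  then have "f = lconst (inverse (1 + (c - a) * a)) * (lconst (1 + (c - a) * a) * f)"
    by (simp flip: mult.assoc lconst_mult)
  then show ?thesis using lsubspace_smult[OF Ws m] f_def by metis
qed

text \<open>An element outside of the ideal has a nonzero remainder, which is a combination of eigenvectors with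
  distinct eigenvalues; a submodule contains each of them separately.\<close>

lemma eigenvector_in_submodule:
  assumes W: "stable v w W" and n: "n \<ge> 1" "n \<le> 2 * N"
    and sub: "range (\<lambda>h. width_poly n C * h) \<subseteq> W" and ne: "W \<noteq> range (\<lambda>h. width_poly n C * h)"
  obtains i where "lrank i < 2 * n" "E v w i \<in> W"
proof -
  have Ws: "lsubspace W" using W by (simp add: stable_def)
  obtain f where f: "f \<in> W" "f \<notin> range (\<lambda>h. width_poly n C * h)" using sub ne by blast
  obtain h g where hg: "f = width_poly n C * h + g" "\<And>k. Poly_Mapping.lookup g k \<noteq> 0 \<Longrightarrow> lrank k < 2 * n"
    using width_reduce[OF n(1)] by blast
  have "f - width_poly n C * h \<in> W" using sub by (intro lsubspace_diff[OF Ws f(1)]) blast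
  then have gW: "g \<in> W" using hg(1) by simp
  obtain c where c: "g = (\<Sum>j\<in>{j. lrank j < 2 * n}. lconst (c j) * E v w j)"
    using unitriangular_expand[OF unitriangular_E hg(2)] by blast
  have "\<exists>i. lrank i < 2 * n \<and> c i \<noteq> 0"
  proof (rule ccontr)
    assume "\<not> ?thesis"
    then have "g = 0" unfolding c by (intro sum.neutral) auto
    then show False using f(2) hg(1) by auto
  qed
  then obtain i where i: "lrank i < 2 * n" "c i \<noteq> 0" by blast
  have "lconst (c i) * E v w i \<in> W"
  proof (rule eigen_components[OF Ws linear_op_dunkl, where c = "lam v w" and A = "{j. lrank j < 2 * n}"])
    show "inj_on (lam v w) {j. lrank j < 2 * n}"
      by (rule inj_on_subset[OF lam_inj_on]) (use n in auto)
    show "(\<Sum>j\<in>{j. lrank j < 2 * n}. lconst (c j) * E v w j) \<in> W" using gW c by simp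
    show "dunkl v w f \<in> W" if "f \<in> W" for f using that W by (simp add: stable_def)
    show "dunkl v w (lconst (c j) * E v w j) = lconst (lam v w j) * (lconst (c j) * E v w j)" for j
      by (simp add: dunkl_lconst_times dunkl_E mult.left_commute)
  qed (use i finite_rank_less in auto)
  then have "lconst (inverse (c i)) * (lconst (c i) * E v w i) \<in> W" by (rule lsubspace_smult[OF Ws])
  then have "E v w i \<in> W" using i(2) by (simp flip: mult.assoc lconst_mult)
  then show ?thesis using that i(1) by blast
qed

text \<open>From a vector \<open>E j\<close> with \<open>j\<close> in \<open>(-N, N]\<close> the inverse intertwiners lead down to 1.\<close>

lemma I0_maximal:
  assumes W: "stable v w W" and sub: "I0 \<subseteq> W"
  shows "W = I0 \<or> W = UNIV"
proof (rule disjCI)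
  assume "W \<noteq> UNIV"
  show "W = I0"
  proof (rule ccontr)
    assume "W \<noteq> I0"
    then obtain i where i: "lrank i < 2 * N" "E v w i \<in> W"
      using eigenvector_in_submodule[OF W N, of 0] sub unfolding p0_width[symmetric] by auto
    have dn: "n < N \<Longrightarrow> en v w n \<in> W \<Longrightarrow> en v w 0 \<in> W" for n
    proof (induction n)
      case (Suc n)
      have "\<not> N dvd Suc n" using Suc.prems(1) by (auto dest: dvd_imp_le)
      then have "ep v w n \<in> W" by (rule turn_back[OF W Suc.prems(2)])
      then show ?case using Suc up_mem_iff[OF W] by simp
    qed
    have "\<exists>n<N. en v w n \<in> W"
    proof (cases rule: E_cases[of i])
      case (neg n)
      then show ?thesis using i by (intro exI[of _ n]) (simp add: E_neg rank_less_iff)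
    next
      case (pos n)
      then have "ep v w n \<in> W" "n < N" using i(2) i(1)[unfolded rank_less_iff] unfolding pos E_pos by auto
      then show ?thesis using up_mem_iff[OF W] by blast
    qed
    then have "1 \<in> W" using dn by auto
    then show False using stable_one_imp_UNIV[OF W] \<open>W \<noteq> UNIV\<close> by blast
  qed
qed

text \<open>From a vector \<open>E j\<close> of rank below \<open>4 N\<close> the intertwiners lead up to \<open>e_(-2 N) = z + 2\<close>, which differs
  from \<open>z + C\<close> by a nonzero constant.\<close>

lemma IC_maximal:
  assumes W: "stable v w W" and sub: "IC C \<subseteq> W" and C: "C \<noteq> 2"
  shows "W = IC C \<or> W = UNIV"
proof (rule disjCI)
  have Ws: "lsubspace W" using W by (simp add: stable_def)
  assume "W \<noteq> UNIV"
  show "W = IC C"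
  proof (rule ccontr)
    assume ne: "W \<noteq> IC C"
    have "2 * N \<ge> 1" using N by simp
    then obtain i where i: "lrank i < 2 * (2 * N)" "E v w i \<in> W"
      using eigenvector_in_submodule[OF W, of "2 * N" C] sub ne unfolding zC_width[symmetric] by auto
    have "\<exists>n\<le>2 * N. en v w n \<in> W"
    proof (cases rule: E_cases[of i])
      case (neg n)
      then show ?thesis using i(2) i(1)[unfolded rank_less_iff] unfolding neg E_neg by (intro exI[of _ n]) auto
    next
      case (pos n)
      then have "ep v w n \<in> W" "n \<le> 2 * N" using i(2) i(1)[unfolded rank_less_iff] unfolding pos E_pos by auto
      then show ?thesis using up_mem_iff[OF W] by blast
    qed
    then have "en v w (2 * N) \<in> W" using en_mem_mono[OF W] by blast
    then have "zC 2 \<in> W" using E_neg_2N E_neg[of v w "2 * N"] by simp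
    moreover have "zC C * 1 \<in> IC C" by blast
    then have "zC C \<in> W" using sub by auto
    ultimately have "zC 2 - zC C \<in> W" by (rule lsubspace_diff[OF Ws])
    then have "lconst (2 - C) \<in> W" by (simp add: lconst_diff)
    then have "lconst (inverse (2 - C)) * lconst (2 - C) \<in> W" by (rule lsubspace_smult[OF Ws])
    then have "1 \<in> W" using C by (simp flip: lconst_mult)
    then show False using stable_one_imp_UNIV[OF W] \<open>W \<noteq> UNIV\<close> by blast
  qed
qed

lemma one_not_in: "1 \<notin> I0" "1 \<notin> IC C"
proof -
  have "1 \<notin> range (\<lambda>h. width_poly n C * h)" if "n \<ge> 1" for n C
  proof
    assume "1 \<in> range (\<lambda>h. width_poly n C * h)"
    then have "(1 :: complex laurent) = 0"
      by (rule width_remainder_unique[OF that, rotated]) (use that in \<open>auto simp: lookup_one when_def lrank_def split: if_splits\<close>)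
    then show False by simp
  qed
  from this[of N 0] this[of "2 * N" C] show "1 \<notin> I0" "1 \<notin> IC C"
    using N unfolding p0_width zC_width by auto
qed

text \<open>A maximal \<open>J\<close> has a common root \<open>b\<close>. Adding to \<open>J\<close> the ideal of \<open>z + C\<close> with \<open>C = - z(b)\<close>
  preserves this root, so \<open>z + C\<close> lies in \<open>J\<close>. If \<open>C = 2\<close> then \<open>z + C = p^2\<close> with
  \<open>p = X^N + X^(-N)\<close>, and \<open>{f. p f \<in> J}\<close> is a submodule containing \<open>J\<close>; whether it is \<open>J\<close> or
  everything, it follows that \<open>p \<in> J\<close>.\<close>

lemma maximal_submodules:
  "stable v w J \<and> J \<noteq> UNIV \<and> (\<forall>W. stable v w W \<and> J \<subseteq> W \<longrightarrow> W = J \<or> W = UNIV)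
    \<longleftrightarrow> (\<exists>C. C \<noteq> 2 \<and> J = IC C) \<or> J = I0"
proof
  assume "(\<exists>C. C \<noteq> 2 \<and> J = IC C) \<or> J = I0"
  then show "stable v w J \<and> J \<noteq> UNIV \<and> (\<forall>W. stable v w W \<and> J \<subseteq> W \<longrightarrow> W = J \<or> W = UNIV)"
  proof
    assume "\<exists>C. C \<noteq> 2 \<and> J = IC C"
    then obtain C where C: "C \<noteq> 2" "J = IC C" by blast
    show ?thesis
      unfolding C(2) using stable_IC[of C] one_not_in(2)[of C] IC_maximal[OF _ _ C(1)] by blast
  next
    assume "J = I0"
    then show ?thesis using stable_I0 one_not_in(1) I0_maximal by blast
  qed
next
  assume a: "stable v w J \<and> J \<noteq> UNIV \<and> (\<forall>W. stable v w W \<and> J \<subseteq> W \<longrightarrow> W = J \<or> W = UNIV)"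
  then have J: "stable v w J" and mx: "\<And>W. stable v w W \<Longrightarrow> J \<subseteq> W \<Longrightarrow> W = J \<or> W = UNIV" by blast+
  have Js: "lsubspace J" using J by (simp add: stable_def)
  have J1: "1 \<notin> J" using a stable_one_imp_UNIV[OF J] by blast
  have "J \<noteq> {0}"
  proof
    assume "J = {0}"
    moreover have "0 \<in> I0" by (rule range_eqI[of _ _ 0]) simp
    ultimately have "I0 = {0} \<or> I0 = UNIV" using mx[OF stable_I0] by simp
    moreover have "p0 * 1 \<in> I0" by blast
    moreover have "p0 * 1 \<noteq> 0" using lookup_p0[of "int N"] by auto
    ultimately show False using one_not_in(1) by auto
  qed
  then obtain f where "f \<in> J" "f \<noteq> 0" using lsubspace_0[OF Js] by blast
  then obtain b where b: "b \<noteq> 0" "\<And>g. g \<in> J \<Longrightarrow> leval g b = 0"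
    using stable_common_root[OF J] J1 by blast
  define C where "C = - (b powi (2 * int N) + b powi (- (2 * int N)))"
  let ?S = "{f + g | f g. f \<in> J \<and> g \<in> IC C}"
  have S: "stable v w ?S" by (rule stable_sum[OF v0 w0 J stable_IC])
  have "0 \<in> IC C" by (rule range_eqI[of _ _ 0]) simp
  then have JS: "J \<subseteq> ?S" by force
  have "leval f b = 0" if fS: "f \<in> ?S" for f
  proof -
    obtain g h where "f = g + zC C * h" "g \<in> J" using fS by auto
    then show ?thesis using b by (simp add: leval_add leval_mult C_def)
  qed
  then have "1 \<notin> ?S" by fastforce
  then have "?S = J" using mx[OF S JS] by blast
  moreover have "IC C \<subseteq> ?S" using lsubspace_0[OF Js] by force
  ultimately have CJ: "IC C \<subseteq> J" by simp
  show "(\<exists>C. C \<noteq> 2 \<and> J = IC C) \<or> J = I0"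
  proof (cases "C = 2")
    case False
    then show ?thesis using IC_maximal[OF J CJ False] a by blast
  next
    case True
    define W where "W = {f. p0 * f \<in> J}"
    have W: "stable v w W"
      unfolding stable_def
    proof (intro conjI allI ballI)
      show "lsubspace W"
        unfolding lsubspace_def W_def using lsubspace_0[OF Js] lsubspace_add[OF Js] lsubspace_smult[OF Js]
        by (auto simp: distrib_left mult.left_commute[of p0])
      show "lmon 1 * f \<in> W \<longleftrightarrow> f \<in> W" for f
      proof -
        have e: "p0 * (lmon 1 * f) = lmon 1 * (p0 * f)" by (rule mult.left_commute)
        show ?thesis unfolding W_def mem_Collect_eq e using J by (simp add: stable_def)
      qed
      show "dunkl v w f \<in> W \<longleftrightarrow> f \<in> W" for f
      proof -
        have e: "dunkl v w (p0 * f) = - (p0 * dunkl v w f)"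
          using dunkl_invariant_times[OF xrefl_p0(1) v0] by (simp only: xrefl_p0 mult_minus_left)
        have neg: "- g \<in> J \<longleftrightarrow> g \<in> J" for g using lsubspace_uminus[OF Js, of g] lsubspace_uminus[OF Js, of "- g"] by auto
        have "p0 * dunkl v w f \<in> J \<longleftrightarrow> dunkl v w (p0 * f) \<in> J" unfolding e neg ..
        then show ?thesis using J by (simp add: W_def stable_def)
      qed
      show "dl w f \<in> W" if "f \<in> W" for f
        using that J unfolding W_def stable_def mem_Collect_eq dl_invariant_times[OF xrefl_p0(1), symmetric] by blast
    qed
    have "J \<subseteq> W" using stable_ideal_mem[OF J, of _ p0] by (auto simp: W_def mult.commute)
    then consider "W = J" | "W = UNIV" using mx[OF W] by blast
    then have "p0 \<in> J"
    proof cases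
      case 1
      have "zC 2 * 1 \<in> IC 2" by blast
      then have "p0 * p0 \<in> J" using CJ unfolding True by (auto simp: p0_square)
      then have "p0 \<in> W" by (simp only: W_def mem_Collect_eq)
      then show ?thesis using 1 by simp
    next
      case 2
      then have "1 \<in> W" by simp
      then show ?thesis by (simp add: W_def)
    qed
    then have "I0 \<subseteq> J" using stable_ideal_mem[OF J] by auto
    then show ?thesis using I0_maximal[OF J] a by blast
  qed
qed

end

section \<open>Bases of eigenvectors\<close>

lemma lconst_div_times: "d \<noteq> 0 \<Longrightarrow> lconst (c / d) * (lconst d * f) = lconst c * f"
  by (simp flip: mult.assoc lconst_mult)

text \<open>The scaling factors \<open>d i\<close> allow to treat the families \<open>e\<close> and \<open>\<epsilon>\<close> simultaneously.\<close>

lemma triangular_family_basis: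
  assumes P: "presentation M U (\<lambda>f. f)" and F: "unitriangular F" and d: "\<And>i. d i \<noteq> 0"
    and FU: "\<And>i. i \<in> I \<Longrightarrow> F i \<in> U"
    and span: "\<And>g. g \<in> U \<Longrightarrow> \<exists>A c. finite A \<and> A \<subseteq> I \<and> g = (\<Sum>i\<in>A. lconst (c i) * F i)"
  shows "family_basis M (\<lambda>i. lconst (d i) * F i) I"
proof -
  interpret presentation M U "\<lambda>f. f" by (rule P)
  show ?thesis
  proof (rule family_basisI[where f = "\<lambda>i. lconst (d i) * F i"])
    show "lconst (d i) * F i \<in> U" if "i \<in> I" for i using lsubspace_smult[OF U FU[OF that]] .
  next
    fix A c assume A: "finite A" "A \<subseteq> I" "(\<Sum>i\<in>A. lconst (c i) * (lconst (d i) * F i)) = 0"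
    then have "(\<Sum>i\<in>A. lconst (c i * d i) * F i) = 0" by (simp add: lconst_mult mult.assoc)
    then have "c i * d i = 0" if "i \<in> A" for i by (rule unitriangular_independent[OF F A(1) _ that])
    then show "\<forall>i\<in>A. c i = 0" using d by simp
  next
    fix g assume "g \<in> U"
    then obtain A c where A: "finite A" "A \<subseteq> I" "g = (\<Sum>i\<in>A. lconst (c i) * F i)" using span by blast
    have "g = (\<Sum>i\<in>A. lconst (c i / d i) * (lconst (d i) * F i))"
      unfolding A(3) by (simp only: lconst_div_times[OF d])
    then show "\<exists>A c. finite A \<and> A \<subseteq> I \<and> g = (\<Sum>i\<in>A. lconst (c i) * (lconst (d i) * F i))"
      by (intro exI[of _ A] exI[of _ "\<lambda>i. c i / d i"] conjI A(1,2))
  qed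
qed

section \<open>Interpolation\<close>

definition lagrange :: "complex set \<Rightarrow> complex \<Rightarrow> complex laurent" where
  "lagrange Z a = (\<Prod>b\<in>Z - {a}. lconst (inverse (a - b)) * (lmon 1 - lconst b))"

lemma leval_prod: "x \<noteq> 0 \<Longrightarrow> leval (prod f A) x = (\<Prod>i\<in>A. leval (f i) x)"
  by (induction A rule: infinite_finite_induct) (auto simp: leval_mult)

lemma leval_lagrange:
  assumes "finite Z" "a \<in> Z" "b \<in> Z" "b \<noteq> 0"
  shows "leval (lagrange Z a) b = (if b = a then 1 else 0)"
proof -
  have eq: "leval (lagrange Z a) b = (\<Prod>c\<in>Z - {a}. inverse (a - c) * (b - c))"
    using assms by (simp add: lagrange_def leval_prod leval_mult leval_diff)
  show ?thesis
  proof (cases "b = a")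
    case True
    have "(\<Prod>c\<in>Z - {a}. inverse (a - c) * (b - c)) = 1"
    proof (rule prod.neutral, rule ballI)
      fix c assume "c \<in> Z - {a}"
      then have "a - c \<noteq> 0" by auto
      then show "inverse (a - c) * (b - c) = 1" by (simp add: True)
    qed
    then show ?thesis unfolding eq using True by simp
  next
    case False
    then show ?thesis unfolding eq using assms by (auto intro!: prod_zero bexI[of _ b])
  qed
qed

lemma leval_interpolation:
  assumes "finite Z" "b \<in> Z" "b \<noteq> 0"
  shows "leval (\<Sum>a\<in>Z. lconst (c a) * lagrange Z a) b = c b"
proof -
  have "leval (\<Sum>a\<in>Z. lconst (c a) * lagrange Z a) b = (\<Sum>a\<in>Z. if a = b then c b else 0)"
    unfolding leval_sum leval_lconst_times
    by (rule sum.cong) (use assms leval_lagrange[OF assms(1) _ assms(2,3)] in auto)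
  then show ?thesis using assms by (simp add: sum.delta)
qed

text \<open>Times a power of \<open>X\<close>, this is a polynomial of degree below \<open>2 n\<close>.\<close>

lemma zero_of_many_roots:
  assumes sup: "\<And>k. Poly_Mapping.lookup g k \<noteq> 0 \<Longrightarrow> lrank k < 2 * n" and n: "n \<ge> 1"
    and Z: "2 * n \<le> card Z" "\<And>z. z \<in> Z \<Longrightarrow> z \<noteq> 0 \<and> leval g z = (0::complex)"
  shows "g = 0"
proof -
  define Q where "Q = (\<Sum>i<2 * n. monom (Poly_Mapping.lookup g (int i - int n + 1)) i)"
  have co: "coeff Q i = (if i < 2 * n then Poly_Mapping.lookup g (int i - int n + 1) else 0)" for i
    by (simp add: Q_def coeff_sum)
  have "degree Q \<le> 2 * n - 1"
    by (rule degree_le) (use n in \<open>auto simp: co\<close>)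
  then have deg: "degree Q < 2 * n" using n by linarith
  have root: "poly Q z = 0" if z: "z \<in> Z" for z
  proof -
    have z0: "z \<noteq> 0" using Z(2)[OF z] by simp
    have "leval g z = (\<Sum>k\<in>(\<lambda>i. int i - int n + 1) ` {..<2 * n}. Poly_Mapping.lookup g k * z powi k)"
      unfolding leval_def
    proof (rule sum.mono_neutral_left)
      show "Poly_Mapping.keys g \<subseteq> (\<lambda>i. int i - int n + 1) ` {..<2 * n}"
      proof
        fix k assume "k \<in> Poly_Mapping.keys g"
        then have "lrank k < 2 * n" using sup by (simp add: in_keys_iff)
        then have k: "- int n < k \<and> k \<le> int n" by (simp add: rank_less_iff)
        then show "k \<in> (\<lambda>i. int i - int n + 1) ` {..<2 * n}"
          by (intro image_eqI[of _ _ "nat (k + int n - 1)"]) auto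
      qed
    qed (auto simp: in_keys_iff)
    also have "\<dots> = (\<Sum>i<2 * n. Poly_Mapping.lookup g (int i - int n + 1) * z powi (int i - int n + 1))"
      by (subst sum.reindex) (auto simp: inj_on_def)
    finally have "z powi (int n - 1) * leval g z = (\<Sum>i<2 * n. Poly_Mapping.lookup g (int i - int n + 1) * (z powi (int n - 1) * z powi (int i - int n + 1)))"
      by (simp add: sum_distrib_left mult.left_commute)
    also have "\<dots> = poly Q z"
      using z0 by (simp add: Q_def poly_sum poly_monom flip: power_int_add)
    finally show ?thesis using Z(2)[OF z] by simp
  qed
  have "Q = 0"
  proof (rule ccontr)
    assume "Q \<noteq> 0"
    then have "card Z \<le> card {z. poly Q z = 0}"
      by (intro card_mono poly_roots_finite) (use root in auto)
    also have "\<dots> \<le> degree Q" by (rule card_poly_roots_bound[OF \<open>Q \<noteq> 0\<close>])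
    finally show False using deg Z(1) by simp
  qed
  show ?thesis
  proof (rule lookup_eq_0_all)
    fix k
    show "Poly_Mapping.lookup g k = 0"
    proof (rule ccontr)
      assume nz: "Poly_Mapping.lookup g k \<noteq> 0"
      then have k: "- int n < k \<and> k \<le> int n" using sup by (simp flip: rank_less_iff)
      have "coeff Q (nat (k + int n - 1)) = Poly_Mapping.lookup g k"
        using k by (simp add: co nat_less_iff)
      then show False using nz \<open>Q = 0\<close> by simp
    qed
  qed
qed

lemma leval_root_factor:
  assumes "leval g c = 0" "c \<noteq> (0::complex)"
  obtains h where "g = (lmon 1 - lconst c) * h"
proof -
  have lk: "Poly_Mapping.lookup (lmon 1 - lconst c) k = (if k = 1 then 1 else if k = 0 then - c else 0)" for k
    by (simp add: lookup_minus lookup_lmon lookup_lconst)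
  obtain h r where hr: "g = (lmon 1 - lconst c) * h + r" "\<And>k. Poly_Mapping.lookup r k \<noteq> 0 \<Longrightarrow> 0 < k \<and> k \<le> 1"
    by (rule laurent_reduce[of "lmon 1 - lconst c" 0 1 g]) (use assms(2) in \<open>auto simp: lk split: if_splits\<close>)
  define d where "d = Poly_Mapping.lookup r 1"
  have lr: "Poly_Mapping.lookup r k = (if k = 1 then d else 0)" for k
  proof (cases "k = 1")
    case False
    then have "Poly_Mapping.lookup r k = 0" using hr(2)[of k] by force
    then show ?thesis using False by simp
  qed (simp add: d_def)
  have r: "r = lconst d * lmon 1"
    by (rule poly_mapping_eqI) (simp add: lr lookup_lmon)
  have "leval g c = d * c"
    unfolding hr(1) r using assms(2) by (simp add: leval_add leval_mult leval_diff)
  then have "d = 0" using assms by simp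
  then show ?thesis using that[of h] hr(1) r by simp
qed

context special
begin

subsection \<open>The action of \<open>Y\<close>\<close>

lemma val_nz: "inverse (leval (E v w m) (inverse w)) \<noteq> 0"
  using leval_nz by simp

lemma eps_scaled: "eps v w = (\<lambda>m. lconst (inverse (leval (E v w m) (inverse w))) * E v w m)"
  by (rule ext) (simp add: eps_def)

lemma PP_pres: "presentation (PP v w) UNIV (\<lambda>f. f)"
  using PP_presentation[OF v0 w0] by (simp add: hh_presentation_def)

lemma E_expand: "\<exists>A c. finite A \<and> g = (\<Sum>i\<in>A. lconst (c i) * E v w i)"
proof -
  obtain r where "\<forall>k. Poly_Mapping.lookup g k \<noteq> 0 \<longrightarrow> lrank k < r" using ex_rank_bound by blast
  then obtain c where "g = (\<Sum>j\<in>{j. lrank j < r}. lconst (c j) * E v w j)"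
    using unitriangular_expand[OF unitriangular_E, of g r] by blast
  then show ?thesis using finite_rank_less by blast
qed

lemma basis_scaled: "(\<And>i. d i \<noteq> 0) \<Longrightarrow> family_basis (PP v w) (\<lambda>i. lconst (d i) * E v w i) UNIV"
  by (rule triangular_family_basis[OF PP_pres unitriangular_E]) (use E_expand in auto)

lemma basis_e: "family_basis (PP v w) (e_sp v w) UNIV"
proof -
  have "e_sp v w = (\<lambda>i. lconst 1 * E v w i)" by (rule ext) (simp add: e_sp_eq)
  then show ?thesis using basis_scaled[of "\<lambda>_. 1"] by simp
qed

lemma basis_eps: "family_basis (PP v w) (eps_sp v w) UNIV"
proof -
  have "eps_sp v w = eps v w" by (rule ext) (rule eps_sp_eq)
  show ?thesis unfolding \<open>eps_sp v w = eps v w\<close> eps_scaled by (rule basis_scaled) (rule val_nz)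
qed

text \<open>An element of the radical is orthogonal to the vectors of nonzero norm, so these do not occur in its
  expansion.\<close>

lemma basis_rad0: "family_basis ((PP v w)\<lparr>carrier := Rad0 v w\<rparr>) (eps_sp v w) ({..- int N} \<union> {int N + 1..})"
proof -
  interpret presentation "PP v w" UNIV "\<lambda>f. f" by (rule PP_pres)
  have mem: "m \<in> {..- int N} \<union> {int N + 1..} \<longleftrightarrow> lrank m \<ge> 2 * N" for m
    unfolding not_less[symmetric] rank_less_iff by auto
  have I: "{..- int N} \<union> {int N + 1..} = {m. lrank m \<ge> 2 * N}"
    using mem by blast
  have e: "eps_sp v w = eps v w" by (rule ext) (rule eps_sp_eq)
  show ?thesis
    unfolding Rad0_eq I e eps_scaled
  proof (rule triangular_family_basis[where U = rad0, OF _ unitriangular_E val_nz])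
    show "presentation ((PP v w)\<lparr>carrier := rad0\<rparr>) rad0 (\<lambda>f. f)"
      by (rule sub_presentation[OF lsubspace_rad0 subset_UNIV image_ident[symmetric]])
    show "E v w i \<in> rad0" if "i \<in> {m. 2 * N \<le> lrank m}" for i using E_mem_rad0 that by blast
    fix g assume g: "g \<in> rad0"
    obtain A c where A: "finite A" "g = (\<Sum>i\<in>A. lconst (c i) * E v w i)" using E_expand by blast
    have "c i = 0" if "i \<in> A" "\<not> 2 * N \<le> lrank i" for i
      using rad0_low_rank[OF g[unfolded A(2)] A(1)] that by simp
    then have "g = (\<Sum>i\<in>A \<inter> {m. 2 * N \<le> lrank m}. lconst (c i) * E v w i)"
      unfolding A(2) using A(1) by (intro sum.mono_neutral_right) auto
    then show "\<exists>A c. finite A \<and> A \<subseteq> {m. 2 * N \<le> lrank m} \<and> g = (\<Sum>i\<in>A. lconst (c i) * E v w i)"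
      using A(1) by (intro exI[of _ "A \<inter> {m. 2 * N \<le> lrank m}"] exI[of _ c] conjI) auto
  qed
qed

text \<open>Remainders modulo \<open>X^n + X^(-n) + C\<close> are combinations of the \<open>E j\<close> with \<open>j\<close> in the window, in a unique
  way.\<close>

lemma Y_eigenbasis:
  assumes n: "n \<ge> 1" "n \<le> 2 * N" and KC: "K = range (\<lambda>h. width_poly n C * h)" "stable v w K"
    and d: "\<And>i. d i \<noteq> 0"
  shows "eigenbasis (hh_quotient (PP v w) K) UNIV (\<lambda>f. K +>\<^bsub>PP v w\<^esub> f) (Yop (hh_quotient (PP v w) K))
    {j. lrank j < 2 * n} (\<lambda>j. lconst (d j) * E v w j) (lam v w)"
proof -
  interpret hh_presentation "hh_quotient (PP v w) K" "\<lambda>f. K +>\<^bsub>PP v w\<^esub> f" v w 1 K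
    by (rule PP_quotient[OF v0 w0 KC(2)])
  let ?I = "{j. lrank j < 2 * n}" and ?f = "\<lambda>j. lconst (d j) * E v w j"
  show ?thesis
  proof (intro eigenbasis.intro presentation_axioms eigenbasis_axioms.intro)
    show "finite ?I" by (rule finite_rank_less)
    show "?f i \<in> UNIV" for i by simp
    show "inj_on (lam v w) ?I" by (rule inj_on_subset[OF lam_inj_on]) (use n in auto)
    fix a :: "int \<Rightarrow> complex"
    show "K +>\<^bsub>PP v w\<^esub> (\<Sum>i\<in>?I. lconst (a i) * ?f i) = K +>\<^bsub>PP v w\<^esub> 0 \<Longrightarrow> \<forall>i\<in>?I. a i = 0"
    proof -
      assume "K +>\<^bsub>PP v w\<^esub> (\<Sum>i\<in>?I. lconst (a i) * ?f i) = K +>\<^bsub>PP v w\<^esub> 0"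
      then have mem: "(\<Sum>i\<in>?I. lconst (a i) * ?f i) \<in> range (\<lambda>h. width_poly n C * h)"
        unfolding ker by (simp only: KC(1))
      have eq: "(\<Sum>i\<in>?I. lconst (a i) * ?f i) = (\<Sum>i\<in>?I. lconst (a i * d i) * E v w i)"
        by (simp add: lconst_mult mult.assoc)
      have "(\<Sum>i\<in>?I. lconst (a i * d i) * E v w i) = 0"
      proof (rule width_remainder_unique[OF n(1) _ mem[unfolded eq]])
        fix k assume "Poly_Mapping.lookup (\<Sum>i\<in>?I. lconst (a i * d i) * E v w i) k \<noteq> 0"
        then have "\<exists>i\<in>?I. a i * d i * Poly_Mapping.lookup (E v w i) k \<noteq> 0"
          unfolding lookup_sum lookup_lconst_times by (rule sum.not_neutral_contains_not_neutral) blast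
        then obtain i where i: "lrank i < 2 * n" "Poly_Mapping.lookup (E v w i) k \<noteq> 0" by auto
        then have "lrank k \<le> lrank i" using unitriangular_E unfolding unitriangular_def by blast
        then show "lrank k < 2 * n" using i(1) by simp
      qed
      then have "a i * d i = 0" if "i \<in> ?I" for i
        by (rule unitriangular_independent[OF unitriangular_E finite_rank_less _ that])
      then show ?thesis using d by simp
    qed
    show "Yop (hh_quotient (PP v w) K) (K +>\<^bsub>PP v w\<^esub> (\<Sum>i\<in>?I. lconst (a i) * ?f i))
      = K +>\<^bsub>PP v w\<^esub> (\<Sum>i\<in>?I. lconst (lam v w i * a i) * ?f i)"
    proof -
      have "lconst 1 * dunkl v w (\<Sum>i\<in>?I. lconst (a i) * ?f i) = (\<Sum>i\<in>?I. lconst (a i) * dunkl v w (?f i))"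
        using linear_op_lincomb[OF linear_op_dunkl] by simp
      also have "\<dots> = (\<Sum>i\<in>?I. lconst (lam v w i * a i) * ?f i)"
        by (simp add: dunkl_lconst_times dunkl_E lconst_mult ac_simps)
      finally show ?thesis unfolding Y by simp
    qed
  next
    fix g
    obtain h r where hr: "g = width_poly n C * h + r" "\<And>k. Poly_Mapping.lookup r k \<noteq> 0 \<Longrightarrow> lrank k < 2 * n"
      using width_reduce[OF n(1)] by blast
    obtain c where c: "r = (\<Sum>j\<in>?I. lconst (c j) * E v w j)"
      using unitriangular_expand[OF unitriangular_E hr(2)] by blast
    have "(\<Sum>j\<in>?I. lconst (c j / d j) * ?f j) = r"
      unfolding c by (simp only: lconst_div_times[OF d])
    moreover have "g - r \<in> K" unfolding KC(1) hr(1) by (intro range_eqI[of _ _ h]) simp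
    ultimately show "\<exists>a. K +>\<^bsub>PP v w\<^esub> g = K +>\<^bsub>PP v w\<^esub> (\<Sum>i\<in>?I. lconst (a i) * ?f i)"
      by (intro exI[of _ "\<lambda>j. c j / d j"]) (simp only: phi_eq_iff)
  qed
qed

lemma rank_less_set: "{j. lrank j < 2 * n} = {- int n + 1..int n}"
  by (auto simp: rank_less_iff)

lemma card_rank_less: "card {j. lrank j < 2 * n} = 2 * n"
  by (simp add: rank_less_set)

abbreviation "quot K \<equiv> hh_quotient (PP v w) K"

lemma I0_eigenbasis: "eigenbasis (quot I0) UNIV (\<lambda>f. I0 +>\<^bsub>PP v w\<^esub> f) (Yop (quot I0)) {- int N + 1..int N} (eps v w) (lam v w)"
  unfolding eps_scaled rank_less_set[symmetric]
  by (rule Y_eigenbasis[where C = 0, OF N _ _ stable_I0 val_nz]) (auto simp: p0_width)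

lemma IC_eigenbasis: "eigenbasis (quot (IC C)) UNIV (\<lambda>f. IC C +>\<^bsub>PP v w\<^esub> f) (Yop (quot (IC C))) {j. lrank j < 4 * N} (eps v w) (lam v w)"
proof -
  have "eigenbasis (quot (IC C)) UNIV (\<lambda>f. IC C +>\<^bsub>PP v w\<^esub> f) (Yop (quot (IC C))) {j. lrank j < 2 * (2 * N)} (eps v w) (lam v w)"
    unfolding eps_scaled
    by (rule Y_eigenbasis[where C = C, OF _ _ _ stable_IC val_nz]) (use N in \<open>auto simp: zC_width\<close>)
  then show ?thesis by simp
qed

lemma card_4N: "card {j. lrank j < 4 * N} = 4 * N"
  using card_rank_less[of "2 * N"] by simp

lemma I0_irreducible: "hh_irreducible v w (quot I0)"
proof -
  interpret hh_presentation "quot I0" "\<lambda>f. I0 +>\<^bsub>PP v w\<^esub> f" v w 1 I0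
    by (rule PP_quotient[OF v0 w0 stable_I0])
  show ?thesis unfolding irreducible_iff[OF refl] using I0_maximal one_not_in(1) by blast
qed

lemma irreducible_quotients:
  "hh_submodule J (PP v w) \<and> hh_irreducible v w (quot J) \<longleftrightarrow> (\<exists>C. C \<noteq> 2 \<and> J = IC C) \<or> J = I0"
proof -
  have "stable v w J \<and> hh_irreducible v w (quot J)
    \<longleftrightarrow> stable v w J \<and> J \<noteq> UNIV \<and> (\<forall>W. stable v w W \<and> J \<subseteq> W \<longrightarrow> W = J \<or> W = UNIV)"
  proof (rule conj_cong[OF refl])
    assume J: "stable v w J"
    interpret hh_presentation "quot J" "\<lambda>f. J +>\<^bsub>PP v w\<^esub> f" v w 1 J
      by (rule PP_quotient[OF v0 w0 J])
    show "hh_irreducible v w (quot J) \<longleftrightarrow> J \<noteq> UNIV \<and> (\<forall>W. stable v w W \<and> J \<subseteq> W \<longrightarrow> W = J \<or> W = UNIV)"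
      by (rule irreducible_iff[OF refl])
  qed
  then show ?thesis unfolding hh_submodule_PP_iff[OF v0 w0] maximal_submodules .
qed

subsection \<open>The action of \<open>X\<close>\<close>

text \<open>A remainder modulo \<open>z + C\<close> vanishing at \<open>4 N\<close> points is zero.\<close>

lemma IC_iff_vanish:
  assumes Z: "card Z = 4 * N" "\<And>a. a \<in> Z \<Longrightarrow> a \<noteq> 0 \<and> leval (zC C) a = 0"
  shows "f \<in> IC C \<longleftrightarrow> (\<forall>a\<in>Z. leval f a = 0)"
proof
  assume "f \<in> IC C"
  then obtain h where h: "f = zC C * h" by (rule rangeE)
  show "\<forall>a\<in>Z. leval f a = 0"
  proof
    fix a assume a: "a \<in> Z"
    have a0: "a \<noteq> 0" "leval (zC C) a = 0" using Z(2)[OF a] by blast+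
    show "leval f a = 0" unfolding h by (simp only: leval_mult[OF a0(1)] a0(2) mult_zero_left)
  qed
next
  assume v: "\<forall>a\<in>Z. leval f a = 0"
  have n: "2 * N \<ge> 1" using N by simp
  obtain h g where hg: "f = zC C * h + g" "\<And>k. Poly_Mapping.lookup g k \<noteq> 0 \<Longrightarrow> lrank k < 2 * (2 * N)"
    using width_reduce[OF n, of f C] unfolding zC_width[symmetric] by blast
  have "g = 0"
  proof (rule zero_of_many_roots[OF hg(2) n])
    show "2 * (2 * N) \<le> card Z" using Z(1) by simp
    fix z assume z: "z \<in> Z"
    have z0: "z \<noteq> 0" "leval (zC C) z = 0" using Z(2)[OF z] by blast+
    have "leval f z = leval g z"
      unfolding hg(1) leval_add[of "zC C * h"] leval_mult[OF z0(1)] z0(2) by simp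
    then show "z \<noteq> 0 \<and> leval g z = 0" using z0(1) v z by simp
  qed
  then have "f = zC C * h" using hg(1) by simp
  then show "f \<in> IC C" by (rule range_eqI)
qed

text \<open>The interpolation polynomials of the \<open>4 N\<close> roots are eigenvectors of \<open>X\<close> modulo \<open>z + C\<close>.\<close>

lemma X_eigenbasis:
  assumes Z: "card Z = 4 * N" "\<And>a. a \<in> Z \<Longrightarrow> a \<noteq> 0 \<and> leval (zC C) a = 0"
  shows "eigenbasis (quot (IC C)) UNIV (\<lambda>f. IC C +>\<^bsub>PP v w\<^esub> f) (Xop (quot (IC C))) Z (lagrange Z) (\<lambda>a. a)"
proof -
  interpret hh_presentation "quot (IC C)" "\<lambda>f. IC C +>\<^bsub>PP v w\<^esub> f" v w 1 "IC C"
    by (rule PP_quotient[OF v0 w0 stable_IC])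
  have van: "f \<in> IC C \<longleftrightarrow> (\<forall>a\<in>Z. leval f a = 0)" for f
    by (rule IC_iff_vanish[OF Z(1)]) (rule Z(2))
  have fin: "finite Z" using Z(1) N by (intro card_ge_0_finite) simp
  have ev: "leval (\<Sum>i\<in>Z. lconst (a i) * lagrange Z i) b = a b" if "b \<in> Z" for a b
    using leval_interpolation[OF fin that] Z(2)[OF that] by blast
  show ?thesis
  proof (intro eigenbasis.intro presentation_axioms eigenbasis_axioms.intro fin)
    fix a :: "complex \<Rightarrow> complex"
    show "\<forall>i\<in>Z. a i = 0" if h: "IC C +>\<^bsub>PP v w\<^esub> (\<Sum>i\<in>Z. lconst (a i) * lagrange Z i) = IC C +>\<^bsub>PP v w\<^esub> 0"
      using h unfolding ker van using ev by simp
    show "Xop (quot (IC C)) (IC C +>\<^bsub>PP v w\<^esub> (\<Sum>i\<in>Z. lconst (a i) * lagrange Z i))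
      = IC C +>\<^bsub>PP v w\<^esub> (\<Sum>i\<in>Z. lconst (i * a i) * lagrange Z i)"
      unfolding X phi_eq_iff van
    proof
      fix b assume b: "b \<in> Z"
      then show "leval (lmon 1 * (\<Sum>i\<in>Z. lconst (a i) * lagrange Z i) - (\<Sum>i\<in>Z. lconst (i * a i) * lagrange Z i)) b = 0"
        unfolding leval_diff ev[OF b, of "\<lambda>i. i * a i"] using Z(2)[OF b] by (simp add: leval_mult ev[OF b])
    qed
  next
    fix g
    have "g - (\<Sum>i\<in>Z. lconst (leval g i) * lagrange Z i) \<in> IC C"
      unfolding van
    proof
      fix b assume b: "b \<in> Z"
      show "leval (g - (\<Sum>i\<in>Z. lconst (leval g i) * lagrange Z i)) b = 0"
        unfolding leval_diff ev[OF b] by simp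
    qed
    then show "\<exists>a. IC C +>\<^bsub>PP v w\<^esub> g = IC C +>\<^bsub>PP v w\<^esub> (\<Sum>i\<in>Z. lconst (a i) * lagrange Z i)"
      unfolding phi_eq_iff by blast
  qed auto
qed

lemma leval_zC: "a \<noteq> 0 \<Longrightarrow> leval (zC C) a = a ^ (2 * N) + inverse (a ^ (2 * N)) + C"
proof -
  have "a powi (2 * int N) = a ^ (2 * N)" "a powi (- (2 * int N)) = inverse (a ^ (2 * N))"
    using power_int_of_nat[of a "2 * N"] by (simp_all add: power_int_minus)
  then show ?thesis by (simp only: leval_add leval_lmon leval_lconst)
qed

text \<open>The equation is \<open>u + 1/u + C = 0\<close> for \<open>u = X^(2 N)\<close>, with two different solutions.\<close>

lemma X_roots:
  assumes "C \<noteq> 2" "C \<noteq> - 2"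
  obtains Z where "card Z = 4 * N" "\<And>a. a \<in> Z \<Longrightarrow> a \<noteq> 0 \<and> leval (zC C) a = 0"
proof -
  define s where "s = csqrt (C ^ 2 - 4)"
  have s2: "s * s = C ^ 2 - 4" unfolding s_def by (metis power2_csqrt power2_eq_square)
  have "C ^ 2 - 4 = (C - 2) * (C + 2)" by (simp add: algebra_simps power2_eq_square)
  moreover have "C + 2 \<noteq> 0" using assms(2) by (simp add: eq_neg_iff_add_eq_0)
  ultimately have "s \<noteq> 0" using s2 assms(1) by auto
  define u1 u2 where "u1 = (- C + s) / 2" and "u2 = (- C - s) / 2"
  have sum: "u1 + u2 = - C" by (simp add: u1_def u2_def field_simps)
  have "u1 * u2 = (C ^ 2 - s * s) / 4" by (simp add: u1_def u2_def algebra_simps power2_eq_square)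
  then have prod: "u1 * u2 = 1" using s2 by simp
  have ne: "u1 \<noteq> u2" using \<open>s \<noteq> 0\<close> by (simp add: u1_def u2_def eq_neg_iff_add_eq_0)
  have nz: "u1 \<noteq> 0" "u2 \<noteq> 0" using prod by auto
  define Z where "Z = {z. z ^ (2 * N) = u1} \<union> {z. z ^ (2 * N) = u2}"
  have N2: "2 * N > 0" using N by simp
  have c: "card {z. z ^ (2 * N) = u1} = 2 * N" "card {z. z ^ (2 * N) = u2} = 2 * N"
    using card_nth_roots[OF _ N2] nz by auto
  have "finite {z. z ^ (2 * N) = u1}" "finite {z. z ^ (2 * N) = u2}"
    using c N2 by (auto intro: card_ge_0_finite)
  then have "card Z = 4 * N"
    unfolding Z_def using ne c by (subst card_Un_disjoint) auto
  moreover have "a \<noteq> 0 \<and> leval (zC C) a = 0" if a: "a \<in> Z" for a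
  proof -
    have au: "a ^ (2 * N) = u1 \<or> a ^ (2 * N) = u2" using a by (simp add: Z_def)
    have "a \<noteq> 0"
    proof
      assume "a = 0"
      then have "a ^ (2 * N) = 0" using N2 by (simp add: power_0_left)
      then show False using au nz by auto
    qed
    moreover have "inverse u1 = u2" "inverse u2 = u1" using prod by (auto simp: inverse_unique mult.commute)
    then have "a ^ (2 * N) + inverse (a ^ (2 * N)) = - C" using au sum by (auto simp: add.commute)
    ultimately show ?thesis unfolding leval_zC[OF \<open>a \<noteq> 0\<close>] by simp
  qed
  ultimately show ?thesis using that by blast
qed

lemma X_semisimple:
  assumes "C \<noteq> 2" "C \<noteq> - 2"
  shows "semisimple (quot (IC C)) (Xop (quot (IC C)))" "simple_weights (quot (IC C)) (Xop (quot (IC C)))"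
proof -
  obtain Z where "card Z = 4 * N" "\<And>a. a \<in> Z \<Longrightarrow> a \<noteq> 0 \<and> leval (zC C) a = 0"
    using X_roots[OF assms] by blast
  then interpret eigenbasis "quot (IC C)" UNIV "\<lambda>f. IC C +>\<^bsub>PP v w\<^esub> f" "Xop (quot (IC C))" Z "lagrange Z" "\<lambda>a. a"
    by (rule X_eigenbasis)
  show "semisimple (quot (IC C)) (Xop (quot (IC C)))" "simple_weights (quot (IC C)) (Xop (quot (IC C)))"
    by (rule semisimple simple_weights)+
qed

text \<open>Now \<open>z - 2\<close> is, up to a unit, the square of \<open>G = X^(2 N) - 1\<close>, and \<open>G\<close> is separable. So every
  eigenvector of \<open>X\<close> modulo \<open>z - 2\<close> is annihilated by \<open>G\<close>, whereas \<open>G\<close> itself is not a multiple of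
  \<open>z - 2\<close>.\<close>

lemma X_not_semisimple: "\<not> semisimple (quot (IC (- 2))) (Xop (quot (IC (- 2))))"
proof
  interpret hh_presentation "quot (IC (- 2))" "\<lambda>f. IC (- 2) +>\<^bsub>PP v w\<^esub> f" v w 1 "IC (- 2)"
    by (rule PP_quotient[OF v0 w0 stable_IC])
  interpret V: vectorspace CC "quot (IC (- 2))" by (rule vs)
  assume ss: "semisimple (quot (IC (- 2))) (Xop (quot (IC (- 2))))"
  let ?K = "IC (- 2)" and ?\<phi> = "\<lambda>f. IC (- 2) +>\<^bsub>PP v w\<^esub> f"
  define n where "n = 2 * int N"
  define G where "G = (lmon n - 1 :: complex laurent)"
  have inv: "lmon n * (lmon (- n) * h) = h" for h :: "complex laurent"
    by (simp add: lmon_add[symmetric] flip: mult.assoc)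
  have G2: "G * G = lmon n * zC (- 2)"
  proof -
    have "lmon n * zC (- 2) = lmon n * lmon n + lmon n * lmon (- n) - (lmon n + lmon n)"
    proof -
      have "lconst (- 2) = (- 1 - 1 :: complex laurent)"
        using lconst_add[of 1 "1 :: complex"] by (simp add: lconst_uminus)
      then have "zC (- 2) = lmon n + lmon (- n) - 1 - 1" by (simp only: n_def) simp
      then show ?thesis by (simp only:) (simp add: algebra_simps)
    qed
    also have "lmon n * lmon (- n) = (1 :: complex laurent)" by (simp add: lmon_add[symmetric])
    also have "lmon n * lmon n + 1 - (lmon n + lmon n) = G * G" by (simp add: G_def algebra_simps)
    finally show ?thesis ..
  qed
  have G2_mem: "G * G * h \<in> ?K" for h
    by (rule range_eqI[of _ _ "lmon n * h"]) (simp only: G2 ac_simps)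
  define S where "S = {f. G * f \<in> ?K}"
  have S: "lsubspace S"
    unfolding S_def lsubspace_def using lsubspace_0[OF K_sub] lsubspace_add[OF K_sub] lsubspace_smult[OF K_sub]
    by (simp add: distrib_left mult.left_commute[of G])
  have KS: "?K \<subseteq> S"
    unfolding S_def using stable_ideal_mem[OF stable_IC, of _ _ G] by (simp add: mult.commute[of G] subset_iff)
  have eig: "f \<in> S" if f: "lmon 1 * f - lconst c * f \<in> ?K" for f c
  proof (cases "c = 0")
    case True
    then have "lmon 1 * f \<in> ?K" using f by simp
    then have "f \<in> ?K" using K by (simp add: stable_def)
    then show ?thesis using KS by blast
  next
    case False
    let ?x = "lmon 1 - lconst c :: complex laurent"
    have x0: "?x \<noteq> 0"
    proof
      assume "?x = 0"
      then have "Poly_Mapping.lookup ?x 1 = 0" by simp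
      then show False by (simp add: lookup_minus lookup_lmon lookup_lconst)
    qed
    have cancel: "a = b" if "?x * a = ?x * b" for a b using that by (simp only: mult_left_cancel[OF x0])
    obtain h where "lmon 1 * f - lconst c * f = zC (- 2) * h" using f by (rule rangeE)
    then have "?x * f = lmon n * zC (- 2) * (lmon (- n) * h)"
      using inv[of h] by (simp only: left_diff_distrib mult.assoc mult.left_commute[of "lmon n"])
    then have xf: "?x * f = G * G * (lmon (- n) * h)" by (simp only: G2)
    show ?thesis
    proof (cases "leval G c = 0")
      case True
      \<comment> \<open>One factor \<open>X - c\<close> is cancelled against one of the two copies of \<open>G\<close>.\<close>
      obtain G' where G': "G = ?x * G'" using leval_root_factor[OF True False] by blast
      have "?x * f = ?x * (G' * G * (lmon (- n) * h))"
        unfolding xf by (subst (1) G') (simp only: mult.assoc)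
      then have "f = G' * G * (lmon (- n) * h)" by (rule cancel)
      then have "G * f = G * G * (G' * (lmon (- n) * h))" by (simp only: ac_simps)
      then show ?thesis unfolding S_def mem_Collect_eq using G2_mem by (simp only:)
    next
      case nz: False
      \<comment> \<open>If \<open>c\<close> is no root of \<open>G\<close>, the cofactor is divisible by \<open>X - c\<close>.\<close>
      have "leval (?x * f) c = 0" using False by (simp add: leval_mult leval_diff)
      then have "leval G c * leval G c * leval (lmon (- n) * h) c = 0"
        unfolding xf by (simp only: leval_mult[OF False])
      then have "leval (lmon (- n) * h) c = 0" using nz by simp
      then obtain h' where h': "lmon (- n) * h = ?x * h'" using leval_root_factor False by blast
      have "?x * f = ?x * (G * G * h')" unfolding xf h' by (simp only: ac_simps)
      then have "f = G * G * h'" by (rule cancel)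
      then have "f \<in> ?K" using G2_mem by simp
      then show ?thesis using KS by blast
    qed
  qed
  have "(\<Union>c. eigenspace (quot ?K) (Xop (quot ?K)) c) \<subseteq> ?\<phi> ` S"
  proof safe
    fix x c assume "x \<in> eigenspace (quot ?K) (Xop (quot ?K)) c"
    then obtain f where "x = ?\<phi> f" "Xop (quot ?K) (?\<phi> f) = c \<odot>\<^bsub>quot ?K\<^esub> ?\<phi> f"
      by (auto simp: eigenspace_def carr)
    then have "x = ?\<phi> f" "f \<in> S" using eig[of f c] by (simp_all add: X smult phi_eq_iff)
    then show "x \<in> ?\<phi> ` S" by (rule image_eqI)
  qed
  then have "V.span (\<Union>c. eigenspace (quot ?K) (Xop (quot ?K)) c) \<subseteq> ?\<phi> ` S"
    using V.span_is_subset submodule_image[OF S] by blast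
  then have "?\<phi> 1 \<in> ?\<phi> ` S" using ss unfolding semisimple_def carr by blast
  then obtain f where "f \<in> S" "?\<phi> 1 = ?\<phi> f" by blast
  then have "1 - f \<in> S" using KS phi_eq_iff by blast
  then have "1 - f + f \<in> S" using \<open>f \<in> S\<close> by (rule lsubspace_add[OF S])
  then have GK: "G \<in> ?K" by (simp add: S_def)
  have lk: "Poly_Mapping.lookup G k = (if k = n then 1 else if k = 0 then - 1 else 0)" for k
    using N lookup_lconst[of "1::complex" k] by (simp add: G_def n_def lookup_minus lookup_lmon)
  have "G = 0"
  proof (rule width_remainder_unique[of "2 * N"])
    show "G \<in> range (\<lambda>h. width_poly (2 * N) (- 2) * h)" using GK unfolding zC_width .
    show "lrank k < 2 * (2 * N)" if "Poly_Mapping.lookup G k \<noteq> 0" for k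
      unfolding rank_less_iff using that N by (auto simp: lk n_def split: if_splits)
  qed (use N in simp)
  then show False using lk[of n] by simp
qed

end

section \<open>The evaluation pairing\<close>

context special
begin

lemma lam_nz: "lam v w m \<noteq> 0"
  using v0 w0 by (simp add: lam_powi)

lemma dunkl_inv_E: "dunkl_inv v w (E v w m) = lconst (inverse (lam v w m)) * E v w m"
proof -
  have "lconst (lam v w m) * dunkl_inv v w (E v w m) = dunkl_inv v w (dunkl v w (E v w m))"
    using linear_op_dunkl_inv by (simp add: dunkl_E linear_op_def)
  then have "lconst (lam v w m) * dunkl_inv v w (E v w m) = E v w m"
    by (simp only: dunkl_inv_dunkl[OF v0 w0])
  then have "lconst (inverse (lam v w m)) * (lconst (lam v w m) * dunkl_inv v w (E v w m))
    = lconst (inverse (lam v w m)) * E v w m" by (simp only:)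
  then show ?thesis using lam_nz by (simp flip: mult.assoc lconst_mult)
qed

lemma Y_power_eq: "Y_power v w n = (if n \<ge> 0 then dunkl v w ^^ nat n else dunkl_inv v w ^^ nat (- n))"
proof -
  have "inv_into UNIV (dunkl v w) = dunkl_inv v w"
    by (rule inv_equality) (simp_all only: dunkl_inv_dunkl[OF v0 w0] dunkl_dunkl_inv[OF v0 w0])
  then show ?thesis by (simp add: Y_power_def Y_op_eq_dunkl)
qed

lemma linear_op_funpow: "linear_op x \<Longrightarrow> linear_op (x ^^ n)"
  by (induction n) (auto simp: linear_op_def)

lemma linear_op_Y_power: "linear_op (Y_power v w n)"
  unfolding Y_power_eq by (auto intro: linear_op_funpow linear_op_dunkl linear_op_dunkl_inv)

lemma funpow_eigen:
  assumes "linear_op x" "x f = lconst c * f"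
  shows "(x ^^ n) f = lconst (c ^ n) * f"
proof (induction n)
  case (Suc n)
  have "(x ^^ Suc n) f = lconst (c ^ n) * x f" using Suc assms(1) by (simp add: linear_op_def)
  then show ?case by (simp add: assms(2) lconst_mult ac_simps)
qed simp

lemma Y_power_E: "Y_power v w n (E v w m) = lconst (lam v w m powi n) * E v w m"
proof (cases "n \<ge> 0")
  case True
  then show ?thesis
    unfolding Y_power_eq using funpow_eigen[OF linear_op_dunkl dunkl_E, of "nat n" m] by (simp add: power_int_def)
next
  case False
  then show ?thesis
    unfolding Y_power_eq using funpow_eigen[OF linear_op_dunkl_inv dunkl_inv_E, of "nat (- n)" m] by (simp add: power_int_def)
qed

text \<open>On \<open>E m\<close> the operator \<open>f(Y^(-1))\<close> acts as the scalar \<open>f(1 / lam m)\<close>.\<close>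

lemma curly_form_E: "curly_form v w f (E v w m) = leval f (inverse (lam v w m)) * leval (E v w m) (inverse w)"
proof -
  have "curly_form v w f (E v w m)
    = (\<Sum>n\<in>Poly_Mapping.keys f. Poly_Mapping.lookup f n * (lam v w m powi (- n) * leval (E v w m) (inverse w)))"
    by (simp add: curly_form_def Y_power_E leval_sum leval_lconst_times)
  also have "\<dots> = leval f (inverse (lam v w m)) * leval (E v w m) (inverse w)"
    unfolding leval_def[of f] sum_distrib_right
    by (intro sum.cong refl) (simp add: power_int_inverse power_int_minus mult.assoc)
  finally show ?thesis .
qed

lemma curly_form_lincomb: "curly_form v w f (\<Sum>i\<in>A. lconst (c i) * g i) = (\<Sum>i\<in>A. c i * curly_form v w f (g i))"
proof -
  have "curly_form v w f (\<Sum>i\<in>A. lconst (c i) * g i)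
    = (\<Sum>n\<in>Poly_Mapping.keys f. Poly_Mapping.lookup f n * (\<Sum>i\<in>A. c i * leval (Y_power v w (- n) (g i)) (inverse w)))"
    unfolding curly_form_def leval_sum leval_lconst_times linear_op_lincomb[OF linear_op_Y_power] ..
  also have "\<dots> = (\<Sum>n\<in>Poly_Mapping.keys f. \<Sum>i\<in>A. c i * (Poly_Mapping.lookup f n * leval (Y_power v w (- n) (g i)) (inverse w)))"
    by (simp add: sum_distrib_left mult.left_commute)
  also have "\<dots> = (\<Sum>i\<in>A. \<Sum>n\<in>Poly_Mapping.keys f. c i * (Poly_Mapping.lookup f n * leval (Y_power v w (- n) (g i)) (inverse w)))"
    by (rule sum.swap)
  also have "\<dots> = (\<Sum>i\<in>A. c i * curly_form v w f (g i))"
    unfolding curly_form_def leval_sum leval_lconst_times sum_distrib_left ..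
  finally show ?thesis .
qed

text \<open>The vectors \<open>E m\<close> form a basis and have nonzero values at \<open>1/w\<close>.\<close>

lemma Rad_iff: "f \<in> Rad v w \<longleftrightarrow> (\<forall>m. leval f (inverse (lam v w m)) = 0)"
proof
  assume f: "f \<in> Rad v w"
  show "\<forall>m. leval f (inverse (lam v w m)) = 0"
  proof
    fix m
    have "curly_form v w f (E v w m) = 0" using f by (simp add: Rad_def)
    then show "leval f (inverse (lam v w m)) = 0" using leval_nz[of m] by (simp add: curly_form_E)
  qed
next
  assume z: "\<forall>m. leval f (inverse (lam v w m)) = 0"
  have "curly_form v w f g = 0" for g
  proof -
    obtain A c where g: "g = (\<Sum>i\<in>A. lconst (c i) * E v w i)" using E_expand by blast
    show ?thesis unfolding g curly_form_lincomb curly_form_E using z by simp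
  qed
  then show "f \<in> Rad v w" by (simp add: Rad_def)
qed

text \<open>The index of rank below \<open>4 N\<close> with the same eigenvalue of \<open>Y\<close>.\<close>

definition rank_rep :: "int \<Rightarrow> int" where
  "rank_rep m = (if m > 0 then (m - 1) mod (2 * int N) + 1 else - ((- m) mod (2 * int N)))"

lemma rank_rep: "lrank (rank_rep m) < 4 * N" "lam v w (rank_rep m) = lam v w m"
proof -
  have b1: "0 \<le> (m - 1) mod (2 * int N)" "(m - 1) mod (2 * int N) < 2 * int N"
    and b2: "0 \<le> (- m) mod (2 * int N)" "(- m) mod (2 * int N) < 2 * int N" using N by simp_all
  have pos: "rank_rep m = (m - 1) mod (2 * int N) + 1" if "m > 0" using that by (simp add: rank_rep_def)
  have neg: "rank_rep m = - ((- m) mod (2 * int N))" if "\<not> m > 0" using that by (simp add: rank_rep_def)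
  have "- (2 * int N) < rank_rep m \<and> rank_rep m \<le> 2 * int N"
  proof (cases "m > 0")
    case True
    show ?thesis unfolding pos[OF True] using b1 by linarith
  next
    case False
    show ?thesis unfolding neg[OF False] using b2 by linarith
  qed
  then show "lrank (rank_rep m) < 4 * N" using rank_less_iff[of "rank_rep m" "2 * N"] by simp
  have "rank_rep m > 0 \<longleftrightarrow> m > 0"
  proof (cases "m > 0")
    case True
    show ?thesis unfolding pos[OF True] using b1 True by linarith
  next
    case False
    show ?thesis unfolding neg[OF False] using b2 False by linarith
  qed
  moreover have "int (2 * N) dvd rank_rep m - m"
  proof (cases "m > 0")
    case True
    have "rank_rep m - m = 2 * int N * (- ((m - 1) div (2 * int N)))"
      using mult_div_mod_eq[of "2 * int N" "m - 1"] unfolding pos[OF True] mult_minus_right by linarith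
    then show ?thesis by simp
  next
    case False
    have "rank_rep m - m = 2 * int N * ((- m) div (2 * int N))"
      using mult_div_mod_eq[of "2 * int N" "- m"] unfolding neg[OF False] by linarith
    then show ?thesis by simp
  qed
  ultimately show "lam v w (rank_rep m) = lam v w m" unfolding lam_eq_iff by blast
qed

text \<open>The points \<open>q^(m_#)\<close>, which are the inverse eigenvalues of \<open>Y\<close>.\<close>

definition spec :: "complex set" where
  "spec = (\<lambda>m. inverse (lam v w m)) ` {j. lrank j < 4 * N}"

lemma inverse_lam_spec: "inverse (lam v w m) \<in> spec"
  unfolding spec_def using rank_rep[of m] by (intro image_eqI[of _ _ "rank_rep m"]) auto

lemma card_spec: "card spec = 4 * N"
proof -
  have "inj_on (\<lambda>m. inverse (lam v w m)) {j. lrank j < 4 * N}"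
    using lam_inj_on by (auto simp: inj_on_def)
  then show ?thesis unfolding spec_def by (simp add: card_image card_4N)
qed

definition Ct :: complex where
  "Ct = - (w ^ (2 * N) + inverse (w ^ (2 * N)))"

lemma spec_roots: "a \<in> spec \<Longrightarrow> a \<noteq> 0 \<and> leval (zC Ct) a = 0"
proof -
  assume "a \<in> spec"
  then obtain m where a: "a = inverse (lam v w m)" by (auto simp: spec_def)
  have a0: "a \<noteq> 0" using lam_nz a by simp
  have vp: "(v powi j) ^ (2 * N) = 1" for j
  proof -
    have "(v powi j) ^ (2 * N) = (v ^ (2 * N)) powi j"
      by (metis power_int_mult power_int_of_nat mult.commute)
    then show ?thesis by (simp only: root power_int_1_left)
  qed
  have "a ^ (2 * N) = w ^ (2 * N) \<or> a ^ (2 * N) = inverse (w ^ (2 * N))"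
    unfolding a lam_powi using vp[of "- m"] by (auto simp: power_mult_distrib power_inverse)
  then have "a ^ (2 * N) + inverse (a ^ (2 * N)) + Ct = 0" by (auto simp: Ct_def)
  then show ?thesis unfolding leval_zC[OF a0] using a0 by simp
qed

lemma Rad_eq: "Rad v w = IC Ct"
proof -
  have "f \<in> Rad v w \<longleftrightarrow> (\<forall>a\<in>spec. leval f a = 0)" for f
  proof
    show "\<forall>a\<in>spec. leval f a = 0" if "f \<in> Rad v w" using that by (auto simp: Rad_iff spec_def)
    show "f \<in> Rad v w" if "\<forall>a\<in>spec. leval f a = 0" unfolding Rad_iff using that inverse_lam_spec by blast
  qed
  moreover have "f \<in> IC Ct \<longleftrightarrow> (\<forall>a\<in>spec. leval f a = 0)" for f
    by (rule IC_iff_vanish[OF card_spec]) (rule spec_roots)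
  ultimately show ?thesis by blast
qed

text \<open>The \<open>2 N\<close> powers of \<open>v\<close> are distinct, and there are only \<open>2 N\<close> roots.\<close>

lemma root_of_unity_powi:
  assumes "z ^ (2 * N) = 1"
  shows "\<exists>j::int. z = v powi j"
proof -
  have N2: "2 * N > 0" using N by simp
  have inj: "inj_on (\<lambda>j. v ^ j) {..<2 * N}"
  proof (rule inj_onI)
    fix i j assume ij: "i \<in> {..<2 * N}" "j \<in> {..<2 * N}" "v ^ i = v ^ j"
    then have "int (2 * N) dvd int i - int j" using v_powi_eq_iff[of "int i" "int j"] by simp
    then have "int i - int j = 0" using ij dvd_imp_le_int[of "int i - int j" "int (2 * N)"] by force
    then show "i = j" by simp
  qed
  have "(\<lambda>j. v ^ j) ` {..<2 * N} = {z. z ^ (2 * N) = 1}"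
  proof (rule card_subset_eq)
    show "finite {z::complex. z ^ (2 * N) = 1}" using card_roots_unity_eq[OF N2] N2 by (intro card_ge_0_finite) simp
    show "(\<lambda>j. v ^ j) ` {..<2 * N} \<subseteq> {z. z ^ (2 * N) = 1}"
    proof safe
      fix j
      have "(v ^ j) ^ (2 * N) = (v ^ (2 * N)) ^ j" by (simp only: power_mult[symmetric] mult.commute)
      then show "(v ^ j) ^ (2 * N) = 1" by (simp only: root power_one)
    qed
    show "card ((\<lambda>j. v ^ j) ` {..<2 * N}) = card {z::complex. z ^ (2 * N) = 1}"
      using card_image[OF inj] card_roots_unity_eq[OF N2] by simp
  qed
  then obtain j where "z = v ^ j" using assms by blast
  then show ?thesis by (intro exI[of _ "int j"]) simp
qed

text \<open>With \<open>u = t^N\<close>, equality to 2 or -2 would mean \<open>u = -1\<close> or \<open>u = 1\<close>; then \<open>t\<close> would be a \<open>2 N\<close>-th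
  root of unity, hence a power of \<open>v\<close>.\<close>

lemma Ct_ne: "Ct \<noteq> 2" "Ct \<noteq> - 2"
proof -
  define u where "u = w ^ (2 * N)"
  have u0: "u \<noteq> 0" using w0 by (simp add: u_def)
  have "u ^ 2 \<noteq> 1"
  proof
    assume "u ^ 2 = 1"
    then have "(w ^ 2) ^ (2 * N) = 1" by (simp add: u_def power_mult[symmetric] mult.commute)
    then obtain j where "w ^ 2 = v powi j" using root_of_unity_powi by blast
    then have "w ^ 2 * v powi (- j) = 1" using v0 by (simp add: power_int_minus)
    then show False using w2_v by blast
  qed
  then have "u \<noteq> 1" "u \<noteq> - 1" by auto
  have eq: "(u + inverse u - c) * u = u ^ 2 - c * u + 1" for c
    using u0 by (simp add: algebra_simps power2_eq_square)
  have "(u - 1) ^ 2 = u ^ 2 - 2 * u + 1" "(u + 1) ^ 2 = u ^ 2 - (- 2) * u + 1"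
    by (simp_all add: algebra_simps power2_eq_square)
  moreover have "(u - 1) ^ 2 \<noteq> 0" "(u + 1) ^ 2 \<noteq> 0"
    using \<open>u \<noteq> 1\<close> \<open>u \<noteq> - 1\<close> by (auto simp: add_eq_0_iff2)
  ultimately have ne: "u + inverse u \<noteq> 2" "u + inverse u \<noteq> - 2"
    using eq[of 2] eq[of "- 2"] by auto
  show "Ct \<noteq> 2"
  proof
    assume "Ct = 2"
    then have "u + inverse u = - 2" unfolding u_def Ct_def by (metis minus_minus)
    then show False using ne by simp
  qed
  show "Ct \<noteq> - 2"
  proof
    assume "Ct = - 2"
    then have "u + inverse u = 2" unfolding u_def Ct_def by (metis minus_minus)
    then show False using ne by simp
  qed
qed

lemma leval_eps: "leval (eps v w m) (inverse w) = 1"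
  using leval_nz by (simp add: eps_def leval_lconst_times)

lemma lam_0: "lam v w 0 = w"
  by (simp add: lam_def)

text \<open>Both vectors have the same eigenvalue, and the weights of \<open>Y\<close> in the quotient are simple; so their
  difference is proportional to a vector \<open>\<epsilon>_i\<close> modulo the ideal. Evaluation at \<open>t^(-1/2)\<close>, which
  is one of the roots, shows that the factor is zero.\<close>

lemma eps_diff_mem:
  assumes l: "lam v w m = lam v w n"
  shows "eps v w m - eps v w n \<in> IC Ct"
proof -
  interpret hh_presentation "quot (IC Ct)" "\<lambda>f. IC Ct +>\<^bsub>PP v w\<^esub> f" v w 1 "IC Ct"
    by (rule PP_quotient[OF v0 w0 stable_IC])
  interpret Y: eigenbasis "quot (IC Ct)" UNIV "\<lambda>f. IC Ct +>\<^bsub>PP v w\<^esub> f" "Yop (quot (IC Ct))" "{j. lrank j < 4 * N}" "eps v w" "lam v w"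
    by (rule IC_eigenbasis)
  let ?f = "eps v w m - eps v w n" and ?\<phi> = "\<lambda>f. IC Ct +>\<^bsub>PP v w\<^esub> f"
  let ?i = "rank_rep m"
  have i: "?i \<in> {j. lrank j < 4 * N}" "lam v w ?i = lam v w m" using rank_rep by auto
  have dunkl_eps: "dunkl v w (eps v w j) = lconst (lam v w j) * eps v w j" for j
    by (simp add: eps_def dunkl_lconst_times dunkl_E mult.left_commute)
  have "dunkl v w ?f = lconst (lam v w m) * ?f"
    unfolding dunkl_diff dunkl_eps l right_diff_distrib ..
  then have "?\<phi> ?f \<in> eigenspace (quot (IC Ct)) (Yop (quot (IC Ct))) (lam v w ?i)"
    unfolding i(2) by (simp add: eigenspace_def carr Y smult)
  then have "?\<phi> ?f \<in> ?\<phi> ` {lconst b * eps v w ?i | b. True}"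
    unfolding Y.eigenspace_member[OF i(1)] .
  then obtain b where b: "?\<phi> ?f = ?\<phi> (lconst b * eps v w ?i)" by auto
  then have mem: "?f - lconst b * eps v w ?i \<in> IC Ct" by (simp only: phi_eq_iff)
  then have "?f - lconst b * eps v w ?i \<in> Rad v w" unfolding Rad_eq .
  then have "leval (?f - lconst b * eps v w ?i) (inverse w) = 0"
    unfolding Rad_iff using lam_0 by metis
  then have "b = 0" by (simp add: leval_diff leval_lconst_times leval_eps)
  then show ?thesis using mem by simp
qed

text \<open>Modulo the differences, every polynomial is a combination of the \<open>\<epsilon>_i\<close> of rank below \<open>4 N\<close>, and
  these are independent modulo the ideal.\<close>

lemma span_eps_differences:
  "LinearCombinations.module.span CC (PP v w) {eps v w m - eps v w n | m n. lam v w m = lam v w n} = IC Ct"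
proof -
  interpret Q: hh_presentation "quot (IC Ct)" "\<lambda>f. IC Ct +>\<^bsub>PP v w\<^esub> f" v w 1 "IC Ct"
    by (rule PP_quotient[OF v0 w0 stable_IC])
  interpret Y: eigenbasis "quot (IC Ct)" UNIV "\<lambda>f. IC Ct +>\<^bsub>PP v w\<^esub> f" "Yop (quot (IC Ct))" "{j. lrank j < 4 * N}" "eps v w" "lam v w"
    by (rule IC_eigenbasis)
  interpret presentation "PP v w" UNIV "\<lambda>f. f" by (rule PP_pres)
  interpret V: vectorspace CC "PP v w" by (rule vs)
  let ?D = "{eps v w m - eps v w n | m n. lam v w m = lam v w n}" and ?I = "{j. lrank j < 4 * N}"
  let ?T = "V.span ?D"
  have DC: "?D \<subseteq> carrier (PP v w)" by (simp add: PP_simps)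
  have DT: "?D \<subseteq> ?T" by (rule V.in_own_span[OF DC])
  interpret T: LinearCombinations.submodule CC ?T "PP v w" by (rule V.span_is_submodule[OF DC])
  have T: "lsubspace ?T"
    unfolding lsubspace_def using T.m_closed T.zero_closed T.smult_closed by (simp add: PP_simps)
  have "LinearCombinations.submodule CC (IC Ct) (PP v w)"
    using submodule_image[OF Q.K_sub subset_UNIV] by simp
  moreover have "?D \<subseteq> IC Ct" using eps_diff_mem by blast
  ultimately have TI: "?T \<subseteq> IC Ct" by (intro V.span_is_subset)
  \<comment> \<open>The subspace spanned by the differences and the vectors of rank below \<open>4 N\<close>; it contains all
    \<open>\<epsilon>_m\<close>.\<close>
  define S where "S = {f. \<exists>s\<in>?T. \<exists>c. f = s + (\<Sum>i\<in>?I. lconst (c i) * eps v w i)}"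
  have S: "lsubspace S"
    unfolding lsubspace_def
  proof (intro conjI ballI allI)
    show "0 \<in> S" unfolding S_def using lsubspace_0[OF T] by (intro CollectI bexI[of _ 0] exI[of _ "\<lambda>_. 0"]) simp_all
  next
    fix f g assume "f \<in> S" "g \<in> S"
    then obtain s c s' c' where *: "s \<in> ?T" "s' \<in> ?T" "f = s + (\<Sum>i\<in>?I. lconst (c i) * eps v w i)"
      "g = s' + (\<Sum>i\<in>?I. lconst (c' i) * eps v w i)" unfolding S_def by blast
    have eq: "f + g = (s + s') + (\<Sum>i\<in>?I. lconst (c i + c' i) * eps v w i)"
      unfolding *(3,4) lconst_add distrib_right sum.distrib by (simp only: ac_simps)
    show "f + g \<in> S"
      unfolding S_def by (rule CollectI, rule bexI[OF _ lsubspace_add[OF T *(1,2)]], rule exI, rule eq)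
  next
    fix b f assume "f \<in> S"
    then obtain s c where *: "s \<in> ?T" "f = s + (\<Sum>i\<in>?I. lconst (c i) * eps v w i)" unfolding S_def by blast
    have eq: "lconst b * f = lconst b * s + (\<Sum>i\<in>?I. lconst (b * c i) * eps v w i)"
      unfolding *(2) distrib_left sum_distrib_left lconst_mult mult.assoc ..
    show "lconst b * f \<in> S"
      unfolding S_def by (rule CollectI, rule bexI[OF _ lsubspace_smult[OF T *(1)]], rule exI, rule eq)
  qed
  have eS: "eps v w m \<in> S" for m
  proof -
    let ?i = "rank_rep m"
    have mem: "eps v w m - eps v w ?i \<in> ?T" using DT rank_rep(2)[of m] by (intro subsetD[OF DT]) (blast intro: sym)
    have "(\<Sum>j\<in>?I. lconst (if j = ?i then 1 else 0) * eps v w j) = lconst 1 * eps v w ?i"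
      by (rule Y.single_sum) (use rank_rep(1) in simp)
    then have eq: "eps v w m = (eps v w m - eps v w ?i) + (\<Sum>j\<in>?I. lconst (if j = ?i then 1 else 0) * eps v w j)"
      by simp
    show ?thesis unfolding S_def by (rule CollectI, rule bexI[OF _ mem], rule exI, rule eq)
  qed
  have "IC Ct \<subseteq> ?T"
  proof
    fix f assume f: "f \<in> IC Ct"
    obtain A c where A: "f = (\<Sum>i\<in>A. lconst (c i) * E v w i)" using E_expand by blast
    have "E v w i \<in> S" for i
      by (subst E_eq_eps) (rule lsubspace_smult[OF S eS])
    then have "f \<in> S" unfolding A by (intro lsubspace_sum[OF S] lsubspace_smult[OF S])
    then obtain s c where s: "s \<in> ?T" "f = s + (\<Sum>i\<in>?I. lconst (c i) * eps v w i)" unfolding S_def by blast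
    have "f - s \<in> IC Ct" using lsubspace_diff[OF Q.K_sub f] TI s(1) by blast
    then have "(\<Sum>i\<in>?I. lconst (c i) * eps v w i) \<in> IC Ct" using s(2) by simp
    then have "\<forall>i\<in>?I. c i = 0" by (intro Y.indep) (simp only: Q.ker)
    then have "(\<Sum>i\<in>?I. lconst (c i) * eps v w i) = 0" by (intro sum.neutral) simp
    then show "f \<in> ?T" using s by simp
  qed
  then show ?thesis using TI by blast
qed

section \<open>The reducible quotient\<close>

text \<open>For \<open>p = X^N + X^(-N)\<close> the ideal of \<open>z + 2 = p^2\<close> is contained in that of \<open>p\<close>, and multiplication by
  \<open>p\<close> identifies \<open>P/(p)\<close> with \<open>(p)/(p^2)\<close>. As \<open>\<pi>(p) = - p\<close>, it anticommutes with \<open>Y\<close> and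
  commutes with \<open>X\<close> and \<open>T\<close>.\<close>

lemma V2_filtration:
  defines "V2 \<equiv> quot (IC 2)" and "V2N \<equiv> quot I0"
  shows "is_hh_module v w V2" "\<exists>W. hh_submodule W V2 \<and> hh_iso (V2\<lparr>carrier := W\<rparr>) (twist_y V2N) \<and> hh_iso (hh_quotient V2 W) V2N"
proof -
  let ?\<phi> = "\<lambda>f. IC 2 +>\<^bsub>PP v w\<^esub> f" and ?\<psi> = "\<lambda>f. I0 +>\<^bsub>PP v w\<^esub> f"
  interpret V: hh_presentation V2 ?\<phi> v w 1 "IC 2"
    unfolding V2_def by (rule PP_quotient[OF v0 w0 stable_IC])
  interpret U: hh_presentation V2N ?\<psi> v w 1 I0
    unfolding V2N_def by (rule PP_quotient[OF v0 w0 stable_I0])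
  show "is_hh_module v w V2" by (rule V.is_module[OF refl])
  have p0_nz: "p0 \<noteq> 0"
  proof
    assume "p0 = 0"
    then have "Poly_Mapping.lookup p0 (int N) = 0" by simp
    then show False by (simp only: lookup_p0) simp
  qed
  have zC2: "zC 2 * h = p0 * (p0 * h)" for h by (simp only: p0_square[symmetric] mult.assoc)
  have sub: "IC 2 \<subseteq> I0"
  proof
    fix f assume "f \<in> IC 2"
    then obtain h where "f = zC 2 * h" by (rule rangeE)
    then show "f \<in> I0" unfolding zC2 by (rule range_eqI)
  qed
  have mem: "p0 * h \<in> IC 2 \<longleftrightarrow> h \<in> I0" for h
  proof
    assume "p0 * h \<in> IC 2"
    then obtain g where "p0 * h = zC 2 * g" by (rule rangeE)
    then have "h = p0 * g" unfolding zC2 mult_left_cancel[OF p0_nz] .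
    then show "h \<in> I0" by (rule range_eqI)
  next
    assume "h \<in> I0"
    then obtain g where "h = p0 * g" by (rule rangeE)
    then have "p0 * h = zC 2 * g" by (simp only: zC2)
    then show "p0 * h \<in> IC 2" by (rule range_eqI)
  qed
  define W where "W = ?\<phi> ` I0"
  have A: "hh_presentation (V2\<lparr>carrier := W\<rparr>) (\<lambda>h. ?\<phi> (p0 * h)) v w (- 1) I0"
  proof
    show "lsubspace UNIV" by (rule lsubspace_UNIV)
    show "carrier (V2\<lparr>carrier := W\<rparr>) = (\<lambda>h. ?\<phi> (p0 * h)) ` UNIV" by (simp add: W_def image_image)
    show "\<zero>\<^bsub>V2\<lparr>carrier := W\<rparr>\<^esub> = ?\<phi> (p0 * 0)" by (simp add: V.zero)
    show "?\<phi> (p0 * f) \<oplus>\<^bsub>V2\<lparr>carrier := W\<rparr>\<^esub> ?\<phi> (p0 * g) = ?\<phi> (p0 * (f + g))" for f g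
      using V.add[of "p0 * f" "p0 * g"] by (simp only: distrib_left[of p0]) simp
    show "c \<odot>\<^bsub>V2\<lparr>carrier := W\<rparr>\<^esub> ?\<phi> (p0 * f) = ?\<phi> (p0 * (lconst c * f))" for c f
      using V.smult[of "p0 * f" c] by (simp only: mult.left_commute[of p0]) simp
    show "v \<noteq> 0" "w \<noteq> 0" "- 1 * - 1 = (1::complex)" "stable v w I0"
      by (rule v0, rule w0, simp, rule stable_I0)
    show "?\<phi> (p0 * f) = ?\<phi> (p0 * 0) \<longleftrightarrow> f \<in> I0" for f
      using V.ker[of "p0 * f"] by (simp only: mem mult_zero_right)
    show "Xop (V2\<lparr>carrier := W\<rparr>) (?\<phi> (p0 * f)) = ?\<phi> (p0 * (lmon 1 * f))" for f
      using V.X[of "p0 * f"] by (simp only: mult.left_commute[of p0]) simp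
    show "Yop (V2\<lparr>carrier := W\<rparr>) (?\<phi> (p0 * f)) = ?\<phi> (p0 * (lconst (- 1) * dunkl v w f))" for f
    proof -
      have e: "lconst 1 * dunkl v w (p0 * f) = p0 * (lconst (- 1) * dunkl v w f)"
        unfolding dunkl_invariant_times[OF xrefl_p0(1) v0] xrefl_p0(2)
        by (simp only: lconst_1 mult_1_left mult_minus_left lconst_uminus mult_minus_right)
      show ?thesis using V.Y[of "p0 * f"] unfolding e by simp
    qed
    show "Top (V2\<lparr>carrier := W\<rparr>) (?\<phi> (p0 * f)) = ?\<phi> (p0 * dl w f)" for f
      using V.T[of "p0 * f"] unfolding dl_invariant_times[OF xrefl_p0(1)] by simp
  qed
  have B: "hh_presentation (twist_y V2N) ?\<psi> v w (- 1) I0"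
  proof
    show "lsubspace UNIV" by (rule lsubspace_UNIV)
    show "carrier (twist_y V2N) = ?\<psi> ` UNIV" "\<zero>\<^bsub>twist_y V2N\<^esub> = ?\<psi> 0"
      by (simp_all add: twist_y_def U.carr U.zero)
    show "?\<psi> f \<oplus>\<^bsub>twist_y V2N\<^esub> ?\<psi> g = ?\<psi> (f + g)" for f g by (simp add: twist_y_def U.add)
    show "c \<odot>\<^bsub>twist_y V2N\<^esub> ?\<psi> f = ?\<psi> (lconst c * f)" for c f by (simp add: twist_y_def U.smult)
    show "v \<noteq> 0" "w \<noteq> 0" "- 1 * - 1 = (1::complex)" "stable v w I0"
      by (rule v0, rule w0, simp, rule stable_I0)
    show "?\<psi> f = ?\<psi> 0 \<longleftrightarrow> f \<in> I0" for f by (rule U.ker)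
    show "Xop (twist_y V2N) (?\<psi> f) = ?\<psi> (lmon 1 * f)" "Top (twist_y V2N) (?\<psi> f) = ?\<psi> (dl w f)" for f
      by (simp_all add: twist_y_def U.X U.T)
    show "Yop (twist_y V2N) (?\<psi> f) = ?\<psi> (lconst (- 1) * dunkl v w f)" for f
    proof -
      have "lconst (- 1) * dunkl v w f = - dunkl v w f" by (simp add: lconst_uminus)
      then show ?thesis by (simp add: twist_y_def U.Y U.uminus_eq)
    qed
  qed
  have C: "hh_presentation (hh_quotient V2 W) (\<lambda>f. W +>\<^bsub>V2\<^esub> ?\<phi> f) v w 1 I0"
    unfolding W_def by (rule V.quotient_presentation[OF stable_I0 sub refl])
  have "hh_submodule W V2" unfolding W_def by (rule V.image_submodule[OF stable_I0 refl])
  moreover have "hh_iso (V2\<lparr>carrier := W\<rparr>) (twist_y V2N)" by (rule hh_iso_presentations[OF A B])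
  moreover have "hh_iso (hh_quotient V2 W) V2N" by (rule hh_iso_presentations[OF C U.hh_presentation_axioms])
  ultimately show "\<exists>W. hh_submodule W V2 \<and> hh_iso (V2\<lparr>carrier := W\<rparr>) (twist_y V2N) \<and> hh_iso (hh_quotient V2 W) V2N"
    by blast
qed

end

section \<open>Weights as exponents\<close>

lemma qpow_add: "qpow l (a + b) = qpow l a * qpow l b"
  and qpow_minus: "qpow l (- a) = inverse (qpow l a)"
  and qpow_diff: "qpow l (a - b) = qpow l a / qpow l b"
  and qpow_nz: "qpow l a \<noteq> 0"
  by (simp_all add: qpow_def distrib_left exp_add exp_minus right_diff_distrib exp_diff)

lemma qpow_of_nat: "qpow l (of_nat n * a) = qpow l a ^ n"
  by (simp add: qpow_def exp_of_nat_mult[symmetric] mult.left_commute)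

lemma qpow_of_int: "qpow l (of_int j * a) = qpow l a powi j"
proof (cases "j \<ge> 0")
  case True
  then obtain n where "j = int n" by (rule nonneg_int_cases)
  then show ?thesis by (simp add: qpow_of_nat)
next
  case False
  then obtain n where "j = - int n" using nonpos_int_cases by (metis linorder_linear)
  then show ?thesis by (simp add: qpow_of_nat qpow_minus power_int_minus)
qed

text \<open>The numbers \<open>v\<close> and \<open>w\<close> are now given with a logarithm of \<open>q\<close>, as the weights are exponents.\<close>

locale exponents = special N v w for N v w +
  fixes l k :: complex
  assumes v_exp: "v = qpow l (1 / 2)" and w_exp: "w = qpow l (k / 2)"
begin

lemma qpow_period: "qpow l (z + of_int j * of_nat N) = qpow l z"
proof -
  have "qpow l (of_nat N) = qpow l (of_nat (2 * N) * (1 / 2))" by simp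
  also have "\<dots> = 1" unfolding qpow_of_nat v_exp[symmetric] by (rule root)
  finally show ?thesis by (simp add: qpow_add qpow_of_int)
qed

lemma lam_exp: "lam v w m = qpow l (- nsharp k m)"
proof (cases "m > 0")
  case True
  have "- nsharp k m = of_int (- m) * (1 / 2) + - (k / 2)" using True by (simp add: nsharp_def field_simps)
  then show ?thesis using True
    unfolding lam_powi by (simp only: qpow_add qpow_of_int qpow_minus v_exp w_exp mult.commute if_True)
next
  case False
  have "- nsharp k m = of_int (- m) * (1 / 2) + k / 2" using False by (simp add: nsharp_def field_simps)
  then show ?thesis using False
    unfolding lam_powi by (simp only: qpow_add qpow_of_int v_exp w_exp mult.commute if_False)
qed

text \<open>Congruence of the weights modulo \<open>N\<close> is equality of the eigenvalues: the exponent determines the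
  eigenvalue since \<open>q^N = 1\<close>, and conversely the sign of the index and its residue modulo \<open>2 N\<close> are known
  from the eigenvalue.\<close>

lemma nsharp_modN_iff: "nsharp k n \<in> modN N (nsharp k m) \<longleftrightarrow> lam v w m = lam v w n"
proof
  assume "nsharp k n \<in> modN N (nsharp k m)"
  then obtain j where "nsharp k n = nsharp k m + of_int j * of_nat N" by (auto simp: modN_def)
  then have "qpow l (nsharp k n) = qpow l (nsharp k m)" by (simp only: qpow_period)
  then show "lam v w m = lam v w n" by (simp only: lam_exp qpow_minus)
next
  assume "lam v w m = lam v w n"
  then have *: "m > 0 \<longleftrightarrow> n > 0" "int (2 * N) dvd m - n" by (auto simp only: lam_eq_iff)
  then obtain j where j: "m - n = int (2 * N) * j" by (elim dvdE)
  then have "n = m - 2 * int N * j" by simp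
  then have eq: "(of_int n :: complex) = of_int m - 2 * (of_nat N * of_int j)" by simp
  have "nsharp k n = nsharp k m + of_int (- j) * of_nat N"
    using *(1) by (simp add: nsharp_def eq diff_divide_distrib add_divide_distrib mult.commute)
  then show "nsharp k n \<in> modN N (nsharp k m)" unfolding modN_def by blast
qed

lemma modN_shift: "modN N (z + of_int j * of_nat N) = modN N z"
proof -
  have "\<exists>i'. z + of_int j * of_nat N + of_int i * of_nat N = z + of_int i' * of_nat N"
    "\<exists>i'. z + of_int i * of_nat N = z + of_int j * of_nat N + of_int i' * of_nat N" for i :: int
    by (rule exI[of _ "j + i"], simp add: distrib_right, rule exI[of _ "i - j"], simp add: left_diff_distrib)
  then show ?thesis unfolding modN_def by auto
qed

lemma modN_eq_iff: "modN N y = modN N z \<longleftrightarrow> y \<in> modN N z"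
proof
  assume "modN N y = modN N z"
  moreover have "y \<in> modN N y" unfolding modN_def by (intro CollectI exI[of _ 0]) simp
  ultimately show "y \<in> modN N z" by simp
qed (auto simp: modN_def[of N z] modN_shift)

lemma bowtie_eq: "bowtie N k = (\<lambda>i. modN N (nsharp k i)) ` {j. lrank j < 4 * N}"
proof
  show "bowtie N k \<subseteq> (\<lambda>i. modN N (nsharp k i)) ` {j. lrank j < 4 * N}"
  proof
    fix A assume "A \<in> bowtie N k"
    then obtain m where m: "A = modN N (nsharp k m)" by (auto simp: bowtie_def)
    have "A = modN N (nsharp k (rank_rep m))"
      unfolding m modN_eq_iff nsharp_modN_iff by (rule rank_rep(2))
    then show "A \<in> (\<lambda>i. modN N (nsharp k i)) ` {j. lrank j < 4 * N}"
      by (rule image_eqI) (simp add: rank_rep(1))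
  qed
qed (auto simp: bowtie_def)

lemma card_bowtie: "card (bowtie N k) = 4 * N"
proof -
  have "inj_on (\<lambda>i. modN N (nsharp k i)) {j. lrank j < 4 * N}"
  proof (rule inj_onI)
    fix i j assume ij: "i \<in> {j. lrank j < 4 * N}" "j \<in> {j. lrank j < 4 * N}" "modN N (nsharp k i) = modN N (nsharp k j)"
    then have "lam v w j = lam v w i" by (simp only: modN_eq_iff nsharp_modN_iff)
    then show "i = j" using inj_onD[OF lam_inj_on] ij(1,2) by metis
  qed
  then show ?thesis unfolding bowtie_eq by (simp add: card_image card_4N)
qed

lemma lam_spectrum: "lam v w ` {j. lrank j < 4 * N} = (\<lambda>z. qpow l (- z)) ` \<Union> (bowtie N k)"
proof (intro equalityI subsetI)
  fix x assume "x \<in> lam v w ` {j. lrank j < 4 * N}"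
  then obtain i where i: "x = qpow l (- nsharp k i)" by (auto simp: lam_exp)
  have "nsharp k i \<in> modN N (nsharp k i)" by (simp only: modN_eq_iff[symmetric])
  then have "nsharp k i \<in> \<Union> (bowtie N k)" by (auto simp: bowtie_def)
  then show "x \<in> (\<lambda>z. qpow l (- z)) ` \<Union> (bowtie N k)" using i by blast
next
  fix x assume "x \<in> (\<lambda>z. qpow l (- z)) ` \<Union> (bowtie N k)"
  then obtain m j where "x = qpow l (- (nsharp k m + of_int j * of_nat N))" by (auto simp: bowtie_def modN_def)
  then have "x = lam v w m" unfolding lam_exp by (simp only: qpow_minus qpow_period)
  then have "x = lam v w (rank_rep m)" by (simp only: rank_rep(2))
  then show "x \<in> lam v w ` {j. lrank j < 4 * N}" by (rule image_eqI) (simp add: rank_rep(1))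
qed

lemma nsharp_pos: "m > 0 \<Longrightarrow> - nsharp k m = - (k + of_int m) / 2"
  by (simp only: nsharp_def if_True mult_1_left minus_divide_left add.commute)

lemma nsharp_neg: "\<not> m > 0 \<Longrightarrow> - nsharp k m = (k + of_int (- m)) / 2"
  by (simp add: nsharp_def minus_divide_left)

lemma lam_spectrum_low: "lam v w ` {- int N + 1..int N}
  = qpow l ` ({(k + of_nat j) / 2 | j. j \<le> N - 1} \<union> {- (k + of_nat j) / 2 | j. 1 \<le> j \<and> j \<le> N})"
proof -
  have "(\<lambda>m. - nsharp k m) ` {- int N + 1..int N}
    = {(k + of_nat j) / 2 | j. j \<le> N - 1} \<union> {- (k + of_nat j) / 2 | j. 1 \<le> j \<and> j \<le> N}"
  proof (intro equalityI subsetI)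
    fix x assume "x \<in> (\<lambda>m. - nsharp k m) ` {- int N + 1..int N}"
    then obtain m where m: "- int N + 1 \<le> m" "m \<le> int N" "x = - nsharp k m" by auto
    show "x \<in> {(k + of_nat j) / 2 | j. j \<le> N - 1} \<union> {- (k + of_nat j) / 2 | j. 1 \<le> j \<and> j \<le> N}"
    proof (cases "m > 0")
      case True
      have "x = - (k + of_nat (nat m)) / 2" unfolding m(3) nsharp_pos[OF True] using True by simp
      moreover have "1 \<le> nat m" "nat m \<le> N" using m True by auto
      ultimately show ?thesis by blast
    next
      case False
      have "x = (k + of_nat (nat (- m))) / 2" unfolding m(3) nsharp_neg[OF False] using False by simp
      moreover have "nat (- m) \<le> N - 1" using m False by auto
      ultimately show ?thesis by blast
    qed
  next
    fix x assume "x \<in> {(k + of_nat j) / 2 | j. j \<le> N - 1} \<union> {- (k + of_nat j) / 2 | j. 1 \<le> j \<and> j \<le> N}"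
    then consider j where "x = (k + of_nat j) / 2" "j \<le> N - 1" | j where "x = - (k + of_nat j) / 2" "1 \<le> j" "j \<le> N"
      by blast
    then show "x \<in> (\<lambda>m. - nsharp k m) ` {- int N + 1..int N}"
    proof cases
      case (1 j)
      then have "x = - nsharp k (- int j)" by (simp add: nsharp_neg)
      then show ?thesis using N 1(2) by (intro image_eqI[of _ _ "- int j"]) auto
    next
      case (2 j)
      then have "x = - nsharp k (int j)" by (simp add: nsharp_pos)
      then show ?thesis using 2(2,3) by (intro image_eqI[of _ _ "int j"]) auto
    qed
  qed
  then have "qpow l ` (\<lambda>m. - nsharp k m) ` {- int N + 1..int N}
    = qpow l ` ({(k + of_nat j) / 2 | j. j \<le> N - 1} \<union> {- (k + of_nat j) / 2 | j. 1 \<le> j \<and> j \<le> N})" by (simp only:)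
  moreover have "lam v w = (\<lambda>m. qpow l (- nsharp k m))" by (rule ext) (rule lam_exp)
  ultimately show ?thesis by (simp only: image_image)
qed

section \<open>Functions on the set of weights\<close>

text \<open>The value of \<open>q^z\<close> on a class of weights.\<close>

definition pt :: "complex set \<Rightarrow> complex" where
  "pt A = qpow l (rep A)"

lemma rep_modN:
  obtains j :: int where "rep (modN N z) = z + of_int j * of_nat N"
proof -
  have "z \<in> modN N z" by (simp only: modN_eq_iff[symmetric])
  then have "rep (modN N z) \<in> modN N z" unfolding rep_def by (rule someI)
  then show thesis using that by (auto simp: modN_def)
qed

lemma pt_modN: "pt (modN N z) = qpow l z"
proof -
  obtain j where "rep (modN N z) = z + of_int j * of_nat N" by (rule rep_modN)
  then show ?thesis by (simp only: pt_def qpow_period)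
qed

lemma pt_nsharp: "pt (modN N (nsharp k m)) = inverse (lam v w m)"
  by (simp only: pt_modN lam_exp qpow_minus inverse_inverse_eq)

lemma pt_nz: "pt A \<noteq> 0"
  by (simp add: pt_def qpow_nz)

lemma pt_spec: "pt ` bowtie N k = spec" "inj_on pt (bowtie N k)"
proof -
  show "pt ` bowtie N k = spec" unfolding bowtie_eq spec_def image_image pt_nsharp ..
  then have "card (pt ` bowtie N k) = card (bowtie N k)" by (simp only: card_spec card_bowtie)
  then show "inj_on pt (bowtie N k)" using card_bowtie N by (intro eq_card_imp_inj_on) (auto intro: card_ge_0_finite)
qed

lemma modN_minus_rep: "modN N (c - rep (modN N z)) = modN N (c - z)"
proof -
  obtain j where "rep (modN N z) = z + of_int j * of_nat N" by (rule rep_modN)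
  then have "c - rep (modN N z) = c - z + of_int (- j) * of_nat N" by simp
  then show ?thesis by (simp only: modN_shift)
qed

text \<open>The set of weights is closed under \<open>z \<mapsto> - z\<close> and \<open>z \<mapsto> 1/2 - z\<close>: except for the index 0,
  these are \<open>n \<mapsto> - n\<close> and \<open>n \<mapsto> 1 - n\<close> on indices. For the index 0 the period \<open>2 N\<close> is
  needed. The last claim excludes zero denominators in the action of \<open>T\<close>.\<close>

lemma bowtie_refl:
  assumes "A \<in> bowtie N k"
  shows "modN N (- rep A) \<in> bowtie N k" "pt (modN N (- rep A)) = inverse (pt A)"
    and "modN N (1 / 2 - rep A) \<in> bowtie N k" "pt (modN N (1 / 2 - rep A)) = v / pt A"
    and "(pt A) ^ 2 \<noteq> 1"
proof -
  obtain m where A: "A = modN N (nsharp k m)" using assms by (auto simp: bowtie_def)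
  show "pt (modN N (- rep A)) = inverse (pt A)" "pt (modN N (1 / 2 - rep A)) = v / pt A"
    unfolding pt_modN qpow_minus qpow_diff v_exp[symmetric] by (simp_all only: pt_def)
  have mem: "modN N (nsharp k n) \<in> bowtie N k" for n by (auto simp: bowtie_def)
  have "1 / 2 - nsharp k m = nsharp k (1 - m)" by (auto simp: nsharp_def field_simps)
  then show "modN N (1 / 2 - rep A) \<in> bowtie N k" unfolding A modN_minus_rep by (simp only: mem)
  have "modN N (- nsharp k m) \<in> bowtie N k"
  proof (cases "m = 0")
    case True
    \<comment> \<open>The index 0 counts as negative, so \<open>- 0_# = k/2\<close> is reached only as \<open>(2 N)_# - N\<close>.\<close>
    have "nsharp k (2 * int N) = - nsharp k m + of_int 1 * of_nat N"
      using N True by (simp add: nsharp_def field_simps)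
    then have "modN N (- nsharp k m) = modN N (nsharp k (2 * int N))" by (simp only: modN_shift)
    then show ?thesis by (simp only: mem)
  next
    case False
    then have "- nsharp k m = nsharp k (- m)" by (auto simp: nsharp_def field_simps)
    then show ?thesis by (simp only: mem)
  qed
  moreover have "modN N (- rep A) = modN N (- nsharp k m)"
    using modN_minus_rep[of 0 "nsharp k m"] by (simp only: A diff_0)
  ultimately show "modN N (- rep A) \<in> bowtie N k" by (simp only:)
  show "(pt A) ^ 2 \<noteq> 1"
  proof
    assume p1: "(pt A) ^ 2 = 1"
    then have "(lam v w m) ^ 2 = 1" unfolding A pt_nsharp by (simp add: power_inverse)
    then have "\<exists>j. w ^ 2 * v powi j = 1"
    proof (cases "m > 0")
      case True
      then have "(w * v powi m) ^ 2 = 1"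
        using p1 unfolding A pt_nsharp lam_powi by (simp add: power_int_minus)
      then show ?thesis by (intro exI[of _ "2 * m"]) (simp add: power_mult_distrib power_int_mult mult.commute[of 2])
    next
      case False
      then have "(w * v powi (- m)) ^ 2 = 1"
        using \<open>(lam v w m) ^ 2 = 1\<close> unfolding lam_powi by simp
      then show ?thesis by (intro exI[of _ "(- m) * 2"]) (simp only: power_mult_distrib power_int_mult, simp)
    qed
    then show False using w2_v by blast
  qed
qed

text \<open>The restriction of a polynomial to the set of weights; it becomes the isomorphism of the theorem.\<close>

definition sample :: "complex laurent \<Rightarrow> complex set \<Rightarrow> complex" where
  "sample f = (\<lambda>A\<in>bowtie N k. leval f (pt A))"

lemma sample_apply: "A \<in> bowtie N k \<Longrightarrow> sample f A = leval f (pt A)"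
  by (simp add: sample_def)

lemma fun_T_sample: "fun_T l N k (sample f) = sample (dl w f)"
proof
  fix A
  show "fun_T l N k (sample f) A = sample (dl w f) A"
  proof (cases "A \<in> bowtie N k")
    case True
    note r = bowtie_refl[OF True]
    have q2: "qpow l (2 * rep A) = (pt A) ^ 2"
      using qpow_of_nat[of l 2 "rep A"] by (simp add: pt_def)
    define x where "x = pt A"
    have x1: "x ^ 2 - 1 \<noteq> 0" using r(5) by (simp add: x_def)
    have "fun_T l N k (sample f) A = (w * x ^ 2 - inverse w) / (x ^ 2 - 1) * leval f (inverse x)
      - (w - inverse w) / (x ^ 2 - 1) * leval f x"
      using True r(1,2) by (simp add: fun_T_def Let_def q2 sample_apply x_def flip: w_exp)
    also have "\<dots> = leval (dl w f) x"
    proof -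
      have "(x ^ 2 - 1) * leval (dl w f) x = (w * x ^ 2 - inverse w) * leval f (inverse x) - (w - inverse w) * leval f x"
        by (rule leval_dl[OF _ w0]) (simp add: x_def pt_nz)
      then have "leval (dl w f) x = ((w * x ^ 2 - inverse w) * leval f (inverse x) - (w - inverse w) * leval f x) / (x ^ 2 - 1)"
        using x1 by (simp add: eq_divide_eq mult.commute)
      moreover have "a / d * y - b / d * z = (a * y - b * z) / d" for a b d y z :: complex
        by (simp add: diff_divide_distrib)
      ultimately show ?thesis by (simp only:)
    qed
    finally show ?thesis using True by (simp add: sample_apply x_def)
  qed (simp add: fun_T_def sample_def)
qed

lemma fun_pi_sample: "fun_pi N k (sample f) = sample (xrefl v f)"
proof
  fix A
  show "fun_pi N k (sample f) A = sample (xrefl v f) A"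
  proof (cases "A \<in> bowtie N k")
    case True
    then show ?thesis
      using bowtie_refl(3,4)[OF True] leval_xrefl[OF pt_nz, of v f A] by (simp add: fun_pi_def sample_apply)
  qed (simp add: fun_pi_def sample_def)
qed

lemma finite_spec: "finite spec"
  using card_spec N by (intro card_ge_0_finite) simp

text \<open>By interpolation every function on the weights is the restriction of a polynomial, and the formulas for the
  operators are those for values of polynomials.\<close>

lemma Fun_presentation: "hh_presentation (Fun_bowtie l N k) sample v w 1 (Rad v w)"
proof
  show "lsubspace UNIV" by (rule lsubspace_UNIV)
  show "carrier (Fun_bowtie l N k) = sample ` UNIV"
  proof (intro equalityI subsetI)
    fix F assume "F \<in> carrier (Fun_bowtie l N k)"
    then have F: "F \<in> extensional (bowtie N k)" by (simp add: Fun_bowtie_def PiE_def)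
    define f where "f = (\<Sum>a\<in>spec. lconst (F (the_inv_into (bowtie N k) pt a)) * lagrange spec a)"
    have "sample f = F"
    proof
      fix A
      show "sample f A = F A"
      proof (cases "A \<in> bowtie N k")
        case True
        then have "pt A \<in> spec" using pt_spec(1) by blast
        then have "leval f (pt A) = F (the_inv_into (bowtie N k) pt (pt A))"
          unfolding f_def by (rule leval_interpolation[OF finite_spec _ pt_nz])
        then show ?thesis using True by (simp add: sample_apply the_inv_into_f_f[OF pt_spec(2)])
      next
        case False
        then show ?thesis using F by (simp add: sample_def extensional_def)
      qed
    qed
    then show "F \<in> sample ` UNIV" by blast
  qed (auto simp: Fun_bowtie_def sample_def)
  show "\<zero>\<^bsub>Fun_bowtie l N k\<^esub> = sample 0"
    by (auto simp: Fun_bowtie_def sample_def)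
  show "sample f \<oplus>\<^bsub>Fun_bowtie l N k\<^esub> sample g = sample (f + g)" for f g
    by (auto simp: Fun_bowtie_def sample_def leval_add)
  show "c \<odot>\<^bsub>Fun_bowtie l N k\<^esub> sample f = sample (lconst c * f)" for c f
    by (auto simp: Fun_bowtie_def sample_def leval_lconst_times)
  show "v \<noteq> 0" "w \<noteq> 0" "1 * 1 = (1::complex)" by (rule v0, rule w0, simp)
  show "stable v w (Rad v w)" unfolding Rad_eq by (rule stable_IC)
  show "sample f = sample 0 \<longleftrightarrow> f \<in> Rad v w" for f
  proof -
    have "sample f = sample 0 \<longleftrightarrow> (\<forall>A\<in>bowtie N k. leval f (pt A) = 0)"
      by (auto simp: sample_def fun_eq_iff restrict_def)
    also have "\<dots> \<longleftrightarrow> (\<forall>m. leval f (inverse (lam v w m)) = 0)"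
      by (simp add: bowtie_def pt_nsharp)
    finally show ?thesis by (simp only: Rad_iff)
  qed
  show "Xop (Fun_bowtie l N k) (sample f) = sample (lmon 1 * f)" for f
    by (auto simp: Fun_bowtie_def sample_def leval_mult[OF pt_nz] pt_def[symmetric])
  show "Yop (Fun_bowtie l N k) (sample f) = sample (lconst 1 * dunkl v w f)" for f
    by (simp add: Fun_bowtie_def fun_T_sample fun_pi_sample dunkl_def)
  show "Top (Fun_bowtie l N k) (sample f) = sample (dl w f)" for f
    by (simp add: Fun_bowtie_def fun_T_sample)
qed

end

theorem theorem8p5:
  fixes N :: nat and l k qh th q t :: complex
  assumes "N \<ge> 1"
    and "qh = qpow l (1 / 2)" and "th = qpow l (k / 2)" and "q = qpow l 1" and "t = qpow l k"
    and "qh ^ (2 * N) = 1" and "\<forall>j. 0 < j \<and> j < 2 * N \<longrightarrow> qh ^ j \<noteq> 1"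
    and "\<forall>j::int. t \<noteq> qh powi j"
  shows
    \<comment> \<open>(i)\<close>
    "(\<forall>m. lregular qh th (e_poly m) \<and> lregular qh th (eps_poly m))
     \<and> family_basis (PP qh th) (e_sp qh th) UNIV
     \<and> family_basis (PP qh th) (eps_sp qh th) UNIV
     \<and> e_sp qh th (- int N) = lmon (int N) + lmon (- int N)
     \<and> e_sp qh th (- 2 * int N) = lmon (2 * int N) + lmon (- 2 * int N) + lconst 2
     \<and> (\<forall>n. rf_regular (mu0 n) qh th)
     \<and> (\<forall>m. admissible qh th (eps_poly m))
     \<and> (\<forall>m n. form0 qh th (eps_sp qh th m) (eps_poly n) = (if m = n then mu1_inv q t n else 0))
     \<and> (\<forall>\<sigma>. const_bar qh th \<sigma> \<longrightarrow>
          (\<forall>m n. form0_bar \<sigma> qh th (eps_sp qh th m) (eps_sp qh th n) = (if m = n then mu1_inv q t n else 0))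
        \<and> {f. \<forall>g. form0_bar \<sigma> qh th f g = 0} = Rad0 qh th)
     \<comment> \<open>(ii)\<close>
     \<and> hh_submodule (Rad0 qh th) (PP qh th)
     \<and> family_basis ((PP qh th)\<lparr>carrier := Rad0 qh th\<rparr>) (eps_sp qh th) ({..- int N} \<union> {int N + 1..})
     \<and> (let V = hh_quotient (PP qh th) (Rad0 qh th) in
          family_basis V (\<lambda>m. Rad0 qh th +>\<^bsub>PP qh th\<^esub> eps_sp qh th m) {- int N + 1..int N}
        \<and> hh_irreducible qh th V
        \<and> has_dim V (2 * N)
        \<and> semisimple V (Yop V) \<and> simple_weights V (Yop V)
        \<and> spectrum V (Yop V) = qpow l ` ({(k + of_nat j) / 2 | j. j \<le> N - 1}
                                        \<union> {- (k + of_nat j) / 2 | j. 1 \<le> j \<and> j \<le> N}))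
     \<and> Rad0 qh th = PIdl\<^bsub>PP qh th\<^esub> (e_sp qh th (- int N))
     \<and> Rad0 qh th = PIdl\<^bsub>PP qh th\<^esub> (lmon (int N) + lmon (- int N))
     \<comment> \<open>(iii)\<close>
     \<and> LinearCombinations.module.span CC (PP qh th)
          {eps_sp qh th m - eps_sp qh th n | m n. nsharp k n \<in> modN N (nsharp k m)} = Rad qh th
     \<and> hh_submodule (Rad qh th) (PP qh th)
     \<and> hh_irreducible qh th (hh_quotient (PP qh th) (Rad qh th))
     \<and> card (bowtie N k) = 4 * N
     \<and> is_hh_module qh th (Fun_bowtie l N k)
     \<and> hh_iso (hh_quotient (PP qh th) (Rad qh th)) (Fun_bowtie l N k)
     \<and> Rad qh th = PIdl\<^bsub>PP qh th\<^esub> (lmon (2 * int N) + lmon (- 2 * int N)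
                                        - lconst (t ^ N) - lconst (t powi (- int N)))
     \<comment> \<open>(iv)\<close>
     \<and> (\<forall>J. hh_submodule J (PP qh th) \<and> hh_irreducible qh th (hh_quotient (PP qh th) J) \<longleftrightarrow>
          (\<exists>C. C \<noteq> 2 \<and> J = PIdl\<^bsub>PP qh th\<^esub> (VC_poly N C))
          \<or> J = PIdl\<^bsub>PP qh th\<^esub> (lmon (int N) + lmon (- int N)))
     \<and> (let V2N = hh_quotient (PP qh th) (PIdl\<^bsub>PP qh th\<^esub> (lmon (int N) + lmon (- int N)));
            V2 = VC qh th N 2
        in is_hh_module qh th V2
         \<and> (\<exists>W. hh_submodule W V2 \<and> hh_iso (V2\<lparr>carrier := W\<rparr>) (twist_y V2N)
                \<and> hh_iso (hh_quotient V2 W) V2N))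
     \<and> (\<forall>C. let V = VC qh th N C in
          hh_submodule (PIdl\<^bsub>PP qh th\<^esub> (VC_poly N C)) (PP qh th)
        \<and> has_dim V (4 * N)
        \<and> semisimple V (Yop V) \<and> simple_weights V (Yop V)
        \<and> spectrum V (Yop V) = (\<lambda>z. qpow l (- z)) ` \<Union> (bowtie N k)
        \<and> (C \<noteq> 2 \<and> C \<noteq> - 2 \<longrightarrow> semisimple V (Xop V) \<and> simple_weights V (Xop V))
        \<and> (C = - 2 \<longrightarrow> \<not> semisimple V (Xop V)))
     \<and> (let C = - (t ^ N + t powi (- int N)) in
          hh_quotient (PP qh th) (Rad qh th) = VC qh th N C \<and> C \<noteq> 2 \<and> C \<noteq> - 2)"
proof -
  have q: "q = qh ^ 2" using assms(2,4) qpow_of_nat[of l 2 "1 / 2"] by simp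
  have t: "t = th ^ 2" using assms(3,5) qpow_of_nat[of l 2 "k / 2"] by simp
  interpret exponents N qh th l k
  proof
    show "1 \<le> N" "qh ^ (2 * N) = 1" by (rule assms(1), rule assms(6))
    show "qh ^ j \<noteq> 1" if "0 < j" "j < 2 * N" for j using assms(7) that by blast
    show "th \<noteq> 0" unfolding assms(3) by (rule qpow_nz)
    show "th ^ 2 \<noteq> qh powi j" for j using assms(8) unfolding t by blast
    show "qh = qpow l (1 / 2)" "th = qpow l (k / 2)" by (rule assms(2), rule assms(3))
  qed
  let ?P = "PP qh th"
  have neg: "- 2 * int N = - (2 * int N)" by simp
  have tN: "t ^ N = th ^ (2 * N)" by (simp add: t power_mult)
  have tN': "t powi (- int N) = inverse (th ^ (2 * N))" using tN by (simp add: power_int_minus)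
  have vc: "VC_poly N C = zC C" for C by (simp only: VC_poly_def neg)
  have pvc: "PIdl\<^bsub>?P\<^esub> (VC_poly N C) = IC C" for C by (simp only: vc PIdl_eq)
  have pp0: "PIdl\<^bsub>?P\<^esub> p0 = I0" by (rule PIdl_eq)
  have VC: "VC qh th N C = quot (IC C)" for C by (simp only: VC_def pvc)
  have Ct: "- (t ^ N + t powi (- int N)) = Ct" by (simp only: Ct_def tN tN')
  interpret Q: hh_presentation "quot I0" "\<lambda>f. I0 +>\<^bsub>?P\<^esub> f" qh th 1 I0
    by (rule PP_quotient[OF v0 w0 stable_I0])
  interpret V: eigenbasis "quot I0" UNIV "\<lambda>f. I0 +>\<^bsub>?P\<^esub> f" "Yop (quot I0)" "{- int N + 1..int N}" "eps qh th" "lam qh th"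
    by (rule I0_eigenbasis)
  interpret F: hh_presentation "Fun_bowtie l N k" sample qh th 1 "Rad qh th"
    by (rule Fun_presentation)
  have esp: "eps_sp qh th = eps qh th" by (rule ext) (rule eps_sp_eq)
  have i1: "\<forall>m. lregular qh th (e_poly m) \<and> lregular qh th (eps_poly m)"
    using lregular_LR[OF e_value] lregular_LR[OF eps_value] by blast
  have i2: "e_sp qh th (- int N) = p0" by (simp only: e_sp_eq E_neg_N)
  have i3: "e_sp qh th (- 2 * int N) = lmon (2 * int N) + lmon (- 2 * int N) + lconst 2"
    unfolding neg e_sp_eq by (rule E_neg_2N)
  have i4: "\<forall>n. rf_regular (mu0 n) qh th" using has_value_rf(1)[OF mu0_value] by blast
  have i5: "\<forall>m. admissible qh th (eps_poly m)" using admissible_eps by blast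
  have i6: "\<forall>m n. form0 qh th (eps_sp qh th m) (eps_poly n) = (if m = n then mu1_inv q t n else 0)"
    unfolding eps_sp_eq form0_eq lform_eps_special sph_norm_eq q t by simp
  have i7: "\<forall>\<sigma>. const_bar qh th \<sigma> \<longrightarrow>
          (\<forall>m n. form0_bar \<sigma> qh th (eps_sp qh th m) (eps_sp qh th n) = (if m = n then mu1_inv q t n else 0))
        \<and> {f. \<forall>g. form0_bar \<sigma> qh th f g = 0} = Rad0 qh th"
  proof (intro allI impI conjI)
    fix \<sigma> assume \<sigma>: "const_bar qh th \<sigma>"
    show "form0_bar \<sigma> qh th (eps_sp qh th m) (eps_sp qh th n) = (if m = n then mu1_inv q t n else 0)" for m n
      unfolding eps_sp_eq form0_bar_eq[OF \<sigma>] lform_eps_special sph_norm_eq q t by simp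
    show "{f. \<forall>g. form0_bar \<sigma> qh th f g = 0} = Rad0 qh th"
      unfolding form0_bar_radical[OF \<sigma>] Rad0_eq ..
  qed
  have ii1: "hh_submodule (Rad0 qh th) ?P"
    unfolding Rad0_I0 hh_submodule_PP_iff[OF v0 w0] by (rule stable_I0)
  have ii2: "family_basis (hh_quotient ?P (Rad0 qh th)) (\<lambda>m. Rad0 qh th +>\<^bsub>?P\<^esub> eps_sp qh th m) {- int N + 1..int N}"
    unfolding Rad0_I0 esp by (rule V.family_basis)
  have ii3: "hh_irreducible qh th (hh_quotient ?P (Rad0 qh th))"
    unfolding Rad0_I0 by (rule I0_irreducible)
  have ii4: "has_dim (hh_quotient ?P (Rad0 qh th)) (2 * N)"
    unfolding Rad0_I0 using V.has_dim by (simp add: nat_mult_distrib)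
  have ii5: "semisimple (hh_quotient ?P (Rad0 qh th)) (Yop (hh_quotient ?P (Rad0 qh th)))"
    "simple_weights (hh_quotient ?P (Rad0 qh th)) (Yop (hh_quotient ?P (Rad0 qh th)))"
    unfolding Rad0_I0 by (rule V.semisimple, rule V.simple_weights)
  have ii6: "spectrum (hh_quotient ?P (Rad0 qh th)) (Yop (hh_quotient ?P (Rad0 qh th)))
    = qpow l ` ({(k + of_nat j) / 2 | j. j \<le> N - 1} \<union> {- (k + of_nat j) / 2 | j. 1 \<le> j \<and> j \<le> N})"
    unfolding Rad0_I0 V.spectrum_eq by (rule lam_spectrum_low)
  have ii7: "Rad0 qh th = PIdl\<^bsub>?P\<^esub> (e_sp qh th (- int N))" "Rad0 qh th = PIdl\<^bsub>?P\<^esub> p0"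
    unfolding i2 pp0 by (rule Rad0_I0)+
  have iii1: "LinearCombinations.module.span CC ?P
      {eps_sp qh th m - eps_sp qh th n | m n. nsharp k n \<in> modN N (nsharp k m)} = Rad qh th"
    unfolding esp nsharp_modN_iff Rad_eq by (rule span_eps_differences)
  have iii2: "hh_submodule (Rad qh th) ?P \<and> hh_irreducible qh th (hh_quotient ?P (Rad qh th))"
    unfolding irreducible_quotients Rad_eq using Ct_ne by blast
  have iii3: "is_hh_module qh th (Fun_bowtie l N k)" by (rule F.is_module[OF refl])
  have iii4: "hh_iso (hh_quotient ?P (Rad qh th)) (Fun_bowtie l N k)"
    by (rule hh_iso_presentations[OF PP_quotient[OF v0 w0 F.K] Fun_presentation])
  have "lmon (2 * int N) + lmon (- 2 * int N) - lconst (t ^ N) - lconst (t powi (- int N)) = zC Ct"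
    unfolding neg Ct[symmetric] lconst_uminus lconst_add by simp
  then have iii5: "Rad qh th = PIdl\<^bsub>?P\<^esub> (lmon (2 * int N) + lmon (- 2 * int N)
      - lconst (t ^ N) - lconst (t powi (- int N)))"
    by (simp only: PIdl_eq Rad_eq)
  have iv1: "\<forall>J. hh_submodule J ?P \<and> hh_irreducible qh th (hh_quotient ?P J) \<longleftrightarrow>
          (\<exists>C. C \<noteq> 2 \<and> J = PIdl\<^bsub>?P\<^esub> (VC_poly N C)) \<or> J = PIdl\<^bsub>?P\<^esub> p0"
    unfolding irreducible_quotients pvc pp0 by blast
  have iv2: "is_hh_module qh th (VC qh th N 2)"
    "\<exists>W. hh_submodule W (VC qh th N 2) \<and> hh_iso ((VC qh th N 2)\<lparr>carrier := W\<rparr>) (twist_y (hh_quotient ?P (PIdl\<^bsub>?P\<^esub> p0)))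
      \<and> hh_iso (hh_quotient (VC qh th N 2) W) (hh_quotient ?P (PIdl\<^bsub>?P\<^esub> p0))"
    unfolding VC pp0 by (rule V2_filtration)+
  have iv3: "\<forall>C. hh_submodule (PIdl\<^bsub>?P\<^esub> (VC_poly N C)) ?P
        \<and> has_dim (VC qh th N C) (4 * N)
        \<and> semisimple (VC qh th N C) (Yop (VC qh th N C)) \<and> simple_weights (VC qh th N C) (Yop (VC qh th N C))
        \<and> spectrum (VC qh th N C) (Yop (VC qh th N C)) = (\<lambda>z. qpow l (- z)) ` \<Union> (bowtie N k)
        \<and> (C \<noteq> 2 \<and> C \<noteq> - 2 \<longrightarrow> semisimple (VC qh th N C) (Xop (VC qh th N C)) \<and> simple_weights (VC qh th N C) (Xop (VC qh th N C)))
        \<and> (C = - 2 \<longrightarrow> \<not> semisimple (VC qh th N C) (Xop (VC qh th N C)))"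
  proof (intro allI)
    fix C
    interpret E: eigenbasis "quot (IC C)" UNIV "\<lambda>f. IC C +>\<^bsub>?P\<^esub> f" "Yop (quot (IC C))" "{j. lrank j < 4 * N}" "eps qh th" "lam qh th"
      by (rule IC_eigenbasis)
    have "hh_submodule (IC C) ?P" unfolding hh_submodule_PP_iff[OF v0 w0] by (rule stable_IC)
    moreover have "has_dim (quot (IC C)) (4 * N)" using E.has_dim unfolding card_4N .
    moreover have "spectrum (quot (IC C)) (Yop (quot (IC C))) = (\<lambda>z. qpow l (- z)) ` \<Union> (bowtie N k)"
      unfolding E.spectrum_eq by (rule lam_spectrum)
    ultimately show "hh_submodule (PIdl\<^bsub>?P\<^esub> (VC_poly N C)) ?P
        \<and> has_dim (VC qh th N C) (4 * N)
        \<and> semisimple (VC qh th N C) (Yop (VC qh th N C)) \<and> simple_weights (VC qh th N C) (Yop (VC qh th N C))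
        \<and> spectrum (VC qh th N C) (Yop (VC qh th N C)) = (\<lambda>z. qpow l (- z)) ` \<Union> (bowtie N k)
        \<and> (C \<noteq> 2 \<and> C \<noteq> - 2 \<longrightarrow> semisimple (VC qh th N C) (Xop (VC qh th N C)) \<and> simple_weights (VC qh th N C) (Xop (VC qh th N C)))
        \<and> (C = - 2 \<longrightarrow> \<not> semisimple (VC qh th N C) (Xop (VC qh th N C)))"
      unfolding VC pvc using E.semisimple E.simple_weights X_semisimple[of C] X_not_semisimple by blast
  qed
  have iv4: "hh_quotient ?P (Rad qh th) = VC qh th N (- (t ^ N + t powi (- int N)))"
    unfolding Ct VC Rad_eq ..
  have iv5: "- (t ^ N + t powi (- int N)) \<noteq> 2" "- (t ^ N + t powi (- int N)) \<noteq> - 2"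
    unfolding Ct by (rule Ct_ne)+
  show ?thesis
    unfolding Let_def
    by (intro conjI i1 basis_e basis_eps i2 i3 i4 i5 i6 i7 ii1 basis_rad0 ii2 ii3 ii4 ii5 ii6 ii7
        iii1 conjunct1[OF iii2] conjunct2[OF iii2] card_bowtie iii3 iii4 iii5 iv1 iv2 iv3 iv4 iv5)
qed

end
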